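(* Let $f\colon D\to V$ be a holomorphic map from $\mathcal{E}\cup\mathcal{E}_o$ and define $g=c_1\cdot f\colon D\to c_1\cdot V$, where $c_1\in D_+\setminus\{0\}$. Assume that $g$ has a hyperbolic attracting or a parabolic cycle $\mathcal{O}=\{a_0,\dots,a_{q-1}\}\subset D\setminus\{0\}$ of period $q$ with multiplier $\kappa$. Take $G_w(z)=wf(z)$ where $w\in W:=D_+\setminus\{0\}$. Then at $w=c_1$ one of the following holds: - transversality holds: $\kappa'(c_1)\ne0$ if $\kappa\neq1$, and $Q(a_j)\neq0$ for $a_j\in\mathcal{O}$ if $\kappa=1$; - $f\in\mathcal{E}_o$ and $\mathcal{O}$ is symmetric with respect to the origin.
   Context: A point $v$ is an asymptotic value of a holomorphic map $f\colon D\to\mathbb{C}$ if there is a path $\gamma\colon[0,1)\to D$ with $\gamma(t)\to\partial D$ and $f(\gamma(t))\to v$ as $t\uparrow1$; $v$ is a singular value if it is a critical value or an asymptotic value. Consider holomorphic maps $f\colon D\to V$ such that: (a) $D,V\subset\mathbb{C}$ are open sets symmetric with respect to the real line, and $f(D)=V$; (b) with $I=D\cap\mathbb{R}$, there exists $c>0$ such that $I\cup\{c\}$ is a (bounded or unbounded) open interval, $0\in\overline{I}$, $c\in\operatorname{int}(\overline{I})$; moreover $f$ extends continuously to $\overline{I}$, $f(I)\subset\mathbb{R}$, and $\lim_{z\in D,\,z\to0}f(z)=0$; (c) let $D_+$ be the component of $D$ containing $I\cap(c,\infty)$ (possibly $D_+=D$); then $u\in D\setminus\{0\}$, $v\in D_+\setminus\{0\}$,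 $v\neq u$ implies $u/v\in V$. $\mathcal{E}$ is the class of maps satisfying (a),(b),(c) and: (d) $f\colon D\to V$ has no singular values in $V\setminus\{0,1\}$ and $c>0$ is minimal such that $f$ has a positive local maximum at $c$ and $f(c)=1$. $\mathcal{E}_o$ is the class of maps satisfying (a),(b),(c) and: (e) $f$ is odd, $f\colon D\to V$ has no singular values in $V\setminus\{0,\pm1\}$, and $c>0$ is minimal such that $f$ has a positive local maximum at $c$ and $f(c)=1$. The multiplier of $\mathcal{O}$ is $\kappa=(g^q)'(a_0)$; hyperbolic attracting means $0<|\kappa|<1$; parabolic means $\kappa$ is a root of unity. If $\kappa\ne1$, let $a_0(w)$ be the holomorphic function near $c_1$ with $a_0(c_1)=a_0$ and $G_w^q(a_0(w))=a_0(w)$; $\kappa(w)=(G_w^q)'(a_0(w))$, and $\kappa'(c_1)$ is its derivative in $w$ at $c_1$. Further $Q(z)=\frac{d}{dw}G_w^q(z)\big|_{w=c_1}$. *)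

theory Defs
  imports "HOL-Analysis.Analysis"
begin

text \<open>
  A holomorphic map \<open>f : D \<rightarrow> V\<close> is represented by the triple \<open>D\<close>, \<open>V\<close>, \<open>f\<close> with \<open>f\<close> a total
  function, whose values outside \<open>D\<close> play no role.
\<close>

definition critical_value :: "complex set \<Rightarrow> (complex \<Rightarrow> complex) \<Rightarrow> complex \<Rightarrow> bool" where
  "critical_value D f v \<longleftrightarrow> (\<exists>z\<in>D. deriv f z = 0 \<and> f z = v)"

text \<open>
  Convergence of \<open>\<gamma>(t)\<close> to the boundary of \<open>D\<close> refers to the boundary in the Riemann sphere (so
  that, for instance, \<open>0\<close> is an asymptotic value of the exponential map on the whole plane). It
  means that \<open>\<gamma>\<close> eventually leaves every compact subset of \<open>D\<close>; \<open>\<gamma>(t)\<close> need not converge to a point.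
\<close>

definition tends_to_boundary :: "complex set \<Rightarrow> (real \<Rightarrow> complex) \<Rightarrow> bool" where
  "tends_to_boundary D \<gamma> \<longleftrightarrow>
     (\<forall>K. compact K \<and> K \<subseteq> D \<longrightarrow> (\<forall>\<^sub>F t in at_left 1. \<gamma> t \<notin> K))"

definition asymptotic_value :: "complex set \<Rightarrow> (complex \<Rightarrow> complex) \<Rightarrow> complex \<Rightarrow> bool" where
  "asymptotic_value D f v \<longleftrightarrow>
     (\<exists>\<gamma> :: real \<Rightarrow> complex. continuous_on {0..<1} \<gamma> \<and> \<gamma> ` {0..<1} \<subseteq> D \<and>
        tends_to_boundary D \<gamma> \<and> ((\<lambda>t. f (\<gamma> t)) \<longlongrightarrow> v) (at_left 1))"

definition singular_value :: "complex set \<Rightarrow> (complex \<Rightarrow> complex) \<Rightarrow> complex \<Rightarrow> bool" where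
  "singular_value D f v \<longleftrightarrow> critical_value D f v \<or> asymptotic_value D f v"

definition real_trace :: "complex set \<Rightarrow> real set" where
  "real_trace D = {x. complex_of_real x \<in> D}"

text \<open>
  \<open>F\<close> is the continuous extension to the closure of \<open>I = real_trace D\<close> of the restriction of \<open>f\<close> to
  \<open>I\<close>, which is required to be real valued. It is unique on the closure. The point \<open>c\<close> below need
  not belong to \<open>D\<close>, so the value of \<open>f\<close> at \<open>c\<close> is expressed as \<open>F c\<close>.
\<close>

definition real_extension :: "complex set \<Rightarrow> (complex \<Rightarrow> complex) \<Rightarrow> (real \<Rightarrow> real) \<Rightarrow> bool" where
  "real_extension D f F \<longleftrightarrow>
     continuous_on (closure (real_trace D)) F \<and>
     (\<forall>x\<in>real_trace D. f (complex_of_real x) = complex_of_real (F x))"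

definition D_plus :: "complex set \<Rightarrow> real \<Rightarrow> complex set" where
  "D_plus D c =
     (THE C. C \<in> components D \<and> complex_of_real ` (real_trace D \<inter> {c<..}) \<subseteq> C)"

definition cond_a :: "complex set \<Rightarrow> complex set \<Rightarrow> (complex \<Rightarrow> complex) \<Rightarrow> bool" where
  "cond_a D V f \<longleftrightarrow>
     open D \<and> open V \<and> cnj ` D = D \<and> cnj ` V = V \<and> f holomorphic_on D \<and> f ` D = V"

definition cond_b :: "complex set \<Rightarrow> (complex \<Rightarrow> complex) \<Rightarrow> real \<Rightarrow> bool" where
  "cond_b D f c \<longleftrightarrow>
     c > 0 \<and> open (insert c (real_trace D)) \<and> is_interval (insert c (real_trace D)) \<and>
     0 \<in> closure (real_trace D) \<and> c \<in> interior (closure (real_trace D)) \<and>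
     (\<exists>F. real_extension D f F) \<and> (f \<longlongrightarrow> 0) (at 0 within D)"

definition cond_c :: "complex set \<Rightarrow> complex set \<Rightarrow> real \<Rightarrow> bool" where
  "cond_c D V c \<longleftrightarrow> (\<forall>u \<in> D - {0}. \<forall>v \<in> D_plus D c - {0}. v \<noteq> u \<longrightarrow> u / v \<in> V)"

definition unit_local_max :: "real set \<Rightarrow> (real \<Rightarrow> real) \<Rightarrow> real \<Rightarrow> bool" where
  "unit_local_max J F x \<longleftrightarrow>
     x \<in> J \<and> F x = 1 \<and> (\<forall>\<^sub>F y in at x within J. F y \<le> F x)"

definition first_unit_max :: "complex set \<Rightarrow> (complex \<Rightarrow> complex) \<Rightarrow> real \<Rightarrow> bool" where
  "first_unit_max D f c \<longleftrightarrow>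
     (\<exists>F. real_extension D f F \<and>
        c > 0 \<and> unit_local_max (closure (real_trace D)) F c \<and>
        (\<forall>x. x > 0 \<and> unit_local_max (closure (real_trace D)) F x \<longrightarrow> c \<le> x))"

definition odd_map :: "complex set \<Rightarrow> (complex \<Rightarrow> complex) \<Rightarrow> bool" where
  "odd_map D f \<longleftrightarrow> (\<forall>z\<in>D. - z \<in> D \<and> f (- z) = - f z)"

text \<open>
  The classes of maps. The point \<open>c\<close> is made an explicit argument because \<open>D_plus\<close> depends on it;
  the minimality in \<open>first_unit_max\<close> shows that it is determined by \<open>D\<close> and \<open>f\<close>.
\<close>

definition class_E :: "complex set \<Rightarrow> complex set \<Rightarrow> (complex \<Rightarrow> complex) \<Rightarrow> real \<Rightarrow> bool" where
  "class_E D V f c \<longleftrightarrow>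
     cond_a D V f \<and> cond_b D f c \<and> cond_c D V c \<and>
     (\<forall>v \<in> V - {0, 1}. \<not> singular_value D f v) \<and> first_unit_max D f c"

definition class_Eo :: "complex set \<Rightarrow> complex set \<Rightarrow> (complex \<Rightarrow> complex) \<Rightarrow> real \<Rightarrow> bool" where
  "class_Eo D V f c \<longleftrightarrow>
     cond_a D V f \<and> cond_b D f c \<and> cond_c D V c \<and> odd_map D f \<and>
     (\<forall>v \<in> V - {0, 1, - 1}. \<not> singular_value D f v) \<and> first_unit_max D f c"

definition G :: "(complex \<Rightarrow> complex) \<Rightarrow> complex \<Rightarrow> complex \<Rightarrow> complex" where
  "G f w z = w * f z"

definition is_cycle :: "(complex \<Rightarrow> complex) \<Rightarrow> nat \<Rightarrow> (nat \<Rightarrow> complex) \<Rightarrow> bool" where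
  "is_cycle g q a \<longleftrightarrow>
     q > 0 \<and> inj_on a {..<q} \<and> (\<forall>j<q. g (a j) = a (Suc j mod q))"

text \<open>
  For a cycle contained in the open set \<open>D\<close>, the iterates of the total function below coincide near
  the cycle (and for parameters near \<open>c1\<close>) with the compositions of the map defined on \<open>D\<close> only.
\<close>

definition multiplier :: "(complex \<Rightarrow> complex) \<Rightarrow> nat \<Rightarrow> complex \<Rightarrow> complex" where
  "multiplier g q z = deriv (g ^^ q) z"

definition hyperbolic_attracting :: "complex \<Rightarrow> bool" where
  "hyperbolic_attracting \<kappa> \<longleftrightarrow> 0 < norm \<kappa> \<and> norm \<kappa> < 1"

definition parabolic :: "complex \<Rightarrow> bool" where
  "parabolic \<kappa> \<longleftrightarrow> (\<exists>n>0. \<kappa> ^ n = 1)"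

definition continues_periodic_point ::
    "(complex \<Rightarrow> complex) \<Rightarrow> complex \<Rightarrow> nat \<Rightarrow> complex \<Rightarrow> (complex \<Rightarrow> complex) \<Rightarrow> bool" where
  "continues_periodic_point f c1 q a0 \<alpha> \<longleftrightarrow>
     \<alpha> analytic_on {c1} \<and> \<alpha> c1 = a0 \<and> (\<forall>\<^sub>F w in nhds c1. (G f w ^^ q) (\<alpha> w) = \<alpha> w)"

definition Q :: "(complex \<Rightarrow> complex) \<Rightarrow> complex \<Rightarrow> nat \<Rightarrow> complex \<Rightarrow> complex" where
  "Q f c1 q z = deriv (\<lambda>w. (G f w ^^ q) z) c1"

text \<open>
  The holomorphic continuation \<open>\<alpha>\<close> of the periodic point is only unique as a germ at \<open>c1\<close>. Its
  existence is asserted along with the inequality, which therefore is not vacuous.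
\<close>

definition transversal ::
    "(complex \<Rightarrow> complex) \<Rightarrow> complex \<Rightarrow> nat \<Rightarrow> (nat \<Rightarrow> complex) \<Rightarrow> bool" where
  "transversal f c1 q a \<longleftrightarrow>
     (multiplier (G f c1) q (a 0) \<noteq> 1 \<longrightarrow>
        (\<exists>\<alpha>. continues_periodic_point f c1 q (a 0) \<alpha>) \<and>
        (\<forall>\<alpha>. continues_periodic_point f c1 q (a 0) \<alpha> \<longrightarrow>
               deriv (\<lambda>w. multiplier (G f w) q (\<alpha> w)) c1 \<noteq> 0)) \<and>
     (multiplier (G f c1) q (a 0) = 1 \<longrightarrow> (\<forall>j<q. Q f c1 q (a j) \<noteq> 0))"

end

theory Submission
  imports Defs "HOL-Complex_Analysis.Complex_Analysis"
begin

text \<open>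
 Consider holomorphic motions, over the unit disc, of the orbit of \<open>c1\<close> together with the cycle.
 Since a motion is injective and \<open>f\<close> has no singular values besides \<open>0\<close> and \<open>\<plusminus> 1\<close>, condition (c) allows
 one to lift a motion \<open>M\<close> to a motion \<open>M'\<close> with \<open>M(c1) * f(M'(z)) = M(g(z))\<close>. By Schottky's theorem
 all iterated lifts are uniformly bounded near \<open>0\<close>, hence so are their derivatives. By Fatou's argument
 the cycle, or its mirror image, attracts the orbit of the singular value \<open>c1\<close> of \<open>g\<close>, so that the
 derivatives of the lifts can be followed along this orbit. If transversality fails, a suitable
 initial motion gives lifts whose derivatives are unbounded: if \<open>\<kappa> \<noteq> 1\<close>, a motion which expands the
 orbit at an arbitrarily large rate about the fixed cycle, the derivatives being compared by
 telescoping along diagonals (attracting case) or by Abel summation (parabolic case).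
 If \<open>\<kappa> = 1\<close>, the motion is a sum of two eigenvectors of the lifting operator with eigenvalues
 \<open>\<mu>1\<close>, \<open>\<mu>2\<close> on the unit circle, \<open>(\<mu>1 * \<mu>2)^q = 1\<close>, and the second derivatives are unbounded by resonance
 unless the set of \<open>q\<close>-th roots of unity at which a Fourier transform of \<open>Q\<close> does not vanish is
 closed under multiplication; so it contains \<open>1\<close>, that is, \<open>Q \<noteq> 0\<close>.
\<close>

section \<open>Lifting of discs\<close>

text \<open>All cases rest on a \<open>q\<close>-periodic solution \<open>A\<close> of
  \<open>A (Suc n) = g' (b n) * A n + f (b n)\<close>, the fixed vector of the linearised lifting
  operator on the cycle. For multiplier different from 1 it is the parameter derivative of the
  periodic points, and the logarithmic derivative of the multiplier is the sum of
  \<open>(f' + g'' * A) / g'\<close> over the cycle; for multiplier 1 it exists as soon as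
  \<open>Q\<close> vanishes at one point. The obstacle is that infinitesimal data need not come from
  a motion: infinitely many orbit points accumulate at the cycle and must stay apart, also up to
  sign. Hence two kinds of initial motion. A radial stretching is injective for any rate, while the
  bound on its lifts ignores the rate. For multiplier 1, fields that are Lipschitz on orbit and
  cycle give motions after scaling; they are built only for eigenvalues with
  \<open>\<mu> ^ q \<noteq> 1\<close>, so roots of unity are reached as limits. In the parabolic
  case the orbit approaches the more slowly the more petals there are; the count
  \<open>m \<le> l\<close> of petals is what makes the resonance-free order of approximation
  sufficient.\<close>

lemma holomorphic_on_locally:
 assumes "\<And>x. x \<in> S \<Longrightarrow> \<exists>U h. open U \<and> x \<in> U \<and> h holomorphic_on U \<and> (\<forall>y\<in>U. P y = h y)"
 shows "P holomorphic_on S"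
proof (rule holomorphic_onI)
 fix x assume "x \<in> S"
 from assms[OF this] obtain U h
  where U: "open U" "x \<in> U" "h holomorphic_on U" "\<And>y. y \<in> U \<Longrightarrow> P y = h y" by auto
 have "P holomorphic_on U" using holomorphic_transform[OF U(3)] U(4) by metis
 hence "P field_differentiable at x" by (rule holomorphic_on_imp_differentiable_at[OF _ U(1,2)])
 thus "P field_differentiable at x within S" by (rule field_differentiable_at_within)
qed

lemma holomorphic_local_inverse:
 assumes "open D" "f holomorphic_on D" "z \<in> D" "deriv f z \<noteq> 0"
 obtains e d h where "e > 0" "ball z e \<subseteq> D" "d > 0" "h holomorphic_on ball (f z) d" "h (f z) = z"
  "\<And>w. w \<in> ball (f z) d \<Longrightarrow> h w \<in> ball z e \<and> f (h w) = w"
  "\<And>x. x \<in> ball z e \<Longrightarrow> f x \<in> ball (f z) d \<Longrightarrow> h (f x) = x"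
proof -
 obtain e where e: "e > 0" "ball z e \<subseteq> D" "inj_on f (ball z e)"
  using has_complex_derivative_locally_injective[OF assms(2,3,1,4)] by blast
 have fe: "f holomorphic_on ball z e" using assms(2) e(2) holomorphic_on_subset by blast
 obtain h where h: "h holomorphic_on f ` ball z e" "\<And>x. x \<in> ball z e \<Longrightarrow> h (f x) = x"
  using holomorphic_has_inverse[OF fe open_ball e(3)] by metis
 have "open (f ` ball z e)" using open_mapping_thm3[OF fe open_ball e(3)] .
 moreover have "f z \<in> f ` ball z e" using e(1) by auto
 ultimately obtain d where d: "d > 0" "ball (f z) d \<subseteq> f ` ball z e" by (meson open_contains_ball)
 show ?thesis
 proof (rule that[of e d h])
  show "h holomorphic_on ball (f z) d" using h(1) d(2) holomorphic_on_subset by blast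
  show "h (f z) = z" using h(2) e(1) by auto
  show "h w \<in> ball z e \<and> f (h w) = w" if "w \<in> ball (f z) d" for w using that d(2) h(2) by force
 qed (use e d h in auto)
qed

text \<open>Local injectivity of \<open>f\<close> at the single point \<open>p x0\<close> makes the
  lifts agree near \<open>x0\<close>, and the identity theorem carries this over the connected set
  \<open>X\<close>. Critical points met elsewhere do no harm.\<close>

lemma holomorphic_lift_unique:
 assumes D: "open D" "f holomorphic_on D" and X: "open X" "connected X"
  and p: "p holomorphic_on X" "p ` X \<subseteq> D" and r: "r holomorphic_on X" "r ` X \<subseteq> D"
  and eq: "\<And>x. x \<in> X \<Longrightarrow> f (p x) = f (r x)"
  and x0: "x0 \<in> X" "p x0 = r x0" "deriv f (p x0) \<noteq> 0" and x: "x \<in> X"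
 shows "p x = r x"
proof -
 have "p x0 \<in> D" using p x0 by auto
 then obtain e where e: "e > 0" "ball (p x0) e \<subseteq> D" "inj_on f (ball (p x0) e)"
  using has_complex_derivative_locally_injective[OF D(2) _ D(1) x0(3)] by blast
 have cp: "continuous_on X p" and cr: "continuous_on X r" using p r holomorphic_on_imp_continuous_on by auto
 define N where "N = (X \<inter> p -` ball (p x0) e) \<inter> (X \<inter> r -` ball (p x0) e)"
 have N: "open N" unfolding N_def using cp cr X(1) by (intro open_Int continuous_open_preimage) auto
 have xN: "x0 \<in> N" unfolding N_def using x0 e by auto
 have "p y = r y" if "y \<in> N" for y using that e(3) eq unfolding N_def inj_on_def by auto
 thus ?thesis using analytic_continuation_open[OF N X(1) _ X(2) _ p(1) r(1) _ x] xN N_def by blast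
qed

text \<open>A path whose image converges to a nonsingular value cannot leave every compact subset, so it
 accumulates at a point where \<open>f\<close> is locally invertible.\<close>

lemma nonsingular_path_accumulates:
 assumes D: "open D" "f holomorphic_on D" and w: "\<not> singular_value D f w"
  and g: "continuous_on {0..<1} \<gamma>" "\<gamma> ` {0..<1} \<subseteq> D" "((\<lambda>t. f (\<gamma> t)) \<longlongrightarrow> w) (at_left 1)"
 obtains z where "z \<in> D" "f z = w" "deriv f z \<noteq> 0"
  "\<And>e s. e > 0 \<Longrightarrow> s < (1::real) \<Longrightarrow> \<exists>t. s < t \<and> 0 \<le> t \<and> t < 1 \<and> \<gamma> t \<in> ball z e"
proof -
 have "\<not> tends_to_boundary D \<gamma>" using w g unfolding singular_value_def asymptotic_value_def by blast
 then obtain K where K: "compact K" "K \<subseteq> D" "\<not> (\<forall>\<^sub>F t in at_left 1. \<gamma> t \<notin> K)"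
  unfolding tends_to_boundary_def by blast
 have ex: "\<exists>t. s < t \<and> t < 1 \<and> \<gamma> t \<in> K" if "s < 1" for s
  using K(3) that unfolding eventually_at_left_field by (meson dense linorder_not_less order.strict_trans)
 define T where "T n = (SOME t. 1 - 1 / (real n + 1) < t \<and> t < 1 \<and> \<gamma> t \<in> K)" for n
 have T: "1 - 1 / (real n + 1) < T n \<and> T n < 1 \<and> \<gamma> (T n) \<in> K" for n unfolding T_def by (rule someI_ex, rule ex) simp
 have T0: "0 \<le> T n" for n
 proof -
  have "1 - 1 / (real n + 1) \<ge> 0" by simp
  thus ?thesis using T[of n] by linarith
 qed
 have Tl: "T \<longlonglongrightarrow> 1"
 proof (rule tendsto_sandwich[of "\<lambda>n. 1 - 1 / (real n + 1)" T sequentially "\<lambda>n. 1"])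
  have "(\<lambda>n. 1 / (real n + 1)) \<longlonglongrightarrow> 0" using LIMSEQ_inverse_real_of_nat by (simp add: inverse_eq_divide add.commute)
  hence "(\<lambda>n. 1 - 1 / (real n + 1)) \<longlonglongrightarrow> 1 - 0" by (intro tendsto_intros)
  thus "(\<lambda>n. 1 - 1 / (real n + 1)) \<longlonglongrightarrow> 1" by simp
 qed (auto intro!: always_eventually less_imp_le T[THEN conjunct1] T[THEN conjunct2, THEN conjunct1])
 have TK: "\<gamma> (T n) \<in> K" for n using T by simp
 from K(1)[unfolded compact_def, rule_format, OF TK]
 obtain z where z: "z \<in> K" and "\<exists>k. strict_mono k \<and> ((\<lambda>n. \<gamma> (T n)) \<circ> k) \<longlonglongrightarrow> z" by (rule bexE)
 from this(2) obtain k where "strict_mono k \<and> ((\<lambda>n. \<gamma> (T n)) \<circ> k) \<longlonglongrightarrow> z" by (rule exE)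
 hence k: "strict_mono k" "((\<lambda>n. \<gamma> (T n)) \<circ> k) \<longlonglongrightarrow> z" by simp_all
 have zD: "z \<in> D" using z K by auto
 have Tk: "(T \<circ> k) \<longlonglongrightarrow> 1" using LIMSEQ_subseq_LIMSEQ[OF Tl k(1)] .
 have fl: "filterlim (T \<circ> k) (at_left 1) sequentially"
 proof -
  have "T (k n) < 1" for n using T by blast
  thus ?thesis using Tk by (simp add: filterlim_at less_imp_neq)
 qed
 have "(\<lambda>n. f (\<gamma> ((T \<circ> k) n))) \<longlonglongrightarrow> w" using filterlim_compose[OF g(3) fl] .
 moreover have "isCont f z" using D zD by (meson holomorphic_on_imp_continuous_on continuous_on_eq_continuous_at)
 hence "(\<lambda>n. f (((\<lambda>n. \<gamma> (T n)) \<circ> k) n)) \<longlonglongrightarrow> f z" using k(2) isCont_tendsto_compose by blast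
 ultimately have fz: "f z = w" using LIMSEQ_unique by auto
 have dz: "deriv f z \<noteq> 0" using w zD fz unfolding singular_value_def critical_value_def by blast
 show ?thesis
 proof (rule that[OF zD fz dz])
  fix e s :: real assume "e > 0" "s < 1"
  have "\<forall>\<^sub>F n in sequentially. dist (((\<lambda>n. \<gamma> (T n)) \<circ> k) n) z < e" using k(2) \<open>e > 0\<close> tendstoD by blast
  moreover have "\<forall>\<^sub>F n in sequentially. (T \<circ> k) n > s" using Tk \<open>s < 1\<close> order_tendstoD(1) by blast
  ultimately have "\<forall>\<^sub>F n in sequentially. dist (((\<lambda>n. \<gamma> (T n)) \<circ> k) n) z < e \<and> (T \<circ> k) n > s"
   by eventually_elim auto
  from eventually_happens'[OF sequentially_bot this]
  obtain n where n: "dist (((\<lambda>n. \<gamma> (T n)) \<circ> k) n) z < e" "(T \<circ> k) n > s" by (elim exE conjE)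
  show "\<exists>t. s < t \<and> 0 \<le> t \<and> t < 1 \<and> \<gamma> t \<in> ball z e"
  proof (intro exI conjI)
   show "s < T (k n)" using n(2) by simp
   show "0 \<le> T (k n)" by (rule T0)
   show "T (k n) < 1" using T by blast
   show "\<gamma> (T (k n)) \<in> ball z e" using n(1) by (simp add: dist_commute)
  qed
 qed
qed

text \<open>Serves to compare two local continuations across the circle: the common part of their
  balls contains a point of the open disc, where both agree with the given lift. The point dividing
  the segment from \<open>a\<close> to \<open>b\<close> in the ratio \<open>e : d\<close> works, and
  strict convexity puts it inside the circle.\<close>

lemma ball_lens_meets_disc:
 fixes a b :: complex
 assumes "norm a = r" "norm b = r" "x \<in> ball a e" "x \<in> ball b d"
 shows "\<exists>y. y \<in> ball a e \<and> y \<in> ball b d \<and> y \<in> cball 0 r \<and> (a \<noteq> b \<longrightarrow> norm y < r)"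
proof (cases "a = b")
 case True thus ?thesis using assms by (intro exI[of _ a]) (auto intro: le_less_trans[OF zero_le_dist])
next
 case False
 have ed: "e > 0" "d > 0" "dist a b < e + d"
  using assms(3,4) dist_triangle[of a b x] zero_le_dist[of a x] zero_le_dist[of b x]
  by (auto simp: dist_commute simp del: zero_le_dist)
 define t where "t = e / (e + d)"
 have t: "0 < t" "t < 1" using ed by (auto simp: t_def)
 define y where "y = (1 - t) *\<^sub>R a + t *\<^sub>R b"
 have "dist a y = t * dist a b"
 proof -
  have "a - y = t *\<^sub>R (a - b)" by (simp add: y_def algebra_simps)
  thus ?thesis using t by (simp add: dist_norm)
 qed
 also have "\<dots> < t * (e + d)" using ed t by simp
 finally have 1: "dist a y < e" using ed by (simp add: t_def)
 have "dist b y = (1 - t) * dist a b"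
 proof -
  have "b - y = (1 - t) *\<^sub>R (b - a)" by (simp add: y_def algebra_simps)
  thus ?thesis using t by (simp add: dist_norm norm_minus_commute)
 qed
 also have "\<dots> < (1 - t) * (e + d)" using ed t by simp
 also have "\<dots> = d" using ed by (simp add: t_def field_simps)
 finally have 2: "dist b y < d" .
 have "y \<in> open_segment a b" using t False by (auto simp: y_def in_segment)
 hence "norm y < r" using dist_decreases_open_segment[of y a b 0] assms(1,2) by auto
 thus ?thesis using 1 2 by auto
qed

text \<open>The radial path towards a boundary point \<open>a\<close> has an image tending to the
  nonsingular value \<open>\<phi> a\<close>, so its lift accumulates at a point where
  \<open>f\<close> has a local inverse; composing that inverse with \<open>\<phi>\<close> continues
  \<open>\<psi>\<close> across \<open>a\<close>. Compactness of the circle gives a common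
  width.\<close>

lemma disc_lift_extend:
 assumes D: "open D" "f holomorphic_on D" and r: "0 < r" "r < 1"
  and phi: "\<phi> holomorphic_on ball 0 1" "\<And>x. x \<in> ball 0 1 - {0} \<Longrightarrow> \<not> singular_value D f (\<phi> x)"
  and psi: "\<psi> holomorphic_on ball 0 r" "\<And>x. x \<in> ball 0 r \<Longrightarrow> \<psi> x \<in> D \<and> f (\<psi> x) = \<phi> x"
 shows "\<exists>r' \<psi>'. r < r' \<and> r' \<le> 1 \<and> \<psi>' holomorphic_on ball 0 r' \<and> \<psi>' 0 = \<psi> 0 \<and>
     (\<forall>x\<in>ball 0 r'. \<psi>' x \<in> D \<and> f (\<psi>' x) = \<phi> x)"
proof -
 have ns: "deriv f (h x) \<noteq> 0" if "x \<in> ball 0 1 - {0}" "h x \<in> D" "f (h x) = \<phi> x" for h x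
  using phi(2)[OF that(1)] that(2,3) unfolding singular_value_def critical_value_def by auto
 have cphi: "continuous_on (ball 0 1) \<phi>" using phi(1) holomorphic_on_imp_continuous_on by blast
 have cpsi: "continuous_on (ball 0 r) \<psi>" using psi(1) holomorphic_on_imp_continuous_on by blast
 have loc: "\<exists>e h. e > 0 \<and> ball a e \<subseteq> ball 0 1 - {0} \<and> h holomorphic_on ball a e \<and>
   (\<forall>x\<in>ball a e. h x \<in> D \<and> f (h x) = \<phi> x) \<and> (\<forall>x\<in>ball a e \<inter> ball 0 r. h x = \<psi> x)"
  if a: "norm a = r" for a
 proof -
  have a1: "a \<in> ball 0 1 - {0}" using a r by auto
  define \<gamma> where "\<gamma> t = \<psi> (of_real t * a)" for t :: real
  have in_r: "of_real t * a \<in> ball 0 r" if "t \<in> {0..<1}" for t :: real using that a r by (auto simp: norm_mult)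
  have g1: "continuous_on {0..<1} \<gamma>" unfolding \<gamma>_def
   by (rule continuous_on_compose2[OF cpsi]) (use in_r in \<open>auto intro!: continuous_intros\<close>)
  have g2: "\<gamma> ` {0..<1} \<subseteq> D" using in_r psi(2) by (auto simp: \<gamma>_def)
  have "isCont \<phi> a" using cphi a1 by (simp add: continuous_on_eq_continuous_at)
  moreover have "((\<lambda>t. complex_of_real t * a) \<longlongrightarrow> a) (at_left 1)"
   by (rule tendsto_eq_intros refl tendsto_within_subset | simp)+
  ultimately have "((\<lambda>t. \<phi> (of_real t * a)) \<longlongrightarrow> \<phi> a) (at_left 1)" by (rule isCont_tendsto_compose)
  moreover have "\<forall>\<^sub>F t in at_left 1. \<phi> (of_real t * a) = f (\<gamma> t)"
   using eventually_at_left[of "0::real" 1] psi(2) in_r by (force simp: \<gamma>_def intro!: exI[of _ 0])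
  ultimately have g3: "((\<lambda>t. f (\<gamma> t)) \<longlongrightarrow> \<phi> a) (at_left 1)" using tendsto_cong by force
  obtain z where z: "z \<in> D" "f z = \<phi> a" "deriv f z \<noteq> 0"
   and acc: "\<And>e s. e > 0 \<Longrightarrow> s < (1::real) \<Longrightarrow> \<exists>t. s < t \<and> 0 \<le> t \<and> t < 1 \<and> \<gamma> t \<in> ball z e"
   using nonsingular_path_accumulates[OF D phi(2)[OF a1] g1 g2 g3] by metis
  obtain e d h where h: "e > 0" "ball z e \<subseteq> D" "d > 0" "h holomorphic_on ball (\<phi> a) d"
   "\<And>w. w \<in> ball (\<phi> a) d \<Longrightarrow> h w \<in> ball z e \<and> f (h w) = w"
   "\<And>x. x \<in> ball z e \<Longrightarrow> f x \<in> ball (\<phi> a) d \<Longrightarrow> h (f x) = x" using holomorphic_local_inverse[OF D z(1,3)] z(2) by metis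
  have "open ((ball 0 1 - {0}) \<inter> \<phi> -` ball (\<phi> a) d)"
   by (rule continuous_open_preimage) (auto intro: continuous_on_subset[OF cphi])
  moreover have "a \<in> (ball 0 1 - {0}) \<inter> \<phi> -` ball (\<phi> a) d" using a1 h(3) by auto
  ultimately obtain b where b: "b > 0" "ball a b \<subseteq> (ball 0 1 - {0}) \<inter> \<phi> -` ball (\<phi> a) d"
   by (meson open_contains_ball)
  have "\<phi> holomorphic_on ball a b" by (rule holomorphic_on_subset[OF phi(1)]) (use b(2) in blast)
  moreover have "\<phi> ` ball a b \<subseteq> ball (\<phi> a) d" using b(2) by blast
  ultimately have hp: "(\<lambda>x. h (\<phi> x)) holomorphic_on ball a b"
   using holomorphic_on_compose_gen[of \<phi> "ball a b" h "ball (\<phi> a) d"] h(4) unfolding o_def by blast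
  have hpD: "h (\<phi> x) \<in> D \<and> f (h (\<phi> x)) = \<phi> x" if "x \<in> ball a b" for x
   using \<open>\<phi> ` ball a b \<subseteq> ball (\<phi> a) d\<close> h(2,5) that by blast
  \<comment> \<open>For \<open>s < t < 1\<close> the point \<open>t * a\<close> lies within distance
    \<open>b\<close> of \<open>a\<close>.\<close>
  define s where "s = max 0 (1 - b / r)"
  have "s < 1" using b r by (auto simp: s_def)
  obtain t where t: "s < t" "0 \<le> t" "t < 1" "\<gamma> t \<in> ball z e" using acc[OF h(1) \<open>s < 1\<close>] by blast
  define x0 where "x0 = of_real t * a"
  have "dist a x0 = (1 - t) * r"
  proof -
   have "a - x0 = of_real (1 - t) * a" by (simp add: x0_def algebra_simps)
   thus ?thesis using t a by (simp add: dist_norm norm_mult del: of_real_diff)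
  qed
  also have "\<dots> < b" using t r by (simp add: s_def field_simps)
  finally have x0: "x0 \<in> ball a b" by simp
  have x0r: "x0 \<in> ball 0 r" unfolding x0_def using in_r t by auto
  have "\<phi> x0 \<in> ball (\<phi> a) d" using x0 b(2) by blast
  hence eq0: "h (\<phi> x0) = \<psi> x0" using h(6)[of "\<psi> x0"] t(4) psi(2)[OF x0r] by (simp add: \<gamma>_def x0_def)
  have "h (\<phi> x) = \<psi> x" if x: "x \<in> ball a b \<inter> ball 0 r" for x
  proof (rule holomorphic_lift_unique[OF D, of "ball a b \<inter> ball 0 r" "\<lambda>x. h (\<phi> x)" \<psi> x0 x])
   show "connected (ball a b \<inter> ball 0 r)" by (intro convex_connected convex_Int convex_ball)
   show "(\<lambda>x. h (\<phi> x)) holomorphic_on ball a b \<inter> ball 0 r" "\<psi> holomorphic_on ball a b \<inter> ball 0 r"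
    using hp psi(1) holomorphic_on_subset by blast+
   show "deriv f (h (\<phi> x0)) \<noteq> 0" using ns[of x0 "\<lambda>x. h (\<phi> x)"] hpD[OF x0] x0 b(2) by blast
  qed (use hpD psi(2) x0 x0r x eq0 in auto)
  thus ?thesis using b hp hpD by (intro exI[of _ b] exI[of _ "\<lambda>x. h (\<phi> x)"]) auto
 qed
 then obtain E H where EH: "\<And>a. norm a = r \<Longrightarrow> E a > 0 \<and> ball a (E a) \<subseteq> ball 0 1 - {0} \<and>
   H a holomorphic_on ball a (E a) \<and> (\<forall>x\<in>ball a (E a). H a x \<in> D \<and> f (H a x) = \<phi> x) \<and>
   (\<forall>x\<in>ball a (E a) \<inter> ball 0 r. H a x = \<psi> x)"
  by metis
 have HH: "H a x = H b x" if "norm a = r" "norm b = r" "x \<in> ball a (E a)" "x \<in> ball b (E b)" for a b x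
 proof (cases "a = b")
  case False
  note ab = that
  obtain y where y: "y \<in> ball a (E a)" "y \<in> ball b (E b)" "norm y < r"
   using ball_lens_meets_disc[OF ab] False by blast
  show ?thesis
  proof (rule holomorphic_lift_unique[OF D, of "ball a (E a) \<inter> ball b (E b)" "H a" "H b" y x])
   show "connected (ball a (E a) \<inter> ball b (E b))" by (intro convex_connected convex_Int convex_ball)
   show "H a holomorphic_on ball a (E a) \<inter> ball b (E b)" "H b holomorphic_on ball a (E a) \<inter> ball b (E b)"
    using EH that holomorphic_on_subset by blast+
   show "deriv f (H a y) \<noteq> 0" using ns[of y "H a"] EH[OF that(1)] y by blast
   show "H a y = H b y" using EH[OF that(1)] EH[OF that(2)] y by auto
   show "f (H a x) = f (H b x)" if "x \<in> ball a (E a) \<inter> ball b (E b)" for x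
    using EH[OF \<open>norm a = r\<close>] EH[OF \<open>norm b = r\<close>] that by (metis IntE)
   show "H a ` (ball a (E a) \<inter> ball b (E b)) \<subseteq> D" "H b ` (ball a (E a) \<inter> ball b (E b)) \<subseteq> D"
    using EH[OF \<open>norm a = r\<close>] EH[OF \<open>norm b = r\<close>] by auto
  qed (use that y in auto)
 qed auto
 define Om where "Om = ball 0 r \<union> (\<Union>a\<in>sphere 0 r. ball a (E a))"
 have "open Om" unfolding Om_def by auto
 moreover have Om2: "cball 0 r \<subseteq> Om"
 proof
  fix x :: complex assume "x \<in> cball 0 r"
  show "x \<in> Om"
  proof (cases "norm x = r")
   case True
   hence "x \<in> sphere 0 r" "x \<in> ball x (E x)" using EH[of x] by auto
   thus ?thesis unfolding Om_def by blast
  next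
   case False
   thus ?thesis using \<open>x \<in> cball 0 r\<close> by (auto simp: Om_def)
  qed
 qed
 ultimately obtain e where e: "e > 0" "(\<Union>x\<in>cball 0 r. ball x e) \<subseteq> Om"
  using compact_subset_open_imp_ball_epsilon_subset[OF compact_cball] by blast
 have "ball 0 (r + e) \<subseteq> Om"
 proof
  fix x :: complex assume x: "x \<in> ball 0 (r + e)"
  show "x \<in> Om"
  proof (cases "norm x \<le> r")
   case True thus ?thesis using Om2 by auto
  next
   case False
   define y where "y = of_real (r / norm x) * x"
   have nx: "norm x > 0" using False r by linarith
   hence "norm y = r" unfolding y_def norm_mult norm_of_real using r by simp
   have "y - x = of_real (r / norm x - 1) * x" by (simp add: y_def algebra_simps)
   hence "dist y x = \<bar>r / norm x - 1\<bar> * norm x" by (simp add: dist_norm norm_mult del: of_real_diff)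
   also have "\<dots> = norm x - r" using False nx by (simp add: field_simps)
   finally have "x \<in> ball y e" "y \<in> cball 0 r" using x \<open>norm y = r\<close> by auto
   thus ?thesis using e(2) by blast
  qed
 qed
 then obtain r1 where r1: "r < r1" "ball 0 r1 \<subseteq> Om" using e(1) by (metis less_add_same_cancel1)
 define r' where "r' = min r1 1"
 have r': "r < r'" "r' \<le> 1" "ball 0 r' \<subseteq> Om" using r1 r by (auto simp: r'_def)
 \<comment> \<open>Any boundary point whose ball contains \<open>x\<close> will do:
   \<open>HH\<close> makes the value independent of the choice.\<close>
 define A :: "complex \<Rightarrow> complex" where "A x = (SOME a. norm a = r \<and> x \<in> ball a (E a))" for x
 define P where "P x = (if norm x < r then \<psi> x else H (A x) x)" for x
 have A: "norm (A x) = r \<and> x \<in> ball (A x) (E (A x))" if "x \<in> ball 0 r'" "\<not> norm x < r" for x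
 proof -
  have "x \<in> Om" using that(1) r'(3) by blast
  hence "\<exists>a. norm a = r \<and> x \<in> ball a (E a)" using that(2) unfolding Om_def by force
  thus ?thesis unfolding A_def by (rule someI_ex)
 qed
 have PH: "P x = H a x" if "norm a = r" "x \<in> ball a (E a)" "x \<in> ball 0 r'" for a x
  using that EH[OF that(1)] HH[of "A x" a x] A[of x] by (auto simp: P_def)
 have PD: "P x \<in> D \<and> f (P x) = \<phi> x" if "x \<in> ball 0 r'" for x
  using that A[of x] EH[of "A x"] psi(2)[of x] by (auto simp: P_def)
 have "P holomorphic_on ball 0 r'"
 proof (rule holomorphic_on_locally)
  fix x :: complex assume x: "x \<in> ball 0 r'"
  show "\<exists>U h. open U \<and> x \<in> U \<and> h holomorphic_on U \<and> (\<forall>y\<in>U. P y = h y)"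
  proof (cases "norm x < r")
   case True
   thus ?thesis using psi(1) by (intro exI[of _ "ball 0 r"] exI[of _ \<psi>]) (simp add: P_def)
  next
   case False
   note a = A[OF x False]
   have "H (A x) holomorphic_on ball (A x) (E (A x)) \<inter> ball 0 r'"
    using EH[OF a[THEN conjunct1]] holomorphic_on_subset by blast
   thus ?thesis using a x PH by (intro exI[of _ "ball (A x) (E (A x)) \<inter> ball 0 r'"] exI[of _ "H (A x)"]) auto
  qed
 qed
 moreover have "P 0 = \<psi> 0" using r by (simp add: P_def)
 ultimately show ?thesis using r' PD by blast
qed

text \<open>A monodromy argument on radii: the supremum of the radii of discs that carry a lift is
  1, because a lift can always be continued beyond a smaller disc. The centre is exempt from the
  hypothesis on singular values, as \<open>z0\<close> is given with nonzero derivative; the pull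
  backs below rely on this when the centre of a disc lies on the orbit of a singular value.\<close>

lemma disc_lift:
 assumes D: "open D" "f holomorphic_on D"
  and phi: "\<phi> holomorphic_on ball 0 1" "\<And>x. x \<in> ball 0 1 - {0} \<Longrightarrow> \<not> singular_value D f (\<phi> x)"
  and z0: "z0 \<in> D" "f z0 = \<phi> 0" "deriv f z0 \<noteq> 0"
 obtains \<psi> where "\<psi> holomorphic_on ball 0 1" "\<psi> 0 = z0"
  "\<And>x. x \<in> ball 0 1 \<Longrightarrow> \<psi> x \<in> D \<and> f (\<psi> x) = \<phi> x"
proof -
 define L :: "real \<Rightarrow> (complex \<Rightarrow> complex) \<Rightarrow> bool" where "L r \<psi> \<longleftrightarrow> \<psi> holomorphic_on ball 0 r \<and> \<psi> 0 = z0 \<and>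
   (\<forall>x\<in>ball 0 r. \<psi> x \<in> D \<and> f (\<psi> x) = \<phi> x)" for r \<psi>
 define S where "S = {r. 0 < r \<and> r \<le> 1 \<and> (\<exists>\<psi>. L r \<psi>)}"
 have mono: "L r' \<psi>" if "L r \<psi>" "r' \<le> r" for r r' \<psi>
  using that unfolding L_def by (meson holomorphic_on_subset subset_ball subsetD)
 have cphi: "continuous_on (ball 0 1) \<phi>" using phi(1) holomorphic_on_imp_continuous_on by blast
 obtain e d h where h: "e > 0" "ball z0 e \<subseteq> D" "d > 0" "h holomorphic_on ball (\<phi> 0) d" "h (\<phi> 0) = z0"
   "\<And>w. w \<in> ball (\<phi> 0) d \<Longrightarrow> h w \<in> ball z0 e \<and> f (h w) = w"
  using holomorphic_local_inverse[OF D z0(1,3)] z0(2) by metis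
 have "open (ball 0 1 \<inter> \<phi> -` ball (\<phi> 0) d)" by (rule continuous_open_preimage) (auto intro: cphi)
 moreover have "0 \<in> ball 0 1 \<inter> \<phi> -` ball (\<phi> 0) d" using h(3) by auto
 ultimately obtain b where b: "b > 0" "ball 0 b \<subseteq> ball 0 1 \<inter> \<phi> -` ball (\<phi> 0) d" by (meson open_contains_ball)
 have "\<phi> holomorphic_on ball 0 b" by (rule holomorphic_on_subset[OF phi(1)]) (use b(2) in blast)
 moreover have "\<phi> ` ball 0 b \<subseteq> ball (\<phi> 0) d" using b(2) by blast
 ultimately have "(\<lambda>x. h (\<phi> x)) holomorphic_on ball 0 b"
  using holomorphic_on_compose_gen[of \<phi> "ball 0 b" h "ball (\<phi> 0) d"] h(4) unfolding o_def by blast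
 moreover have "h (\<phi> x) \<in> D \<and> f (h (\<phi> x)) = \<phi> x" if "x \<in> ball 0 b" for x
 proof -
  have "\<phi> x \<in> ball (\<phi> 0) d" using that b(2) by blast
  thus ?thesis using h(2,6) by blast
 qed
 ultimately have "L b (\<lambda>x. h (\<phi> x))" using h(5) by (auto simp: L_def)
 hence "L (min b 1) (\<lambda>x. h (\<phi> x))" by (rule mono) simp
 moreover have "0 < min b 1" "min b 1 \<le> 1" using b by auto
 ultimately have bS: "min b 1 \<in> S" unfolding S_def by blast
 define s where "s = Sup S"
 have bdd: "bdd_above S" by (rule bdd_aboveI[of _ 1]) (auto simp: S_def)
 have s: "0 < s" "s \<le> 1"
 proof -
  have "min b 1 \<le> s" unfolding s_def by (rule cSup_upper[OF bS bdd])
  thus "0 < s" using \<open>0 < min b 1\<close> by linarith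
  show "s \<le> 1" unfolding s_def
  proof (rule cSup_least)
   show "S \<noteq> {}" using bS by blast
  qed (simp add: S_def)
 qed
 have ex: "\<exists>\<psi>. L r \<psi>" if "r < s" for r
 proof -
  have "S \<noteq> {}" using bS by blast
  from less_cSupD[OF this that[unfolded s_def]] obtain r2 where r2: "r2 \<in> S" "r < r2" by (elim bexE)
  from r2(1) obtain \<psi> where "L r2 \<psi>" by (auto simp: S_def)
  hence "L r \<psi>" by (rule mono) (use r2(2) in simp)
  thus ?thesis by (intro exI[of _ \<psi>])
 qed
 define \<Psi> where "\<Psi> r = (SOME \<psi>. L r \<psi>)" for r
 have Psi: "L r (\<Psi> r)" if "r < s" for r unfolding \<Psi>_def using ex[OF that] by (rule someI_ex)
 have uni: "\<psi> x = \<psi>' x" if "L r \<psi>" "L r' \<psi>'" "x \<in> ball 0 r" "x \<in> ball 0 r'" "0 < r" "0 < r'" for r r' \<psi> \<psi>' x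
 proof (rule holomorphic_lift_unique[OF D, of "ball 0 (min r r')" \<psi> \<psi>' 0 x])
  show "\<psi> holomorphic_on ball 0 (min r r')" "\<psi>' holomorphic_on ball 0 (min r r')" using that by (auto simp: L_def)
 qed (use that z0 in \<open>auto simp: L_def\<close>)
 \<comment> \<open>The radius halfway between \<open>norm x\<close> and \<open>s\<close> is one for
   which \<open>\<Psi>\<close> is a lift at \<open>x\<close>; by uniqueness every other such radius
   gives the same value.\<close>
 define P where "P x = \<Psi> ((norm x + s) / 2) x" for x
 have PP: "P x = \<Psi> r x" if "norm x < r" "r < s" for x r
 proof -
  have x: "norm x < s" "0 \<le> norm x" using that by auto
  show ?thesis unfolding P_def
  proof (rule uni[OF Psi[of "(norm x + s) / 2"] Psi[of r]])
   show "(norm x + s) / 2 < s" "x \<in> ball 0 ((norm x + s) / 2)" using x by simp_all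
   have "0 < norm x + s" using x(2) s(1) by (rule add_nonneg_pos)
   thus "0 < (norm x + s) / 2" by simp
   show "0 < r" using le_less_trans[OF x(2) that(1)] .
   show "x \<in> ball 0 r" using that by simp
   show "r < s" by fact
  qed
 qed
 have LP: "L s P" unfolding L_def
 proof (intro conjI ballI)
  show "P holomorphic_on ball 0 s"
  proof (rule holomorphic_on_locally)
   fix x :: complex assume x: "x \<in> ball 0 s"
   define r where "r = (norm x + s) / 2"
   have r: "norm x < r" "r < s" using x by (auto simp: r_def)
   have "\<Psi> r holomorphic_on ball 0 r" using Psi[OF r(2)] by (simp add: L_def)
   thus "\<exists>U h. open U \<and> x \<in> U \<and> h holomorphic_on U \<and> (\<forall>y\<in>U. P y = h y)"
    using PP r by (intro exI[of _ "ball 0 r"] exI[of _ "\<Psi> r"]) auto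
  qed
  show "P 0 = z0" using PP[of 0 "s/2"] Psi[of "s/2"] s by (auto simp: L_def)
  fix x :: complex assume x: "x \<in> ball 0 s"
  define r where "r = (norm x + s) / 2"
  have r: "norm x < r" "r < s" using x by (auto simp: r_def)
  show "P x \<in> D" "f (P x) = \<phi> x" using PP[OF r] Psi[OF r(2)] r by (auto simp: L_def)
 qed
 have "s = 1"
 proof (rule ccontr)
  assume "s \<noteq> 1"
  hence "s < 1" using s by simp
  have "P holomorphic_on ball 0 s" "\<And>x. x \<in> ball 0 s \<Longrightarrow> P x \<in> D \<and> f (P x) = \<phi> x" "P 0 = z0"
   using LP by (auto simp: L_def)
  from disc_lift_extend[OF D s(1) \<open>s < 1\<close> phi this(1,2)] this(3)
  obtain r' \<psi>' where r': "s < r'" "r' \<le> 1" "L r' \<psi>'" unfolding L_def by metis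
  have "r' \<in> S" unfolding S_def using r' s by (intro CollectI conjI exI[of _ \<psi>']) simp_all
  hence "r' \<le> s" unfolding s_def by (rule cSup_upper[OF _ bdd])
  thus False using r' by simp
 qed
 thus ?thesis by (intro that[of P]) (use LP in \<open>simp_all add: L_def\<close>)
qed

section \<open>Holomorphic motions and their lifts\<close>

text \<open>The sign group \<open>U\<close> is \<open>{1}\<close> for the class \<open>\<E>\<close> and \<open>{1, -1}\<close> for the class of odd maps; the singular
 values are \<open>0\<close> and the elements of \<open>U\<close>.\<close>

locale lift_map =
 fixes D :: "complex set" and f :: "complex \<Rightarrow> complex" and U :: "complex set"
  and Dp :: "complex set" and c1 :: complex
 assumes open_D: "open D" and hol_f: "f holomorphic_on D"
  and f_0: "0 \<in> D \<Longrightarrow> f 0 = 0"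
  and U_sub: "U \<subseteq> {1, -1}" and one_U: "1 \<in> U"
  and U_inv: "\<And>u z. u \<in> U \<Longrightarrow> z \<in> D \<Longrightarrow> u * z \<in> D \<and> f (u * z) = u * f z"
  and nonsing: "\<And>v. v \<in> f ` D \<Longrightarrow> v \<noteq> 0 \<Longrightarrow> v \<notin> U \<Longrightarrow> \<not> singular_value D f v"
  and Dp_comp: "Dp \<in> components D"
  and quot: "\<And>u v. u \<in> D \<Longrightarrow> u \<noteq> 0 \<Longrightarrow> v \<in> Dp \<Longrightarrow> v \<noteq> 0 \<Longrightarrow> v \<noteq> u \<Longrightarrow> u / v \<in> f ` D"
  and ex_omitted: "\<exists>p. p \<noteq> 0 \<and> (p \<in> D \<longrightarrow> f p = 1)"
  and not_inj: "\<And>X. finite X \<Longrightarrow> - X \<subseteq> D \<Longrightarrow> \<not> inj_on f (- X)"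
  and c1: "c1 \<in> Dp" "c1 \<noteq> 0"
begin

abbreviation g :: "complex \<Rightarrow> complex" where "g z \<equiv> c1 * f z"
abbreviation g' :: "complex \<Rightarrow> complex" where "g' z \<equiv> c1 * deriv f z"
abbreviation c :: "nat \<Rightarrow> complex" where "c n \<equiv> (g ^^ n) c1"

lemma hol_f': "deriv f holomorphic_on D" by (rule holomorphic_deriv[OF hol_f open_D])

lemma Dp_connected_subset: "connected S \<Longrightarrow> S \<subseteq> D \<Longrightarrow> x \<in> S \<Longrightarrow> x \<in> Dp \<Longrightarrow> S \<subseteq> Dp"
 using components_maximal[OF Dp_comp] by blast

lemma open_Dp: "open Dp" using open_components[OF open_D Dp_comp] .

lemma nonsing_deriv:
 assumes "z \<in> D" "f z \<noteq> 0" "f z \<notin> U"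
 shows "deriv f z \<noteq> 0" using nonsing[of "f z"] assms unfolding singular_value_def critical_value_def by blast

lemma U_cases: "u \<in> U \<Longrightarrow> u = 1 \<or> u = -1" using U_sub by auto

lemma U_square: "u \<in> U \<Longrightarrow> u * u = 1" using U_cases by fastforce

lemma U_nz: "u \<in> U \<Longrightarrow> u \<noteq> 0" using U_cases by fastforce

lemma norm_U: "u \<in> U \<Longrightarrow> norm u = 1" using U_cases by fastforce

lemma f_nz_imp_nz: "z \<in> D \<Longrightarrow> f z \<noteq> 0 \<Longrightarrow> z \<noteq> 0" using f_0 by auto

text \<open>The index \<open>i0\<close> marks \<open>c1\<close>; its motion is confined to
  \<open>Dp\<close> because condition (c) divides only by points of \<open>Dp\<close>. Points are
  kept apart modulo the sign group, so that the quotients formed when lifting avoid all of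
  \<open>U\<close> and not just 1.\<close>

definition motion :: "'i set \<Rightarrow> ('i \<Rightarrow> complex) \<Rightarrow> 'i \<Rightarrow> ('i \<Rightarrow> complex \<Rightarrow> complex) \<Rightarrow> bool" where
 "motion J pt i0 M \<longleftrightarrow>
  (\<forall>i\<in>J. M i holomorphic_on ball 0 1 \<and> M i 0 = pt i \<and> (\<forall>x\<in>ball 0 1. M i x \<in> D \<and> M i x \<noteq> 0)) \<and>
  (\<forall>x\<in>ball 0 1. M i0 x \<in> Dp) \<and>
  (\<forall>i\<in>J. \<forall>j\<in>J. \<forall>u\<in>U. \<forall>x\<in>ball 0 1. i \<noteq> j \<longrightarrow> M i x \<noteq> u * M j x)"

definition lifts_to :: "'i set \<Rightarrow> ('i \<Rightarrow> 'i) \<Rightarrow> 'i \<Rightarrow> ('i \<Rightarrow> complex \<Rightarrow> complex) \<Rightarrow> ('i \<Rightarrow> complex \<Rightarrow> complex) \<Rightarrow> bool" where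
 "lifts_to J nx i0 M M' \<longleftrightarrow> (\<forall>i\<in>J. \<forall>x\<in>ball 0 1. M i0 x * f (M' i x) = M (nx i) x)"

text \<open>By \<open>quot\<close> and separation modulo \<open>U\<close> the quotient
  \<open>M (nx i) x / M i0 x\<close> stays in the image of \<open>f\<close> and off 0 and
  \<open>U\<close>, hence is a nonsingular value throughout the disc and lifts from
  \<open>pt i\<close>. Separation is inherited because \<open>f\<close> commutes with
  \<open>U\<close> and \<open>nx\<close> is injective; a lift starting in \<open>Dp\<close> stays
  there by connectedness.\<close>

lemma motion_lift:
 assumes J: "i0 \<in> J" "\<And>i. i \<in> J \<Longrightarrow> nx i \<in> J" "inj_on nx J" "\<And>i. i \<in> J \<Longrightarrow> nx i \<noteq> i0"
  and pt: "pt i0 = c1" "\<And>i. i \<in> J \<Longrightarrow> pt i \<in> D" "\<And>i. i \<in> J \<Longrightarrow> g (pt i) = pt (nx i)"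
  and M: "motion J pt i0 M"
 shows "\<exists>M'. motion J pt i0 M' \<and> lifts_to J nx i0 M M'"
proof -
 have Mh: "M i holomorphic_on ball 0 1" and M0: "M i 0 = pt i"
  and MD: "\<And>x. x \<in> ball 0 1 \<Longrightarrow> M i x \<in> D \<and> M i x \<noteq> 0" if "i \<in> J" for i using M that unfolding motion_def by auto
 have Mp: "\<And>x. x \<in> ball 0 1 \<Longrightarrow> M i0 x \<in> Dp" using M unfolding motion_def by auto
 have Md: "M i x \<noteq> u * M j x" if "i \<in> J" "j \<in> J" "u \<in> U" "x \<in> ball 0 1" "i \<noteq> j" for i j u x
  using M that unfolding motion_def by auto
 define ph where "ph i x = M (nx i) x / M i0 x" for i x
 have ph: "ph i x \<in> f ` D \<and> ph i x \<noteq> 0 \<and> ph i x \<notin> U" if i: "i \<in> J" and x: "x \<in> ball 0 1" for i x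
 proof -
  note n = J(2)[OF i] and n0 = J(4)[OF i]
  have "M (nx i) x \<noteq> 1 * M i0 x" by (rule Md[OF n J(1) one_U x n0])
  hence "ph i x \<in> f ` D" unfolding ph_def
   using quot[of "M (nx i) x" "M i0 x"] MD[OF n x] MD[OF J(1) x] Mp[OF x] by auto
  moreover have "ph i x \<noteq> 0" using MD[OF n x] MD[OF J(1) x] by (simp add: ph_def)
  moreover have "ph i x \<notin> U" by (metis MD Md assms(1) n n0 nonzero_eq_divide_eq ph_def x)
  ultimately show ?thesis by simp
 qed
 have "\<exists>h. h holomorphic_on ball 0 1 \<and> h 0 = pt i \<and> (\<forall>x\<in>ball 0 1. h x \<in> D \<and> f (h x) = ph i x)"
  if i: "i \<in> J" for i
 proof -
  have 1: "ph i holomorphic_on ball 0 1" unfolding ph_def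
   by (intro holomorphic_intros Mh[OF J(2)[OF i]] Mh[OF J(1)]) (use MD[OF J(1)] in blast)
  have 2: "\<not> singular_value D f (ph i x)" if "x \<in> ball 0 1 - {0}" for x
   using ph[OF i, of x] that nonsing[of "ph i x"] by simp
  have 3: "f (pt i) = ph i 0"
   using pt(1) pt(3)[OF i] M0[OF J(1)] M0[OF J(2)[OF i]] c1 by (simp add: ph_def field_simps)
  have 4: "deriv f (pt i) \<noteq> 0" using nonsing_deriv[OF pt(2)[OF i]] ph[OF i, of 0] 3 by simp
  show ?thesis by (metis "1" "2" "3" "4" disc_lift hol_f open_D pt(2) i)
 qed
 then obtain M' where M': "\<And>i. i \<in> J \<Longrightarrow> M' i holomorphic_on ball 0 1 \<and> M' i 0 = pt i \<and>
   (\<forall>x\<in>ball 0 1. M' i x \<in> D \<and> f (M' i x) = ph i x)" by metis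
 have lift: "M i0 x * f (M' i x) = M (nx i) x" if "i \<in> J" "x \<in> ball 0 1" for i x
  using M'[OF that(1)] that(2) MD[OF J(1) that(2)] by (simp add: ph_def)
 have "motion J pt i0 M'" unfolding motion_def
 proof (intro conjI ballI impI)
  fix i assume i: "i \<in> J"
  show "M' i holomorphic_on ball 0 1" "M' i 0 = pt i" using M'[OF i] by auto
  fix x assume x: "x \<in> ball (0::complex) 1"
  show "M' i x \<in> D" using M'[OF i] x by auto
  show "M' i x \<noteq> 0" using f_nz_imp_nz[of "M' i x"] M'[OF i] x ph[OF i x] by auto
 next
  fix x assume x: "x \<in> ball (0::complex) 1"
  have "connected (M' i0 ` ball 0 1)"
   using M'[OF J(1)] holomorphic_on_imp_continuous_on connected_continuous_image by blast
  moreover have "M' i0 ` ball 0 1 \<subseteq> D" using M'[OF J(1)] by auto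
  moreover have "M' i0 0 \<in> M' i0 ` ball 0 1" by auto
  moreover have "M' i0 0 \<in> Dp" using M'[OF J(1)] pt(1) c1 by auto
  ultimately have "M' i0 ` ball 0 1 \<subseteq> Dp" by (rule Dp_connected_subset)
  thus "M' i0 x \<in> Dp" using x by blast
 next
  fix i j u x assume i: "i \<in> J" and j: "j \<in> J" and u: "u \<in> U" and x: "x \<in> ball (0::complex) 1" and "i \<noteq> j"
  show "M' i x \<noteq> u * M' j x"
  proof
   assume "M' i x = u * M' j x"
   moreover have "M' j x \<in> D" using M'[OF j] x by auto
   ultimately have "f (M' i x) = u * f (M' j x)" using U_inv[OF u] by simp
   hence "M (nx i) x = u * M (nx j) x" using lift[OF i x] lift[OF j x] by (metis mult.left_commute)
   moreover have "nx i \<noteq> nx j" using J(3) i j \<open>i \<noteq> j\<close> by (meson inj_onD)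
   ultimately show False using Md[OF J(2)[OF i] J(2)[OF j] u x] by blast
  qed
 qed
 moreover have "lifts_to J nx i0 M M'" using lift by (simp add: lifts_to_def)
 ultimately show ?thesis by blast
qed

lemma motion_iterates:
 assumes J: "i0 \<in> J" "\<And>i. i \<in> J \<Longrightarrow> nx i \<in> J" "inj_on nx J" "\<And>i. i \<in> J \<Longrightarrow> nx i \<noteq> i0"
  and pt: "pt i0 = c1" "\<And>i. i \<in> J \<Longrightarrow> pt i \<in> D" "\<And>i. i \<in> J \<Longrightarrow> g (pt i) = pt (nx i)"
  and M: "motion J pt i0 M"
 obtains Ms where "Ms 0 = M" "\<And>k. motion J pt i0 (Ms k)" "\<And>k. lifts_to J nx i0 (Ms k) (Ms (Suc k))"
proof -
 have "\<exists>Ms. (\<forall>n. motion J pt i0 (Ms n)) \<and> Ms 0 = M \<and> (\<forall>n. lifts_to J nx i0 (Ms n) (Ms (Suc n)))"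
  using dependent_nat_choice[of "\<lambda>n X. motion J pt i0 X \<and> (n = 0 \<longrightarrow> X = M)" "\<lambda>n X Y. lifts_to J nx i0 X Y"]
   M motion_lift[OF J pt] by (metis nat.distinct(1))
 thus ?thesis using that by auto
qed

text \<open>A lift omits \<open>0\<close> and a second point which does not depend on anything, so Schottky's theorem applies.\<close>

lemma lift_bounded:
 obtains C where "C > 0" "\<And>(M :: 'i \<Rightarrow> complex \<Rightarrow> complex) M' J nx i0 pt i x n.
  motion J pt i0 M \<Longrightarrow> motion J pt i0 M' \<Longrightarrow> lifts_to J nx i0 M M' \<Longrightarrow>
  i0 \<in> J \<Longrightarrow> i \<in> J \<Longrightarrow> nx i \<in> J \<Longrightarrow> nx i \<noteq> i0 \<Longrightarrow> norm (pt i) \<le> B \<Longrightarrow>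
  norm ((deriv ^^ n) (M' i) 0) \<le> fact n * C * 2 ^ n"
proof -
 \<comment> \<open>The second omitted value: a lift passing through \<open>p\<close> would have
   \<open>f p = 1\<close>, that is, \<open>M (nx i)\<close> and \<open>M i0\<close> would
   meet.\<close>
 obtain p where p: "p \<noteq> 0" "p \<in> D \<longrightarrow> f p = 1" using ex_omitted by blast
 define E where "E = norm p * exp (pi * exp (pi * (2 + 2 * (B / norm p) + 12 * (2/3) / (1 - 2/3))))"
 have E: "E > 0" using p by (simp add: E_def)
 show ?thesis
 proof (rule that[OF E])
  fix M M' :: "'i \<Rightarrow> complex \<Rightarrow> complex" and J nx i0 pt i n
  assume M: "motion J pt i0 M" and M': "motion J pt i0 M'" and l: "lifts_to J nx i0 M M'"
   and J: "i0 \<in> J" "i \<in> J" "nx i \<in> J" "nx i \<noteq> i0" and B: "norm (pt i) \<le> B"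
  have hol: "M' i holomorphic_on ball 0 1" and M0: "M' i 0 = pt i" using M' J unfolding motion_def by auto
  have nz: "M' i x \<noteq> 0" if "x \<in> ball 0 1" for x using M' J that unfolding motion_def by auto
  have np: "M' i x \<noteq> p" if x: "x \<in> ball 0 1" for x
  proof
   assume "M' i x = p"
   moreover have "M' i x \<in> D" using M' J x unfolding motion_def by auto
   ultimately have "f (M' i x) = 1" using p by auto
   hence "M (nx i) x = 1 * M i0 x" using l J x unfolding lifts_to_def by fastforce
   moreover have "M (nx i) x \<noteq> 1 * M i0 x" using M J one_U x unfolding motion_def by blast
   ultimately show False by blast
  qed
  \<comment> \<open>Shrinking by 3/4 gives holomorphy on the closed disc, dividing by
    \<open>p\<close> gives the omitted values 0 and 1. Schottky's bound on radius 2/3 then covers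
    radius 1/2 for \<open>M' i\<close>, where the Cauchy estimates are taken.\<close>
  define h where "h x = M' i (of_real (3/4) * x) / p" for x
  have im: "of_real (3/4) * x \<in> ball 0 1" if "x \<in> cball 0 1" for x :: complex using that by auto
  have "h holomorphic_on cball 0 1" unfolding h_def
  proof (intro holomorphic_intros)
   have "M' i \<circ> (\<lambda>x. of_real (3/4) * x) holomorphic_on cball 0 1"
    by (rule holomorphic_on_compose_gen[OF _ hol]) (use im in \<open>auto intro!: holomorphic_intros\<close>)
   thus "(\<lambda>x. M' i (of_real (3/4) * x)) holomorphic_on cball 0 1" by (simp add: o_def)
  qed (use p in auto)
  moreover have "norm (h 0) \<le> B / norm p" using B M0 by (simp add: h_def norm_divide divide_right_mono)
  moreover have "\<not> (h x = 0 \<or> h x = 1)" if "x \<in> cball 0 1" for x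
   using nz[OF im[OF that]] np[OF im[OF that]] p by (auto simp: h_def)
  ultimately have S: "norm (h x) \<le> exp (pi * exp (pi * (2 + 2 * (B / norm p) + 12 * (2/3) / (1 - 2/3))))"
   if "norm x \<le> 2/3" for x using Schottky[of h "B / norm p" "2/3" x] that by simp
  have bd: "norm (M' i x) \<le> E" if "norm x \<le> 1/2" for x
  proof -
   have "norm (h (of_real (4/3) * x)) \<le> exp (pi * exp (pi * (2 + 2 * (B / norm p) + 12 * (2/3) / (1 - 2/3))))"
    by (rule S) (use that in \<open>simp \<close>)
   moreover have "M' i x = p * h (of_real (4/3) * x)" using p by (simp add: h_def)
   ultimately show ?thesis unfolding E_def by (simp only: norm_mult mult_left_mono norm_ge_zero)
  qed
  have "norm ((deriv ^^ n) (M' i) 0) \<le> fact n * E / (1/2) ^ n"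
  proof (rule Cauchy_inequality)
   have "cball (0::complex) (1/2) \<subseteq> ball 0 1" by auto
   thus "continuous_on (cball 0 (1/2)) (M' i)"
    using hol holomorphic_on_imp_continuous_on continuous_on_subset by blast
   show "M' i holomorphic_on ball 0 (1/2)" by (rule holomorphic_on_subset[OF hol]) auto
   show "norm (M' i x) \<le> E" if "norm (0 - x) = 1/2" for x using bd that by simp
  qed simp
  thus "norm ((deriv ^^ n) (M' i) 0) \<le> fact n * E * 2 ^ n" by (simp add: field_simps)
 qed
qed

end

section \<open>Critical orbits and pull backs of discs\<close>

lemma filterlim_div_nat: "0 < N \<Longrightarrow> filterlim (\<lambda>n::nat. n div N) at_top at_top" unfolding filterlim_at_top
proof
 fix Z :: nat assume N: "0 < N"
 show "\<forall>\<^sub>F n in sequentially. Z \<le> n div N" using eventually_ge_at_top[of "Z * N"]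
 proof eventually_elim
  case (elim n)
  hence "Z * N div N \<le> n div N" by (rule div_le_mono)
  thus ?case using N by simp
 qed
qed

lemma eventually_by_residues:
 assumes N: "0 < (N::nat)" and P: "\<And>s. s < N \<Longrightarrow> \<forall>\<^sub>F k in sequentially. P (N * k + s)"
 shows "\<forall>\<^sub>F n in sequentially. P n"
proof -
 have "\<forall>\<^sub>F k in sequentially. \<forall>s\<in>{..<N}. P (N * k + s)" by (rule eventually_ball_finite) (use P in auto)
 hence "\<forall>\<^sub>F n in sequentially. \<forall>s\<in>{..<N}. P (N * (n div N) + s)"
  by (rule eventually_compose_filterlim[OF _ filterlim_div_nat[OF N]])
 thus ?thesis
 proof eventually_elim
  case (elim n)
  from this[rule_format, of "n mod N"] show ?case using N by simp
 qed
qed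

lemma tendsto_by_residues:
 assumes "0 < (N::nat)" "\<And>s. s < N \<Longrightarrow> (\<lambda>k. x (N * k + s)) \<longlonglongrightarrow> (L :: 'a::metric_space)"
 shows "x \<longlonglongrightarrow> L"
proof (rule tendstoI)
 fix e :: real assume "0 < e"
 show "\<forall>\<^sub>F n in sequentially. dist (x n) L < e"
  by (rule eventually_by_residues[OF assms(1)]) (rule tendstoD[OF assms(2) \<open>0 < e\<close>])
qed

text \<open>Koebe-type bound: an injective branch of the logarithm of \<open>h\<close> cannot cover a disc of radius
 larger than \<open>\<pi>\<close>.\<close>

lemma injective_nonzero_deriv_bound:
 assumes h: "h holomorphic_on ball z R" "inj_on h (ball z R)" and R: "0 < R"
  and nz: "\<And>x. x \<in> ball z R \<Longrightarrow> h x \<noteq> 0"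
 shows "norm (deriv h z) * R \<le> 12 * pi * norm (h z)"
proof (rule ccontr)
 assume neg: "\<not> ?thesis"
 obtain l where l: "l holomorphic_on ball z R" "\<And>x. x \<in> ball z R \<Longrightarrow> h x = exp (l x)"
  using contractible_imp_holomorphic_log[OF h(1) convex_imp_contractible[OF convex_ball] nz] by blast
 have zb: "z \<in> ball z R" using R by simp
 have "(h has_field_derivative exp (l z) * deriv l z) (at z)"
 proof (rule has_field_derivative_transform_within_open[of "\<lambda>x. exp (l x)" _ _ "ball z R"])
  show "((\<lambda>x. exp (l x)) has_field_derivative exp (l z) * deriv l z) (at z)"
   by (rule DERIV_chain2[OF DERIV_exp]) (use l(1) zb in \<open>auto intro: holomorphic_derivI\<close>)
 qed (use l zb in auto)
 hence dh: "deriv h z = h z * deriv l z" using l(2)[OF zb] DERIV_imp_deriv by simp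
 have "norm (h z) > 0" using nz[OF zb] by simp
 moreover have "norm (h z) * (R * norm (deriv l z)) > norm (h z) * (12 * pi)"
  using neg dh by (simp add: norm_mult algebra_simps)
 ultimately have big: "R * norm (deriv l z) > 12 * pi" by simp
 \<comment> \<open>The 12 is the constant in Bloch's theorem. A disc of radius above
   \<open>pi\<close> contains two points that differ by \<open>2 * pi * \<i>\<close>, at which
   \<open>exp\<close> agrees.\<close>
 define r where "r = R * norm (deriv l z) / 12"
 have "r > pi" using big by (simp add: r_def)
 obtain b where b: "ball b r \<subseteq> l ` ball z R" using Bloch[OF l(1) R, of r] by (auto simp: r_def)
 have "b + \<i> * pi \<in> ball b r" "b - \<i> * pi \<in> ball b r" using \<open>r > pi\<close> by (auto simp: dist_norm norm_mult)
 hence "b + \<i> * pi \<in> l ` ball z R" "b - \<i> * pi \<in> l ` ball z R" using b by auto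
 then obtain x y where xy: "x \<in> ball z R" "y \<in> ball z R" "b + \<i> * pi = l x" "b - \<i> * pi = l y"
  unfolding image_iff by (elim bexE)
 have "exp (l x) = exp (l y)"
 proof -
  have "exp (l x) = exp b * exp (\<i> * pi)" "exp (l y) = exp b / exp (\<i> * pi)"
   unfolding xy(3,4)[symmetric] by (simp_all add: exp_add exp_diff)
  thus ?thesis by simp
 qed
 hence "h x = h y" using l(2) xy by simp
 hence "x = y" by (rule inj_onD[OF h(2) _ xy(1,2)])
 hence "b + \<i> * pi = b - \<i> * pi" using xy by simp
 thus False by simp
qed

section \<open>Derivatives along orbits and inverse branches of iterates\<close>

context lift_map begin

text \<open>The derivative of \<open>g ^^ n\<close> at \<open>z\<close> as long as the orbit remains
  in \<open>D\<close>, written as a product so that it splits along the orbit.\<close>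

definition tau :: "complex \<Rightarrow> nat \<Rightarrow> complex" where
 "tau z n = (\<Prod>i<n. g' ((g ^^ i) z))"

lemma tau_Suc: "tau z (Suc n) = tau z n * g' ((g ^^ n) z)" by (simp add: tau_def)

lemma tau_add: "tau z (m + n) = tau z m * tau ((g ^^ m) z) n"
 by (induction n) (simp_all add: tau_Suc tau_def[of _ 0] funpow_add add.commute)

lemma tau_0 [simp]: "tau z 0 = 1" by (simp add: tau_def)

lemma g_deriv: "z \<in> D \<Longrightarrow> (g has_field_derivative g' z) (at z)"
 by (rule DERIV_cmult) (rule holomorphic_derivI[OF hol_f open_D])

lemma funpow_deriv:
 "(\<And>j. j < n \<Longrightarrow> (g ^^ j) z \<in> D) \<Longrightarrow> ((g ^^ n) has_field_derivative tau z n) (at z)"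
proof (induction n)
 case 0
 have *: "g ^^ 0 = (\<lambda>x. x)" by auto
 show ?case unfolding tau_0 * by (rule DERIV_ident)
next
 case (Suc n)
 have 1: "((g ^^ n) has_field_derivative tau z n) (at z)" using Suc by simp
 have 2: "(g has_field_derivative g' ((g ^^ n) z)) (at ((g ^^ n) z))" by (rule g_deriv) (use Suc in simp)
 show ?case using DERIV_chain[OF 2 1] by (simp add: tau_Suc mult.commute o_def)
qed

lemma g_U: "u \<in> U \<Longrightarrow> z \<in> D \<Longrightarrow> g (u * z) = u * g z" using U_inv by simp

lemma deriv_f_U: "u \<in> U \<Longrightarrow> z \<in> D \<Longrightarrow> deriv f (u * z) = deriv f z"
proof -
 assume u: "u \<in> U" and z: "z \<in> D"
 have "((\<lambda>x. f (u * x)) has_field_derivative deriv f (u * z) * u) (at z)"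
 proof (rule DERIV_chain2[where f = f and g = "\<lambda>x. u * x"])
  show "(f has_field_derivative deriv f (u * z)) (at (u * z))"
   by (rule holomorphic_derivI[OF hol_f open_D]) (use U_inv[OF u z] in simp)
 qed (auto intro!: derivative_eq_intros)
 moreover have "((\<lambda>x. f (u * x)) has_field_derivative u * deriv f z) (at z)"
 proof (rule has_field_derivative_transform_within_open[of "\<lambda>x. u * f x" _ _ D])
  show "((\<lambda>x. u * f x) has_field_derivative u * deriv f z) (at z)"
   by (rule DERIV_cmult) (rule holomorphic_derivI[OF hol_f open_D z])
 qed (use u z open_D U_inv in auto)
 ultimately have "deriv f (u * z) * u = u * deriv f z" by (rule DERIV_unique)
 thus ?thesis using U_nz[OF u] by simp
qed

lemma funpow_U:
 "u \<in> U \<Longrightarrow> (\<And>j. j < n \<Longrightarrow> (g ^^ j) z \<in> D) \<Longrightarrow> (g ^^ n) (u * z) = u * (g ^^ n) z"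
proof (induction n)
 case (Suc n)
 hence "(g ^^ Suc n) (u * z) = g (u * (g ^^ n) z)" by simp
 also have "\<dots> = u * g ((g ^^ n) z)" by (rule g_U) (use Suc in simp_all)
 finally show ?case by simp
qed simp

text \<open>The nonzero singular values of \<open>g\<close> are among the points
  \<open>u * c1\<close>; their orbits are the only obstruction to inverse branches.\<close>

definition hits :: "complex set \<Rightarrow> nat \<Rightarrow> complex \<Rightarrow> bool" where
 "hits B i u \<longleftrightarrow> u \<in> U \<and> (\<forall>j<i. (g ^^ j) (u * c1) \<in> D \<and> (g ^^ j) (u * c1) \<noteq> 0) \<and> (g ^^ i) (u * c1) \<in> B"

text \<open>Each inverse branch is one application of \<open>disc_lift\<close>, to the values
  \<open>h z / c1\<close>. Such a value can be singular only if \<open>h z = u * c1\<close>, that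
  is, if the orbit of \<open>u * c1\<close> enters the disc; at the centre this is allowed because
  the backward orbit \<open>b\<close> avoids critical points. In the first step membership in the
  image of \<open>f\<close> comes from the hypothesis on the disc, afterwards from condition (c), as
  the branch already takes values in \<open>D\<close>.\<close>

lemma pull_back:
 assumes R: "0 < R" "\<And>z. z \<in> ball zs R \<Longrightarrow> z \<noteq> 0 \<and> (z \<noteq> c1 \<longrightarrow> z / c1 \<in> f ` D)"
  and b: "b 0 = zs" "\<And>i. i < n \<Longrightarrow> b (Suc i) \<in> D \<and> b i \<noteq> 0 \<and> g (b (Suc i)) = b i \<and> deriv f (b (Suc i)) \<noteq> 0"
  and no: "\<And>i u. i < n \<Longrightarrow> \<not> hits (ball zs R - {zs}) i u"
 shows "\<exists>h. h holomorphic_on ball zs R \<and> h zs = b n \<and>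
  (\<forall>z\<in>ball zs R. (g ^^ n) (h z) = z \<and> (\<forall>j<n. (g ^^ j) (h z) \<in> D \<and> (g ^^ j) (h z) \<noteq> 0))"
 using b(2) no
proof (induction n)
 case 0
 show ?case by (rule exI[of _ "\<lambda>z. z"]) (use b(1) in \<open>auto \<close>)
next
 case (Suc n)
 then obtain h where h: "h holomorphic_on ball zs R" "h zs = b n"
  "\<And>z. z \<in> ball zs R \<Longrightarrow> (g ^^ n) (h z) = z"
  "\<And>z j. z \<in> ball zs R \<Longrightarrow> j < n \<Longrightarrow> (g ^^ j) (h z) \<in> D \<and> (g ^^ j) (h z) \<noteq> 0" by force
 have hD: "h z \<noteq> 0 \<and> (h z \<noteq> c1 \<longrightarrow> h z / c1 \<in> f ` D)" if "z \<in> ball zs R" for z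
 proof (cases n)
  case 0
  thus ?thesis using h(3)[OF that] R(2)[OF that] by simp
 next
  case (Suc n')
  hence "h z \<in> D" "h z \<noteq> 0" using h(4)[OF that, of 0] by simp_all
  thus ?thesis using quot[of "h z" c1] c1 by auto
 qed
 have nu: "h z \<noteq> u * c1" if z: "z \<in> ball zs R" "z \<noteq> zs" and u: "u \<in> U" for z u
 proof
  assume eq: "h z = u * c1"
  have "hits (ball zs R - {zs}) n u" unfolding hits_def using u z h(3)[OF z(1)] h(4)[OF z(1)] unfolding eq by auto
  thus False using Suc.prems(2)[of n u] by simp
 qed
 define ph where "ph x = h (zs + of_real R * x) / c1" for x
 have im: "zs + of_real R * x \<in> ball zs R" if "x \<in> ball 0 1" for x using that R(1) by (simp add: dist_norm norm_mult)
 have 1: "ph holomorphic_on ball 0 1" unfolding ph_def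
 proof (intro holomorphic_intros)
  have "h \<circ> (\<lambda>x. zs + of_real R * x) holomorphic_on ball 0 1"
   by (rule holomorphic_on_compose_gen[OF _ h(1)]) (use im in \<open>auto intro!: holomorphic_intros\<close>)
  thus "(\<lambda>x. h (zs + of_real R * x)) holomorphic_on ball 0 1" by (simp add: o_def)
 qed (use c1 in auto)
 have 2: "\<not> singular_value D f (ph x) \<and> ph x \<noteq> 0" if x: "x \<in> ball 0 1 - {0}" for x
 proof -
  define z where "z = zs + of_real R * x"
  have z: "z \<in> ball zs R" "z \<noteq> zs" using im[of x] x by (auto simp: z_def)
  have "h z / c1 \<in> f ` D" using hD[OF z(1)] nu[OF z one_U] by auto
  moreover have "h z / c1 \<noteq> 0" using hD[OF z(1)] c1 by simp
  moreover have "h z / c1 \<notin> U"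
  proof
   assume "h z / c1 \<in> U"
   from nu[OF z this] show False using c1 by simp
  qed
  ultimately show ?thesis using nonsing by (simp add: ph_def z_def)
 qed
 have bn: "b (Suc n) \<in> D" "b n \<noteq> 0" "g (b (Suc n)) = b n" "deriv f (b (Suc n)) \<noteq> 0" using Suc.prems(1)[of n] by auto
 have 3: "f (b (Suc n)) = ph 0" using bn h(2) c1 by (simp add: ph_def field_simps)
 show ?case
 proof (rule disc_lift[OF open_D hol_f 1 conjunct1[OF 2] bn(1) 3 bn(4)])
  fix \<psi> assume psi: "\<psi> holomorphic_on ball 0 1" "\<psi> 0 = b (Suc n)"
   "\<And>x. x \<in> ball 0 1 \<Longrightarrow> \<psi> x \<in> D \<and> f (\<psi> x) = ph x"
  define k where "k z = \<psi> ((z - zs) / of_real R)" for z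
  have im2: "(z - zs) / of_real R \<in> ball 0 1" if "z \<in> ball zs R" for z
   using that R(1) by (simp add: dist_norm norm_divide norm_minus_commute)
  have gk: "g (k z) = h z" if "z \<in> ball zs R" for z
   using psi(3)[OF im2[OF that]] R(1) c1 by (simp add: k_def ph_def)
  have kD: "k z \<in> D" if "z \<in> ball zs R" for z using psi(3)[OF im2[OF that]] by (simp add: k_def)
  have knz: "k z \<noteq> 0" if "z \<in> ball zs R" for z by (metis f_nz_imp_nz gk hD kD mult_zero_right that)
  have "\<psi> \<circ> (\<lambda>z. (z - zs) / of_real R) holomorphic_on ball zs R"
   by (rule holomorphic_on_compose_gen[OF _ psi(1)]) (use im2 in \<open>auto intro!: holomorphic_intros\<close>)
  hence "k holomorphic_on ball zs R" by (simp add: o_def k_def[abs_def])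
  moreover have "k zs = b (Suc n)" using psi(2) by (simp add: k_def)
  moreover have "(g ^^ Suc n) (k z) = z \<and> (\<forall>j<Suc n. (g ^^ j) (k z) \<in> D \<and> (g ^^ j) (k z) \<noteq> 0)"
   if z: "z \<in> ball zs R" for z
  proof -
   have s: "(g ^^ Suc j) (k z) = (g ^^ j) (h z)" for j by (simp only: funpow_Suc_right o_apply gk[OF z])
   show ?thesis
   proof (intro conjI allI impI)
    show "(g ^^ Suc n) (k z) = z" using s h(3)[OF z] by simp
    fix j assume "j < Suc n"
    thus "(g ^^ j) (k z) \<in> D" "(g ^^ j) (k z) \<noteq> 0"
     using s[of "j - 1"] h(4)[OF z, of "j - 1"] kD[OF z] knz[OF z] by (cases j; simp)+
   qed
  qed
  ultimately show ?thesis by (intro exI[of _ k]) simp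
 qed
qed

text \<open>Fatou's argument in quantitative form. Without a hit there is an injective, zero-free
  inverse branch of \<open>g ^^ n\<close> on the disc, with derivative \<open>1 / tau z0 n\<close>
  at the centre, and the Koebe-type bound limits the radius to
  \<open>12 * pi * norm z0 * norm (tau z0 n)\<close>.\<close>

lemma critical_orbit_hits:
 assumes R: "\<And>z. z \<in> ball zs R \<Longrightarrow> z \<in> D \<and> z \<noteq> 0"
  and z0: "(g ^^ n) z0 = zs" "\<And>j. j \<le> n \<Longrightarrow> (g ^^ j) z0 \<in> D \<and> (g ^^ j) z0 \<noteq> 0"
   "\<And>j. j < n \<Longrightarrow> deriv f ((g ^^ j) z0) \<noteq> 0"
  and big: "12 * pi * norm z0 * norm (tau z0 n) < R"
 shows "\<exists>i<n. \<exists>u. hits (ball zs R - {zs}) i u"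
proof (rule ccontr)
 assume no: "\<not> ?thesis"
 have R0: "0 < R" using big by (rule le_less_trans[rotated]) simp
 have R': "z \<noteq> 0 \<and> (z \<noteq> c1 \<longrightarrow> z / c1 \<in> f ` D)" if "z \<in> ball zs R" for z using R[OF that] quot[of z c1] c1 by auto
 define b where "b i = (g ^^ (n - i)) z0" for i
 have b0: "b 0 = zs" using z0 by (simp add: b_def)
 have b: "b (Suc i) \<in> D \<and> b i \<noteq> 0 \<and> g (b (Suc i)) = b i \<and> deriv f (b (Suc i)) \<noteq> 0" if "i < n" for i
 proof -
  have "n - i = Suc (n - Suc i)" using that by simp
  hence "g (b (Suc i)) = b i" by (simp add: b_def)
  thus ?thesis using z0 that by (simp add: b_def)
 qed
 obtain h where h: "h holomorphic_on ball zs R" "h zs = b n"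
  "\<And>z. z \<in> ball zs R \<Longrightarrow> (g ^^ n) (h z) = z"
  "\<And>z j. z \<in> ball zs R \<Longrightarrow> j < n \<Longrightarrow> (g ^^ j) (h z) \<in> D \<and> (g ^^ j) (h z) \<noteq> 0"
  using pull_back[where n = n and b = b and R = R and zs = zs, OF R0 R' b0 b] no by blast
 have hz: "h zs = z0" using h(2) by (simp add: b_def)
 have "inj_on h (ball zs R)" using h(3) by (metis inj_onI)
 moreover have "h z \<noteq> 0" if "z \<in> ball zs R" for z
  using h(3)[OF that] h(4)[OF that, of 0] R[OF that] by (cases n) simp_all
 ultimately have bd: "norm (deriv h zs) * R \<le> 12 * pi * norm z0"
  using injective_nonzero_deriv_bound[OF h(1) _ R0] hz by simp
 have zsb: "zs \<in> ball zs R" using R0 by simp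
 have "((g ^^ n) has_field_derivative tau z0 n) (at (h zs))" unfolding hz by (rule funpow_deriv) (use z0 in simp)
 hence "((\<lambda>z. (g ^^ n) (h z)) has_field_derivative tau z0 n * deriv h zs) (at zs)"
  by (rule DERIV_chain2) (rule holomorphic_derivI[OF h(1) open_ball zsb])
 moreover have "((\<lambda>z. (g ^^ n) (h z)) has_field_derivative 1) (at zs)"
  by (rule has_field_derivative_transform_within_open[of "\<lambda>z. z" _ _ "ball zs R"])
   (use h(3) zsb in auto)
 ultimately have "tau z0 n * deriv h zs = 1" by (rule DERIV_unique)
 hence "norm (tau z0 n) * norm (deriv h zs) = 1" by (metis norm_mult norm_one)
 hence "R = norm (tau z0 n) * (norm (deriv h zs) * R)" by simp
 also have "\<dots> \<le> norm (tau z0 n) * (12 * pi * norm z0)" by (rule mult_left_mono[OF bd]) simp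
 finally show False using big by (simp add: mult.commute)
qed

end

text \<open>The cycle is numbered periodically by all natural numbers, so that phases are shifts of
  the index. The assumption \<open>asym\<close> says that no point of the cycle is the mirror image
  of a point of the cycle; \<open>deriv_b\<close> reflects a nonzero multiplier.\<close>

locale map_cycle = lift_map +
 fixes b :: "nat \<Rightarrow> complex" and q :: nat
 assumes q_pos: "0 < q" and b_per: "\<And>n. b (n + q) = b n" and b_inj: "inj_on b {..<q}"
  and b_D: "\<And>n. b n \<in> D" and b_nz: "\<And>n. b n \<noteq> 0" and g_b: "\<And>n. g (b n) = b (Suc n)"
  and asym: "\<And>u m n. u \<in> U \<Longrightarrow> b m = u * b n \<Longrightarrow> u = 1"
  and deriv_b: "\<And>n. deriv f (b n) \<noteq> 0"
begin

lemma b_per_mult: "b (n + q * k) = b n" by (induction k) (simp_all , metis b_per add.assoc add.commute)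

lemma b_mod: "b (n mod q) = b n" using b_per_mult[of "n mod q" "n div q"] by simp

lemma b_eq_iff: "b m = b n \<longleftrightarrow> m mod q = n mod q"
 using b_inj q_pos by (metis b_mod inj_onD lessThan_iff mod_less_divisor)

lemma funpow_b: "(g ^^ m) (b n) = b (n + m)" by (induction m) (simp_all add: g_b)

definition kappa :: complex where "kappa = (\<Prod>i<q. g' (b i))"

lemma g'_b_nz: "g' (b n) \<noteq> 0" using deriv_b c1 by simp

lemma kappa_nz: "kappa \<noteq> 0" unfolding kappa_def using g'_b_nz by simp

lemma tau_b: "tau (b n) q = kappa"
proof (induction n)
 case 0 show ?case by (simp add: tau_def kappa_def funpow_b)
next
 case (Suc n)
 have "tau (b n) (Suc q) = tau (b n) q * g' (b n)" by (simp add: tau_Suc funpow_b b_per)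
 moreover have "tau (b n) (1 + q) = g' (b n) * tau (b (Suc n)) q"
  using tau_add[of "b n" 1 q] by (simp add: tau_def g_b)
 ultimately show ?case using Suc g'_b_nz[of n] by simp
qed

lemma tau_b_mult: "tau (b n) (q * k) = kappa ^ k"
proof (induction k)
 case (Suc k)
 have "tau (b n) (q * k + q) = tau (b n) (q * k) * tau ((g ^^ (q * k)) (b n)) q" by (rule tau_add)
 thus ?case using Suc by (simp add: funpow_b tau_b algebra_simps)
qed simp

text \<open>What the orbit of \<open>c1\<close> approaches is the cycle up to a sign and a phase;
  this makes all results available for the renumbered mirror cycle.\<close>

lemma map_cycle_shift:
 assumes u: "u \<in> U"
 shows "map_cycle D f U Dp c1 (\<lambda>n. u * b (n + s)) q"
proof unfold_locales
 show "0 < q" by (rule q_pos)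
 show "inj_on (\<lambda>n. u * b (n + s)) {..<q}"
 proof (rule inj_onI)
  fix m n assume mn: "m \<in> {..<q}" "n \<in> {..<q}" "u * b (m + s) = u * b (n + s)"
  hence "(m + s) mod q = (n + s) mod q" using U_nz[OF u] b_eq_iff by simp
  hence "(m + s + (q - 1) * s) mod q = (n + s + (q - 1) * s) mod q" by (metis mod_add_left_eq)
  moreover have e: "x + s + (q - 1) * s = x + q * s" for x using q_pos by (cases q) (simp_all)
  ultimately have "(m + q * s) mod q = (n + q * s) mod q" unfolding e by simp
  hence "m mod q = n mod q" by simp
  thus "m = n" using mn by simp
 qed
 fix n
 show "u * b (n + q + s) = u * b (n + s)" using b_per[of "n + s"] by (simp add: algebra_simps)
 show "u * b (n + s) \<in> D" using U_inv[OF u b_D] by simp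
 show "u * b (n + s) \<noteq> 0" using U_nz[OF u] b_nz by simp
 show "g (u * b (n + s)) = u * b (Suc n + s)" using g_U[OF u b_D] g_b by simp
 show "deriv f (u * b (n + s)) \<noteq> 0" using deriv_f_U[OF u b_D] deriv_b by simp
 fix v m assume v: "v \<in> U" and "u * b (m + s) = v * (u * b (n + s))"
 hence "b (m + s) = v * b (n + s)" using U_nz[OF u] by simp
 thus "v = 1" by (rule asym[OF v])
qed

text \<open>Besides convergence this records the distinctness, modulo \<open>U\<close>, of the orbit
  points among themselves and from the cycle, which is what a motion of all these points
  requires.\<close>

definition orbit_attracted :: "(nat \<Rightarrow> complex) \<Rightarrow> (nat \<Rightarrow> complex) \<Rightarrow> bool" where
 "orbit_attracted C x \<longleftrightarrow> (\<forall>n. C n \<in> D \<and> C n \<noteq> 0) \<and> (\<lambda>n. C n - x n) \<longlonglongrightarrow> 0 \<and>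
  (\<forall>u\<in>U. \<forall>n m. C n \<noteq> u * x m) \<and> (\<forall>u\<in>U. \<forall>n m. n \<noteq> m \<longrightarrow> C n \<noteq> u * C m)"

text \<open>If the \<open>i\<close>-th iterate is near \<open>b 0\<close>, then the
  \<open>n\<close>-th is near \<open>b (n - i)\<close>; since indices count modulo \<open>q\<close>,
  \<open>(q - 1) * i\<close> stands for \<open>- i\<close>. A coincidence up to a sign
  \<open>v\<close> passes to the limit, where \<open>asym\<close> gives \<open>v = 1\<close>; a true
  coincidence makes the orbit eventually periodic, so that its limit \<open>b 0\<close> would be
  attained, against \<open>ne\<close>.\<close>

lemma orbit_landing:
 assumes N: "0 < N" "q dvd N" and u: "u \<in> U"
  and C: "\<And>n. (g ^^ n) (u * c1) \<in> D \<and> (g ^^ n) (u * c1) \<noteq> 0"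
  and lim: "(\<lambda>k. (g ^^ (i + N * k)) (u * c1)) \<longlonglongrightarrow> b 0"
  and ne: "\<And>k. (g ^^ (i + N * k)) (u * c1) \<noteq> b 0"
 shows "orbit_attracted c (\<lambda>n. u * b (n + (q - 1) * i))"
proof -
 define C where "C n = (g ^^ n) (u * c1)" for n
 have CD: "C n \<in> D" "C n \<noteq> 0" for n using assms(4) by (auto simp: C_def)
 have Cadd: "C (m + n) = (g ^^ n) (C m)" for m n unfolding C_def by (metis add.commute comp_apply funpow_add)
 have Clim: "(\<lambda>k. C (i + N * k)) \<longlonglongrightarrow> b 0" and Cne: "C (i + N * k) \<noteq> b 0" for k using lim ne by (auto simp: C_def)
 obtain l where Nl: "N = q * l" using N(2) by blast
 have step: "(\<lambda>n. C (i + n) - b n) \<longlonglongrightarrow> 0"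
 proof (rule tendsto_by_residues[OF N(1)])
  fix s assume "s < N"
  have "isCont (g ^^ s) (b 0)" by (rule DERIV_isCont[OF funpow_deriv]) (simp add: funpow_b b_D)
  from isCont_tendsto_compose[OF this Clim]
  have "(\<lambda>k. C (i + N * k + s)) \<longlonglongrightarrow> b s" by (simp add: Cadd funpow_b)
  hence "(\<lambda>k. C (i + N * k + s) - b s) \<longlonglongrightarrow> b s - b s" by (intro tendsto_intros)
  moreover have "b (N * k + s) = b s" for k using b_per_mult[of s "l * k"] by (simp add: Nl algebra_simps)
  ultimately show "(\<lambda>k. C (i + (N * k + s)) - b (N * k + s)) \<longlonglongrightarrow> 0" by (simp add: add.assoc)
 qed
 have Cq: "(\<lambda>j. C (n + (i + q * j))) \<longlonglongrightarrow> b n" for n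
 proof -
  have "filterlim (\<lambda>j. n + q * j) at_top sequentially" using q_pos by (intro filterlim_subseq strict_monoI) simp
  from filterlim_compose[OF step this] have "(\<lambda>j. C (i + (n + q * j)) - b n) \<longlonglongrightarrow> 0" by (simp add: b_per_mult)
  from tendsto_add[OF this tendsto_const[of "b n"]] show ?thesis by (simp add: algebra_simps)
 qed
 have CU: "C (n + k) = v * C (m + k)" if "C n = v * C m" "v \<in> U" for n m k v
 proof -
  have "(g ^^ k) (v * C m) = v * (g ^^ k) (C m)" by (rule funpow_U[OF that(2)]) (simp add: Cadd[symmetric] CD)
  thus ?thesis using that(1) by (simp add: Cadd)
 qed
 have no_b: "C n \<noteq> v * b m" if v: "v \<in> U" for n m v
 proof
  assume eq: "C n = v * b m"
  have k: "C (n + k) = v * b (m + k)" for k using funpow_U[OF v, of k "b m"] b_D eq by (simp add: Cadd funpow_b)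
  have "(\<lambda>j. C (n + (i + q * j))) \<longlonglongrightarrow> v * b (m + i)"
   using b_per_mult[of "m + i"] unfolding k by (simp add: add.assoc[symmetric])
  with Cq have "b n = v * b (m + i)" using LIMSEQ_unique by blast
  hence "v = 1" by (rule asym[OF v])
  have "n \<le> i + N * n" using N(1) by (simp add: trans_le_add2)
  hence const: "C (i + N * (n + t)) = C (i + N * n)" for t
  proof -
   assume le: "n \<le> i + N * n"
   have 1: "C (i + N * n) = b (m + (i + N * n - n))" using k[of "i + N * n - n"] le \<open>v = 1\<close> by simp
   have "i + N * (n + t) = n + (i + N * n - n + q * (l * t))" using le by (simp add: Nl algebra_simps)
   hence "C (i + N * (n + t)) = b (m + (i + N * n - n) + q * (l * t))"
    using k[of "i + N * n - n + q * (l * t)"] \<open>v = 1\<close> by (simp add: add.assoc)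
   thus ?thesis using 1 b_per_mult by simp
  qed
  have "(\<lambda>t. C (i + N * (n + t))) \<longlonglongrightarrow> b 0"
   using LIMSEQ_ignore_initial_segment[OF Clim, of n] by (simp add: add.commute)
  hence "C (i + N * n) = b 0" unfolding const using LIMSEQ_const_iff by blast
  thus False using Cne by blast
 qed
 have no_C0: False if nm: "n < m" and eq: "C n = C m" for n m
 proof -
  define p where "p = m - n"
  have p: "C (n + k) = C (n + k + p)" for k using CU[of n 1 m k] eq one_U nm by (simp add: p_def algebra_simps)
  have per: "C (n + k + p * t) = C (n + k)" for k t
  proof (induction t)
   case (Suc t)
   have "C (n + (k + p * t)) = C (n + (k + p * t) + p)" by (rule p)
   thus ?case using Suc by (simp add: algebra_simps)
  qed simp
  have le: "n \<le> i + N * n" using N(1) by (simp add: trans_le_add2)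
  have "C (i + N * (n + p * t)) = C (i + N * n)" for t
   using per[of "i + N * n - n" "N * t"] le by (simp add: algebra_simps)
  moreover have "filterlim (\<lambda>t. n + p * t) at_top sequentially"
   using nm by (intro filterlim_subseq strict_monoI) (simp add: p_def)
  from filterlim_compose[OF Clim this] have "(\<lambda>t. C (i + N * (n + p * t))) \<longlonglongrightarrow> b 0" .
  ultimately have "C (i + N * n) = b 0" using LIMSEQ_const_iff by auto
  thus False using Cne by blast
 qed
 have no_C: "C n \<noteq> v * C m" if v: "v \<in> U" and nm: "n \<noteq> m" for n m v
 proof
  assume eq: "C n = v * C m"
  have "(\<lambda>j. v * C (m + (i + q * j))) \<longlonglongrightarrow> v * b m" by (intro tendsto_intros Cq)
  hence "(\<lambda>j. C (n + (i + q * j))) \<longlonglongrightarrow> v * b m" using CU[OF eq v] by simp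
  with Cq have "b n = v * b m" using LIMSEQ_unique by blast
  hence "v = 1" by (rule asym[OF v])
  thus False using no_C0[of n m] no_C0[of m n] eq nm by (cases "n < m") auto
 qed
 have uu: "u * u = 1" by (rule U_square[OF u])
 have c_C: "c n = u * C n" for n
 proof -
  have "(g ^^ n) (u * (u * c1)) = u * (g ^^ n) (u * c1)" by (rule funpow_U[OF u]) (use CD C_def in simp)
  thus ?thesis using uu by (simp add: C_def mult.assoc[symmetric])
 qed
 show ?thesis unfolding orbit_attracted_def c_C
 proof (intro conjI allI ballI impI)
  fix n show "u * C n \<in> D" "u * C n \<noteq> 0" using U_inv[OF u] CD U_nz[OF u] by auto
 next
  have "(\<lambda>n. C (n + i) - b (n + i + (q - 1) * i)) \<longlonglongrightarrow> 0"
  proof -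
   have "b (n + i + (q - 1) * i) = b n" for n
    by (metis add.assoc b_per_mult bot_nat_0.not_eq_extremum mult_eq_if q_pos)
   thus ?thesis using step by (simp add: add.commute)
  qed
  hence "(\<lambda>n. C n - b (n + (q - 1) * i)) \<longlonglongrightarrow> 0" by (rule LIMSEQ_offset)
  hence "(\<lambda>n. u * (C n - b (n + (q - 1) * i))) \<longlonglongrightarrow> u * 0" by (intro tendsto_intros)
  thus "(\<lambda>n. u * C n - u * b (n + (q - 1) * i)) \<longlonglongrightarrow> 0" by (simp add: algebra_simps)
 next
  fix v n m assume v: "v \<in> U"
  show "u * C n \<noteq> v * (u * b (m + (q - 1) * i))" using no_b[OF v] U_nz[OF u] by simp
  assume "n \<noteq> m"
  thus "u * C n \<noteq> v * (u * C m)" using no_C[OF v] U_nz[OF u] by simp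
 qed
qed

text \<open>Near \<open>b 0\<close> the return map contracts, so a singular orbit that enters the
  disc of radius \<open>r\<close> converges to the cycle. It does enter: going \<open>k\<close>
  times around the cycle gives the derivative \<open>kappa ^ k\<close>, which is small enough for
  \<open>critical_orbit_hits\<close>.\<close>

lemma attracting_orbit_attracted:
 assumes "norm kappa < 1"
 shows "\<exists>u\<in>U. \<exists>s. orbit_attracted c (\<lambda>n. u * b (n + s))"
proof -
 define th where "th = (1 + norm kappa) / 2"
 have th: "norm kappa < th" "th < 1" "0 < th" using assms by (auto simp: th_def intro: add_pos_nonneg)
 have F: "((g ^^ q) has_field_derivative kappa) (at (b 0))"
  using funpow_deriv[of q "b 0"] tau_b[of 0] b_D by (simp add: funpow_b)
 have Fb: "(g ^^ q) (b 0) = b 0" using b_per[of 0] by (simp add: funpow_b)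
 have lim: "((\<lambda>z. ((g ^^ q) z - b 0) / (z - b 0)) \<longlongrightarrow> kappa) (at (b 0))"
  using F Fb by (simp add: has_field_derivative_iff)
 \<comment> \<open>The first bound keeps the difference quotient below \<open>th\<close>, the second
   keeps it nonzero, so that the orbit never lands on \<open>b 0\<close>.\<close>
 define e where "e = min (th - norm kappa) (norm kappa)"
 have e: "0 < e" using th kappa_nz by (simp add: e_def)
 have 1: "\<forall>\<^sub>F z in at (b 0). dist (((g ^^ q) z - b 0) / (z - b 0)) kappa < e" using tendstoD[OF lim e] .
 have 2: "\<forall>\<^sub>F z in at (b 0). \<forall>s\<in>{..<q}. (g ^^ s) z \<in> D - {0}"
 proof (rule eventually_ball_finite)
  show "\<forall>s\<in>{..<q}. \<forall>\<^sub>F z in at (b 0). (g ^^ s) z \<in> D - {0}"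
  proof
   fix s
   have "isCont (g ^^ s) (b 0)" by (rule DERIV_isCont[OF funpow_deriv]) (simp add: funpow_b b_D)
   hence "((g ^^ s) \<longlongrightarrow> b s) (at (b 0))" by (simp add: isCont_def funpow_b)
   thus "\<forall>\<^sub>F z in at (b 0). (g ^^ s) z \<in> D - {0}" by (rule topological_tendstoD) (use open_D b_D b_nz in auto)
  qed
 qed simp
 obtain r where r: "0 < r" and
  rz: "\<And>z. z \<noteq> b 0 \<Longrightarrow> dist z (b 0) < r \<Longrightarrow>
   dist (((g ^^ q) z - b 0) / (z - b 0)) kappa < e \<and> (\<forall>s\<in>{..<q}. (g ^^ s) z \<in> D - {0})"
  using eventually_conj[OF 1 2] unfolding eventually_at by blast
 have contr: "dist ((g ^^ q) z) (b 0) \<le> th * dist z (b 0)" "(g ^^ q) z \<noteq> b 0"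
  if z: "z \<noteq> b 0" "dist z (b 0) < r" for z
 proof -
  define w where "w = ((g ^^ q) z - b 0) / (z - b 0)"
  have w: "dist w kappa < e" using rz[OF z] by (simp add: w_def)
  have eq: "(g ^^ q) z - b 0 = w * (z - b 0)" using z by (simp add: w_def)
  have "norm w \<le> norm kappa + dist w kappa" by (metis dist_norm norm_triangle_sub)
  hence "norm w \<le> th" using w by (simp add: e_def)
  thus "dist ((g ^^ q) z) (b 0) \<le> th * dist z (b 0)" unfolding dist_norm eq norm_mult by (rule mult_right_mono) simp
  have "w \<noteq> 0" using w by (auto simp: e_def)
  thus "(g ^^ q) z \<noteq> b 0" using eq z by auto
 qed
 have "(\<lambda>k. norm kappa ^ k) \<longlonglongrightarrow> 0" by (rule LIMSEQ_power_zero) (use assms in simp)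
 from tendsto_mult[OF tendsto_const this]
 have "(\<lambda>k. 12 * pi * norm (b 0) * norm kappa ^ k) \<longlonglongrightarrow> 12 * pi * norm (b 0) * 0" .
 hence "\<forall>\<^sub>F k in sequentially. 12 * pi * norm (b 0) * norm kappa ^ k < r" using r by (intro order_tendstoD(2)) auto
 from eventually_happens'[OF sequentially_bot this]
 obtain k where k: "12 * pi * norm (b 0) * norm kappa ^ k < r" by (elim exE)
 have rD: "z \<in> D \<and> z \<noteq> 0" if "z \<in> ball (b 0) r" for z
 proof (cases "z = b 0")
  case False
  hence "\<forall>s\<in>{..<q}. (g ^^ s) z \<in> D - {0}" using rz[of z] that by (simp add: dist_commute)
  from this[rule_format, of 0] show ?thesis using q_pos by simp
 qed (use b_D b_nz in simp)
 have "\<exists>i<q * k. \<exists>u. hits (ball (b 0) r - {b 0}) i u"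
 proof (rule critical_orbit_hits[OF rD])
  show "(g ^^ (q * k)) (b 0) = b 0" using b_per_mult[of 0 k] by (simp add: funpow_b)
  show "12 * pi * norm (b 0) * norm (tau (b 0) (q * k)) < r" using k by (simp add: tau_b_mult norm_power)
 qed (use b_D b_nz deriv_b in \<open>auto simp: funpow_b\<close>)
 then obtain i u where h: "hits (ball (b 0) r - {b 0}) i u" by blast
 define z where "z j = (g ^^ (i + q * j)) (u * c1)" for j
 have zS: "z (Suc j) = (g ^^ q) (z j)" for j
  by (simp add: z_def funpow_add[symmetric, unfolded comp_def, THEN fun_cong] algebra_simps)
 have z0: "z 0 \<noteq> b 0" "dist (z 0) (b 0) < r" using h by (auto simp: hits_def z_def dist_commute)
 have zin: "z j \<noteq> b 0 \<and> dist (z j) (b 0) \<le> th ^ j * dist (z 0) (b 0) \<and> dist (z j) (b 0) < r" for j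
 proof (induction j)
  case (Suc j)
  have c: "dist (z (Suc j)) (b 0) \<le> th * dist (z j) (b 0)" "z (Suc j) \<noteq> b 0" using contr[of "z j"] Suc zS by auto
  have "th * dist (z j) (b 0) \<le> th * (th ^ j * dist (z 0) (b 0))" using Suc th by (intro mult_left_mono) auto
  moreover have "th * dist (z j) (b 0) \<le> dist (z j) (b 0)"
   using mult_right_mono[of th 1 "dist (z j) (b 0)"] th by simp
  hence "dist (z (Suc j)) (b 0) < r" using c(1) Suc by linarith
  ultimately show ?case using c by simp
 qed (use z0 in auto)
 have "(\<lambda>j. th ^ j * dist (z 0) (b 0)) \<longlonglongrightarrow> 0 * dist (z 0) (b 0)"
  using th by (intro tendsto_intros LIMSEQ_power_zero) simp
 hence "(\<lambda>j. th ^ j * dist (z 0) (b 0)) \<longlonglongrightarrow> 0" by simp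
 hence "(\<lambda>j. z j - b 0) \<longlonglongrightarrow> 0" by (rule Lim_null_comparison[rotated]) (use zin in \<open>simp add: dist_norm\<close>)
 hence zlim: "z \<longlonglongrightarrow> b 0" by (rule LIM_zero_cancel)
 have CD: "(g ^^ n) (u * c1) \<in> D \<and> (g ^^ n) (u * c1) \<noteq> 0" for n
 proof (cases "n \<le> i")
  case False
  define m where "m = n - i"
  have "n = (i + q * (m div q)) + m mod q" using False by (simp add: m_def)
  hence "(g ^^ n) (u * c1) = (g ^^ (m mod q)) (z (m div q))"
   unfolding z_def by (metis add.commute comp_apply funpow_add)
  moreover have "(g ^^ (m mod q)) (z (m div q)) \<in> D - {0}"
   using rz[of "z (m div q)"] zin[of "m div q"] q_pos by auto
  ultimately show ?thesis by simp
 next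
  case True
  thus ?thesis using h rD by (cases "n = i") (auto simp: hits_def)
 qed
 have u: "u \<in> U" using h by (simp add: hits_def)
 have "orbit_attracted c (\<lambda>n. u * b (n + (q - 1) * i))"
  by (rule orbit_landing[OF q_pos dvd_refl u CD]) (use zlim zin in \<open>simp_all add: z_def[abs_def]\<close>)
 thus ?thesis using u by blast
qed

end

section \<open>Petals of parabolic germs\<close>

lemma cesaro_null:
 fixes e :: "nat \<Rightarrow> 'a::real_normed_vector"
 assumes "e \<longlonglongrightarrow> 0"
 shows "(\<lambda>n. (\<Sum>i<n. e i) /\<^sub>R real n) \<longlonglongrightarrow> 0"
proof (rule LIMSEQ_I)
 fix r :: real assume r: "0 < r"
 obtain K where K: "\<And>n. n \<ge> K \<Longrightarrow> norm (e n) < r / 2" using LIMSEQ_D[OF assms, of "r/2"] r by auto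
 define B where "B = norm (\<Sum>i<K. e i)"
 obtain L :: nat where L: "real L > 2 * B / r" using reals_Archimedean2 by blast
 show "\<exists>no. \<forall>n\<ge>no. norm ((\<Sum>i<n. e i) /\<^sub>R real n - 0) < r"
 proof (intro exI allI impI)
  fix n assume n: "max (max K L) 1 \<le> n"
  have "(\<Sum>i<n. e i) = (\<Sum>i<K. e i) + (\<Sum>i=K..<n. e i)"
   using n by (simp add: sum.atLeastLessThan_concat lessThan_atLeast0)
  hence "norm (\<Sum>i<n. e i) \<le> B + norm (\<Sum>i=K..<n. e i)" unfolding B_def by (metis norm_triangle_ineq)
  also have "norm (\<Sum>i=K..<n. e i) \<le> (\<Sum>i=K..<n. r / 2)" by (rule sum_norm_le) (use K in \<open>auto intro: less_imp_le\<close>)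
  also have "\<dots> \<le> real n * (r / 2)" using r by simp
  also have "B < real n * (r / 2)"
  proof -
   have "2 * B / r < real n" using L n by linarith
   thus ?thesis using r by (simp add: field_simps)
  qed
  finally have "norm (\<Sum>i<n. e i) < r * real n" by simp
  moreover have "0 < real n" using n by simp
  ultimately show "norm ((\<Sum>i<n. e i) /\<^sub>R real n - 0) < r" by (simp add: field_simps)
 qed
qed

lemma tendsto_average_increments:
 fixes u :: "nat \<Rightarrow> complex"
 assumes "(\<lambda>k. u (Suc k) - u k) \<longlonglongrightarrow> 1"
 shows "(\<lambda>k. u k / of_nat k) \<longlonglongrightarrow> 1"
proof -
 have "(\<lambda>k. u (Suc k) - u k - 1) \<longlonglongrightarrow> 1 - 1" by (intro tendsto_intros assms)
 hence 1: "(\<lambda>n. (\<Sum>i<n. u (Suc i) - u i - 1) /\<^sub>R real n) \<longlonglongrightarrow> 0" by (intro cesaro_null) simp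
 have 2: "(\<lambda>n. u 0 / of_nat n) \<longlonglongrightarrow> 0" using tendsto_mult[OF tendsto_const[of "u 0"] lim_1_over_n] by simp
 have eq: "(\<Sum>i<n. u (Suc i) - u i - 1) = u n - u 0 - of_nat n" for n by (induction n) (simp_all)
 have "(\<lambda>n. (\<Sum>i<n. u (Suc i) - u i - 1) /\<^sub>R real n + u 0 / of_nat n + 1) \<longlonglongrightarrow> 0 + 0 + 1" by (intro tendsto_intros 1 2)
 moreover have "\<forall>\<^sub>F n in sequentially. (\<Sum>i<n. u (Suc i) - u i - 1) /\<^sub>R real n + u 0 / of_nat n + 1 = u n / of_nat n"
  using eventually_gt_at_top[of 0]
 proof eventually_elim
  case (elim n)
  thus ?case unfolding eq by (simp add: scaleR_conv_of_real field_simps)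
 qed
 ultimately show ?thesis using tendsto_cong by force
qed

lemma holomorphic_bound2:
 assumes h: "h holomorphic_on ball 0 r" "0 < r"
 obtains C s where "0 < s" "s < r" "0 \<le> C" "\<And>x. norm x \<le> s \<Longrightarrow> norm (h x - h 0 - deriv h 0 * x) \<le> C * norm x ^ 2"
  "\<And>x. norm x \<le> s \<Longrightarrow> norm (h x - h 0) \<le> C * norm x" "\<And>x. norm x \<le> s \<Longrightarrow> norm (h x) \<le> C"
  "\<And>x. norm x \<le> s \<Longrightarrow> norm (deriv h x) \<le> C"
proof -
 define s where "s = min (r / 2) 1"
 have s: "0 < s" "s < r" "s \<le> 1" using h(2) by (auto simp: s_def)
 have sub: "cball 0 s \<subseteq> ball (0::complex) r" using s by auto
 have d1: "deriv h holomorphic_on ball 0 r" by (rule holomorphic_deriv[OF h(1) open_ball])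
 have d2: "deriv (deriv h) holomorphic_on ball 0 r" by (rule holomorphic_deriv[OF d1 open_ball])
 have bdd: "\<exists>B. \<forall>x\<in>cball 0 s. norm (k x) \<le> B" if "k holomorphic_on ball 0 r" for k :: "complex \<Rightarrow> complex"
 proof -
  have "continuous_on (cball 0 s) k" using that sub holomorphic_on_imp_continuous_on continuous_on_subset by blast
  hence "bounded (k ` cball 0 s)" by (intro compact_imp_bounded compact_continuous_image) auto
  thus ?thesis unfolding bounded_iff by auto
 qed
 obtain B0 B1 B2 where B: "\<And>x. x \<in> cball 0 s \<Longrightarrow> norm (h x) \<le> B0" "\<And>x. x \<in> cball 0 s \<Longrightarrow> norm (deriv h x) \<le> B1"
   "\<And>x. x \<in> cball 0 s \<Longrightarrow> norm (deriv (deriv h) x) \<le> B2" using bdd[OF h(1)] bdd[OF d1] bdd[OF d2] by blast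
 define C where "C = Max {B0, B1, B2, 0}"
 have C: "B0 \<le> C" "B1 \<le> C" "B2 \<le> C" "0 \<le> C" by (auto simp: C_def)
 have hd: "(h has_field_derivative deriv h x) (at x within cball 0 s)" if "x \<in> cball 0 s" for x
  using holomorphic_derivI[OF h(1) open_ball, of x] sub that by (meson has_field_derivative_at_within subsetD)
 have hd2: "(deriv h has_field_derivative deriv (deriv h) x) (at x within cball 0 s)" if "x \<in> cball 0 s" for x
  using holomorphic_derivI[OF d1 open_ball, of x] sub that by (meson has_field_derivative_at_within subsetD)
 have l1: "norm (h x - h 0) \<le> C * norm x" if "norm x \<le> s" for x
  using field_differentiable_bound[of "cball 0 s" h "deriv h" C x 0] hd B C that s by force
 have l2: "norm (deriv h x - deriv h 0) \<le> C * norm x" if "norm x \<le> s" for x :: complex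
  using field_differentiable_bound[of "cball 0 s" "deriv h" "deriv (deriv h)" C x 0] hd2 B C that s by force
 have l3: "norm (h x - h 0 - deriv h 0 * x) \<le> C * norm x ^ 2" if x: "norm x \<le> s" for x
 proof -
  define k where "k y = h y - deriv h 0 * y" for y :: complex
  have "norm (k x - k 0) \<le> (C * norm x) * norm (x - 0)"
  proof (rule field_differentiable_bound[of "cball 0 (norm x)" k "\<lambda>y. deriv h y - deriv h 0"])
   fix y :: complex assume y: "y \<in> cball 0 (norm x)"
   hence ys: "y \<in> cball 0 s" "cball 0 (norm x) \<subseteq> cball 0 s" using x by auto
   have "(h has_field_derivative deriv h y) (at y within cball 0 (norm x))"
    using hd[OF ys(1)] ys(2) by (rule DERIV_subset)
   thus "(k has_field_derivative deriv h y - deriv h 0) (at y within cball 0 (norm x))"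
    unfolding k_def by (auto intro!: derivative_eq_intros)
   have "norm (deriv h y - deriv h 0) \<le> C * norm y" using l2 ys by simp
   also have "\<dots> \<le> C * norm x" using y C by (intro mult_left_mono) auto
   finally show "norm (deriv h y - deriv h 0) \<le> C * norm x" .
  qed auto
  thus ?thesis by (simp add: k_def power2_eq_square algebra_simps)
 qed
 show ?thesis by (rule that[OF s(1,2) C(4) l3 l1]) (use B C in \<open>auto intro: order_trans\<close>)
qed

text \<open>The coordinate \<open>u = - 1 / (m A \<xi>^m)\<close> on the petal in direction \<open>th\<close> is inverted by \<open>petal\<close>.\<close>

definition petal :: "nat \<Rightarrow> complex \<Rightarrow> complex \<Rightarrow> complex" where
 "petal m th u = th * exp (- Ln u / of_nat m)"

lemma petal_power: "0 < m \<Longrightarrow> u \<noteq> 0 \<Longrightarrow> petal m th u ^ m = th ^ m / u"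
proof -
 assume m: "0 < m" and u: "u \<noteq> 0"
 have "exp (- Ln u / of_nat m) ^ m = exp (of_nat m * (- Ln u / of_nat m))" by (rule exp_of_nat_mult[symmetric])
 also have "\<dots> = exp (- Ln u)" using m by simp
 also have "\<dots> = inverse u" using u by (simp add: exp_minus)
 finally show ?thesis by (simp add: petal_def field_simps)
qed

lemma petal_nz: "th \<noteq> 0 \<Longrightarrow> petal m th u \<noteq> 0" by (simp add: petal_def)

lemma norm_petal_power: "0 < m \<Longrightarrow> u \<noteq> 0 \<Longrightarrow> norm (petal m th u) ^ m = norm th ^ m / norm u"
 using petal_power[of m u th] by (metis norm_divide norm_power)

text \<open>Multiplying the point by \<open>1 + x\<close> divides the coordinate \<open>u\<close> by
  the \<open>m\<close>-th power of \<open>1 + x\<close>. This is exact only if principal logarithms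
  add up: the bound on \<open>x\<close> makes \<open>m * Im (Ln (1 + x))\<close> at most 1 in
  modulus, and with an argument of \<open>u\<close> below \<open>pi / 2\<close> the total stays
  below \<open>pi\<close>.\<close>

lemma petal_mult:
 assumes "0 < m" "Re u > 0" "norm x < 1 / (2 * real m)"
 shows "petal m th (u * exp (- of_nat m * Ln (1 + x))) = petal m th u * (1 + x)"
proof -
 have x2: "norm x < 1/2"
 proof -
  have "1 / (2 * real m) \<le> 1 / 2" using assms(1) by simp
  thus ?thesis using assms(3) by linarith
 qed
 have x1: "1 + x \<noteq> 0"
 proof
  assume "1 + x = 0"
  hence "x = -1" by (simp add: eq_neg_iff_add_eq_0 add.commute)
  thus False using x2 by simp
 qed
 have u: "u \<noteq> 0" using assms(2) by auto
 have "norm (Ln (1 + x)) \<le> 2 * norm x" using x2 norm_Ln_le[of x] by auto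
 hence "\<bar>Im (Ln (1 + x))\<bar> \<le> 2 * norm x" using abs_Im_le_cmod order_trans by blast
 hence "real m * \<bar>Im (Ln (1 + x))\<bar> \<le> real m * (2 * norm x)" by (intro mult_left_mono) auto
 also have "\<dots> \<le> 1" using assms(1,3) by (simp add: field_simps)
 finally have i1: "\<bar>real m * Im (Ln (1 + x))\<bar> \<le> 1" by (simp add: abs_mult)
 have i2: "\<bar>Im (Ln u)\<bar> < pi / 2" using Re_Ln_pos_lt[OF u] assms(2) by simp
 define L where "L = Ln u - of_nat m * Ln (1 + x)"
 have ImL: "Im L = Im (Ln u) - real m * Im (Ln (1 + x))" by (simp add: L_def)
 have "pi > 2" using pi_gt3 by linarith
 hence L: "- pi < Im L" "Im L \<le> pi" unfolding ImL using i1 i2 by linarith+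
 have "exp L = u * exp (- of_nat m * Ln (1 + x))" using u by (simp add: L_def exp_diff exp_minus field_simps)
 hence "Ln (u * exp (- of_nat m * Ln (1 + x))) = L" using Ln_exp[OF L] by simp
 hence "- Ln (u * exp (- of_nat m * Ln (1 + x))) / of_nat m = - Ln u / of_nat m + Ln (1 + x)"
  using assms(1) by (simp add: L_def field_simps)
 thus ?thesis using x1 unfolding petal_def by (simp only: exp_add exp_Ln mult.assoc not_False_eq_True)
qed

lemma petal_small:
 assumes "0 < m" "0 < e"
 obtains R where "R > 0" "\<And>u. norm u \<ge> R \<Longrightarrow> norm (petal m th u) < e"
proof -
 define R where "R = (norm th ^ m + 1) / e ^ m"
 have R: "R > 0" using assms by (simp add: R_def add_nonneg_pos)
 have "norm (petal m th u) < e" if "norm u \<ge> R" for u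
 proof (rule ccontr)
  assume "\<not> ?thesis"
  hence "e ^ m \<le> norm (petal m th u) ^ m" using assms by (intro power_mono) auto
  also have "\<dots> = norm th ^ m / norm u" using that R by (intro norm_petal_power assms(1)) auto
  finally have "e ^ m * norm u \<le> norm th ^ m" using less_le_trans[OF R that] by (simp add: pos_le_divide_eq)
  moreover have "e ^ m * norm u \<ge> e ^ m * R" using that assms by (intro mult_left_mono) auto
  ultimately show False using assms by (simp add: R_def)
 qed
 thus ?thesis using that R by blast
qed

text \<open>The normalisation of the attracting direction \<open>th\<close> makes the coordinate
  \<open>u = th ^ m / x ^ m\<close> advance by about 1 under \<open>\<phi>\<close>: the leading term
  of the change is \<open>- m * S 0 * th ^ m\<close>.\<close>

locale parabolic_germ =
 fixes \<phi> S :: "complex \<Rightarrow> complex" and r :: real and m :: nat and th :: complex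
 assumes r: "0 < r" and S: "S holomorphic_on ball 0 r" and m: "0 < m"
  and th: "of_nat m * S 0 * th ^ m = -1"
  and phi: "\<And>x. x \<in> ball 0 r \<Longrightarrow> \<phi> x = x + x ^ Suc m * S x"
begin

lemma th_nz: "th \<noteq> 0" using th m by (auto simp: power_0_left)

lemma deriv_phi: "x \<in> ball 0 r \<Longrightarrow> deriv \<phi> x = 1 + of_nat (Suc m) * (x ^ m * S x) + x ^ Suc m * deriv S x"
proof (rule DERIV_imp_deriv)
 assume x: "x \<in> ball 0 r"
 have "((\<lambda>x. x + x ^ Suc m * S x) has_field_derivative
   1 + of_nat (Suc m) * (x ^ m * S x) + x ^ Suc m * deriv S x) (at x)"
  using holomorphic_derivI[OF S open_ball x] power_minus_mult[OF m, of x]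
  by (auto intro!: derivative_eq_intros simp: algebra_simps)
 thus "(\<phi> has_field_derivative 1 + of_nat (Suc m) * (x ^ m * S x) + x ^ Suc m * deriv S x) (at x)"
  by (rule has_field_derivative_transform_within_open[of _ _ _ "ball 0 r"]) (use x phi in auto)
qed

definition nextu :: "complex \<Rightarrow> complex" where
 "nextu u = u * exp (- of_nat m * Ln (1 + petal m th u ^ m * S (petal m th u)))"

text \<open>\<open>nextu\<close> is \<open>\<phi>\<close> in the coordinate \<open>u\<close>. The
  product in the last clause is the derivative of that coordinate map: \<open>u\<close> is a
  constant times the power \<open>- m\<close> of the point, whence the quotients of old and new
  points and coordinates. Its distance from 1 is of order \<open>m + 1\<close> in the size of the
  point, which will be summable along an orbit.\<close>

definition good_step :: "real \<Rightarrow> complex \<Rightarrow> bool" where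
 "good_step C u \<longleftrightarrow> petal m th u \<in> ball 0 r \<and> \<phi> (petal m th u) = petal m th (nextu u) \<and>
   norm (nextu u - u - 1) \<le> 1/4 \<and> norm (nextu u - u - 1) \<le> C * norm (petal m th u) \<and>
   deriv \<phi> (petal m th u) \<noteq> 0 \<and>
   norm (deriv \<phi> (petal m th u) * (petal m th u / petal m th (nextu u)) * (nextu u / u) - 1) \<le> C * norm (petal m th u) ^ Suc m"

lemma petal_step:
 obtains R0 C where "0 < R0" "0 \<le> C" "\<And>u. Re u \<ge> R0 \<Longrightarrow> good_step C u"
proof -
 obtain C1 s1 where s1: "0 < s1" "s1 < r" "0 \<le> C1" "\<And>x. norm x \<le> s1 \<Longrightarrow> norm (S x - S 0) \<le> C1 * norm x"
  "\<And>x. norm x \<le> s1 \<Longrightarrow> norm (S x) \<le> C1" "\<And>x. norm x \<le> s1 \<Longrightarrow> norm (deriv S x) \<le> C1"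
  by (rule holomorphic_bound2[OF S r]) blast
 define e1 where "e1 x = exp (- of_nat m * Ln (1 + x))" for x :: complex
 define e3 where "e3 x = exp (- of_nat (Suc m) * Ln (1 + x))" for x :: complex
 \<comment> \<open>With \<open>y = x ^ m * S x\<close> this is the main part of the derivative of
   the coordinate map. Its linear term cancels, so the error is of order \<open>y ^ 2\<close>,
   within \<open>norm x ^ (m + 1)\<close>.\<close>
 define e2 where "e2 x = (1 + of_nat (Suc m) * x) * e3 x" for x :: complex
 have nn: "1 + x \<notin> \<real>\<^sub>\<le>\<^sub>0" if "x \<in> ball 0 1" for x :: complex
 proof
  assume "1 + x \<in> \<real>\<^sub>\<le>\<^sub>0"
  hence "Re (1 + x) \<le> 0" by (simp add: complex_nonpos_Reals_iff)
  hence "1 \<le> \<bar>Re x\<bar>" by simp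
  thus False using abs_Re_le_cmod[of x] that by simp
 qed
 have h1: "e1 holomorphic_on ball 0 1" unfolding e1_def by (intro holomorphic_intros) (use nn in auto)
 have h3: "e3 holomorphic_on ball 0 1" unfolding e3_def by (intro holomorphic_intros) (use nn in auto)
 have h2: "e2 holomorphic_on ball 0 1" unfolding e2_def by (intro holomorphic_intros h3)
 have d1: "deriv e1 0 = - of_nat m" unfolding e1_def by (rule DERIV_imp_deriv) (auto intro!: derivative_eq_intros)
 have d2: "deriv e2 0 = 0" unfolding e2_def e3_def by (rule DERIV_imp_deriv) (auto intro!: derivative_eq_intros)
 have v1: "e1 0 = 1" "e2 0 = 1" "e3 0 = 1" by (auto simp: e1_def e2_def e3_def)
 obtain C2 s2 where s2: "0 < s2" "s2 < 1" "0 \<le> C2" "\<And>x. norm x \<le> s2 \<Longrightarrow> norm (e1 x - 1 + of_nat m * x) \<le> C2 * norm x ^ 2"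
  by (rule holomorphic_bound2[OF h1 zero_less_one]) (unfold d1 v1 mult_minus_left diff_minus_eq_add, blast)
 obtain C3 s3 where s3: "0 < s3" "s3 < 1" "0 \<le> C3" "\<And>x. norm x \<le> s3 \<Longrightarrow> norm (e2 x - 1) \<le> C3 * norm x ^ 2"
  by (rule holomorphic_bound2[OF h2 zero_less_one]) (unfold d2 v1 mult_zero_left diff_zero, blast)
 obtain C4 s4 where s4: "0 < s4" "s4 < 1" "0 \<le> C4" "\<And>x. norm x \<le> s4 \<Longrightarrow> norm (e3 x) \<le> C4"
  by (rule holomorphic_bound2[OF h3 zero_less_one]) blast
 define a where "a = norm th ^ m"
 define C where "C = a * real m * C1 + a * C2 * C1 ^ 2 + (C3 * C1 ^ 2 + C1 * C4)"
 have a: "0 < a" using th_nz by (simp add: a_def)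
 have C0: "0 \<le> a * real m * C1 + a * C2 * C1 ^ 2" "0 \<le> C3 * C1 ^ 2 + C1 * C4" using a s1 s2 s3 s4 by simp_all
 have C: "0 \<le> C" using C0 by (simp add: C_def)
 define sE where "sE = min (min s2 s3) (min s4 (1 / (3 * real m)))"
 have sE: "0 < sE" using s2 s3 s4 m by (simp add: sE_def)
 \<comment> \<open>A radius within which \<open>y\<close> stays in the range of all expansions
   (\<open>C1 * d \<le> sE\<close>), \<open>norm x ^ m\<close> is at most \<open>norm x\<close>, and
   \<open>C * norm x\<close> is at most 1/4.\<close>
 define d where "d = Min {s1, 1, sE / (C1 + 1), 1 / (4 * (C + 1)), 1 / (2 * (C + 1))}"
 have d: "0 < d" using s1 sE C by (simp add: d_def)
 have d': "d \<le> s1" "d \<le> 1" "d \<le> sE / (C1 + 1)" "d \<le> 1 / (4 * (C + 1))" "d \<le> 1 / (2 * (C + 1))" by (auto simp: d_def)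
 obtain R where R: "R > 0" "\<And>u. norm u \<ge> R \<Longrightarrow> norm (petal m th u) < d" using petal_small[OF m d] by blast
 show ?thesis
 proof (rule that[OF R(1) C])
  fix u assume "R \<le> Re u"
  hence u: "Re u > 0" "norm u \<ge> R" using R(1) complex_Re_le_cmod[of u] by linarith+
  have unz: "u \<noteq> 0" using u(1) by auto
  define x where "x = petal m th u"
  have x: "norm x < d" "x \<noteq> 0" using R(2)[OF u(2)] petal_nz[OF th_nz] by (auto simp: x_def)
  have xr: "x \<in> ball 0 r" using x d' s1 by simp
  have xm: "x ^ m = th ^ m / u" using petal_power[OF m unz] by (simp add: x_def)
  define y where "y = x ^ m * S x"
  have nx: "norm x \<le> 1" "norm x \<le> s1" using x d' by auto
  have pw: "norm x ^ m \<le> norm x" using m nx power_decreasing[of 1 m "norm x"] by simp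
  have ny: "norm y \<le> C1 * norm x ^ m" using s1(5)[OF nx(2)]
   by (simp add: y_def norm_mult norm_power mult.commute mult_right_mono)
  also have "\<dots> \<le> C1 * norm x" using pw s1(3) by (rule mult_left_mono)
  also have "\<dots> \<le> C1 * d" using x s1(3) by (intro mult_left_mono) auto
  also have "\<dots> \<le> C1 * (sE / (C1 + 1))" using d'(3) s1(3) by (rule mult_left_mono)
  also have "\<dots> \<le> sE" using s1(3) sE by (simp add: field_simps)
  finally have ysE: "norm y \<le> sE" .
  hence ys: "norm y \<le> s2" "norm y \<le> s3" "norm y \<le> s4" "norm y \<le> 1 / (3 * real m)" by (auto simp: sE_def)
  have ym: "norm y < 1 / (2 * real m)"
  proof -
   have "1 / (3 * real m) < 1 / (2 * real m)" using m by (simp add: field_simps)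
   thus ?thesis using ys(4) by linarith
  qed
  have y1: "1 + y \<noteq> 0"
  proof
   assume "1 + y = 0"
   hence "y = -1" by (simp add: eq_neg_iff_add_eq_0 add.commute)
   thus False using ys(1) s2(2) by simp
  qed
  have nu: "nextu u = u * e1 y" by (simp add: nextu_def e1_def y_def x_def)
  have pn: "petal m th (nextu u) = x * (1 + y)" using petal_mult[OF m u(1) ym, of th] by (simp add: nu e1_def x_def)
  have ph: "\<phi> x = x * (1 + y)" using phi[OF xr] by (simp add: y_def algebra_simps)
  have ny2: "norm y ^ 2 \<le> C1 ^ 2 * (norm x ^ m * norm x ^ m)"
   using power_mono[OF ny norm_ge_zero, of 2] by (simp add: power2_eq_square mult_ac)
  have uxm: "u * x ^ m = th ^ m" using unz by (simp add: xm)
  have S0: "S 0 \<noteq> 0" using th by auto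
  \<comment> \<open>Here the normalisation of \<open>th\<close> enters: the increment of
    \<open>u\<close> is \<open>S x / S 0\<close> up to smaller terms, hence close to 1.\<close>
  have uy: "u * (of_nat m * y) = - S x / S 0"
  proof -
   have "u * (of_nat m * y) = of_nat m * S x * (u * x ^ m)" by (simp add: y_def)
   also have "\<dots> = S x * (of_nat m * th ^ m)" by (simp add: uxm)
   also have "of_nat m * th ^ m = - 1 / S 0" using th unfolding nonzero_eq_divide_eq[OF S0] by (simp only: mult_ac)
   finally show ?thesis by simp
  qed
  have nS0: "1 / norm (S 0) = real m * a"
  proof -
   have "norm (of_nat m * S 0 * th ^ m) = 1" using th by simp
   hence "real m * norm (S 0) * a = 1" by (simp add: norm_mult norm_power a_def)
   thus ?thesis using S0 by (simp add: field_simps)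
  qed
  have "nextu u - u - 1 = u * (e1 y - 1 + of_nat m * y) - (u * (of_nat m * y) + 1)" by (simp add: nu algebra_simps)
  also have "u * (of_nat m * y) + 1 = - (S x - S 0) / S 0" unfolding uy using S0 by (simp add: field_simps)
  finally have "norm (nextu u - u - 1) \<le> norm (u * (e1 y - 1 + of_nat m * y)) + norm ((S x - S 0) / S 0)"
   by (metis norm_triangle_ineq diff_minus_eq_add divide_minus_left minus_minus)
  moreover have "norm (u * (e1 y - 1 + of_nat m * y)) \<le> a * C2 * C1 ^ 2 * norm x"
  proof -
   have "norm (u * (e1 y - 1 + of_nat m * y)) \<le> norm u * (C2 * norm y ^ 2)"
    unfolding norm_mult using s2(4)[OF ys(1)] by (intro mult_left_mono) auto
   also have "\<dots> \<le> norm u * (C2 * (C1 ^ 2 * (norm x ^ m * norm x ^ m)))"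
    using ny2 s2(3) by (intro mult_left_mono) auto
   also have "\<dots> = (norm u * norm x ^ m) * (C2 * C1 ^ 2 * norm x ^ m)" by simp
   also have "norm u * norm x ^ m = a" using uxm by (metis a_def norm_mult norm_power)
   also have "a * (C2 * C1 ^ 2 * norm x ^ m) \<le> a * (C2 * C1 ^ 2 * norm x)"
    using pw a s2(3) by (intro mult_left_mono) auto
   finally show ?thesis by simp
  qed
  moreover have "norm ((S x - S 0) / S 0) \<le> a * real m * C1 * norm x"
  proof -
   have "norm ((S x - S 0) / S 0) = norm (S x - S 0) * (1 / norm (S 0))" by (simp add: norm_divide)
   also have "\<dots> \<le> (C1 * norm x) * (real m * a)" unfolding nS0
    using s1(4)[OF nx(2)] a by (intro mult_right_mono) auto
   finally show ?thesis by (simp add: mult_ac)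
  qed
  ultimately have b1: "norm (nextu u - u - 1) \<le> C * norm x"
   using mult_right_mono[OF C0(2), of "norm x"] by (simp add: C_def algebra_simps)
  have Cx: "C * norm x \<le> C * d" using x C by (intro mult_left_mono) auto
  also have "\<dots> \<le> C * (1 / (4 * (C + 1)))" using d'(4) C by (rule mult_left_mono)
  also have "\<dots> \<le> 1/4" using C by simp
  finally have b2: "C * norm x \<le> 1/4" .
  have dphi: "deriv \<phi> x = (1 + of_nat (Suc m) * y) + x ^ Suc m * deriv S x"
   using deriv_phi[OF xr] by (simp add: y_def)
  have e31: "e3 y = e1 y / (1 + y)"
   using y1 by (simp add: e3_def e1_def algebra_simps exp_diff exp_minus) (simp add: divide_inverse)
  have "deriv \<phi> x * (x / petal m th (nextu u)) * (nextu u / u) = deriv \<phi> x * e3 y"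
   using x(2) unz unfolding pn e31 unfolding nu by simp
  also have "\<dots> - 1 = (e2 y - 1) + x ^ Suc m * deriv S x * e3 y" unfolding dphi e2_def by (simp add: algebra_simps)
  finally have "norm (deriv \<phi> x * (x / petal m th (nextu u)) * (nextu u / u) - 1)
    \<le> norm (e2 y - 1) + norm (x ^ Suc m * deriv S x * e3 y)" by (metis norm_triangle_ineq)
  also have "norm (e2 y - 1) \<le> C3 * C1 ^ 2 * norm x ^ Suc m"
  proof -
   have "norm (e2 y - 1) \<le> C3 * norm y ^ 2" by (rule s3(4)[OF ys(2)])
   also have "\<dots> \<le> C3 * (C1 ^ 2 * (norm x ^ m * norm x ^ m))" using ny2 s3(3) by (rule mult_left_mono)
   also have "\<dots> \<le> C3 * (C1 ^ 2 * (norm x ^ m * norm x))" using pw s3(3) by (intro mult_left_mono) auto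
   finally show ?thesis by (simp add: mult_ac)
  qed
  also have "norm (x ^ Suc m * deriv S x * e3 y) \<le> norm x ^ Suc m * C1 * C4" unfolding norm_mult norm_power
   using s1(6)[OF nx(2)] s4(4)[OF ys(3)] s1(3) by (intro mult_mono) auto
  finally have b3: "norm (deriv \<phi> x * (x / petal m th (nextu u)) * (nextu u / u) - 1) \<le> C * norm x ^ Suc m"
   using mult_right_mono[OF C0(1), of "norm x ^ Suc m"] by (simp add: C_def algebra_simps)
  have "C * norm x ^ Suc m \<le> C * norm x"
   using C nx by (intro mult_left_mono) (simp_all add: mult_left_le power_le_one)
  hence "norm (deriv \<phi> x * (x / petal m th (nextu u)) * (nextu u / u) - 1) \<le> 1/4" using b2 b3 by linarith
  hence nz: "deriv \<phi> x \<noteq> 0" by auto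
  show "good_step C u" unfolding good_step_def using xr ph pn b1 b2 b3 nz unfolding x_def[symmetric] by auto
 qed
qed

text \<open>The last clause concerns, up to a constant, the derivative of the \<open>k\<close>-th
  iterate in the coordinate \<open>u\<close>: it has a nonzero limit, so that the derivative of the
  iterate itself behaves like \<open>x k / v k\<close>.\<close>

definition petal_orbit_at :: "complex \<Rightarrow> (nat \<Rightarrow> complex) \<Rightarrow> (nat \<Rightarrow> complex) \<Rightarrow> bool" where
 "petal_orbit_at u0 v x \<longleftrightarrow> (\<forall>k. x k \<in> ball 0 r \<and> \<phi> (x k) = x (Suc k) \<and> Re u0 + 3/4 * real k \<le> Re (v k) \<and> norm (v (Suc k) - v k - 1) \<le> 1/4 \<and> deriv \<phi> (x k) \<noteq> 0) \<and>
  (\<lambda>k. v k / of_nat k) \<longlonglongrightarrow> 1 \<and> x \<longlonglongrightarrow> 0 \<and>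
  (\<exists>L. L \<noteq> 0 \<and> (\<lambda>k. (\<Prod>i<k. deriv \<phi> (x i)) * v k / x k) \<longlonglongrightarrow> L)"

text \<open>The coordinate moves to the right by at least 3/4 per step, so
  \<open>norm (x k) ^ m\<close> is \<open>O(1 / k)\<close> and the coordinate derivatives deviate
  from 1 by at most a constant times \<open>k powr - (1 + 1 / m)\<close>. This is summable, so the
  infinite product of the derivatives converges to a nonzero limit.\<close>

lemma petal_orbit:
 obtains R0 where "1 \<le> R0" "\<And>u0 v x. R0 \<le> Re u0 \<Longrightarrow> v = (\<lambda>k. (nextu ^^ k) u0) \<Longrightarrow> x = (\<lambda>k. petal m th (v k)) \<Longrightarrow> petal_orbit_at u0 v x"
proof -
 obtain R C where R: "0 < R" "0 \<le> C" and st: "\<And>u. Re u \<ge> R \<Longrightarrow> good_step C u" by (rule petal_step) blast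
 note st = st[unfolded good_step_def]
 show ?thesis
 proof (rule that[of "max R 1"], simp)
  fix u0 :: complex and v x :: "nat \<Rightarrow> complex"
  assume u0: "max R 1 \<le> Re u0" and v: "v = (\<lambda>k. (nextu ^^ k) u0)" and x: "x = (\<lambda>k. petal m th (v k))"
  have vS: "v (Suc k) = nextu (v k)" for k by (simp add: v)
  have Re: "Re u0 + 3/4 * real k \<le> Re (v k)" for k
  proof (induction k)
   case (Suc k)
   have "norm (v (Suc k) - v k - 1) \<le> 1/4" using st[of "v k"] Suc u0 by (simp add: vS)
   hence "\<bar>Re (v (Suc k) - v k - 1)\<bar> \<le> 1/4" using abs_Re_le_cmod order_trans by blast
   hence "\<bar>Re (v (Suc k)) - Re (v k) - 1\<bar> \<le> 1/4" by (simp only: minus_complex.sel one_complex.sel)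
   hence "- (1/4) \<le> Re (v (Suc k)) - Re (v k) - 1" by linarith
   thus ?case using Suc unfolding of_nat_Suc distrib_left by linarith
  qed (simp add: v)
  have RR: "R \<le> Re (v k)" for k using Re[of k] u0 by simp
  note st' = st[OF RR, folded vS]
  have xk: "petal m th (v k) = x k" for k by (simp add: x)
  note st' = st'[unfolded xk]
  have v1: "3/4 * (real k + 1) \<le> norm (v k)" for k using Re[of k] u0 complex_Re_le_cmod[of "v k"] by simp
  have vnz: "v k \<noteq> 0" for k using v1[of k] by auto
  have xnz: "x k \<noteq> 0" for k by (simp add: x petal_nz th_nz)
  define a where "a = norm th ^ m"
  have a: "0 < a" using th_nz by (simp add: a_def)
  have xm: "norm (x k) ^ m = a / norm (v k)" for k unfolding x a_def by (rule norm_petal_power[OF m vnz])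
  have xp: "norm (x k) = (a / norm (v k)) powr (1 / real m)" for k
  proof -
   have "norm (x k) ^ m = norm (x k) powr real m" using xnz[of k] by (simp add: powr_realpow)
   hence "(norm (x k) powr real m) powr (1 / real m) = (a / norm (v k)) powr (1 / real m)" using xm[of k] by simp
   thus ?thesis unfolding powr_powr using m by simp
  qed
  have le: "a / norm (v k) \<le> 4/3 * a * (1 / (real k + 1))" for k
  proof -
   have "a / norm (v k) \<le> a / (3/4 * (real k + 1))" using v1[of k] a by (intro divide_left_mono mult_pos_pos) (auto)
   thus ?thesis by (simp add: mult.commute)
  qed
  have xlim: "x \<longlonglongrightarrow> 0"
  proof (rule tendsto_norm_zero_cancel)
   have c: "(\<lambda>k. 4/3 * a * (1 / (real k + 1))) \<longlonglongrightarrow> 4/3 * a * 0"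
    using LIMSEQ_inverse_real_of_nat by (intro tendsto_mult tendsto_const) (simp add: inverse_eq_divide add.commute)
   have "(\<lambda>k. a / norm (v k)) \<longlonglongrightarrow> 0"
   proof (rule Lim_null_comparison)
    show "(\<lambda>k. 4/3 * a * (1 / (real k + 1))) \<longlonglongrightarrow> 0" using c by simp
    show "\<forall>\<^sub>F k in sequentially. norm (a / norm (v k)) \<le> 4/3 * a * (1 / (real k + 1))"
     by (rule always_eventually) (use le a in \<open>simp \<close>)
   qed
   hence "(\<lambda>k. (a / norm (v k)) powr (1 / real m)) \<longlonglongrightarrow> 0 powr (1 / real m)"
    by (rule tendsto_powr'[OF _ tendsto_const]) (use m a in simp)
   thus "(\<lambda>k. norm (x k)) \<longlonglongrightarrow> 0" unfolding xp by simp
  qed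
  have "(\<lambda>k. v (Suc k) - v k - 1) \<longlonglongrightarrow> 0"
  proof (rule Lim_null_comparison)
   show "\<forall>\<^sub>F k in sequentially. norm (v (Suc k) - v k - 1) \<le> C * norm (x k)" using st' by simp
   show "(\<lambda>k. C * norm (x k)) \<longlonglongrightarrow> 0" using tendsto_mult[OF tendsto_const tendsto_norm_zero[OF xlim]] by simp
  qed
  hence "(\<lambda>k. v (Suc k) - v k - 1 + 1) \<longlonglongrightarrow> 0 + 1" by (intro tendsto_intros)
  hence vlim: "(\<lambda>k. v k / of_nat k) \<longlonglongrightarrow> 1" by (intro tendsto_average_increments) simp
  define p where "p k = deriv \<phi> (x k) * (x k / x (Suc k)) * (v (Suc k) / v k)" for k
  have pb: "norm (p k - 1) \<le> C * norm (x k) ^ Suc m" for k using st' by (simp add: p_def)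
  have pnz: "p k \<noteq> 0" for k using st'[of k] xnz[of k] xnz[of "Suc k"] vnz[of k] vnz[of "Suc k"] by (simp add: p_def)
  have "summable (\<lambda>k. norm (p k - 1))"
  proof (rule summable_comparison_test')
   have "summable (\<lambda>k. real k powr (- (1 + 1 / real m)))" using m by (simp add: summable_real_powr_iff)
   hence "summable (\<lambda>k. real (k + 1) powr (- (1 + 1 / real m)))" by (subst summable_iff_shift)
   thus "summable (\<lambda>k. C * ((4/3 * a) powr (1 + 1 / real m) * real (k + 1) powr (- (1 + 1 / real m))))"
    by (intro summable_mult)
   fix k
   have "norm (x k) ^ Suc m = (a / norm (v k)) powr (1 + 1 / real m)"
   proof -
    have "norm (x k) ^ Suc m = norm (x k) * norm (x k) ^ m" by simp
    also have "\<dots> = (a / norm (v k)) powr (1 / real m) * (a / norm (v k)) powr 1"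
     unfolding xm by (simp add: xp a less_imp_le)
    finally show ?thesis unfolding powr_add[symmetric] by (simp only: add.commute)
   qed
   also have "\<dots> \<le> (4/3 * a * (1 / (real k + 1))) powr (1 + 1 / real m)" using le a by (intro powr_mono2) (auto)
   also have "\<dots> = (4/3 * a) powr (1 + 1 / real m) * real (k + 1) powr (- (1 + 1 / real m))"
    by (simp only: powr_mult powr_minus) (simp add: powr_divide inverse_eq_divide add.commute)
   finally have "norm (x k) ^ Suc m \<le> (4/3 * a) powr (1 + 1 / real m) * real (k + 1) powr (- (1 + 1 / real m))" .
   from mult_left_mono[OF this R(2)] pb[of k]
   show "norm (norm (p k - 1)) \<le> C * ((4/3 * a) powr (1 + 1 / real m) * real (k + 1) powr (- (1 + 1 / real m)))"
    by simp
  qed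
  hence cp: "convergent_prod p" by (intro abs_convergent_prod_imp_convergent_prod summable_imp_abs_convergent_prod)
  have eq: "(\<Prod>i<k. deriv \<phi> (x i)) * v k / x k = v 0 / x 0 * (\<Prod>i<k. p i)" for k
  proof (induction k)
   case (Suc k)
   have "(\<Prod>i<Suc k. deriv \<phi> (x i)) * v (Suc k) / x (Suc k) = ((\<Prod>i<k. deriv \<phi> (x i)) * v k / x k) * p k"
    using xnz vnz by (simp add: p_def)
   thus ?case using Suc by simp
  qed simp
  have "(\<lambda>k. \<Prod>i<Suc k. p i) \<longlonglongrightarrow> prodinf p" using convergent_prod_LIMSEQ[OF cp] by (simp add: lessThan_Suc_atMost)
  hence "(\<lambda>k. \<Prod>i<k. p i) \<longlonglongrightarrow> prodinf p" by (rule LIMSEQ_imp_Suc)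
  hence "(\<lambda>k. (\<Prod>i<k. deriv \<phi> (x i)) * v k / x k) \<longlonglongrightarrow> v 0 / x 0 * prodinf p" unfolding eq by (rule tendsto_mult_left)
  moreover have "v 0 / x 0 * prodinf p \<noteq> 0" using xnz vnz prodinf_nonzero[OF cp pnz] by simp
  ultimately show "petal_orbit_at u0 v x" unfolding petal_orbit_at_def using st' Re vlim xlim by blast
 qed
qed

end

section \<open>Parabolic petals of the cycle capture the orbit of a singular value\<close>

context lift_map begin

lemma funpow_near:
 assumes "\<And>j. j < N \<Longrightarrow> (g ^^ j) z \<in> D \<and> (g ^^ j) z \<noteq> 0"
 shows "\<forall>\<^sub>F w in nhds z. \<forall>j<N. (g ^^ j) w \<in> D \<and> (g ^^ j) w \<noteq> 0"
proof -
 have "\<forall>\<^sub>F w in nhds z. \<forall>j\<in>{..<N}. (g ^^ j) w \<in> D - {0}"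
 proof (rule eventually_ball_finite)
  show "\<forall>j\<in>{..<N}. \<forall>\<^sub>F w in nhds z. (g ^^ j) w \<in> D - {0}"
  proof
   fix j assume j: "j \<in> {..<N}"
   have "isCont (g ^^ j) z" by (rule DERIV_isCont[OF funpow_deriv]) (use assms j in simp)
   hence "((g ^^ j) \<longlongrightarrow> (g ^^ j) z) (nhds z)" by (simp add: tendsto_at_iff_tendsto_nhds[symmetric] isCont_def)
   thus "\<forall>\<^sub>F w in nhds z. (g ^^ j) w \<in> D - {0}" by (rule topological_tendstoD) (use open_D assms j in auto)
  qed
 qed simp
 thus ?thesis by (simp only: Ball_def lessThan_iff Diff_iff insert_iff empty_iff simp_thms)
qed

lemma tau_nz_deriv: "tau z N \<noteq> 0 \<Longrightarrow> j < N \<Longrightarrow> deriv f ((g ^^ j) z) \<noteq> 0" unfolding tau_def by auto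

lemma tau_funpow_ident:
 assumes "\<forall>\<^sub>F w in nhds z. (\<forall>j<N. (g ^^ j) w \<in> D \<and> (g ^^ j) w \<noteq> 0) \<and> (g ^^ N) w = w"
 shows "tau z N = 1"
proof -
 have z: "\<forall>j<N. (g ^^ j) z \<in> D" using eventually_nhds_x_imp_x[OF assms] by blast
 have "((g ^^ N) has_field_derivative 1) (at z) \<longleftrightarrow> ((\<lambda>w. w) has_field_derivative 1) (at z)"
  by (rule DERIV_cong_ev) (use assms in \<open>auto elim: eventually_mono\<close>)
 moreover have "((\<lambda>w. w) has_field_derivative 1) (at z)" by (rule DERIV_ident)
 ultimately have "((g ^^ N) has_field_derivative 1) (at z)" by (rule iffD2)
 moreover have "((g ^^ N) has_field_derivative tau z N) (at z)" by (rule funpow_deriv) (use z in simp)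
 ultimately show ?thesis using DERIV_unique by blast
qed

text \<open>If an iterate were the identity near some point, the identity would propagate along chains of discs to
 the complement of a finite set: condition (c) leaves enough slack to pull back a disc meeting the
 boundary of the set where the iterate is the identity.\<close>

lemma iterate_not_ident:
 assumes N: "0 < N" and z: "\<And>j. j < N \<Longrightarrow> (g ^^ j) z \<in> D \<and> (g ^^ j) z \<noteq> 0"
 shows "\<not> (\<forall>\<^sub>F w in nhds z. (g ^^ N) w = w)"
proof
 assume id: "\<forall>\<^sub>F w in nhds z. (g ^^ N) w = w"
 define P where "P w \<longleftrightarrow> (\<forall>j<N. (g ^^ j) w \<in> D \<and> (g ^^ j) w \<noteq> 0) \<and> (g ^^ N) w = w" for w
 define E where "E = interior (Collect P)"
 \<comment> \<open>Off 0 and the first \<open>N\<close> points of the singular orbits, pulling back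
   a small disc by \<open>N\<close> steps meets no obstruction.\<close>
 define Pt where "Pt = insert 0 ((\<lambda>(i, u). (g ^^ i) (u * c1)) ` ({..<N} \<times> U))"
 have "finite U" using U_sub finite_subset by blast
 hence finPt: "finite Pt" by (simp add: Pt_def)
 have EP: "P w" if "w \<in> E" for w using that interior_subset[of "Collect P"] by (auto simp: E_def)
 have ev: "eventually P (nhds x) \<longleftrightarrow> x \<in> E" for x unfolding E_def eventually_nhds interior_def by blast
 have zE: "z \<in> E" unfolding ev[symmetric] P_def by (rule eventually_conj[OF funpow_near[OF z] id])
 have cl: "w \<in> E" if w: "w \<in> closure E" "w \<notin> Pt" for w
 proof -
  have wnz: "w \<noteq> 0" using w(2) by (auto simp: Pt_def)
  \<comment> \<open>The slack in condition (c): for \<open>x\<close>, \<open>y\<close> near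
    \<open>w\<close> the point \<open>v = c1 * x / y\<close> is close to \<open>c1\<close>, hence in
    \<open>Dp\<close>, and \<open>x / v = y / c1\<close>. So \<open>y / c1\<close> is in the image
    of \<open>f\<close> for all \<open>y\<close> in a disc about \<open>x\<close>, although only
    \<open>x\<close> is known to lie in \<open>D\<close>.\<close>
  have "((\<lambda>p. c1 * fst p / snd p) \<longlongrightarrow> c1 * w / w) (nhds w \<times>\<^sub>F nhds w)"
   by (intro tendsto_intros filterlim_fst filterlim_snd) (rule wnz)
  hence "((\<lambda>p. c1 * fst p / snd p) \<longlongrightarrow> c1) (nhds w \<times>\<^sub>F nhds w)" using wnz by simp
  hence "\<forall>\<^sub>F p in nhds w \<times>\<^sub>F nhds w. c1 * fst p / snd p \<in> Dp"
   by (rule topological_tendstoD) (use open_Dp c1 in auto)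
  then obtain Q where Q: "eventually Q (nhds w)" "\<And>x y. Q x \<Longrightarrow> Q y \<Longrightarrow> c1 * x / y \<in> Dp"
   unfolding eventually_prod_same by auto
  have "\<forall>\<^sub>F x in nhds w. x \<in> - Pt"
   by (rule eventually_nhds_in_open) (use w finPt in \<open>auto intro: finite_imp_closed\<close>)
  from eventually_conj[OF Q(1) this]
  obtain d where d: "0 < d" "\<And>x. dist x w < d \<Longrightarrow> Q x \<and> x \<in> - Pt" unfolding eventually_nhds_metric by blast
  obtain x where x: "x \<in> E" "dist x w < d / 2" using w(1) d(1) unfolding closure_approachable by (meson half_gt_zero)
  have bal: "dist y w < d" if "y \<in> ball x (d/2)" for y
   using that x(2) dist_triangle[of y w x] by (simp add: dist_commute)
  have xw: "dist x w < d" using x d by simp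
  have xP: "\<And>j. j < N \<Longrightarrow> (g ^^ j) x \<in> D \<and> (g ^^ j) x \<noteq> 0" "(g ^^ N) x = x" using EP[OF x(1)] by (auto simp: P_def)
  have xD: "x \<in> D" "x \<noteq> 0" using xP(1)[of 0] N by auto
  have "tau x N = 1" by (rule tau_funpow_ident) (use x(1) ev[of x] in \<open>simp add: P_def[abs_def]\<close>)
  hence dnz: "deriv f ((g ^^ j) x) \<noteq> 0" if "j < N" for j by (intro tau_nz_deriv[OF _ that]) simp
  define b where "b i = (g ^^ (N - i)) x" for i
  have R: "y \<noteq> 0 \<and> (y \<noteq> c1 \<longrightarrow> y / c1 \<in> f ` D)" if y: "y \<in> ball x (d/2)" for y
  proof -
   have y0: "y \<noteq> 0" using d(2)[OF bal[OF y]] by (auto simp: Pt_def)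
   moreover have "y / c1 \<in> f ` D" if "y \<noteq> c1"
   proof -
    have "c1 * x / y \<in> Dp" using Q(2) d(2)[OF bal[OF y]] d(2)[OF xw] by blast
    moreover have "c1 * x / y \<noteq> 0" using c1 xD y0 by simp
    moreover have "c1 * x / y \<noteq> x" using that y0 xD by (simp add: field_simps)
    ultimately have "x / (c1 * x / y) \<in> f ` D" by (rule quot[OF xD])
    thus ?thesis using xD by simp
   qed
   ultimately show ?thesis by blast
  qed
  have b0: "b 0 = x" using xP by (simp add: b_def)
  have bs: "b (Suc i) \<in> D \<and> b i \<noteq> 0 \<and> g (b (Suc i)) = b i \<and> deriv f (b (Suc i)) \<noteq> 0" if "i < N" for i
  proof -
   have s: "N - i = Suc (N - Suc i)" using that by simp
   hence "g (b (Suc i)) = b i" by (simp add: b_def)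
   moreover have "b i \<noteq> 0" using xP(1)[of "N - i"] xP(2) xD that by (cases "i = 0") (simp_all add: b_def)
   ultimately show ?thesis using xP dnz s by (simp add: b_def)
  qed
  have no: "\<not> hits (ball x (d/2) - {x}) i u" if "i < N" for i u
  proof
   assume "hits (ball x (d/2) - {x}) i u"
   hence "(g ^^ i) (u * c1) \<in> ball x (d/2)" "u \<in> U" by (auto simp: hits_def)
   hence "(g ^^ i) (u * c1) \<in> - Pt" using d(2)[OF bal] by blast
   thus False using \<open>u \<in> U\<close> that by (force simp: Pt_def)
  qed
  have d2: "0 < d / 2" using d by simp
  obtain h where h: "h holomorphic_on ball x (d/2)" "h x = b N"
   "\<And>z. z \<in> ball x (d/2) \<Longrightarrow> (g ^^ N) (h z) = z \<and> (\<forall>j<N. (g ^^ j) (h z) \<in> D \<and> (g ^^ j) (h z) \<noteq> 0)"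
   using pull_back[where n = N and b = b and R = "d/2" and zs = x, OF d2 R b0 bs no] by blast
  have hx: "h x = x" using h(2) by (simp add: b_def)
  have xb: "x \<in> ball x (d/2)" using d2 by simp
  have "isCont h x" using h(1) xb by (meson continuous_on_eq_continuous_at holomorphic_on_imp_continuous_on open_ball)
  hence "(h \<longlongrightarrow> x) (nhds x)" using tendsto_at_iff_tendsto_nhds[of h x] hx by (simp add: isCont_def)
  moreover have "eventually P (nhds x)" using x(1) ev by simp
  ultimately have "\<forall>\<^sub>F y in nhds x. P (h y)" by (rule eventually_compose_filterlim[rotated])
  moreover have "\<forall>\<^sub>F y in nhds x. y \<in> ball x (d/2)" by (rule eventually_nhds_in_open) (use xb in auto)
  ultimately have "\<forall>\<^sub>F y in nhds x. h y = y \<and> y \<in> ball x (d/2)" by eventually_elim (use h(3) P_def in metis)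
  then obtain T where T: "open T" "x \<in> T" "\<And>y. y \<in> T \<Longrightarrow> h y = y \<and> y \<in> ball x (d/2)" unfolding eventually_nhds by blast
  \<comment> \<open>The inverse branch is the identity near \<open>x\<close>, hence on the whole
    disc, which contains \<open>w\<close>.\<close>
  have hid: "h y = y" if "y \<in> ball x (d/2)" for y
   by (rule analytic_continuation_open[of T "ball x (d/2)" h "\<lambda>y. y"])
    (use T h(1) that in \<open>auto \<close>)
  have "w \<in> ball x (d/2)" using x(2) by simp
  moreover have "\<forall>y\<in>ball x (d/2). P y" using h(3) hid by (simp add: P_def)
  ultimately show ?thesis unfolding E_def interior_def using open_ball by blast
 qed
 \<comment> \<open>The set where the iterate is the identity is open and closed in the complement of
   \<open>Pt\<close>; filling it, it would make \<open>f\<close> injective off a finite set.\<close>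
 have "connected (- Pt)"
  using connected_UNIV connected_open_delete_finite[of "UNIV :: complex set" Pt] finPt by (simp add: Compl_eq_Diff_UNIV)
 moreover have "openin (top_of_set (- Pt)) (- Pt \<inter> E)" unfolding E_def by (intro openin_open_Int open_interior)
 moreover have "closedin (top_of_set (- Pt)) (- Pt \<inter> E)"
 proof -
  have "- Pt \<inter> E = - Pt \<inter> closure E" using cl closure_subset[of E] by blast
  thus ?thesis by (simp add: closedin_closed_Int)
 qed
 moreover have "- Pt \<inter> E \<noteq> {}"
 proof
  assume "- Pt \<inter> E = {}"
  hence "finite E" using finPt by (metis Int_commute disjoint_eq_subset_Compl double_complement finite_subset)
  thus False using zE open_interior unfolding E_def by (metis empty_iff finite_imp_not_open)
 qed
 ultimately have "- Pt \<inter> E = - Pt" unfolding connected_clopen by blast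
 hence all: "P w" if "w \<in> - Pt" for w using EP that by blast
 have "- Pt \<subseteq> D"
 proof
  fix w assume "w \<in> - Pt"
  from all[OF this] show "w \<in> D" using N unfolding P_def by (metis funpow_0)
 qed
 moreover have "inj_on f (- Pt)"
 proof (rule inj_onI)
  fix v w assume vw: "v \<in> - Pt" "w \<in> - Pt" "f v = f w"
  have "(g ^^ N) v = (g ^^ N) w" using N vw(3) by (cases N) (simp_all only: funpow_Suc_right o_apply)
  thus "v = w" using all vw P_def by metis
 qed
 ultimately show False using not_inj[OF finPt] by blast
qed

end

context map_cycle begin

lemma b_orbit_D: "(g ^^ j) (b n) \<in> D \<and> (g ^^ j) (b n) \<noteq> 0" by (simp add: funpow_b b_D b_nz)

text \<open>Derivative 1 makes the zero of \<open>(g ^^ N) (b 0 + x) - b 0 - x\<close> at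
  \<open>x = 0\<close> at least double, and its order is finite because no iterate of
  \<open>g\<close> is locally the identity.\<close>

lemma germ_at_cycle:
 assumes N: "0 < N" and per: "b N = b 0" and t1: "tau (b 0) N = 1"
 obtains S r m where "0 < r" "S holomorphic_on ball 0 r" "0 < m" "S 0 \<noteq> 0"
  "\<And>x. x \<in> ball 0 r \<Longrightarrow> (g ^^ N) (b 0 + x) - b 0 = x + x ^ Suc m * S x"
  "\<And>x j. x \<in> ball 0 r \<Longrightarrow> j < N \<Longrightarrow> (g ^^ j) (b 0 + x) \<in> D \<and> (g ^^ j) (b 0 + x) \<noteq> 0"
proof -
 have "\<forall>\<^sub>F w in nhds (b 0). \<forall>j<N. (g ^^ j) w \<in> D \<and> (g ^^ j) w \<noteq> 0" by (rule funpow_near) (rule b_orbit_D)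
 then obtain r0 where r0: "0 < r0" "\<And>w. dist w (b 0) < r0 \<Longrightarrow> \<forall>j<N. (g ^^ j) w \<in> D \<and> (g ^^ j) w \<noteq> 0"
  unfolding eventually_nhds_metric by blast
 have D0: "\<And>j. j < N \<Longrightarrow> (g ^^ j) (b 0 + x) \<in> D \<and> (g ^^ j) (b 0 + x) \<noteq> 0" if "x \<in> ball 0 r0" for x
  using r0(2)[of "b 0 + x"] that by (simp add: dist_norm)
 define \<psi> where "\<psi> x = (g ^^ N) (b 0 + x) - b 0 - x" for x
 have der: "(\<psi> has_field_derivative tau (b 0 + x) N - 1) (at x)" if "x \<in> ball 0 r0" for x
 proof -
  have "((g ^^ N) has_field_derivative tau (b 0 + x) N) (at (b 0 + x))"
   by (rule funpow_deriv) (use D0[OF that] in simp)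
  hence "((\<lambda>x. (g ^^ N) (b 0 + x)) has_field_derivative tau (b 0 + x) N) (at x)"
   by (simp add: DERIV_shift add.commute)
  thus ?thesis unfolding \<psi>_def by (auto intro!: derivative_eq_intros)
 qed
 have hol: "\<psi> holomorphic_on ball 0 r0" unfolding holomorphic_on_open[OF open_ball] using der by blast
 have z0: "0 \<in> ball (0::complex) r0" using r0 by simp
 have p0: "\<psi> 0 = 0" using per funpow_b[of N 0] by (simp add: \<psi>_def)
 have nc: "\<not> \<psi> constant_on ball 0 r0"
 proof
  assume "\<psi> constant_on ball 0 r0"
  then obtain a where a: "\<And>x. x \<in> ball 0 r0 \<Longrightarrow> \<psi> x = a" unfolding constant_on_def by blast
  have "a = 0" using a[OF z0] p0 by simp
  have "\<forall>\<^sub>F w in nhds (b 0). (g ^^ N) w = w" unfolding eventually_nhds_metric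
  proof (intro exI conjI allI impI)
   show "0 < r0" by (rule r0)
   fix w assume "dist w (b 0) < r0"
   hence "\<psi> (w - b 0) = 0" using a[of "w - b 0"] \<open>a = 0\<close> by (simp add: dist_norm norm_minus_commute)
   thus "(g ^^ N) w = w" by (simp add: \<psi>_def)
  qed
  thus False using iterate_not_ident[OF N b_orbit_D] by blast
 qed
 show ?thesis
 proof (rule holomorphic_factor_zero_nonconstant[OF hol open_ball connected_ball z0 p0 nc])
  fix k r n assume k: "0 < n" "0 < r" "ball (0::complex) r \<subseteq> ball 0 r0" "k holomorphic_on ball 0 r"
   "\<And>w. w \<in> ball 0 r \<Longrightarrow> \<psi> w = (w - 0) ^ n * k w" "\<And>w. w \<in> ball 0 r \<Longrightarrow> k w \<noteq> 0"
  have zr: "0 \<in> ball (0::complex) r" using k by simp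
  have "n \<noteq> 1"
  proof
   assume n: "n = 1"
   have "((\<lambda>w. w * k w) has_field_derivative k 0) (at 0)"
    using holomorphic_derivI[OF k(4) open_ball zr] by (auto intro!: derivative_eq_intros)
   hence "(\<psi> has_field_derivative k 0) (at 0)"
    by (rule has_field_derivative_transform_within_open[of _ _ _ "ball 0 r"]) (use k n in auto)
   moreover have "(\<psi> has_field_derivative 0) (at 0)" using der[OF z0] t1 by simp
   ultimately have "k 0 = 0" by (rule DERIV_unique)
   thus False using k(6)[OF zr] by simp
  qed
  then obtain m where m: "n = Suc m" "0 < m" using k(1) by (cases n) auto
  show ?thesis
  proof (rule that[OF k(2,4) m(2) k(6)[OF zr]])
   fix x :: complex assume x: "x \<in> ball 0 r"
   show "(g ^^ N) (b 0 + x) - b 0 = x + x ^ Suc m * k x"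
    using k(5)[OF x] unfolding \<psi>_def m diff_zero by (simp only: diff_eq_eq add.commute)
   fix j assume "j < N"
   thus "(g ^^ j) (b 0 + x) \<in> D \<and> (g ^^ j) (b 0 + x) \<noteq> 0" by (rule D0[OF subsetD[OF k(3) x]])
  qed
 qed
qed

definition in_petal :: "nat \<Rightarrow> nat \<Rightarrow> complex \<Rightarrow> complex \<Rightarrow> (nat \<Rightarrow> complex) \<Rightarrow> bool" where
 "in_petal N m th z v \<longleftrightarrow>
  (\<forall>n. (g ^^ n) z \<in> D \<and> (g ^^ n) z \<noteq> 0) \<and> (\<forall>k. (g ^^ (N * k)) z = b 0 + petal m th (v k)) \<and>
  (\<forall>k. 3/4 * real k + 1 \<le> Re (v k) \<and> norm (v (Suc k) - v k - 1) \<le> 1/4 \<and> tau z (N * k) \<noteq> 0) \<and>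
  (\<lambda>k. v k / of_nat k) \<longlonglongrightarrow> 1 \<and> (\<lambda>k. petal m th (v k)) \<longlonglongrightarrow> 0 \<and>
  (\<exists>L. L \<noteq> 0 \<and> (\<lambda>k. tau z (N * k) * v k / petal m th (v k)) \<longlonglongrightarrow> L)"

context
 fixes N m :: nat and S :: "complex \<Rightarrow> complex" and r :: real and th :: complex
 assumes N: "0 < N" and G: "parabolic_germ (\<lambda>x. (g ^^ N) (b 0 + x) - b 0) S r m th"
  and DN: "\<And>x j. x \<in> ball 0 r \<Longrightarrow> j < N \<Longrightarrow> (g ^^ j) (b 0 + x) \<in> D \<and> (g ^^ j) (b 0 + x) \<noteq> 0"
begin

lemma petal_orbit_g:
 obtains R0 where "1 \<le> R0" "\<And>u. R0 \<le> Re u \<Longrightarrow> \<exists>v. v 0 = u \<and> in_petal N m th (b 0 + petal m th u) v"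
proof -
 define \<phi> where "\<phi> x = (g ^^ N) (b 0 + x) - b 0" for x
 interpret G: parabolic_germ \<phi> S r m th using G by (simp add: \<phi>_def[abs_def])
 obtain R0 where R0: "1 \<le> R0" and orb: "\<And>u0 v x. R0 \<le> Re u0 \<Longrightarrow> v = (\<lambda>k. (G.nextu ^^ k) u0) \<Longrightarrow> x = (\<lambda>k. petal m th (v k)) \<Longrightarrow> G.petal_orbit_at u0 v x"
  by (rule G.petal_orbit) blast
 have d\<phi>: "deriv \<phi> x = tau (b 0 + x) N" if "x \<in> ball 0 r" for x
 proof (rule DERIV_imp_deriv)
  have "((g ^^ N) has_field_derivative tau (b 0 + x) N) (at (b 0 + x))"
   by (rule funpow_deriv) (use DN[OF that] in simp)
  hence "((\<lambda>x. (g ^^ N) (b 0 + x)) has_field_derivative tau (b 0 + x) N) (at x)"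
   by (simp add: DERIV_shift add.commute)
  thus "(\<phi> has_field_derivative tau (b 0 + x) N) (at x)" unfolding \<phi>_def by (auto intro!: derivative_eq_intros)
 qed
 show ?thesis
 proof (rule that[OF R0])
  fix u assume u: "R0 \<le> Re u"
  define v where "v = (\<lambda>k. (G.nextu ^^ k) u)"
  define x where "x = (\<lambda>k. petal m th (v k))"
  note o = orb[OF u v_def x_def, unfolded G.petal_orbit_at_def]
  have xr: "x k \<in> ball 0 r" and xS: "\<phi> (x k) = x (Suc k)" and vR: "Re u + 3/4 * real k \<le> Re (v k)"
   and dv: "norm (v (Suc k) - v k - 1) \<le> 1/4" and dnz: "deriv \<phi> (x k) \<noteq> 0" for k using o by auto
  define z where "z = b 0 + x 0"
  have zk: "(g ^^ (N * k)) z = b 0 + x k" for k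
  proof (induction k)
   case (Suc k)
   have "(g ^^ (N * Suc k)) z = (g ^^ N) ((g ^^ (N * k)) z)" by (simp only: mult_Suc_right funpow_add o_apply)
   also have "\<dots> = b 0 + x (Suc k)" using xS[of k] Suc by (simp add: \<phi>_def algebra_simps)
   finally show ?case .
  qed (simp add: z_def)
  have tk: "tau z (N * k) = (\<Prod>i<k. deriv \<phi> (x i))" for k
  proof (induction k)
   case (Suc k)
   have "tau z (N * Suc k) = tau z (N * k) * tau ((g ^^ (N * k)) z) N"
    using tau_add[of z "N * k" N] by (simp add: add.commute)
   thus ?case using Suc d\<phi>[OF xr, of k] by (simp add: zk)
  qed simp
  have zD: "(g ^^ n) z \<in> D \<and> (g ^^ n) z \<noteq> 0" for n
  proof -
   have "n = n mod N + N * (n div N)" by simp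
   hence "(g ^^ n) z = (g ^^ (n mod N)) ((g ^^ (N * (n div N))) z)" by (metis comp_apply funpow_add)
   thus ?thesis using DN[OF xr, of "n mod N" "n div N"] N by (simp add: zk)
  qed
  have v0: "v 0 = u" by (simp add: v_def)
  have "3/4 * real k + 1 \<le> Re (v k)" for k using vR[of k] u R0 by linarith
  hence "in_petal N m th z v" unfolding in_petal_def using zD zk tk o unfolding x_def by simp
  thus "\<exists>v. v 0 = u \<and> in_petal N m th (b 0 + petal m th u) v"
   using v0 by (intro exI[of _ v]) (simp add: z_def x_def)
 qed
qed

text \<open>Fatou's argument on a petal. Along a petal orbit the derivative is comparable to
  \<open>x k / v k\<close>, hence small against \<open>norm (x k)\<close>, while the disc of radius
  \<open>d * norm (x k)\<close> about the \<open>k\<close>-th point still lies in the region filled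
  by petal orbits. For large \<open>k\<close> this disc is too big for an inverse branch, so a
  singular orbit enters it.\<close>

lemma petal_hit:
 shows "\<exists>i. \<exists>u\<in>U. \<exists>v. (\<forall>j<i. (g ^^ j) (u * c1) \<in> D \<and> (g ^^ j) (u * c1) \<noteq> 0) \<and>
  in_petal N m th ((g ^^ i) (u * c1)) v"
proof -
 interpret G: parabolic_germ "\<lambda>x. (g ^^ N) (b 0 + x) - b 0" S r m th by (rule G)
 have m: "0 < m" by (rule G.m)
 obtain R0 where R0: "1 \<le> R0" and orb: "\<And>u. R0 \<le> Re u \<Longrightarrow> \<exists>v. v 0 = u \<and> in_petal N m th (b 0 + petal m th u) v"
  by (rule petal_orbit_g) (rule that)
 obtain v where v: "v 0 = of_real R0" "in_petal N m th (b 0 + petal m th (of_real R0)) v"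
  using orb[of "of_real R0"] by auto
 define z where "z = b 0 + petal m th (of_real R0)"
 have zD: "\<And>n. (g ^^ n) z \<in> D \<and> (g ^^ n) z \<noteq> 0" and zk: "\<And>k. (g ^^ (N * k)) z = b 0 + petal m th (v k)"
  and vk: "\<And>k. 3/4 * real k + 1 \<le> Re (v k)" "\<And>k. tau z (N * k) \<noteq> 0"
  and vlim: "(\<lambda>k. v k / of_nat k) \<longlonglongrightarrow> 1" and Lex: "\<exists>L. L \<noteq> 0 \<and> (\<lambda>k. tau z (N * k) * v k / petal m th (v k)) \<longlonglongrightarrow> L"
  using v(2) unfolding in_petal_def z_def[symmetric] by auto
 define x where "x k = petal m th (v k)" for k
 have xnz: "x k \<noteq> 0" for k by (simp add: x_def petal_nz G.th_nz)
 have vnz: "v k \<noteq> 0" for k using vk(1)[of k] by auto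
 \<comment> \<open>A point of the disc will have the coordinate \<open>v k * E\<close>. With
   \<open>E\<close> and \<open>v k / k\<close> both within 1/10 of 1, its real part is at least
   \<open>k / 2\<close>, so at least \<open>R0\<close> once \<open>k \<ge> 2 * R0\<close>.\<close>
 have "isCont (\<lambda>y. exp (- of_nat m * Ln (1 + y))) 0" by (intro continuous_intros) auto
 hence "((\<lambda>y. exp (- of_nat m * Ln (1 + y))) \<longlongrightarrow> 1) (nhds 0)"
  using tendsto_at_iff_tendsto_nhds[of "\<lambda>y. exp (- of_nat m * Ln (1 + y))" 0] by (simp add: isCont_def)
 hence "\<forall>\<^sub>F y in nhds 0. dist (exp (- of_nat m * Ln (1 + y))) 1 < 1/10" by (rule tendstoD) simp
 then obtain d0 where d0: "0 < d0" "\<And>y. dist y 0 < d0 \<Longrightarrow> dist (exp (- of_nat m * Ln (1 + y))) 1 < 1/10"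
  unfolding eventually_nhds_metric by blast
 define d where "d = min d0 (1 / (2 * real m))"
 have d: "0 < d" using d0 m by (simp add: d_def)
 have "(\<lambda>k. tau z (N * k) / x k) \<longlonglongrightarrow> 0"
 proof -
  obtain L where L: "(\<lambda>k. tau z (N * k) * v k / x k) \<longlonglongrightarrow> L" using Lex unfolding x_def by blast
  have "(\<lambda>k. (1 / of_nat k) / (v k / of_nat k)) \<longlonglongrightarrow> 0 / 1" by (intro tendsto_divide lim_1_over_n vlim) simp
  moreover have "\<forall>\<^sub>F k in sequentially. (1 / of_nat k) / (v k / of_nat k) = 1 / v k"
   using eventually_gt_at_top[of 0] by eventually_elim (simp)
  ultimately have "(\<lambda>k. 1 / v k) \<longlonglongrightarrow> 0 / 1" by (rule Lim_transform_eventually)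
  hence "(\<lambda>k. 1 / v k) \<longlonglongrightarrow> 0" by simp
  from tendsto_mult[OF L this] have "(\<lambda>k. tau z (N * k) * v k / x k * (1 / v k)) \<longlonglongrightarrow> 0" by simp
  thus ?thesis using vnz by simp
 qed
 hence "(\<lambda>k. norm (tau z (N * k) / x k) * (12 * pi * norm z)) \<longlonglongrightarrow> 0 * (12 * pi * norm z)"
  by (intro tendsto_mult tendsto_const tendsto_norm_zero)
 hence e1: "\<forall>\<^sub>F k in sequentially. norm (tau z (N * k) / x k) * (12 * pi * norm z) < d"
  by (intro order_tendstoD(2)) (use d in auto)
 have e2: "\<forall>\<^sub>F k in sequentially. dist (v k / of_nat k) 1 < 1/10" by (rule tendstoD[OF vlim]) simp
 have e3: "\<forall>\<^sub>F k in sequentially. max 1 (2 * R0) \<le> real k"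
  by (rule eventually_compose_filterlim[OF eventually_ge_at_top filterlim_real_sequentially])
 from eventually_happens'[OF sequentially_bot eventually_conj[OF e1 eventually_conj[OF e2 e3]]]
 obtain k where k1: "norm (tau z (N * k) / x k) * (12 * pi * norm z) < d"
  and k2: "dist (v k / of_nat k) 1 < 1/10" and k3: "1 \<le> real k" "2 * R0 \<le> real k" by auto
 have rep: "\<exists>u'. R0 \<le> Re u' \<and> w = b 0 + petal m th u'" if w: "w \<in> ball (b 0 + x k) (d * norm (x k))" for w
 proof -
  define y where "y = (w - b 0 - x k) / x k"
  have weq: "w = b 0 + x k * (1 + y)" using xnz by (simp add: y_def field_simps)
  have "norm (w - b 0 - x k) < d * norm (x k)" using w by (simp add: dist_norm norm_minus_commute algebra_simps)
  hence y: "norm y < d" using xnz[of k] by (simp add: y_def norm_divide pos_divide_less_eq)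
  define E where "E = exp (- of_nat m * Ln (1 + y))"
  have "Re (v k) > 0" using vk(1)[of k] by simp
  hence "petal m th (v k * E) = x k * (1 + y)"
   unfolding E_def x_def by (rule petal_mult[OF m]) (use y d_def in simp)
  moreover have "R0 \<le> Re (v k * E)"
  proof -
   have E1: "norm (E - 1) < 1/10" using d0(2)[of y] y by (simp add: E_def d_def dist_norm)
   define r where "r = v k / of_nat k"
   have r1: "norm (r - 1) < 1/10" using k2 by (simp add: r_def dist_norm)
   have "norm r \<le> norm (r - 1) + norm (1::complex)" using norm_triangle_ineq[of "r - 1" 1] by simp
   hence r2: "norm r \<le> 2" using r1 by simp
   have "norm (r * E - 1) \<le> norm (r * (E - 1)) + norm (r - 1)"
    using norm_triangle_ineq[of "r * (E - 1)" "r - 1"] by (simp add: algebra_simps)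
   also have "\<dots> \<le> 2 * (1/10) + 1/10" unfolding norm_mult using r1 r2 E1 by (intro add_mono mult_mono) auto
   finally have "\<bar>Re (r * E - 1)\<bar> \<le> 3/10" using abs_Re_le_cmod[of "r * E - 1"] by linarith
   hence "1/2 \<le> Re (r * E)" unfolding minus_complex.sel one_complex.sel by linarith
   hence "real k * (1/2) \<le> real k * Re (r * E)" by (rule mult_left_mono) simp
   moreover have "v k * E = of_real (real k) * (r * E)" using k3 by (simp add: r_def)
   hence "Re (v k * E) = real k * Re (r * E)" by (simp only: Re_complex_of_real Im_complex_of_real times_complex.sel mult_zero_left diff_zero)
   ultimately show ?thesis using k3 by linarith
  qed
  ultimately show ?thesis using weq by (intro exI[of _ "v k * E"]) simp
 qed
 have "\<exists>i<N * k. \<exists>u. hits (ball (b 0 + x k) (d * norm (x k)) - {b 0 + x k}) i u"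
 proof (rule critical_orbit_hits)
  fix w assume "w \<in> ball (b 0 + x k) (d * norm (x k))"
  from rep[OF this] obtain u' where u': "R0 \<le> Re u'" "w = b 0 + petal m th u'" by blast
  from orb[OF u'(1)] obtain v' where "in_petal N m th w v'" using u'(2) by blast
  thus "w \<in> D \<and> w \<noteq> 0" unfolding in_petal_def by (metis funpow_0)
 next
  show "(g ^^ (N * k)) z = b 0 + x k" by (simp add: zk x_def)
  show "(g ^^ j) z \<in> D \<and> (g ^^ j) z \<noteq> 0" for j by (rule zD)
  show "deriv f ((g ^^ j) z) \<noteq> 0" if "j < N * k" for j by (rule tau_nz_deriv[OF vk(2) that])
  show "12 * pi * norm z * norm (tau z (N * k)) < d * norm (x k)"
   using k1 xnz[of k] by (simp add: norm_divide field_simps)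
 qed
 then obtain i u where h: "hits (ball (b 0 + x k) (d * norm (x k)) - {b 0 + x k}) i u" by blast
 then obtain u' where u': "R0 \<le> Re u'" "(g ^^ i) (u * c1) = b 0 + petal m th u'" using rep by (auto simp: hits_def)
 from orb[OF u'(1)] obtain v' where "in_petal N m th ((g ^^ i) (u * c1)) v'" using u'(2) by auto
 thus ?thesis using h unfolding hits_def by blast
qed

lemma petal_captured:
 assumes qN: "q dvd N"
 shows "\<exists>i. \<exists>u. \<exists>v. u \<in> U \<and> orbit_attracted c (\<lambda>n. u * b (n + (q - 1) * i)) \<and>
  in_petal N m th ((g ^^ i) (u * c1)) v"
proof -
 interpret G: parabolic_germ "\<lambda>x. (g ^^ N) (b 0 + x) - b 0" S r m th by (rule G)
 have "\<exists>i. \<exists>u\<in>U. \<exists>v. (\<forall>j<i. (g ^^ j) (u * c1) \<in> D \<and> (g ^^ j) (u * c1) \<noteq> 0) \<and>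
  in_petal N m th ((g ^^ i) (u * c1)) v"
  by (rule petal_hit)
 then obtain i u v where u: "u \<in> U" and lo: "\<forall>j<i. (g ^^ j) (u * c1) \<in> D \<and> (g ^^ j) (u * c1) \<noteq> 0"
  and p: "in_petal N m th ((g ^^ i) (u * c1)) v" by (elim exE bexE conjE)
 have add: "(g ^^ (i + n)) (u * c1) = (g ^^ n) ((g ^^ i) (u * c1))" for n
  by (metis add.commute comp_apply funpow_add)
 have CD: "(g ^^ n) (u * c1) \<in> D \<and> (g ^^ n) (u * c1) \<noteq> 0" for n
 proof (cases "n < i")
  case False
  hence "(g ^^ n) (u * c1) = (g ^^ (n - i)) ((g ^^ i) (u * c1))" using add[of "n - i"] by simp
  thus ?thesis using p unfolding in_petal_def by simp
 qed (use lo in simp)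
 have pk: "(g ^^ (i + N * k)) (u * c1) = b 0 + petal m th (v k)" for k
  unfolding add using p unfolding in_petal_def by simp
 have "orbit_attracted c (\<lambda>n. u * b (n + (q - 1) * i))"
 proof (rule orbit_landing[OF N qN u CD])
  have "(\<lambda>k. b 0 + petal m th (v k)) \<longlonglongrightarrow> b 0 + 0" using p unfolding in_petal_def by (intro tendsto_intros) simp
  thus "(\<lambda>k. (g ^^ (i + N * k)) (u * c1)) \<longlonglongrightarrow> b 0" unfolding pk by simp
  show "(g ^^ (i + N * k)) (u * c1) \<noteq> b 0" for k unfolding pk using petal_nz[OF G.th_nz] by simp
 qed
 thus ?thesis using u p by blast
qed

end

lemma U_mult:
 assumes "u \<in> U" "v \<in> U"
 shows "u * v \<in> U"
proof (cases "u = 1 \<or> v = 1")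
 case False
 hence "u * v = 1" using U_cases[OF assms(1)] U_cases[OF assms(2)] by simp
 thus ?thesis using one_U by simp
qed (use assms in auto)

text \<open>Both approached sequences have period \<open>q\<close>, so asymptotic equality is
  equality; \<open>asym\<close> then separates the sign from the phase.\<close>

lemma orbit_attracted_unique:
 assumes "u \<in> U" "u' \<in> U" "orbit_attracted C (\<lambda>n. u * b (n + s))" "orbit_attracted C (\<lambda>n. u' * b (n + s'))"
 shows "u = u' \<and> b s = b s'"
proof -
 have "(\<lambda>n. (C n - u' * b (n + s')) - (C n - u * b (n + s))) \<longlonglongrightarrow> 0 - 0"
  using assms(3,4) unfolding orbit_attracted_def by (intro tendsto_diff) simp_all
 hence lim: "(\<lambda>n. u * b (n + s) - u' * b (n + s')) \<longlonglongrightarrow> 0" by simp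
 have "filterlim (\<lambda>k. q * k) at_top sequentially" using q_pos by (intro filterlim_subseq strict_monoI) simp
 from filterlim_compose[OF lim this]
 have "(\<lambda>k. u * b (q * k + s) - u' * b (q * k + s')) \<longlonglongrightarrow> 0" .
 moreover have "b (q * k + s) = b s" for k s using b_per_mult[of s k] by (simp add: add.commute)
 ultimately have "(\<lambda>k::nat. u * b s - u' * b s') \<longlonglongrightarrow> 0" by simp
 hence eq: "u * b s = u' * b s'" by (simp add: tendsto_const_iff)
 hence "u * (u * b s) = u * (u' * b s')" by simp
 hence bs: "b s = (u * u') * b s'" using U_square[OF assms(1)] by (simp add: mult.assoc[symmetric])
 have "u * u' = 1" by (rule asym[OF U_mult[OF assms(1,2)] bs])
 hence "u * (u * u') = u" by simp
 hence "u' = u" using U_square[OF assms(1)] by (simp add: mult.assoc[symmetric])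
 thus ?thesis using bs \<open>u * u' = 1\<close> by simp
qed

text \<open>Each of the \<open>m\<close> attracting directions captures an iterate of the orbit of a singular value; these
 iterates lie in the same class modulo \<open>q\<close>, and in different classes modulo \<open>q l\<close>.\<close>

lemma parabolic_orbit:
 assumes l: "0 < l" "kappa ^ l = 1"
  and r: "0 < r" and S: "S holomorphic_on ball 0 r" and m: "0 < m" and S0: "S 0 \<noteq> 0"
  and phi: "\<And>x. x \<in> ball 0 r \<Longrightarrow> (g ^^ (q * l)) (b 0 + x) - b 0 = x + x ^ Suc m * S x"
  and D': "\<And>x j. x \<in> ball 0 r \<Longrightarrow> j < q * l \<Longrightarrow> (g ^^ j) (b 0 + x) \<in> D \<and> (g ^^ j) (b 0 + x) \<noteq> 0"
 shows "m \<le> l \<and> (\<exists>i u v th. u \<in> U \<and> th \<noteq> 0 \<and>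
  orbit_attracted c (\<lambda>n. u * b (n + (q - 1) * i)) \<and> in_petal (q * l) m th ((g ^^ i) (u * c1)) v)"
proof -
 define N where "N = q * l"
 have N: "0 < N" "q dvd N" using q_pos l by (auto simp: N_def)
 have ph: "\<And>x. x \<in> ball 0 r \<Longrightarrow> (g ^^ N) (b 0 + x) - b 0 = x + x ^ Suc m * S x" unfolding N_def by (rule phi)
 have DN: "\<And>x j. x \<in> ball 0 r \<Longrightarrow> j < N \<Longrightarrow> (g ^^ j) (b 0 + x) \<in> D \<and> (g ^^ j) (b 0 + x) \<noteq> 0" unfolding N_def by (rule D')
 \<comment> \<open>The attracting directions are the \<open>m\<close> values
   \<open>th e = th0 * w e\<close> with the prescribed \<open>m\<close>-th power; each of them makes
   \<open>petal_captured\<close> applicable.\<close>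
 define th0 where "th0 = exp (Ln (- 1 / (of_nat m * S 0)) / of_nat m)"
 define w where "w e = exp (2 * of_real pi * \<i> * of_nat e / of_nat m)" for e :: nat
 define th where "th e = th0 * w e" for e
 have th0: "th0 ^ m = - 1 / (of_nat m * S 0)"
 proof -
  have "th0 ^ m = exp (of_nat m * (Ln (- 1 / (of_nat m * S 0)) / of_nat m))"
   unfolding th0_def by (rule exp_of_nat_mult[symmetric])
  thus ?thesis using m S0 by simp
 qed
 have wm: "w e ^ m = 1" for e unfolding w_def using complex_root_unity[of m e] m by simp
 have thp: "th e ^ m = th0 ^ m" for e by (simp add: th_def power_mult_distrib wm)
 have thnz: "th e \<noteq> 0" for e by (simp add: th_def th0_def w_def)
 have G: "parabolic_germ (\<lambda>x. (g ^^ N) (b 0 + x) - b 0) S r m (th e)" for e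
 proof
  show "of_nat m * S 0 * th e ^ m = - 1" unfolding thp th0 using m S0 by simp
 qed (use r S m ph in auto)
 have "\<forall>e. \<exists>i u v. u \<in> U \<and> orbit_attracted c (\<lambda>n. u * b (n + (q - 1) * i)) \<and>
  in_petal N m (th e) ((g ^^ i) (u * c1)) v"
 proof
  fix e
  show "\<exists>i u v. u \<in> U \<and> orbit_attracted c (\<lambda>n. u * b (n + (q - 1) * i)) \<and>
   in_petal N m (th e) ((g ^^ i) (u * c1)) v"
   by (rule petal_captured[OF N(1) G _ N(2)]) (erule (1) DN)
 qed
 then obtain i u v where u: "\<And>e. u e \<in> U"
  and att: "\<And>e. orbit_attracted c (\<lambda>n. u e * b (n + (q - 1) * i e))"
  and pet: "\<And>e. in_petal N m (th e) ((g ^^ i e) (u e * c1)) (v e)" by (elim choice[THEN exE]) (metis that)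
 have uu: "u e = u e'" and bb: "b ((q - 1) * i e) = b ((q - 1) * i e')" for e e'
  using orbit_attracted_unique[OF u u att att, of e e'] by auto
 have modq: "i e mod q = i e' mod q" for e e'
 proof -
  have "(q - 1) * i e mod q = (q - 1) * i e' mod q" using bb[of e e'] b_eq_iff by simp
  hence 1: "((q - 1) * i e + (i e + i e')) mod q = ((q - 1) * i e' + (i e + i e')) mod q"
   by (rule mod_add_cong) simp
  have 2: "(q - 1) * i e + (i e + i e') = i e' + q * i e" "(q - 1) * i e' + (i e + i e') = i e + q * i e'"
   using q_pos by (cases q; simp)+
  show ?thesis using 1 unfolding 2 by simp
 qed
 \<comment> \<open>If two captured iterates differ by a multiple of \<open>N\<close>, one petal
   orbit is a tail of the other. The \<open>m\<close>-th power of a point determines its coordinate,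
   and point and coordinate determine the direction, so the petals agree.\<close>
 have sep: "e = e'" if e: "e < m" "e' < m" and le: "i e \<le> i e'" and md: "i e mod N = i e' mod N" for e e'
 proof -
  obtain t where t: "i e' = i e + N * t" using md le by (metis mod_eq_iff_dvd_symdiff_nat dvdE le_add_diff_inverse mod_eq_dvd_iff_nat)
  have P: "(g ^^ (N * k)) ((g ^^ i e) (u e * c1)) = b 0 + petal m (th e) (v e k)" and R: "Re (v e k) > 0" for e k
  proof -
   have "3/4 * real k + 1 \<le> Re (v e k)" using pet[of e] unfolding in_petal_def by blast
   thus "Re (v e k) > 0" by (rule less_le_trans[rotated]) simp
   show "(g ^^ (N * k)) ((g ^^ i e) (u e * c1)) = b 0 + petal m (th e) (v e k)"
    using pet[of e] unfolding in_petal_def by blast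
  qed
  have "(g ^^ i e') (u e' * c1) = (g ^^ (N * t)) ((g ^^ i e) (u e * c1))"
   unfolding t uu[of e' e] by (metis add.commute comp_apply funpow_add)
  hence eq: "petal m (th e') (v e' 0) = petal m (th e) (v e t)" using P[of 0 e'] P[of t e] by simp
  have nz: "v e' 0 \<noteq> 0" "v e t \<noteq> 0" using R[of e' 0] R[of e t] by auto
  have "th e' ^ m / v e' 0 = th e ^ m / v e t"
   using petal_power[OF m nz(1), of "th e'"] petal_power[OF m nz(2), of "th e"] eq by simp
  hence "v e' 0 = v e t" using thp by (simp add: th0_def)
  hence "th e' = th e" using eq by (simp add: petal_def)
  hence "w e' = w e" by (simp add: th_def th0_def)
  hence "e' mod m = e mod m" unfolding w_def using complex_root_unity_eq[of m e' e] m by simp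
  thus "e = e'" using e by simp
 qed
 have inj: "inj_on (\<lambda>e. i e mod N) {..<m}"
 proof (rule inj_onI)
  fix e e' assume "e \<in> {..<m}" "e' \<in> {..<m}" "i e mod N = i e' mod N"
  thus "e = e'" using sep[of e e'] sep[of e' e] by (cases "i e \<le> i e'") auto
 qed
 have "(\<lambda>e. i e mod N) ` {..<m} \<subseteq> (\<lambda>t. i 0 mod q + q * t) ` {..<l}"
 proof (rule image_subsetI)
  fix e
  define x where "x = i e mod N"
  have "x < q * l" using N by (simp add: x_def N_def)
  hence "x div q < l" by (simp add: less_mult_imp_div_less mult.commute)
  moreover have "x mod q = i 0 mod q" unfolding x_def using modq[of e 0] N(2) by (simp add: mod_mod_cancel)
  hence "x = i 0 mod q + q * (x div q)" by (metis mod_mult_div_eq)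
  ultimately show "i e mod N \<in> (\<lambda>t. i 0 mod q + q * t) ` {..<l}" unfolding x_def by blast
 qed
 hence "card ((\<lambda>e. i e mod N) ` {..<m}) \<le> card {..<l}"
  by (meson card_image_le card_mono finite_imageI finite_lessThan le_trans)
 hence "m \<le> l" using card_image[OF inj] by simp
 moreover have "u 0 \<in> U \<and> th 0 \<noteq> 0 \<and> orbit_attracted c (\<lambda>n. u 0 * b (n + (q - 1) * i 0)) \<and>
  in_petal (q * l) m (th 0) ((g ^^ i 0) (u 0 * c1)) (v 0)"
  using u att pet thnz unfolding N_def by blast
 ultimately show ?thesis by blast
qed

text \<open>The petal asymptotics for the orbit of \<open>c1\<close> itself, relative to an
  arbitrary numbering \<open>B\<close>, because the cycle approached may be the mirror image in
  another phase.\<close>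

definition parabolic_asymptotics :: "nat \<Rightarrow> nat \<Rightarrow> (nat \<Rightarrow> complex) \<Rightarrow> bool" where
 "parabolic_asymptotics N m B \<longleftrightarrow> (\<exists>i th v. th \<noteq> 0 \<and>
  (\<forall>k. (g ^^ (i + N * k)) c1 = B (i + N * k) + petal m th (v k)) \<and>
  (\<forall>k. 3/4 * real k + 1 \<le> Re (v k) \<and> norm (v (Suc k) - v k - 1) \<le> 1/4) \<and>
  (\<lambda>k. v k / of_nat k) \<longlonglongrightarrow> 1 \<and>
  (\<exists>L. L \<noteq> 0 \<and> (\<lambda>k. tau (c i) (N * k) * v k / petal m th (v k)) \<longlonglongrightarrow> L))"

lemma parabolic_captured:
 assumes l: "0 < l" "kappa ^ l = 1"
 shows "\<exists>u s m. u \<in> U \<and> 0 < m \<and> m \<le> l \<and> orbit_attracted c (\<lambda>n. u * b (n + s)) \<and>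
  parabolic_asymptotics (q * l) m (\<lambda>n. u * b (n + s))"
proof -
 define N where "N = q * l"
 have N: "0 < N" using q_pos l by (auto simp: N_def)
 have t1: "tau (b 0) N = 1" using tau_b_mult l by (simp add: N_def)
 have bN: "b N = b 0" using b_per_mult[of 0 l] by (simp add: N_def)
 obtain S r m where r: "0 < r" and S: "S holomorphic_on ball 0 r" and m: "0 < m" and S0: "S 0 \<noteq> 0"
  and ph: "\<And>x. x \<in> ball 0 r \<Longrightarrow> (g ^^ N) (b 0 + x) - b 0 = x + x ^ Suc m * S x"
  and DN: "\<And>x j. x \<in> ball 0 r \<Longrightarrow> j < N \<Longrightarrow> (g ^^ j) (b 0 + x) \<in> D \<and> (g ^^ j) (b 0 + x) \<noteq> 0"
  by (rule germ_at_cycle[OF N bN t1]) (rule that)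
 have "m \<le> l \<and> (\<exists>i u v th. u \<in> U \<and> th \<noteq> 0 \<and>
  orbit_attracted c (\<lambda>n. u * b (n + (q - 1) * i)) \<and> in_petal (q * l) m th ((g ^^ i) (u * c1)) v)"
  by (rule parabolic_orbit[OF l r S m S0]) (use ph DN N_def in auto)
 then obtain i u v th where u: "u \<in> U" and th: "th \<noteq> 0" and ml: "m \<le> l"
  and att: "orbit_attracted c (\<lambda>n. u * b (n + (q - 1) * i))"
  and pet: "in_petal N m th ((g ^^ i) (u * c1)) v" unfolding N_def by (elim exE conjE)
 have cD: "c n \<in> D" for n using att unfolding orbit_attracted_def by blast
 have cu: "(g ^^ n) (u * c1) = u * c n" for n by (rule funpow_U[OF u cD])
 have uu: "u * u = 1" by (rule U_square[OF u])
 have pD: "(g ^^ n) (c i) \<in> D" for n using cD[of "n + i"] by (simp add: funpow_add)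
 have tu: "tau (u * c i) n = tau (c i) n" for n
  unfolding tau_def by (intro prod.cong refl) (simp add: funpow_U[OF u pD] deriv_f_U[OF u pD])
 \<comment> \<open>Multiplying by the sign \<open>u\<close> turns the orbit of \<open>u * c1\<close>
   into that of \<open>c1\<close> and the direction \<open>th\<close> into
   \<open>u * th\<close>.\<close>
 have "(g ^^ (i + N * k)) c1 = u * b (i + N * k + (q - 1) * i) + petal m (u * th) (v k)" for k
 proof -
  have "(g ^^ (N * k)) ((g ^^ i) (u * c1)) = b 0 + petal m th (v k)" using pet unfolding in_petal_def by blast
  hence "u * (g ^^ (i + N * k)) c1 = b 0 + petal m th (v k)"
   unfolding cu[symmetric] by (simp only: add.commute[of i] funpow_add o_apply)
  hence "u * u * (g ^^ (i + N * k)) c1 = u * b 0 + u * petal m th (v k)" by (simp only: mult.assoc distrib_left)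
  moreover have "b (i + N * k + (q - 1) * i) = b 0"
   by (metis N_def add_0 b_per_mult bot_nat_0.not_eq_extremum funpow_b mult.assoc mult_eq_if q_pos)
  ultimately show ?thesis using uu by (simp add: petal_def)
 qed
 moreover have "\<exists>L. L \<noteq> 0 \<and> (\<lambda>k. tau (c i) (N * k) * v k / petal m (u * th) (v k)) \<longlonglongrightarrow> L"
 proof -
  obtain L where L: "L \<noteq> 0" "(\<lambda>k. tau ((g ^^ i) (u * c1)) (N * k) * v k / petal m th (v k)) \<longlonglongrightarrow> L"
   using pet unfolding in_petal_def by blast
  have pe: "x / petal m th y / u = x / petal m (u * th) y" for x y by (simp add: petal_def)
  have "(\<lambda>k. tau (c i) (N * k) * v k / petal m th (v k) / u) \<longlonglongrightarrow> L / u"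
   using L(2) U_nz[OF u] unfolding cu tu by (intro tendsto_divide tendsto_const)
  thus ?thesis unfolding pe using L U_nz[OF u] by (intro exI[of _ "L / u"] conjI) simp_all
 qed
 moreover have "\<forall>k. 3/4 * real k + 1 \<le> Re (v k) \<and> norm (v (Suc k) - v k - 1) \<le> 1/4" "(\<lambda>k. v k / of_nat k) \<longlonglongrightarrow> 1"
  using pet unfolding in_petal_def by blast+
 moreover have "u * th \<noteq> 0" using th U_nz[OF u] by simp
 ultimately have "parabolic_asymptotics N m (\<lambda>n. u * b (n + (q - 1) * i))"
  unfolding parabolic_asymptotics_def by blast
 thus ?thesis using u m ml att unfolding N_def by blast
qed

end

section \<open>Displacement of the captured orbit from the cycle\<close>

lemma eventually_bound_all:
 fixes A B :: "nat \<Rightarrow> real"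
 assumes ev: "\<forall>\<^sub>F n in sequentially. A n \<le> C * B n" and B: "\<And>n. 0 < B n" and A: "\<And>n. 0 \<le> A n"
 shows "\<exists>K>0. \<forall>n. A n \<le> K * B n"
proof -
 obtain n0 where n0: "\<And>n. n \<ge> n0 \<Longrightarrow> A n \<le> C * B n" using ev unfolding eventually_sequentially by blast
 define K where "K = \<bar>C\<bar> + (\<Sum>i<n0. A i / B i) + 1"
 have s: "0 \<le> (\<Sum>i<n0. A i / B i)" by (rule sum_nonneg) (use A B in \<open>simp add: less_imp_le\<close>)
 have "A n \<le> K * B n" for n
 proof (cases "n < n0")
  case True
  have "A n / B n \<le> (\<Sum>i<n0. A i / B i)" by (rule member_le_sum) (use True A B in \<open>auto simp: less_imp_le\<close>)
  hence "A n / B n \<le> K" by (simp add: K_def)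
  thus ?thesis using B[of n] by (simp add: pos_divide_le_eq)
 next
  case False
  have "C * B n \<le> K * B n" using s B[of n] by (intro mult_right_mono) (auto simp: K_def)
  thus ?thesis using n0[of n] False by simp
 qed
 moreover have "0 < K" using s by (simp add: K_def)
 ultimately show ?thesis by blast
qed

lemma holomorphic_second_order_bound:
 assumes h: "h holomorphic_on D" and D: "open D" "z \<in> D"
 shows "\<exists>C s. 0 < s \<and> 0 \<le> C \<and> (\<forall>w. norm (w - z) \<le> s \<longrightarrow> norm (h w - h z) \<le> C * norm (w - z) \<and>
  norm (h w - h z - deriv h z * (w - z)) \<le> C * norm (w - z) ^ 2)"
proof -
 obtain r where r: "0 < r" "ball z r \<subseteq> D" using D open_contains_ball by blast
 have im: "(\<lambda>x. z + x) ` ball 0 r \<subseteq> D" using r(2) by auto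
 have "(h \<circ> (\<lambda>x. z + x)) holomorphic_on ball 0 r"
  by (rule holomorphic_on_compose_gen[OF _ h im]) (intro holomorphic_intros)
 hence hol: "(\<lambda>x. h (z + x)) holomorphic_on ball 0 r" by (simp add: o_def)
 have der: "deriv (\<lambda>x. h (z + x)) 0 = deriv h z" by (metis (no_types, lifting) ext comp_apply deriv_shift_0)
 show ?thesis
 proof (rule holomorphic_bound2[OF hol r(1)])
  fix C s assume a: "0 < s" "0 \<le> C"
   "\<And>x. norm x \<le> s \<Longrightarrow> norm (h (z + x) - h (z + 0) - deriv (\<lambda>x. h (z + x)) 0 * x) \<le> C * norm x ^ 2"
   "\<And>x. norm x \<le> s \<Longrightarrow> norm (h (z + x) - h (z + 0)) \<le> C * norm x"
  show ?thesis
  proof (intro exI conjI allI impI)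
   show "0 < s" by (rule a(1))
   show "0 \<le> C" by (rule a(2))
   fix w assume "norm (w - z) \<le> s"
   thus "norm (h w - h z) \<le> C * norm (w - z)"
    "norm (h w - h z - deriv h z * (w - z)) \<le> C * norm (w - z) ^ 2"
    using a(3)[of "w - z"] a(4)[of "w - z"] by (simp_all add: der)
  qed
 qed
qed

text \<open>From here on the cycle is numbered in phase with the orbit of \<open>c1\<close>, so that
  \<open>c n\<close> is close to \<open>b n\<close>.\<close>

locale captured = map_cycle +
 assumes att: "orbit_attracted c b"
begin

definition d :: "nat \<Rightarrow> complex" where "d n = c n - b n"

abbreviation T :: "nat \<Rightarrow> complex" where "T n \<equiv> tau c1 n"

lemma c_D: "c n \<in> D" and c_nz: "c n \<noteq> 0" and d_lim: "d \<longlonglongrightarrow> 0"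
 and c_ne_b: "u \<in> U \<Longrightarrow> c n \<noteq> u * b m" and c_ne_c: "u \<in> U \<Longrightarrow> n \<noteq> m \<Longrightarrow> c n \<noteq> u * c m"
 using att unfolding orbit_attracted_def d_def[abs_def] by auto

lemma d_nz: "d n \<noteq> 0" using c_ne_b[OF one_U, of n n] by (simp add: d_def)

text \<open>A critical point on the orbit would have \<open>f (c n)\<close> in \<open>U\<close>,
  since 0 is excluded, and then the orbit would return to \<open>c1\<close> up to sign.\<close>

lemma deriv_c: "deriv f (c n) \<noteq> 0"
proof -
 have "f (c n) \<noteq> 0" using c_nz[of "Suc n"] by simp
 moreover have "f (c n) \<notin> U"
 proof
  assume u: "f (c n) \<in> U"
  have "c (Suc n) = f (c n) * c 0" by simp
  thus False using c_ne_c[OF u, of "Suc n" 0] by simp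
 qed
 ultimately show ?thesis using nonsing_deriv c_D by blast
qed

lemma g'_c_nz: "g' (c n) \<noteq> 0" using deriv_c c1 by simp

lemma T_nz: "T n \<noteq> 0" unfolding tau_def by (simp add: deriv_c c1)

text \<open>Taylor estimates at the finitely many points of the cycle, valid once the orbit is
  close; the early indices are absorbed into the constant.\<close>

lemma holomorphic_along_orbit:
 assumes h: "h holomorphic_on D"
 shows "\<exists>C>0. \<forall>n. norm (h (c n) - h (b n)) \<le> C * norm (d n) \<and>
  norm (h (c n) - h (b n) - deriv h (b n) * d n) \<le> C * norm (d n) ^ 2"
proof -
 have "\<forall>j. \<exists>C s. 0 < s \<and> 0 \<le> C \<and> (\<forall>w. norm (w - b j) \<le> s \<longrightarrow> norm (h w - h (b j)) \<le> C * norm (w - b j) \<and>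
   norm (h w - h (b j) - deriv h (b j) * (w - b j)) \<le> C * norm (w - b j) ^ 2)"
  by (intro allI holomorphic_second_order_bound[OF h open_D b_D])
 from choice[OF this] obtain C where
  "\<forall>j. \<exists>s. 0 < s \<and> 0 \<le> C j \<and> (\<forall>w. norm (w - b j) \<le> s \<longrightarrow> norm (h w - h (b j)) \<le> C j * norm (w - b j) \<and>
   norm (h w - h (b j) - deriv h (b j) * (w - b j)) \<le> C j * norm (w - b j) ^ 2)" by (rule exE)
 from choice[OF this] obtain s where
  "\<forall>j. 0 < s j \<and> 0 \<le> C j \<and> (\<forall>w. norm (w - b j) \<le> s j \<longrightarrow> norm (h w - h (b j)) \<le> C j * norm (w - b j) \<and>
   norm (h w - h (b j) - deriv h (b j) * (w - b j)) \<le> C j * norm (w - b j) ^ 2)" by (rule exE)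
 hence s: "\<And>j. 0 < s j" and C: "\<And>j. 0 \<le> C j"
  and Cs: "\<And>j w. norm (w - b j) \<le> s j \<Longrightarrow> norm (h w - h (b j)) \<le> C j * norm (w - b j) \<and>
   norm (h w - h (b j) - deriv h (b j) * (w - b j)) \<le> C j * norm (w - b j) ^ 2" by simp_all
 define K where "K = (\<Sum>j<q. C j)"
 have CK: "C j \<le> K" if "j < q" for j unfolding K_def by (rule member_le_sum) (use that C in auto)
 have ev: "\<forall>\<^sub>F n in sequentially. \<forall>j\<in>{..<q}. norm (d n) < s j"
 proof (rule eventually_ball_finite)
  show "\<forall>j\<in>{..<q}. \<forall>\<^sub>F n in sequentially. norm (d n) < s j" using tendstoD[OF d_lim s] by simp
 qed simp
 have E: "\<forall>\<^sub>F n in sequentially. norm (h (c n) - h (b n)) \<le> K * norm (d n) \<and>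
  norm (h (c n) - h (b n) - deriv h (b n) * d n) \<le> K * norm (d n) ^ 2"
  using ev
 proof eventually_elim
  case (elim n)
  define j where "j = n mod q"
  have j: "j < q" "b j = b n" using q_pos by (auto simp: j_def b_mod)
  have "norm (c n - b j) \<le> s j" using elim j by (auto simp: d_def less_imp_le)
  from Cs[OF this] have "norm (h (c n) - h (b n)) \<le> C j * norm (d n)"
   "norm (h (c n) - h (b n) - deriv h (b n) * d n) \<le> C j * norm (d n) ^ 2" by (simp_all add: j d_def)
  moreover have "C j * norm (d n) \<le> K * norm (d n)" "C j * norm (d n) ^ 2 \<le> K * norm (d n) ^ 2"
   using CK[OF j(1)] by (intro mult_right_mono; simp)+
  ultimately show ?case by linarith
 qed
 have "\<exists>K1>0. \<forall>n. norm (h (c n) - h (b n)) \<le> K1 * norm (d n)"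
  by (rule eventually_bound_all[of _ K]) (use E d_nz in \<open>auto elim: eventually_mono\<close>)
 then obtain K1 where K1: "0 < K1" "\<And>n. norm (h (c n) - h (b n)) \<le> K1 * norm (d n)" by blast
 have "\<exists>K2>0. \<forall>n. norm (h (c n) - h (b n) - deriv h (b n) * d n) \<le> K2 * norm (d n) ^ 2"
  by (rule eventually_bound_all[of _ K]) (use E d_nz in \<open>auto elim: eventually_mono\<close>)
 then obtain K2 where K2: "0 < K2" "\<And>n. norm (h (c n) - h (b n) - deriv h (b n) * d n) \<le> K2 * norm (d n) ^ 2" by blast
 have "norm (h (c n) - h (b n)) \<le> (K1 + K2) * norm (d n) \<and>
  norm (h (c n) - h (b n) - deriv h (b n) * d n) \<le> (K1 + K2) * norm (d n) ^ 2" for n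
 proof
  have "K1 * norm (d n) \<le> (K1 + K2) * norm (d n)" using K2 by (intro mult_right_mono) auto
  thus "norm (h (c n) - h (b n)) \<le> (K1 + K2) * norm (d n)" using K1(2)[of n] by linarith
  have "K2 * norm (d n) ^ 2 \<le> (K1 + K2) * norm (d n) ^ 2" using K1 by (intro mult_right_mono) auto
  thus "norm (h (c n) - h (b n) - deriv h (b n) * d n) \<le> (K1 + K2) * norm (d n) ^ 2" using K2(2)[of n] by linarith
 qed
 thus ?thesis using K1 K2 by (intro exI[of _ "K1 + K2"]) simp
qed

lemma b_range_bound: "\<exists>C>0. \<forall>n. norm (h (b n)) \<le> C" for h :: "complex \<Rightarrow> complex"
proof -
 define C where "C = (\<Sum>j<q. norm (h (b j))) + 1"
 have C: "0 < C" unfolding C_def by (intro add_nonneg_pos sum_nonneg) auto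
 have "norm (h (b n)) \<le> C" for n
 proof -
  have "norm (h (b (n mod q))) \<le> (\<Sum>j<q. norm (h (b j)))" by (rule member_le_sum) (use q_pos in auto)
  thus ?thesis by (simp add: C_def b_mod)
 qed
 thus ?thesis using C by blast
qed

lemma g'_b_lower: "\<exists>C>0. \<forall>n. C \<le> norm (g' (b n))"
proof -
 obtain C where C: "0 < C" "\<And>n. norm (inverse (g' (b n))) \<le> C" using b_range_bound[of "\<lambda>z. inverse (g' z)"] by blast
 have "1 / C \<le> norm (g' (b n))" for n
 proof -
  have "1 = norm (inverse (g' (b n))) * norm (g' (b n))" unfolding norm_inverse using g'_b_nz[of n] by simp
  also have "\<dots> \<le> C * norm (g' (b n))" using C(2)[of n] by (rule mult_right_mono) simp
  finally show ?thesis using C(1) by (simp add: pos_divide_le_eq mult.commute)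
 qed
 thus ?thesis using C(1) by (intro exI[of _ "1 / C"]) simp
qed

lemma g'_lim: "(\<lambda>n. g' (c n) - g' (b n)) \<longlonglongrightarrow> 0"
proof -
 obtain C where C: "0 < C" "\<And>n. norm (deriv f (c n) - deriv f (b n)) \<le> C * norm (d n)"
  using holomorphic_along_orbit[OF hol_f'] by blast
 have "(\<lambda>n. deriv f (c n) - deriv f (b n)) \<longlonglongrightarrow> 0"
 proof (rule Lim_null_comparison)
  show "(\<lambda>n. C * norm (d n)) \<longlonglongrightarrow> 0" using tendsto_mult[OF tendsto_const tendsto_norm_zero[OF d_lim]] by simp
 qed (use C in simp)
 from tendsto_mult[OF tendsto_const[of c1] this] show ?thesis by (simp add: right_diff_distrib)
qed

lemma g'_c_lower: "\<exists>C>0. \<forall>n. C \<le> norm (g' (c n))"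
proof -
 obtain C where C: "0 < C" "\<And>n. C \<le> norm (g' (b n))" using g'_b_lower by blast
 have "\<forall>\<^sub>F n in sequentially. norm (g' (c n) - g' (b n)) < C / 2" using tendstoD[OF g'_lim, of "C/2"] C by simp
 hence "\<forall>\<^sub>F n in sequentially. 1 \<le> 2 / C * norm (g' (c n))"
 proof eventually_elim
  case (elim n)
  have "norm (g' (b n)) \<le> norm (g' (c n)) + norm (g' (c n) - g' (b n))"
   using norm_triangle_ineq4[of "g' (c n)" "g' (c n) - g' (b n)"] by simp
  hence "C / 2 \<le> norm (g' (c n))" using elim C(2)[of n] by linarith
  thus ?case using C(1) by simp
 qed
 from eventually_bound_all[OF this] g'_c_nz obtain K where K: "0 < K" "\<And>n. 1 \<le> K * norm (g' (c n))" by force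
 have "1 / K \<le> norm (g' (c n))" for n using K(1) K(2)[of n] by (simp add: field_simps)
 thus ?thesis using K(1) by (intro exI[of _ "1 / K"]) simp
qed

lemma d_Suc: "\<exists>C>0. \<forall>n. norm (d (Suc n) - g' (b n) * d n) \<le> C * norm (d n) ^ 2"
proof -
 obtain C where C: "0 < C" "\<And>n. norm (f (c n) - f (b n) - deriv f (b n) * d n) \<le> C * norm (d n) ^ 2"
  using holomorphic_along_orbit[OF hol_f] by blast
 have eq: "d (Suc n) - g' (b n) * d n = c1 * (f (c n) - f (b n) - deriv f (b n) * d n)" for n
  using g_b[of n] by (simp add: d_def algebra_simps)
 have "norm (d (Suc n) - g' (b n) * d n) \<le> norm c1 * C * norm (d n) ^ 2" for n
  unfolding eq norm_mult using mult_left_mono[OF C(2)[of n], of "norm c1"] by simp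
 thus ?thesis using C(1) c1 by (intro exI[of _ "norm c1 * C"]) simp
qed

lemma d_Suc_upper: "\<exists>C>0. \<forall>n. norm (d (Suc n)) \<le> C * norm (d n)"
proof -
 obtain C where C: "0 < C" "\<And>n. norm (f (c n) - f (b n)) \<le> C * norm (d n)"
  using holomorphic_along_orbit[OF hol_f] by blast
 have eq: "d (Suc n) = c1 * (f (c n) - f (b n))" for n using g_b[of n] by (simp add: d_def algebra_simps)
 have "norm (d (Suc n)) \<le> norm c1 * C * norm (d n)" for n
  unfolding eq norm_mult using mult_left_mono[OF C(2)[of n], of "norm c1"] by simp
 thus ?thesis using C(1) c1 by (intro exI[of _ "norm c1 * C"]) simp
qed

lemma d_bounded: "\<exists>C>0. \<forall>n. norm (d n) \<le> C"
proof -
 have "Bseq d" using d_lim convergentI convergent_imp_Bseq by blast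
 thus ?thesis by (elim BseqE) blast
qed

text \<open>Both \<open>d n\<close> and \<open>T n\<close> are multiplied by about
  \<open>g' (b n)\<close> in each step, so their quotient varies slowly: it converges in the
  attracting case and grows linearly in the parabolic one.\<close>

definition t :: "nat \<Rightarrow> complex" where "t n = d n / T n"

lemma t_nz: "t n \<noteq> 0" using d_nz T_nz by (simp add: t_def)

lemma T_Suc: "T (Suc n) = T n * g' (c n)" by (rule tau_Suc)

lemma t_ratio: "\<exists>C>0. \<forall>n. norm (t (Suc n) - t n) \<le> C * norm (d n) * norm (t n)"
proof -
 obtain C1 where C1: "0 < C1" "\<And>n. norm (d (Suc n) - g' (b n) * d n) \<le> C1 * norm (d n) ^ 2" using d_Suc by blast
 obtain C2 where C2: "0 < C2" "\<And>n. norm (deriv f (c n) - deriv f (b n)) \<le> C2 * norm (d n)"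
  using holomorphic_along_orbit[OF hol_f'] by blast
 obtain C3 where C3: "0 < C3" "\<And>n. C3 \<le> norm (g' (c n))" using g'_c_lower by blast
 define C where "C = (C1 + norm c1 * C2) / C3"
 have C: "0 < C" using C1 C2 C3 by (simp add: C_def add_pos_nonneg)
 have "norm (t (Suc n) - t n) \<le> C * norm (d n) * norm (t n)" for n
 proof -
  have eq: "t (Suc n) - t n = ((d (Suc n) - g' (b n) * d n) - c1 * (deriv f (c n) - deriv f (b n)) * d n) / (T n * g' (c n))"
   using T_nz[of n] g'_c_nz[of n] by (simp add: t_def T_Suc field_simps)
  have le: "norm (t (Suc n) - t n) \<le> (C1 * norm (d n) ^ 2 + norm c1 * (C2 * norm (d n)) * norm (d n)) / (norm (T n) * C3)"
   unfolding eq norm_divide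
  proof (rule frac_le)
   have "norm (c1 * (deriv f (c n) - deriv f (b n)) * d n) \<le> norm c1 * (C2 * norm (d n)) * norm (d n)"
    unfolding norm_mult using C2(2)[of n] by (intro mult_right_mono mult_left_mono) auto
   thus "norm ((d (Suc n) - g' (b n) * d n) - c1 * (deriv f (c n) - deriv f (b n)) * d n)
     \<le> C1 * norm (d n) ^ 2 + norm c1 * (C2 * norm (d n)) * norm (d n)"
    by (intro order_trans[OF norm_triangle_ineq4] add_mono C1(2))
   show "norm (T n) * C3 \<le> norm (T n * g' (c n))" unfolding norm_mult[of "T n"]
    by (rule mult_left_mono[OF C3(2)]) simp
   show "0 < norm (T n) * C3" using C3(1) T_nz[of n] by simp
   show "0 \<le> C1 * norm (d n) ^ 2 + norm c1 * (C2 * norm (d n)) * norm (d n)"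
    using C1(1) C2(1) by (intro add_nonneg_nonneg mult_nonneg_nonneg) auto
  qed
  have "C1 * norm (d n) ^ 2 + norm c1 * (C2 * norm (d n)) * norm (d n) = (C1 + norm c1 * C2) * (norm (d n) * norm (d n))"
   by (simp add: power2_eq_square distrib_right)
  moreover have "(C1 + norm c1 * C2) * (norm (d n) * norm (d n)) / (norm (T n) * C3) = C * norm (d n) * norm (t n)"
   unfolding C_def t_def norm_divide by (simp add: mult_ac)
  ultimately show ?thesis using le by simp
 qed
 thus ?thesis using C by (intro exI[of _ C]) simp
qed

lemma t_ratio_lim: "(\<lambda>n. t (Suc n) / t n) \<longlonglongrightarrow> 1"
proof -
 obtain C where C: "0 < C" "\<And>n. norm (t (Suc n) - t n) \<le> C * norm (d n) * norm (t n)" using t_ratio by blast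
 have "(\<lambda>n. t (Suc n) / t n - 1) \<longlonglongrightarrow> 0"
 proof (rule Lim_null_comparison)
  show "(\<lambda>n. C * norm (d n)) \<longlonglongrightarrow> 0" using tendsto_mult[OF tendsto_const tendsto_norm_zero[OF d_lim]] by simp
  have "norm (t (Suc n) / t n - 1) \<le> C * norm (d n)" for n
  proof -
   have "t (Suc n) / t n - 1 = (t (Suc n) - t n) / t n" using t_nz[of n] by (simp add: field_simps)
   thus ?thesis using C(2)[of n] t_nz[of n] by (simp add: norm_divide pos_divide_le_eq)
  qed
  thus "\<forall>\<^sub>F n in sequentially. norm (t (Suc n) / t n - 1) \<le> C * norm (d n)" by simp
 qed
 thus ?thesis by (rule LIM_zero_cancel)
qed

lemma d_Suc_lower: "\<exists>C>0. \<forall>n. norm (d n) \<le> C * norm (d (Suc n))"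
proof -
 obtain C where C: "0 < C" "\<And>n. C \<le> norm (g' (c n))" using g'_c_lower by blast
 have "\<forall>\<^sub>F n in sequentially. 1 / 2 < norm (t (Suc n) / t n)"
  by (rule order_tendstoD[OF tendsto_norm[OF t_ratio_lim]]) simp
 hence "\<forall>\<^sub>F n in sequentially. norm (d n) \<le> (2 / C) * norm (d (Suc n))"
 proof eventually_elim
  case (elim n)
  have "t (Suc n) / t n = d (Suc n) / (d n * g' (c n))" using T_nz[of n] g'_c_nz[of n] by (simp add: t_def T_Suc)
  hence "norm (d n) * norm (g' (c n)) \<le> 2 * norm (d (Suc n))"
   using elim d_nz[of n] g'_c_nz[of n] by (simp only: norm_divide norm_mult) (simp add: field_simps)
  moreover have "norm (d n) * C \<le> norm (d n) * norm (g' (c n))" by (rule mult_left_mono[OF C(2)]) simp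
  ultimately show ?case using C(1) by (simp add: field_simps)
 qed
 from eventually_bound_all[OF this] show ?thesis using d_nz by simp
qed

end

section \<open>Lifts of motions of the captured orbit\<close>

lemma derivs_of_product_compose:
 fixes F h H f :: "complex \<Rightarrow> complex"
 assumes hol: "F holomorphic_on ball 0 1" "h holomorphic_on ball 0 1" "f holomorphic_on D" "open D"
  and im: "\<And>x. x \<in> ball 0 1 \<Longrightarrow> h x \<in> D" and H: "\<And>x. x \<in> ball 0 1 \<Longrightarrow> F x * f (h x) = H x"
 shows "deriv H 0 = deriv F 0 * f (h 0) + F 0 * (deriv f (h 0) * deriv h 0)"
  and "(deriv ^^ 2) H 0 = (deriv ^^ 2) F 0 * f (h 0) + 2 * (deriv F 0 * (deriv f (h 0) * deriv h 0)) +
   F 0 * (deriv (deriv f) (h 0) * (deriv h 0) ^ 2 + deriv f (h 0) * (deriv ^^ 2) h 0)"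
proof -
 have f': "deriv f holomorphic_on D" by (rule holomorphic_deriv[OF hol(3,4)])
 have F': "deriv F holomorphic_on ball 0 1" and h': "deriv h holomorphic_on ball 0 1"
  by (rule holomorphic_deriv[OF hol(1) open_ball] holomorphic_deriv[OF hol(2) open_ball])+
 note dF = holomorphic_derivI[OF hol(1) open_ball] and dh = holomorphic_derivI[OF hol(2) open_ball]
  and dF' = holomorphic_derivI[OF F' open_ball] and dh' = holomorphic_derivI[OF h' open_ball]
 have dfh: "((\<lambda>x. f (h x)) has_field_derivative deriv f (h x) * deriv h x) (at x)"
  "((\<lambda>x. deriv f (h x)) has_field_derivative deriv (deriv f) (h x) * deriv h x) (at x)"
  if x: "x \<in> ball 0 1" for x by (rule DERIV_chain2[OF holomorphic_derivI[OF hol(3,4) im[OF x]] dh[OF x]],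
   rule DERIV_chain2[OF holomorphic_derivI[OF f' hol(4) im[OF x]] dh[OF x]])
 have 1: "deriv H x = deriv F x * f (h x) + F x * (deriv f (h x) * deriv h x)" if x: "x \<in> ball 0 1" for x
 proof (rule DERIV_imp_deriv)
  have "((\<lambda>x. F x * f (h x)) has_field_derivative deriv F x * f (h x) + F x * (deriv f (h x) * deriv h x)) (at x)"
   by (rule DERIV_cong[OF DERIV_mult[OF dF[OF x] dfh(1)[OF x]]]) (simp)
  thus "(H has_field_derivative deriv F x * f (h x) + F x * (deriv f (h x) * deriv h x)) (at x)"
   by (rule has_field_derivative_transform_within_open[of _ _ _ "ball 0 1"]) (use x H in auto)
 qed
 have z: "0 \<in> ball (0::complex) 1" by simp
 show "deriv H 0 = deriv F 0 * f (h 0) + F 0 * (deriv f (h 0) * deriv h 0)" by (rule 1[OF z])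
 have "((\<lambda>x. deriv F x * f (h x) + F x * (deriv f (h x) * deriv h x)) has_field_derivative
   (deriv (deriv F) 0 * f (h 0) + deriv f (h 0) * deriv h 0 * deriv F 0) +
   (deriv F 0 * (deriv f (h 0) * deriv h 0) +
    (deriv (deriv f) (h 0) * deriv h 0 * deriv h 0 + deriv (deriv h) 0 * deriv f (h 0)) * F 0)) (at 0)"
  by (intro DERIV_add DERIV_mult dF'[OF z] dF[OF z] dfh[OF z] dh'[OF z])
 hence "(deriv H has_field_derivative
   (deriv (deriv F) 0 * f (h 0) + deriv f (h 0) * deriv h 0 * deriv F 0) +
   (deriv F 0 * (deriv f (h 0) * deriv h 0) +
    (deriv (deriv f) (h 0) * deriv h 0 * deriv h 0 + deriv (deriv h) 0 * deriv f (h 0)) * F 0)) (at 0)"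
  by (rule has_field_derivative_transform_within_open[of _ _ _ "ball 0 1"]) (use 1 in auto)
 hence "deriv (deriv H) 0 = (deriv (deriv F) 0 * f (h 0) + deriv f (h 0) * deriv h 0 * deriv F 0) +
   (deriv F 0 * (deriv f (h 0) * deriv h 0) +
    (deriv (deriv f) (h 0) * deriv h 0 * deriv h 0 + deriv (deriv h) 0 * deriv f (h 0)) * F 0)"
  by (rule DERIV_imp_deriv)
 thus "(deriv ^^ 2) H 0 = (deriv ^^ 2) F 0 * f (h 0) + 2 * (deriv F 0 * (deriv f (h 0) * deriv h 0)) +
   F 0 * (deriv (deriv f) (h 0) * (deriv h 0) ^ 2 + deriv f (h 0) * (deriv ^^ 2) h 0)"
  by (simp add: numeral_2_eq_2)
qed

context captured begin

definition Idx :: "(nat + nat) set" where "Idx = range Inl \<union> Inr ` {..<q}"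

definition nxt :: "nat + nat \<Rightarrow> nat + nat" where
 "nxt x = (case x of Inl n \<Rightarrow> Inl (Suc n) | Inr j \<Rightarrow> Inr (Suc j mod q))"

definition pnt :: "nat + nat \<Rightarrow> complex" where
 "pnt x = (case x of Inl n \<Rightarrow> c n | Inr j \<Rightarrow> b j)"

lemma Idx_props:
 shows "Inl 0 \<in> Idx" "i \<in> Idx \<Longrightarrow> nxt i \<in> Idx" "inj_on nxt Idx" "i \<in> Idx \<Longrightarrow> nxt i \<noteq> Inl 0"
proof -
 show "Inl 0 \<in> Idx" by (simp add: Idx_def)
 show "i \<in> Idx \<Longrightarrow> nxt i \<in> Idx" by (auto simp: Idx_def nxt_def)
 show "i \<in> Idx \<Longrightarrow> nxt i \<noteq> Inl 0" by (auto simp: Idx_def nxt_def)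
 show "inj_on nxt Idx"
 proof (rule inj_onI)
  fix x y assume "x \<in> Idx" "y \<in> Idx" "nxt x = nxt y"
  thus "x = y" by (auto simp: Idx_def nxt_def mod_Suc split: if_splits)
 qed
qed

lemma pnt_props:
 shows "pnt (Inl 0) = c1" "i \<in> Idx \<Longrightarrow> pnt i \<in> D" "i \<in> Idx \<Longrightarrow> g (pnt i) = pnt (nxt i)"
proof -
 show "pnt (Inl 0) = c1" by (simp add: pnt_def)
 show "i \<in> Idx \<Longrightarrow> pnt i \<in> D" using c_D b_D by (auto simp: Idx_def pnt_def)
 show "i \<in> Idx \<Longrightarrow> g (pnt i) = pnt (nxt i)" by (auto simp: Idx_def pnt_def nxt_def g_b b_mod)
qed

lemma pnt_separated:
 assumes "i \<in> Idx" "j \<in> Idx" "u \<in> U" "i \<noteq> j"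
 shows "pnt i \<noteq> u * pnt j"
proof
 assume eq: "pnt i = u * pnt j"
 have uu: "u * u = 1" by (rule U_square[OF assms(3)])
 have eq': "pnt j = u * pnt i" using uu by (simp add: eq)
 show False
 proof (cases i; cases j)
  fix n m assume "i = Inl n" "j = Inl m"
  thus False using eq c_ne_c[OF assms(3), of n m] assms(4) by (simp add: pnt_def)
 next
  fix n m assume "i = Inl n" "j = Inr m"
  thus False using eq c_ne_b[OF assms(3), of n m] by (simp add: pnt_def)
 next
  fix n m assume "i = Inr n" "j = Inl m"
  thus False using eq' c_ne_b[OF assms(3), of m n] by (simp add: pnt_def)
 next
  fix n m assume ij: "i = Inr n" "j = Inr m"
  hence bu: "b n = u * b m" using eq by (simp add: pnt_def)
  have "u = 1" by (rule asym[OF assms(3) bu])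
  hence "n mod q = m mod q" using bu b_eq_iff by simp
  thus False using ij assms by (auto simp: Idx_def)
 qed
qed

lemma pnt_bounded: "\<exists>B. \<forall>i\<in>Idx. norm (pnt i) \<le> B"
proof -
 obtain B1 where B1: "\<And>n. norm (b n) \<le> B1" using b_range_bound[of "\<lambda>z. z"] by blast
 obtain B2 where B2: "0 < B2" "\<And>n. norm (d n) \<le> B2" using d_bounded by blast
 have "norm (c n) \<le> B1 + B2" for n using norm_triangle_mono[OF B1[of n] B2(2)[of n]] by (simp add: d_def)
 moreover have "norm (b n) \<le> B1 + B2" for n using B1[of n] B2(1) norm_ge_zero[of "d 0"] by linarith
 ultimately show ?thesis by (intro exI[of _ "B1 + B2"]) (auto simp: Idx_def pnt_def)
qed

text \<open>First and second derivatives of the iterated lifts. The bounds from the first lift on do not depend on the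
 initial motion.\<close>

definition lift_jets ::
  "real \<Rightarrow> (nat + nat \<Rightarrow> complex \<Rightarrow> complex) \<Rightarrow> (nat \<Rightarrow> nat \<Rightarrow> complex) \<Rightarrow> (nat \<Rightarrow> nat \<Rightarrow> complex) \<Rightarrow>
  (nat \<Rightarrow> complex) \<Rightarrow> (nat \<Rightarrow> nat \<Rightarrow> complex) \<Rightarrow> bool" where
 "lift_jets B M v \<alpha> s2 \<alpha>2 \<longleftrightarrow>
  (\<forall>n. v 0 n = deriv (M (Inl n)) 0) \<and> (\<forall>j. \<alpha> 0 j = deriv (M (Inr (j mod q))) 0) \<and>
  (\<forall>k n. v k (Suc n) = g' (c n) * v (Suc k) n + v k 0 * f (c n)) \<and>
  (\<forall>k j. \<alpha> k (Suc j) = g' (b j) * \<alpha> (Suc k) j + v k 0 * f (b j)) \<and>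
  (\<forall>k j. \<alpha> k (j + q) = \<alpha> k j) \<and> (\<forall>k n. norm (v (Suc k) n) \<le> B) \<and> (\<forall>k j. norm (\<alpha> (Suc k) j) \<le> B) \<and>
  (\<forall>k j. \<alpha>2 k (Suc j) = g' (b j) * \<alpha>2 (Suc k) j + s2 k * f (b j) +
   2 * v k 0 * deriv f (b j) * \<alpha> (Suc k) j + c1 * deriv (deriv f) (b j) * (\<alpha> (Suc k) j) ^ 2) \<and>
  (\<forall>k j. \<alpha>2 k (j + q) = \<alpha>2 k j) \<and> (\<forall>k j. norm (\<alpha>2 (Suc k) j) \<le> B)"

lemma lift_jets_exist:
 obtains B where "0 < B" "\<And>M. motion Idx pnt (Inl 0) M \<Longrightarrow> \<exists>v \<alpha> s2 \<alpha>2. lift_jets B M v \<alpha> s2 \<alpha>2"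
proof -
 obtain B0 where B0: "\<And>i. i \<in> Idx \<Longrightarrow> norm (pnt i) \<le> B0" using pnt_bounded by blast
 obtain C where C: "C > 0" "\<And>(M :: nat + nat \<Rightarrow> complex \<Rightarrow> complex) M' J nx i0 pt i x n.
  motion J pt i0 M \<Longrightarrow> motion J pt i0 M' \<Longrightarrow> lifts_to J nx i0 M M' \<Longrightarrow>
  i0 \<in> J \<Longrightarrow> i \<in> J \<Longrightarrow> nx i \<in> J \<Longrightarrow> nx i \<noteq> i0 \<Longrightarrow> norm (pt i) \<le> B0 \<Longrightarrow>
  norm ((deriv ^^ n) (M' i) 0) \<le> fact n * C * 2 ^ n"
  by (rule lift_bounded[where B = B0 and 'i = "nat + nat"]) (rule that)
 show ?thesis
 \<comment> \<open>This is the bound \<open>fact n * C * 2 ^ n\<close> for \<open>n = 2\<close>, and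
   it dominates the one for \<open>n = 1\<close>.\<close>
 proof (rule that[of "8 * C"])
  show "0 < 8 * C" using C(1) by simp
  fix M assume M: "motion Idx pnt (Inl 0) M"
  show "\<exists>v \<alpha> s2 \<alpha>2. lift_jets (8 * C) M v \<alpha> s2 \<alpha>2"
  proof (rule motion_iterates[OF Idx_props pnt_props M])
   fix Ms assume Ms0: "Ms 0 = M" and Ms: "\<And>k. motion Idx pnt (Inl 0) (Ms k)"
    and lf: "\<And>k. lifts_to Idx nxt (Inl 0) (Ms k) (Ms (Suc k))"
   have bd: "norm ((deriv ^^ n) (Ms (Suc k) i) 0) \<le> fact n * C * 2 ^ n" if "i \<in> Idx" for k n i
    by (rule C(2)[OF Ms Ms lf Idx_props(1) that Idx_props(2)[OF that] Idx_props(4)[OF that] B0[OF that]])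
   have hol: "Ms k i holomorphic_on ball 0 1" and at0: "Ms k i 0 = pnt i"
    and inD: "\<And>x. x \<in> ball 0 1 \<Longrightarrow> Ms k i x \<in> D" if "i \<in> Idx" for k i
    using Ms[of k] that unfolding motion_def by auto
   have eq: "Ms k (Inl 0) x * f (Ms (Suc k) i x) = Ms k (nxt i) x" if "i \<in> Idx" "x \<in> ball 0 1" for k i x
    using lf[of k] that unfolding lifts_to_def by blast
   have c1_0: "Ms k (Inl 0) 0 = c1" for k using at0[OF Idx_props(1)] by (simp add: pnt_def)
   have I1: "Inl n \<in> Idx" "Inr (j mod q) \<in> Idx" for n j using q_pos by (auto simp: Idx_def)
   have p1: "pnt (Inl n) = c n" "pnt (Inr (j mod q)) = b j" for n j by (auto simp: pnt_def b_mod)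
   have n1: "nxt (Inl n) = Inl (Suc n)" "nxt (Inr (j mod q)) = Inr (Suc j mod q)" for n j
    by (auto simp: nxt_def mod_Suc_eq)
   have ds: "deriv (Ms k (nxt i)) 0 = deriv (Ms k (Inl 0)) 0 * f (pnt i) + c1 * (deriv f (pnt i) * deriv (Ms (Suc k) i) 0)"
    "(deriv ^^ 2) (Ms k (nxt i)) 0 = (deriv ^^ 2) (Ms k (Inl 0)) 0 * f (pnt i) +
     2 * (deriv (Ms k (Inl 0)) 0 * (deriv f (pnt i) * deriv (Ms (Suc k) i) 0)) +
     c1 * (deriv (deriv f) (pnt i) * (deriv (Ms (Suc k) i) 0) ^ 2 + deriv f (pnt i) * (deriv ^^ 2) (Ms (Suc k) i) 0)"
    if i: "i \<in> Idx" for k i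
   proof -
    note h = hol[OF Idx_props(1), of k] hol[OF i, of "Suc k"]
    have "deriv (Ms k (nxt i)) 0 = deriv (Ms k (Inl 0)) 0 * f (Ms (Suc k) i 0) +
      Ms k (Inl 0) 0 * (deriv f (Ms (Suc k) i 0) * deriv (Ms (Suc k) i) 0)"
     by (rule derivs_of_product_compose(1)[OF h hol_f open_D inD[OF i] eq[OF i]])
    thus "deriv (Ms k (nxt i)) 0 = deriv (Ms k (Inl 0)) 0 * f (pnt i) + c1 * (deriv f (pnt i) * deriv (Ms (Suc k) i) 0)"
     by (simp only: c1_0 at0[OF i])
    have "(deriv ^^ 2) (Ms k (nxt i)) 0 = (deriv ^^ 2) (Ms k (Inl 0)) 0 * f (Ms (Suc k) i 0) +
      2 * (deriv (Ms k (Inl 0)) 0 * (deriv f (Ms (Suc k) i 0) * deriv (Ms (Suc k) i) 0)) +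
      Ms k (Inl 0) 0 * (deriv (deriv f) (Ms (Suc k) i 0) * (deriv (Ms (Suc k) i) 0) ^ 2 +
       deriv f (Ms (Suc k) i 0) * (deriv ^^ 2) (Ms (Suc k) i) 0)"
     by (rule derivs_of_product_compose(2)[OF h hol_f open_D inD[OF i] eq[OF i]])
    thus "(deriv ^^ 2) (Ms k (nxt i)) 0 = (deriv ^^ 2) (Ms k (Inl 0)) 0 * f (pnt i) +
      2 * (deriv (Ms k (Inl 0)) 0 * (deriv f (pnt i) * deriv (Ms (Suc k) i) 0)) +
      c1 * (deriv (deriv f) (pnt i) * (deriv (Ms (Suc k) i) 0) ^ 2 + deriv f (pnt i) * (deriv ^^ 2) (Ms (Suc k) i) 0)"
     by (simp only: c1_0 at0[OF i])
   qed
   note dl = ds(1)[OF I1(1), unfolded p1 n1] and dr = ds[OF I1(2), unfolded p1 n1]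
   define v where "v k n = deriv (Ms k (Inl n)) 0" for k n
   define \<alpha> where "\<alpha> k j = deriv (Ms k (Inr (j mod q))) 0" for k j
   define s2 where "s2 k = (deriv ^^ 2) (Ms k (Inl 0)) 0" for k
   define \<alpha>2 where "\<alpha>2 k j = (deriv ^^ 2) (Ms k (Inr (j mod q))) 0" for k j
   have b1: "norm (deriv (Ms (Suc k) i) 0) \<le> 8 * C" if "i \<in> Idx" for k i using bd[OF that, of 1 k] C(1) by simp
   have b2: "norm ((deriv ^^ 2) (Ms (Suc k) i) 0) \<le> 8 * C" if "i \<in> Idx" for k i using bd[OF that, of 2 k] by simp
   have "lift_jets (8 * C) M v \<alpha> s2 \<alpha>2" unfolding lift_jets_def
   proof (intro conjI allI)
    fix k n
    show "v 0 n = deriv (M (Inl n)) 0" "\<alpha> 0 n = deriv (M (Inr (n mod q))) 0" by (simp_all add: v_def \<alpha>_def Ms0)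
    show "v k (Suc n) = g' (c n) * v (Suc k) n + v k 0 * f (c n)"
     unfolding v_def dl by (simp only: mult.assoc add.commute)
    show "\<alpha> k (Suc n) = g' (b n) * \<alpha> (Suc k) n + v k 0 * f (b n)"
     unfolding v_def \<alpha>_def dr by (simp only: mult.assoc add.commute)
    show "\<alpha> k (n + q) = \<alpha> k n" "\<alpha>2 k (n + q) = \<alpha>2 k n" by (simp_all add: \<alpha>_def \<alpha>2_def)
    show "norm (v (Suc k) n) \<le> 8 * C" "norm (\<alpha> (Suc k) n) \<le> 8 * C" "norm (\<alpha>2 (Suc k) n) \<le> 8 * C"
     unfolding v_def \<alpha>_def \<alpha>2_def by (intro b1 b2 I1)+
    show "\<alpha>2 k (Suc n) = g' (b n) * \<alpha>2 (Suc k) n + s2 k * f (b n) +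
      2 * v k 0 * deriv f (b n) * \<alpha> (Suc k) n + c1 * deriv (deriv f) (b n) * (\<alpha> (Suc k) n) ^ 2"
     unfolding v_def \<alpha>_def \<alpha>2_def s2_def dr by (simp add: algebra_simps)
   qed
   thus ?thesis by blast
  qed
 qed
qed

end

lemma finite_uniform_radius:
 assumes "finite Z" "\<And>p. p \<in> Z \<Longrightarrow> \<exists>e>0::real. P p e"
  and mono: "\<And>p e e'. P p e \<Longrightarrow> 0 < e' \<Longrightarrow> e' \<le> e \<Longrightarrow> P p e'"
 shows "\<exists>e>0. \<forall>p\<in>Z. P p e" using assms(1,2)
proof (induction Z rule: finite_induct)
 case empty
 show ?case by (intro exI[of _ 1]) simp
next
 case (insert x F)
 obtain e1 where e1: "0 < e1" "\<forall>p\<in>F. P p e1" using insert.IH insert.prems by auto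
 obtain e2 where e2: "0 < e2" "P x e2" using insert.prems by auto
 show ?case
 proof (intro exI[of _ "min e1 e2"] conjI ballI)
  show "0 < min e1 e2" using e1 e2 by simp
  fix p assume "p \<in> insert x F"
  thus "P p (min e1 e2)"
  proof
   assume "p = x"
   thus ?thesis using mono[OF e2(2), of "min e1 e2"] e1(1) e2(1) by simp
  next
   assume "p \<in> F"
   thus ?thesis using mono[OF bspec[OF e1(2)], of p "min e1 e2"] e1(1) e2(1) by simp
  qed
 qed
qed

section \<open>Base motions of arbitrarily large rate\<close>

context captured begin

definition centers :: "complex set" where "centers = (\<lambda>(u, j). u * b j) ` (U \<times> {..<q})"

lemma finite_centers: "finite centers" unfolding centers_def using U_sub finite_subset by blast

lemma center_U: "u \<in> U \<Longrightarrow> p \<in> centers \<Longrightarrow> u * p \<in> centers"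
proof -
 assume u: "u \<in> U" and "p \<in> centers"
 then obtain v j where vj: "v \<in> U" "j < q" "p = v * b j" by (auto simp: centers_def)
 hence "u * p = (u * v) * b j" by simp
 thus ?thesis unfolding centers_def using U_mult[OF u vj(1)] vj(2) by (intro image_eqI[of _ _ "(u * v, j)"]) auto
qed

lemma b_center: "b n \<in> centers"
 unfolding centers_def using one_U q_pos by (intro image_eqI[of _ _ "(1, n mod q)"]) (auto simp: b_mod)

lemma center_radius:
 obtains \<rho> where "0 < \<rho>" "\<And>p. p \<in> centers \<Longrightarrow> ball p \<rho> \<subseteq> D - {0}"
  "\<And>p p'. p \<in> centers \<Longrightarrow> p' \<in> centers \<Longrightarrow> p' \<noteq> p \<Longrightarrow> 2 * \<rho> \<le> dist p p'"
proof -
 have "\<exists>e>0. \<forall>p\<in>centers. ball p e \<subseteq> D - {0} \<and> (\<forall>p'\<in>centers. p' \<noteq> p \<longrightarrow> 2 * e \<le> dist p p')"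
 proof (rule finite_uniform_radius[OF finite_centers])
  fix p assume "p \<in> centers"
  hence "p \<in> D - {0}" using U_inv b_D b_nz U_nz by (auto simp: centers_def)
  then obtain e1 where e1: "0 < e1" "ball p e1 \<subseteq> D - {0}"
   using open_contains_ball[of "D - {0}"] open_D by (meson open_delete)
  obtain e2 where e2: "0 < e2" "\<forall>x\<in>centers. x \<noteq> p \<longrightarrow> e2 \<le> dist p x"
   using finite_set_avoid[OF finite_centers] by blast
  show "\<exists>e>0. ball p e \<subseteq> D - {0} \<and> (\<forall>p'\<in>centers. p' \<noteq> p \<longrightarrow> 2 * e \<le> dist p p')"
  proof (intro exI[of _ "min e1 (e2 / 2)"] conjI ballI impI)
   show "0 < min e1 (e2 / 2)" using e1 e2 by simp
   show "ball p (min e1 (e2 / 2)) \<subseteq> D - {0}" using e1(2) by (meson min.cobounded1 subset_ball subset_trans)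
   fix p' assume "p' \<in> centers" "p' \<noteq> p"
   hence "e2 \<le> dist p p'" using e2 by simp
   thus "2 * min e1 (e2 / 2) \<le> dist p p'" by linarith
  qed
 next
  fix p and e e' :: real
  assume a: "ball p e \<subseteq> D - {0} \<and> (\<forall>p'\<in>centers. p' \<noteq> p \<longrightarrow> 2 * e \<le> dist p p')" "0 < e'" "e' \<le> e"
  hence "ball p e' \<subseteq> ball p e" by (intro subset_ball)
  thus "ball p e' \<subseteq> D - {0} \<and> (\<forall>p'\<in>centers. p' \<noteq> p \<longrightarrow> 2 * e' \<le> dist p p')" using a by force
 qed
 thus ?thesis using that by auto
qed

text \<open>The base motion stretches a punctured disc about each point of the cycle radially, by a factor
 which near the centre is \<open>exp (K * x)\<close> with \<open>K\<close> arbitrarily large.\<close>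

lemma large_base_motion:
 assumes K: "0 \<le> K"
 shows "\<exists>M n0. motion Idx pnt (Inl 0) M \<and> (\<forall>j. deriv (M (Inr j)) 0 = 0) \<and>
  (\<forall>n\<ge>n0. deriv (M (Inl n)) 0 = of_real K * d n)"
proof -
 obtain \<rho> where \<rho>: "0 < \<rho>" and Dp: "\<And>p. p \<in> centers \<Longrightarrow> ball p \<rho> \<subseteq> D - {0}"
  and sep: "\<And>p p'. p \<in> centers \<Longrightarrow> p' \<in> centers \<Longrightarrow> p' \<noteq> p \<Longrightarrow> 2 * \<rho> \<le> dist p p'" by (rule center_radius) (rule that)
 have uniq: "p = p'" if p: "p \<in> centers" "p' \<in> centers" and z: "dist p z < \<rho>" "dist p' z < \<rho>" for p p' z
 proof (rule ccontr)
  assume "p \<noteq> p'"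
  hence "2 * \<rho> \<le> dist p p'" using sep[OF p] by simp
  moreover have "dist p p' \<le> dist p z + dist p' z" by (rule dist_triangle2)
  ultimately show False using z by linarith
 qed
 define R where "R = ln \<rho>"
 \<comment> \<open>In the logarithmic radius \<open>l = ln (norm \<xi>)\<close> the motion is the
   shift by \<open>Re x * A\<close>. The slope of \<open>A\<close> is at most 1/2 in modulus and
   \<open>A\<close> vanishes at the rim, so for \<open>\<bar>Re x\<bar> < 1\<close> radii keep their
   order and stay below \<open>\<rho>\<close>; for \<open>l \<le> R - 2 * K\<close> the value is
   exactly \<open>K\<close>.\<close>
 define A where "A r = (R - max (ln r) (R - 2 * K)) / 2" for r
 define S where "S x \<xi> = \<xi> * exp (x * of_real (A (norm \<xi>)))" for x \<xi> :: complex
 have nS: "norm (S x \<xi>) = exp (ln (norm \<xi>) + Re x * A (norm \<xi>))" if "\<xi> \<noteq> 0" for x \<xi>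
  using that by (simp add: S_def norm_mult exp_add)
 have rx: "\<bar>Re x\<bar> < 1" if "x \<in> ball 0 1" for x :: complex using that abs_Re_le_cmod[of x] by simp
 have Slt: "norm (S x \<xi>) < \<rho>" if x: "x \<in> ball 0 1" and xi: "norm \<xi> < \<rho>" for x \<xi>
 proof (cases "\<xi> = 0")
  case False
  define l where "l = ln (norm \<xi>)"
  have l: "l < R" using False xi \<rho> by (simp add: l_def R_def)
  have A: "0 \<le> A (norm \<xi>)" "A (norm \<xi>) \<le> (R - l) / 2" using l K by (auto simp: A_def l_def[symmetric])
  have "Re x * A (norm \<xi>) \<le> 1 * A (norm \<xi>)" using rx[OF x] A by (intro mult_right_mono) auto
  hence "l + Re x * A (norm \<xi>) < R" using A l by simp
  hence "norm (S x \<xi>) < exp R" unfolding nS[OF False] by (simp add: l_def)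
  thus ?thesis using \<rho> by (simp add: R_def)
 qed (use \<rho> in \<open>simp add: S_def\<close>)
 have mono: "norm (S x \<xi>) < norm (S x \<eta>)" if x: "x \<in> ball 0 1" and lt: "norm \<xi> < norm \<eta>" for x \<xi> \<eta>
 proof (cases "\<xi> = 0")
  case False
  have e: "\<eta> \<noteq> 0" using lt by auto
  define l where "l = ln (norm \<xi>)"
  define l' where "l' = ln (norm \<eta>)"
  have ll: "l < l'" using False lt e by (simp add: l_def l'_def)
  define \<delta> where "\<delta> = A (norm \<xi>) - A (norm \<eta>)"
  have "\<delta> = (max l' (R - 2 * K) - max l (R - 2 * K)) / 2"
   unfolding \<delta>_def A_def l_def[symmetric] l'_def[symmetric] by (simp add: field_simps)
  hence dl: "0 \<le> \<delta>" "\<delta> \<le> (l' - l) / 2" using ll by auto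
  have "Re x * \<delta> \<le> 1 * \<delta>" using rx[OF x] dl by (intro mult_right_mono) auto
  hence "Re x * \<delta> < l' - l" using dl ll by simp
  hence "l + Re x * A (norm \<xi>) < l' + Re x * A (norm \<eta>)" by (simp add: \<delta>_def algebra_simps)
  thus ?thesis unfolding nS[OF False] nS[OF e] by (simp add: l_def l'_def)
 next
  case True
  hence "\<eta> \<noteq> 0" using lt by auto
  thus ?thesis using True by (simp add: S_def)
 qed
 have Sinj: "\<xi> = \<eta>" if x: "x \<in> ball 0 1" and eq: "S x \<xi> = S x \<eta>" for x \<xi> \<eta>
 proof -
  have "norm \<xi> = norm \<eta>" using mono[OF x, of \<xi> \<eta>] mono[OF x, of \<eta> \<xi>] eq by (metis linorder_neqE_linordered_idom order_less_irrefl)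
  thus ?thesis using eq by (simp add: S_def)
 qed
 define ctr where "ctr z = (SOME p. p \<in> centers \<and> dist p z < \<rho>)" for z
 define H where "H z x = (if \<exists>p\<in>centers. dist p z < \<rho> then ctr z + S x (z - ctr z) else z)" for z x
 have H1: "H z x = p + S x (z - p)" if "p \<in> centers" "dist p z < \<rho>" for p z x
 proof -
  have "ctr z \<in> centers \<and> dist (ctr z) z < \<rho>" unfolding ctr_def by (rule someI[of _ p]) (use that in simp)
  hence "ctr z = p" using uniq[of "ctr z" p z] that by simp
  thus ?thesis using that by (auto simp: H_def)
 qed
 have H2: "H z x = z" if "\<not> (\<exists>p\<in>centers. dist p z < \<rho>)" for z x using that by (simp only: H_def if_False)
 have H1b: "dist p (H z x) < \<rho>" if "p \<in> centers" "dist p z < \<rho>" "x \<in> ball 0 1" for p z x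
  unfolding H1[OF that(1,2)] using Slt[OF that(3), of "z - p"] that(2) by (simp add: dist_norm norm_minus_commute)
 have Hinj: "z = z'" if x: "x \<in> ball 0 1" and eq: "H z x = H z' x" for z z' x
 proof (cases "\<exists>p\<in>centers. dist p z < \<rho>")
  case True
  then obtain p where p: "p \<in> centers" "dist p z < \<rho>" by blast
  have hz: "dist p (H z x) < \<rho>" by (rule H1b[OF p x])
  show ?thesis
  proof (cases "\<exists>p\<in>centers. dist p z' < \<rho>")
   case True
   then obtain p' where p': "p' \<in> centers" "dist p' z' < \<rho>" by blast
   have "p = p'" using uniq[OF p(1) p'(1) hz] H1b[OF p' x] eq by simp
   hence "S x (z - p) = S x (z' - p)" using eq H1[OF p] H1[OF p'] by simp
   from Sinj[OF x this] show ?thesis by simp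
  next
   case False
   hence "H z' x = z'" by (rule H2)
   thus ?thesis using hz p(1) eq False by auto
  qed
 next
  case False
  note hz = H2[OF False, of x]
  show ?thesis
  proof (cases "\<exists>p\<in>centers. dist p z' < \<rho>")
   case True
   then obtain p' where p': "p' \<in> centers" "dist p' z' < \<rho>" by blast
   thus ?thesis using H1b[OF p' x] hz eq False by auto
  next
   case False
   thus ?thesis using hz eq H2 by simp
  qed
 qed
 \<comment> \<open>Commuting with \<open>U\<close> turns injectivity of \<open>H\<close> into
   separation modulo \<open>U\<close>.\<close>
 have HU: "H (u * z) x = u * H z x" if u: "u \<in> U" for u z x
 proof (cases "\<exists>p\<in>centers. dist p z < \<rho>")
  case True
  then obtain p where p: "p \<in> centers" "dist p z < \<rho>" by blast
  have du: "dist (u * a) (u * w) = dist a w" for a w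
   using norm_U[OF u] by (simp add: dist_norm right_diff_distrib[symmetric] norm_mult)
  have "H (u * z) x = u * p + S x (u * z - u * p)" by (rule H1) (use center_U[OF u p(1)] p du in auto)
  also have "S x (u * z - u * p) = u * S x (z - p)"
   using norm_U[OF u] by (simp add: S_def right_diff_distrib[symmetric] norm_mult)
  finally show ?thesis unfolding H1[OF p] by (simp add: distrib_left)
 next
  case False
  have "\<not> (\<exists>p\<in>centers. dist p (u * z) < \<rho>)"
  proof
   assume "\<exists>p\<in>centers. dist p (u * z) < \<rho>"
   then obtain p where p: "p \<in> centers" "dist p (u * z) < \<rho>" by blast
   have "u * (u * z) = z" using U_square[OF u] by simp
   hence "dist (u * p) z = norm u * dist p (u * z)" by (metis dist_norm norm_mult right_diff_distrib)
   hence "dist (u * p) z < \<rho>" using p norm_U[OF u] by simp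
   thus False using False center_U[OF u p(1)] by blast
  qed
  thus ?thesis using H2 False by simp
 qed
 define M where "M i x = H (pnt i) x" for i :: "nat + nat" and x
 have H0: "H z 0 = z" for z by (simp add: H_def S_def)
 have HD: "H z x \<in> D \<and> H z x \<noteq> 0" if "z \<in> D" "z \<noteq> 0" "x \<in> ball 0 1" for z x
 proof (cases "\<exists>p\<in>centers. dist p z < \<rho>")
  case True
  then obtain p where p: "p \<in> centers" "dist p z < \<rho>" by blast
  have "H z x \<in> ball p \<rho>" using H1b[OF p that(3)] by simp
  thus ?thesis using Dp[OF p(1)] by blast
 next
  case False
  show ?thesis unfolding H2[OF False] using that by simp
 qed
 have Hhol: "(\<lambda>x. H z x) holomorphic_on ball 0 1" for z
 proof (cases "\<exists>p\<in>centers. dist p z < \<rho>")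
  case True
  then obtain p where p: "p \<in> centers" "dist p z < \<rho>" by blast
  show ?thesis unfolding H1[OF p] S_def by (intro holomorphic_intros)
 next
  case False
  show ?thesis unfolding H2[OF False] by (intro holomorphic_intros)
 qed
 have pD: "pnt i \<in> D \<and> pnt i \<noteq> 0" if "i \<in> Idx" for i
  using pnt_props(2)[OF that] that c_nz b_nz by (auto simp: Idx_def pnt_def)
 have "motion Idx pnt (Inl 0) M" unfolding motion_def
 proof (intro conjI ballI impI)
  fix i assume i: "i \<in> Idx"
  show "M i holomorphic_on ball 0 1" unfolding M_def[abs_def] by (rule Hhol)
  show "M i 0 = pnt i" by (simp add: M_def H0)
  fix x :: complex assume x: "x \<in> ball 0 1"
  show "M i x \<in> D" "M i x \<noteq> 0" using HD[of "pnt i" x] pD[OF i] x by (auto simp: M_def)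
 next
  fix x :: complex assume x: "x \<in> ball 0 1"
  have c0: "pnt (Inl 0) = c1" by (simp add: pnt_def)
  show "M (Inl 0) x \<in> Dp"
  proof (cases "\<exists>p\<in>centers. dist p c1 < \<rho>")
   case True
   then obtain p where p: "p \<in> centers" "dist p c1 < \<rho>" by blast
   have "ball p \<rho> \<subseteq> Dp" by (rule Dp_connected_subset[of _ c1]) (use Dp[OF p(1)] p(2) c1 in auto)
   thus ?thesis using H1b[OF p x] by (auto simp: M_def c0)
  next
   case False
   show ?thesis unfolding M_def c0 H2[OF False] by (rule c1(1))
  qed
 next
  fix i j u and x :: complex
  assume ij: "i \<in> Idx" "j \<in> Idx" and u: "u \<in> U" and x: "x \<in> ball 0 1" and ne: "i \<noteq> j"
  show "M i x \<noteq> u * M j x"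
  proof
   assume "M i x = u * M j x"
   hence "H (pnt i) x = H (u * pnt j) x" by (simp add: M_def HU[OF u])
   hence "pnt i = u * pnt j" by (rule Hinj[OF x])
   thus False using pnt_separated[OF ij u ne] by simp
  qed
 qed
 moreover have "deriv (M (Inr j)) 0 = 0" for j
 proof -
  have "dist (b j) (b j) < \<rho>" using \<rho> by simp
  have "M (Inr j) x = b j" for x
   unfolding M_def using H1[OF b_center \<open>dist (b j) (b j) < \<rho>\<close>, of x] by (simp add: pnt_def S_def)
  hence "M (Inr j) = (\<lambda>x. b j)" by (rule ext)
  thus ?thesis by simp
 qed
 moreover have "\<exists>n0. \<forall>n\<ge>n0. deriv (M (Inl n)) 0 = of_real K * d n"
 proof -
  have "\<forall>\<^sub>F n in sequentially. norm (d n) < min \<rho> (exp (R - 2 * K))"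
   using tendstoD[OF d_lim, of "min \<rho> (exp (R - 2 * K))"] \<rho> by simp
  then obtain n0 where n0: "\<And>n. n \<ge> n0 \<Longrightarrow> norm (d n) < min \<rho> (exp (R - 2 * K))"
   unfolding eventually_sequentially by blast
  have "deriv (M (Inl n)) 0 = of_real K * d n" if "n \<ge> n0" for n
  proof -
   have n: "norm (d n) < \<rho>" "norm (d n) < exp (R - 2 * K)" using n0[OF that] by auto
   have "ln (norm (d n)) < R - 2 * K" using n(2) d_nz[of n] by (metis exp_less_cancel_iff exp_ln zero_less_norm_iff)
   hence A: "A (norm (d n)) = K" by (simp add: A_def)
   have "dist (b n) (c n) < \<rho>" using n(1) by (simp add: d_def dist_norm norm_minus_commute)
   from H1[OF b_center this] have "M (Inl n) x = b n + d n * exp (x * of_real K)" for x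
    unfolding M_def pnt_def by (simp add: S_def A d_def[symmetric])
   hence "M (Inl n) = (\<lambda>x. b n + d n * exp (x * of_real K))" by (rule ext)
   moreover have "((\<lambda>x. b n + d n * exp (x * of_real K)) has_field_derivative of_real K * d n) (at 0)"
    by (auto intro!: derivative_eq_intros)
   ultimately show ?thesis by (simp add: DERIV_imp_deriv)
  qed
  thus ?thesis by blast
 qed
 ultimately show ?thesis by blast
qed

definition large_jets :: "real \<Rightarrow> real \<Rightarrow> nat \<Rightarrow> (nat \<Rightarrow> nat \<Rightarrow> complex) \<Rightarrow> (nat \<Rightarrow> nat \<Rightarrow> complex) \<Rightarrow> bool" where
 "large_jets B K n0 v \<alpha> \<longleftrightarrow>
  (\<forall>k n. v k (Suc n) = g' (c n) * v (Suc k) n + v k 0 * f (c n)) \<and>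
  (\<forall>k j. \<alpha> k (Suc j) = g' (b j) * \<alpha> (Suc k) j + v k 0 * f (b j)) \<and>
  (\<forall>k j. \<alpha> k (j + q) = \<alpha> k j) \<and> (\<forall>k n. norm (v (Suc k) n) \<le> B) \<and> (\<forall>k j. norm (\<alpha> k j) \<le> B) \<and>
  (\<forall>j. \<alpha> 0 j = 0) \<and> (\<forall>n\<ge>n0. v 0 n = of_real K * d n)"

text \<open>The order of quantifiers is the point: the lifts are bounded by a \<open>B\<close> that
  is fixed before the rate \<open>K\<close> of the initial motion.\<close>

lemma large_lifts:
 obtains B where "0 < B" "\<And>K. 0 \<le> K \<Longrightarrow> \<exists>v \<alpha> n0. large_jets B K n0 v \<alpha>"
proof -
 obtain B where B: "0 < B" "\<And>M. motion Idx pnt (Inl 0) M \<Longrightarrow> \<exists>v \<alpha> s2 \<alpha>2. lift_jets B M v \<alpha> s2 \<alpha>2"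
  by (rule lift_jets_exist) (rule that)
 show ?thesis
 proof (rule that[OF B(1)])
  fix K :: real assume "0 \<le> K"
  from large_base_motion[OF this] obtain M n0 where M: "motion Idx pnt (Inl 0) M"
   "\<forall>j. deriv (M (Inr j)) 0 = 0" "\<forall>n\<ge>n0. deriv (M (Inl n)) 0 = of_real K * d n" by (elim exE conjE)
  obtain v \<alpha> s2 \<alpha>2 where jets: "lift_jets B M v \<alpha> s2 \<alpha>2" using B(2)[OF M(1)] by (elim exE)
  have a0: "\<forall>j. \<alpha> 0 j = 0" using jets M(2) unfolding lift_jets_def by simp
  have "norm (\<alpha> k j) \<le> B" for k j using a0 B(1) jets unfolding lift_jets_def by (cases k) simp_all
  moreover have "\<forall>n\<ge>n0. v 0 n = of_real K * d n" using jets M(3) unfolding lift_jets_def by simp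
  ultimately show "\<exists>v \<alpha> n0. large_jets B K n0 v \<alpha>"
   using a0 jets unfolding lift_jets_def large_jets_def by (intro exI[of _ v] exI[of _ \<alpha>] exI[of _ n0]) simp
 qed
qed

end

section \<open>Linear recursions around a cycle\<close>

lemma periodic_from_start:
 assumes "\<And>n. x (Suc n) = F n (x n)" "\<And>n. F (n + q) = F n" "x q = x 0"
 shows "x (n + q) = x (n :: nat)" by (induction n) (simp_all add: assms)

lemma periodic_window_sum:
 fixes h :: "nat \<Rightarrow> 'a::ab_group_add"
 assumes "\<And>n. h (n + q) = h n"
 shows "(\<Sum>j<q. h (n + j)) = (\<Sum>j<q. h j)"
proof (induction n)
 case (Suc n)
 have "(\<Sum>j<q. h (n + Suc j)) + h n = (\<Sum>j<q. h (n + j)) + h (n + q)"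
  using sum.lessThan_Suc_shift[of "\<lambda>j. h (n + j)" q] by simp
 thus ?case using Suc assms by simp
qed simp

text \<open>The return map around the cycle is affine with slope different from 1, and its fixed
  point \<open>x0\<close> is the right initial value.\<close>

lemma cyclic_linear_solve:
 fixes a \<beta> :: "nat \<Rightarrow> 'a::field"
 assumes per: "\<And>n. a (n + q) = a n" "\<And>n. \<beta> (n + q) = \<beta> n" and ne: "(\<Prod>i<q. a i) \<noteq> 1"
 shows "\<exists>x. (\<forall>n. x (Suc n) = a n * x n + \<beta> n) \<and> (\<forall>n. x (n + q) = x n)"
proof -
 define R where "R = rec_nat 0 (\<lambda>n r. a n * r + \<beta> n)"
 have R: "R 0 = 0" "R (Suc n) = a n * R n + \<beta> n" for n by (simp_all add: R_def)
 define P where "P n = (\<Prod>i<n. a i)" for n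
 define x0 where "x0 = R q / (1 - P q)"
 define x where "x n = P n * x0 + R n" for n
 have 1: "x (Suc n) = a n * x n + \<beta> n" for n by (simp add: x_def P_def R algebra_simps)
 have "x q = x 0" using ne by (simp add: x_def R x0_def P_def field_simps)
 hence "x (n + q) = x n" for n
  by (rule periodic_from_start[of x "\<lambda>n y. a n * y + \<beta> n", rotated 2]) (simp_all add: 1 per)
 thus ?thesis using 1 by (intro exI[of _ x]) simp
qed

lemma cyclic_sum_solve:
 fixes \<beta> :: "nat \<Rightarrow> 'a::ab_group_add"
 assumes per: "\<And>n. \<beta> (n + q) = \<beta> n" and z: "(\<Sum>i<q. \<beta> i) = 0"
 shows "\<exists>x. (\<forall>n. x (Suc n) = x n + \<beta> n) \<and> (\<forall>n. x (n + q) = x n)"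
proof -
 define x where "x n = (\<Sum>i<n. \<beta> i)" for n
 have 1: "x (Suc n) = x n + \<beta> n" for n by (simp add: x_def)
 have "x q = x 0" using z by (simp add: x_def)
 hence "x (n + q) = x n" for n by (rule periodic_from_start[of x "\<lambda>n y. y + \<beta> n", rotated 2]) (simp_all add: 1 per)
 thus ?thesis using 1 by (intro exI[of _ x]) simp
qed

lemma window_ratio:
 fixes x \<beta> :: "nat \<Rightarrow> complex"
 assumes x: "\<And>n. x n \<noteq> 0" and lim: "(\<lambda>n. x (Suc n) / x n - \<beta> n) \<longlonglongrightarrow> 0" and \<beta>: "Bseq \<beta>"
 shows "(\<lambda>n. x (n + k) / x n - (\<Prod>i<k. \<beta> (n + i))) \<longlonglongrightarrow> 0 \<and> Bseq (\<lambda>n. \<Prod>i<k. \<beta> (n + i))"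
proof (induction k)
 case 0
 show ?case using x by simp
next
 case (Suc k)
 define p where "p n = (\<Prod>i<k. \<beta> (n + i))" for n
 have bk: "Bseq (\<lambda>n. \<beta> (n + k))" using \<beta> by (simp add: Bseq_ignore_initial_segment)
 have lk: "(\<lambda>n. x (n + Suc k) / x (n + k) - \<beta> (n + k)) \<longlonglongrightarrow> 0" using LIMSEQ_ignore_initial_segment[OF lim, of k] by simp
 have l1: "(\<lambda>n. (x (n + k) / x n - p n) * (x (n + Suc k) / x (n + k) - \<beta> (n + k))) \<longlonglongrightarrow> 0"
  using tendsto_mult[OF _ lk, of "\<lambda>n. x (n + k) / x n - p n" 0] Suc by (simp add: p_def)
 have l2: "(\<lambda>n. (x (n + k) / x n - p n) * \<beta> (n + k)) \<longlonglongrightarrow> 0"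
  using bounded_bilinear.Zfun_prod_Bfun[OF bounded_bilinear_mult, of "\<lambda>n. x (n + k) / x n - p n" sequentially "\<lambda>n. \<beta> (n + k)"] Suc bk
  by (simp add: p_def tendsto_Zfun_iff)
 have l3: "(\<lambda>n. p n * (x (n + Suc k) / x (n + k) - \<beta> (n + k))) \<longlonglongrightarrow> 0"
  using bounded_bilinear.Bfun_prod_Zfun[OF bounded_bilinear_mult, of p sequentially "\<lambda>n. x (n + Suc k) / x (n + k) - \<beta> (n + k)"] Suc lk
  by (simp add: p_def[abs_def] tendsto_Zfun_iff)
 have "(\<lambda>n. x (n + Suc k) / x n - (\<Prod>i<Suc k. \<beta> (n + i))) \<longlonglongrightarrow> 0 + 0 + 0"
 proof (rule Lim_transform_eventually[OF tendsto_add[OF tendsto_add[OF l1 l2] l3] always_eventually], rule allI)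
  fix n
  have "x (n + Suc k) / x n = x (n + k) / x n * (x (n + Suc k) / x (n + k))" using x by simp
  thus "(x (n + k) / x n - p n) * (x (n + Suc k) / x (n + k) - \<beta> (n + k)) + (x (n + k) / x n - p n) * \<beta> (n + k) +
    p n * (x (n + Suc k) / x (n + k) - \<beta> (n + k)) = x (n + Suc k) / x n - (\<Prod>i<Suc k. \<beta> (n + i))"
   by (simp add: p_def algebra_simps)
 qed
 moreover have "Bseq (\<lambda>n. \<Prod>i<Suc k. \<beta> (n + i))" using Bseq_mult[of "\<lambda>n. \<Prod>i<k. \<beta> (n + i)" "\<lambda>n. \<beta> (n + k)"] Suc bk by simp
 ultimately show ?case by simp
qed

lemma summable_window_contraction:
 fixes x :: "nat \<Rightarrow> complex"
 assumes th: "0 < th" "th < 1" and ev: "\<forall>\<^sub>F n in sequentially. norm (x (n + q)) \<le> th * norm (x n)"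
 shows "summable (\<lambda>n. norm (x n))"
proof -
 obtain n0 where n0: "\<And>n. n \<ge> n0 \<Longrightarrow> norm (x (n + q)) \<le> th * norm (x n)" using ev unfolding eventually_sequentially by blast
 define y where "y n = norm (x (n + n0))" for n
 have y: "y (n + q) \<le> th * y n" for n using n0[of "n + n0"] by (simp add: y_def add_ac)
 have "sum y {..<N} \<le> sum y {..<q} / (1 - th)" for N
 proof -
  have "sum y {..<N} \<le> sum y {..<N + q}" by (intro sum_mono2) (auto simp: y_def)
  also have "\<dots> = sum y {..<q} + (\<Sum>n<N. y (n + q))" by (induction N) (simp_all)
  also have "(\<Sum>n<N. y (n + q)) \<le> (\<Sum>n<N. th * y n)" by (intro sum_mono y)
  finally have "sum y {..<N} \<le> sum y {..<q} + th * sum y {..<N}" by (simp add: sum_distrib_left)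
  thus ?thesis using th by (simp add: pos_le_divide_eq algebra_simps)
 qed
 hence "summable y" by (intro summableI_nonneg_bounded) (auto simp: y_def)
 thus ?thesis unfolding y_def using summable_iff_shift[of "\<lambda>n. norm (x n)" n0] by simp
qed

context captured begin

abbreviation f' :: "nat \<Rightarrow> complex" where "f' n \<equiv> deriv f (b n)"
abbreviation g'' :: "nat \<Rightarrow> complex" where "g'' n \<equiv> c1 * deriv (deriv f) (b n)"

lemma kappa_window: "(\<Prod>i<q. g' (b (n + i))) = kappa" using tau_b[of n] by (simp add: tau_def funpow_b)

lemma Bseq_b: "Bseq (\<lambda>n. h (b n))" for h :: "complex \<Rightarrow> complex" using b_range_bound[of h] by (auto simp: Bseq_def)

lemma window_limit: "(\<lambda>n. d (n + q) / d n) \<longlonglongrightarrow> kappa"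
proof -
 obtain C where C: "0 < C" "\<And>n. norm (d (Suc n) - g' (b n) * d n) \<le> C * norm (d n) ^ 2" using d_Suc by blast
 have "(\<lambda>n. d (Suc n) / d n - g' (b n)) \<longlonglongrightarrow> 0"
 proof (rule Lim_null_comparison)
  show "(\<lambda>n. C * norm (d n)) \<longlonglongrightarrow> 0" using tendsto_mult[OF tendsto_const tendsto_norm_zero[OF d_lim]] by simp
  have "norm (d (Suc n) / d n - g' (b n)) \<le> C * norm (d n)" for n
  proof -
   have "d (Suc n) / d n - g' (b n) = (d (Suc n) - g' (b n) * d n) / d n" using d_nz[of n] by (simp add: diff_divide_distrib)
   thus ?thesis using C(2)[of n] d_nz[of n] by (simp add: norm_divide pos_divide_le_eq power2_eq_square)
  qed
  thus "\<forall>\<^sub>F n in sequentially. norm (d (Suc n) / d n - g' (b n)) \<le> C * norm (d n)" by simp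
 qed
 from conjunct1[OF window_ratio[OF d_nz this Bseq_b, of q]] show ?thesis unfolding kappa_window by (rule LIM_zero_cancel)
qed

text \<open>A lift shifts the orbit index by one, so the rescaled derivative
  \<open>(v - \<alpha>) / T\<close> is followed along diagonals. To first order its change is
  \<open>d n\<close> times the derivative at \<open>b n\<close> of the function
  \<open>g' z * \<alpha> + s * f z\<close> of \<open>z\<close>, divided by \<open>T (Suc n)\<close>;
  replacing \<open>g' (c n)\<close> by \<open>g' (b n)\<close> in the divisor costs only another
  factor \<open>d n\<close>.\<close>

lemma diagonal_step:
 "\<exists>C>0. \<forall>n \<alpha> s v v' \<alpha>'. v' = g' (c n) * v + s * f (c n) \<longrightarrow> \<alpha>' = g' (b n) * \<alpha> + s * f (b n) \<longrightarrow>
  norm ((v' - \<alpha>') / T (Suc n) - (v - \<alpha>) / T n - t n * ((g'' n * \<alpha> + f' n * s) / g' (b n)))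
   \<le> C * norm (d n) * norm (t n) * (norm \<alpha> + norm s)"
proof -
 obtain C1 where C1: "0 < C1" "\<And>n. norm (f (c n) - f (b n) - deriv f (b n) * d n) \<le> C1 * norm (d n) ^ 2"
  using holomorphic_along_orbit[OF hol_f] by blast
 obtain C2 where C2: "0 < C2" "\<And>n. norm (deriv f (c n) - deriv f (b n)) \<le> C2 * norm (d n)"
  "\<And>n. norm (deriv f (c n) - deriv f (b n) - deriv (deriv f) (b n) * d n) \<le> C2 * norm (d n) ^ 2"
  using holomorphic_along_orbit[OF hol_f'] by blast
 obtain C3 where C3: "0 < C3" "\<And>n. C3 \<le> norm (g' (c n))" using g'_c_lower by blast
 obtain C4 where C4: "0 < C4" "\<And>n. C4 \<le> norm (g' (b n))" using g'_b_lower by blast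
 obtain C5 where C5: "0 < C5" "\<And>n. norm (f' n) \<le> C5" using b_range_bound[of "deriv f"] by blast
 obtain C6 where C6: "0 < C6" "\<And>n. norm (g'' n) \<le> C6" using b_range_bound[of "\<lambda>z. c1 * deriv (deriv f) z"] by blast
 define C where "C = (norm c1 * C2 + C1) / C3 + (C5 + C6) * (norm c1 * C2 / (C3 * C4))"
 have n1: "0 < norm c1" using c1 by simp
 have C: "0 < C" unfolding C_def using C1(1) C2(1) C3(1) C4(1) C5(1) C6(1) n1
  by (intro add_pos_pos divide_pos_pos mult_pos_pos) auto
 have "norm ((v' - \<alpha>') / T (Suc n) - (v - \<alpha>) / T n - t n * ((g'' n * \<alpha> + f' n * s) / g' (b n)))
   \<le> C * norm (d n) * norm (t n) * (norm \<alpha> + norm s)"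
  if v': "v' = g' (c n) * v + s * f (c n)" and \<alpha>': "\<alpha>' = g' (b n) * \<alpha> + s * f (b n)" for n \<alpha> s v v' \<alpha>'
 proof -
  define N where "N = norm \<alpha> + norm s"
  have N: "0 \<le> N" "norm \<alpha> \<le> N" "norm s \<le> N" by (auto simp: N_def)
  define X where "X = c1 * (deriv f (c n) - f' n) * \<alpha> + s * (f (c n) - f (b n))"
  define Y where "Y = d n * (g'' n * \<alpha> + f' n * s)"
  have v1: "v' - \<alpha>' = g' (c n) * (v - \<alpha>) + X" unfolding v' \<alpha>' X_def by (simp add: algebra_simps)
  have "(v' - \<alpha>') / T (Suc n) - (v - \<alpha>) / T n = X / g' (c n) / T n"
   unfolding v1 T_Suc using g'_c_nz[of n] by (simp add: add_divide_distrib)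
  moreover have "t n * ((g'' n * \<alpha> + f' n * s) / g' (b n)) = Y / g' (b n) / T n" by (simp add: t_def Y_def)
  ultimately have e1: "(v' - \<alpha>') / T (Suc n) - (v - \<alpha>) / T n - t n * ((g'' n * \<alpha> + f' n * s) / g' (b n))
    = (X / g' (c n) - Y / g' (b n)) / T n" by (simp add: diff_divide_distrib)
  have e2: "X / g' (c n) - Y / g' (b n) = (X - Y) / g' (c n) + Y * (c1 * (f' n - deriv f (c n)) / (g' (c n) * g' (b n)))"
   using g'_c_nz[of n] g'_b_nz[of n] by (simp add: field_simps)
  have XY: "norm (X - Y) \<le> (norm c1 * C2 + C1) * (norm (d n) ^ 2 * N)"
  proof -
   have e: "X - Y = c1 * (deriv f (c n) - f' n - deriv (deriv f) (b n) * d n) * \<alpha> + s * (f (c n) - f (b n) - f' n * d n)"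
    by (simp add: X_def Y_def algebra_simps)
   have "norm (X - Y) \<le> norm c1 * (C2 * norm (d n) ^ 2) * N + N * (C1 * norm (d n) ^ 2)"
    unfolding e by (intro order_trans[OF norm_triangle_ineq] add_mono; unfold norm_mult; intro mult_mono mult_nonneg_nonneg)
     (use C2 C1 N in auto)
   thus ?thesis by (simp add: algebra_simps)
  qed
  have Yb: "norm Y \<le> norm (d n) * ((C5 + C6) * N)"
  proof -
   have "norm (g'' n * \<alpha> + f' n * s) \<le> C6 * N + C5 * N"
    by (intro order_trans[OF norm_triangle_ineq] add_mono; unfold norm_mult[of "g'' n"] norm_mult[of "f' n"]; intro mult_mono)
     (use C5 C6 N in auto)
   thus ?thesis unfolding Y_def norm_mult[of "d n"] by (intro mult_left_mono) (auto simp: algebra_simps)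
  qed
  have "norm ((X - Y) / g' (c n)) \<le> (norm c1 * C2 + C1) * (norm (d n) ^ 2 * N) / C3"
   unfolding norm_divide by (rule frac_le[OF _ XY C3(1) C3(2)]) (use C1 C2 N in simp)
  moreover have "norm (Y * (c1 * (f' n - deriv f (c n)) / (g' (c n) * g' (b n))))
    \<le> (norm (d n) * ((C5 + C6) * N)) * (norm c1 * (C2 * norm (d n)) / (C3 * C4))"
  proof -
   have "norm (c1 * (f' n - deriv f (c n)) / (g' (c n) * g' (b n))) \<le> norm c1 * (C2 * norm (d n)) / (C3 * C4)"
    unfolding norm_divide
   proof (rule frac_le)
    show "norm (c1 * (f' n - deriv f (c n))) \<le> norm c1 * (C2 * norm (d n))"
     unfolding norm_mult using C2(2)[of n] by (intro mult_left_mono) (auto simp: norm_minus_commute)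
    show "C3 * C4 \<le> norm (g' (c n) * g' (b n))" unfolding norm_mult[of "g' (c n)"]
     using C3 C4 by (intro mult_mono) auto
   qed (use C2 C3 C4 n1 in auto)
   thus ?thesis unfolding norm_mult[of Y] using Yb C5 C6 N by (intro mult_mono) auto
  qed
  ultimately have "norm (X / g' (c n) - Y / g' (b n)) \<le> (norm c1 * C2 + C1) * (norm (d n) ^ 2 * N) / C3 +
    (norm (d n) * ((C5 + C6) * N)) * (norm c1 * (C2 * norm (d n)) / (C3 * C4))"
   unfolding e2 by (intro order_trans[OF norm_triangle_ineq] add_mono)
  hence le: "norm (X / g' (c n) - Y / g' (b n)) \<le> C * norm (d n) ^ 2 * N"
   unfolding C_def by (simp add: algebra_simps power2_eq_square add_divide_distrib)
  have "norm ((X / g' (c n) - Y / g' (b n)) / T n) \<le> C * norm (d n) ^ 2 * N / norm (T n)"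
   unfolding norm_divide[of _ "T n"] by (rule divide_right_mono[OF le]) simp
  also have "\<dots> = C * norm (d n) * norm (t n) * N" by (simp add: t_def norm_divide power2_eq_square)
  finally show ?thesis unfolding e1 N_def .
 qed
 thus ?thesis using C by (intro exI[of _ C]) simp
qed

end

section \<open>Attracting cycles\<close>

context captured begin

lemma t_converges:
 assumes sd: "summable (\<lambda>n. norm (d n))"
 obtains t0 where "t0 \<noteq> 0" "t \<longlonglongrightarrow> t0"
proof -
 obtain C where C: "0 < C" "\<And>n. norm (t (Suc n) - t n) \<le> C * norm (d n) * norm (t n)" using t_ratio by blast
 define p where "p n = t (Suc n) / t n" for n
 have pn: "norm (p n - 1) \<le> C * norm (d n)" for n
 proof -
  have "p n - 1 = (t (Suc n) - t n) / t n" using t_nz[of n] by (simp add: p_def diff_divide_distrib)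
  thus ?thesis using C(2)[of n] t_nz[of n] by (simp add: norm_divide pos_divide_le_eq)
 qed
 have "summable (\<lambda>n. norm (p n - 1))"
  by (rule summable_comparison_test'[OF summable_mult[OF sd, of C]]) (use pn in simp)
 hence cp: "convergent_prod p" by (intro abs_convergent_prod_imp_convergent_prod summable_imp_abs_convergent_prod)
 have pnz: "p n \<noteq> 0" for n using t_nz by (simp add: p_def)
 have eq: "t n = t 0 * (\<Prod>i<n. p i)" for n
 proof (induction n)
  case (Suc n)
  have "t (Suc n) = t n * p n" using t_nz[of n] by (simp add: p_def)
  thus ?case using Suc by simp
 qed simp
 have "(\<lambda>n. \<Prod>i<Suc n. p i) \<longlonglongrightarrow> prodinf p" using convergent_prod_LIMSEQ[OF cp] by (simp add: lessThan_Suc_atMost)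
 hence "(\<lambda>n. \<Prod>i<n. p i) \<longlonglongrightarrow> prodinf p" by (rule LIMSEQ_imp_Suc)
 hence "(\<lambda>n. t 0 * (\<Prod>i<n. p i)) \<longlonglongrightarrow> t 0 * prodinf p" by (rule tendsto_mult_left)
 moreover have "(\<lambda>n. t 0 * (\<Prod>i<n. p i)) = t" by (rule ext) (rule eq[symmetric])
 ultimately have "t \<longlonglongrightarrow> t 0 * prodinf p" by simp
 moreover have "t 0 * prodinf p \<noteq> 0" using t_nz prodinf_nonzero[OF cp pnz] by simp
 ultimately show ?thesis using that by blast
qed

text \<open>Summation by parts with a periodic \<open>\<eta>\<close> solving
  \<open>g'' n / g' (b n) = \<eta> n - g' (b n) * \<eta> (Suc n)\<close> turns the transversality
  sum into the sum of \<open>\<sigma>\<close> over one period. If it vanishes, the first-order drift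
  of the rescaled derivatives over a period comes from \<open>H (Suc k) - H k\<close>, so the
  corrected quantity \<open>F\<close> is nearly constant on diagonals, with summable error. At orbit
  index 0 it is bounded independently of \<open>K\<close>, whereas on the initial motion it tends to
  \<open>K * q * t0\<close>.\<close>

lemma attracting_transversal:
 assumes attr: "norm kappa < 1"
  and A: "\<And>n. A (Suc n) = g' (b n) * A n + f (b n)" "\<And>n. A (n + q) = A n"
 shows "(\<Sum>j<q. (f' j + g'' j * A j) / g' (b j)) \<noteq> 0"
proof
 assume zero: "(\<Sum>j<q. (f' j + g'' j * A j) / g' (b j)) = 0"
 have gnz: "g' (b n) \<noteq> 0" for n by (rule g'_b_nz)
 have perb: "h (b (n + q)) = h (b n)" for h :: "complex \<Rightarrow> complex" and n by (simp add: b_per)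
 have "\<exists>\<eta>. (\<forall>n. \<eta> (Suc n) = inverse (g' (b n)) * \<eta> n + - (g'' n / g' (b n)) / g' (b n)) \<and> (\<forall>n. \<eta> (n + q) = \<eta> n)"
 proof (rule cyclic_linear_solve[of "\<lambda>n. inverse (g' (b n))" q "\<lambda>n. - (g'' n / g' (b n)) / g' (b n)"])
  have "(\<Prod>i<q. inverse (g' (b i))) = inverse kappa" by (simp only: kappa_def prod_inversef[symmetric] o_def)
  moreover have "kappa \<noteq> 1" using attr by auto
  ultimately show "(\<Prod>i<q. inverse (g' (b i))) \<noteq> 1" by simp
 qed (auto simp: b_per)
 then obtain \<eta> where \<eta>: "\<And>n. \<eta> (Suc n) = inverse (g' (b n)) * \<eta> n + - (g'' n / g' (b n)) / g' (b n)"
  and \<eta>p: "\<And>n. \<eta> (n + q) = \<eta> n" by blast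
 have g''_eta: "g'' n / g' (b n) = \<eta> n - g' (b n) * \<eta> (Suc n)" for n
  unfolding \<eta> using gnz[of n] by (simp add: field_simps)
 define \<sigma> where "\<sigma> n = f' n / g' (b n) + \<eta> (Suc n) * f (b n)" for n
 have "(\<Sum>j<q. \<sigma> j) = 0"
 proof -
  have "(f' j + g'' j * A j) / g' (b j) = \<sigma> j + (\<eta> j * A j - \<eta> (Suc j) * A (Suc j))" for j
  proof -
   have "(f' j + g'' j * A j) / g' (b j) = f' j / g' (b j) + (g'' j / g' (b j)) * A j" by (simp add: add_divide_distrib)
   thus ?thesis unfolding g''_eta A(1) \<sigma>_def by (simp add: algebra_simps)
  qed
  hence "(\<Sum>j<q. (f' j + g'' j * A j) / g' (b j)) = (\<Sum>j<q. \<sigma> j) + (\<Sum>j<q. \<eta> j * A j - \<eta> (Suc j) * A (Suc j))"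
   by (simp add: sum.distrib)
  also have "(\<Sum>j<q. \<eta> j * A j - \<eta> (Suc j) * A (Suc j)) = \<eta> 0 * A 0 - \<eta> q * A q" by (rule sum_lessThan_telescope')
  finally show ?thesis using zero \<eta>p[of 0] A(2)[of 0] by simp
 qed
 hence \<sigma>0: "(\<Sum>j<q. \<sigma> (n + j)) = 0" for n
  using periodic_window_sum[of \<sigma> q n] by (simp add: \<sigma>_def \<eta>p[of "Suc _", simplified] b_per)
 define th where "th = (1 + norm kappa) / 2"
 have th: "norm kappa < th" "th < 1" "0 < th" using attr by (auto simp: th_def intro: add_pos_nonneg)
 have "\<forall>\<^sub>F n in sequentially. norm (d (n + q) / d n) < th"
  by (rule order_tendstoD(2)[OF tendsto_norm[OF window_limit] th(1)])
 hence "\<forall>\<^sub>F n in sequentially. norm (d (n + q)) \<le> th * norm (d n)"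
  by eventually_elim (simp add: norm_divide d_nz pos_divide_less_eq)
 from summable_window_contraction[OF th(3,2) this] have sd: "summable (\<lambda>n. norm (d n))" .
 obtain t0 where t0: "t0 \<noteq> 0" "t \<longlonglongrightarrow> t0" by (rule t_converges[OF sd])
 have "Bseq t" using t0(2) convergentI convergent_imp_Bseq by blast
 then obtain Bt where Bt: "0 < Bt" "\<And>n. norm (t n) \<le> Bt" by (elim BseqE) blast
 obtain C1 where C1: "0 < C1" "\<And>n. norm (t (Suc n) - t n) \<le> C1 * norm (d n) * norm (t n)" using t_ratio by blast
 obtain C2 where C2: "0 < C2" and step: "\<And>n \<alpha> s v v' \<alpha>'. v' = g' (c n) * v + s * f (c n) \<Longrightarrow> \<alpha>' = g' (b n) * \<alpha> + s * f (b n) \<Longrightarrow>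
  norm ((v' - \<alpha>') / T (Suc n) - (v - \<alpha>) / T n - t n * ((g'' n * \<alpha> + f' n * s) / g' (b n)))
   \<le> C2 * norm (d n) * norm (t n) * (norm \<alpha> + norm s)" using diagonal_step by blast
 obtain C3 where C3: "0 < C3" "\<And>n. norm (g'' n / g' (b n)) \<le> C3"
  using b_range_bound[of "\<lambda>z. c1 * deriv (deriv f) z / g' z"] by blast
 obtain C4 where C4: "0 < C4" "\<And>n. norm (f' n / g' (b n)) \<le> C4"
  using b_range_bound[of "\<lambda>z. deriv f z / g' z"] by blast
 define Be where "Be = (\<Sum>j<q. norm (\<eta> j))"
 have Be: "0 \<le> Be" by (simp add: Be_def sum_nonneg)
 \<comment> \<open>The drift terms cancel only over a full period, so all estimates are made for
   windows of length \<open>q\<close>.\<close>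
 define e where "e n = (\<Sum>j<q. norm (d (n + j)))" for n
 have e: "0 \<le> e n" "norm (d (n + j)) \<le> e n" if "j < q" for n j
  unfolding e_def by (rule sum_nonneg, simp, rule member_le_sum) (use that in auto)
 have e0: "0 \<le> e n" for n unfolding e_def by (rule sum_nonneg) simp
 have se: "summable e" unfolding e_def by (rule summable_sum) (rule summable_iff_shift[of "\<lambda>n. norm (d n)", THEN iffD2, OF sd])
 have elim0: "e \<longlonglongrightarrow> 0" by (rule summable_LIMSEQ_zero[OF se])
 have tdiff: "norm (t (n + j) - t n) \<le> C1 * Bt * e n" if j: "j \<le> q" for n j
 proof -
  have "norm (t (n + j) - t n) \<le> C1 * Bt * (\<Sum>i<j. norm (d (n + i)))"
  proof (induction j)
   case (Suc j)
   have "C1 * norm (d (n + j)) * norm (t (n + j)) \<le> C1 * norm (d (n + j)) * Bt"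
    using C1(1) Bt(2) by (intro mult_left_mono) auto
   hence "norm (t (n + Suc j) - t (n + j)) \<le> C1 * Bt * norm (d (n + j))" using C1(2)[of "n + j"] by (simp add: mult_ac)
   moreover have "norm (t (n + Suc j) - t n) \<le> norm (t (n + Suc j) - t (n + j)) + norm (t (n + j) - t n)"
    using norm_triangle_ineq[of "t (n + Suc j) - t (n + j)" "t (n + j) - t n"] by simp
   ultimately show ?case using Suc by (simp add: distrib_left)
  qed simp
  also have "\<dots> \<le> C1 * Bt * e n" unfolding e_def using C1(1) Bt(1) j by (intro mult_left_mono sum_mono2) auto
  finally show ?thesis .
 qed
 define C5 where "C5 = C1 * Bt * Be + real q * (C1 * Bt * (C3 + C4)) + real q * (C2 * Bt)"
 have C5: "0 \<le> C5" unfolding C5_def using C1(1) Bt(1) C2 C3(1) C4(1) Be by simp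
 obtain B where B: "0 < B" and lifts: "\<And>K. 0 \<le> K \<Longrightarrow> \<exists>v \<alpha> n0. large_jets B K n0 v \<alpha>" by (rule large_lifts) (rule that)
 define C6 where "C6 = (\<Sum>j<q. 2 * B / norm (T j)) + Bt * (Be * B)"
 define C7 where "C7 = C6 + C5 * (2 * B) * suminf e"
 have bound: "K * (real q * norm t0) \<le> C7" if K: "0 \<le> K" for K
 proof -
  obtain v \<alpha> n0 where v: "\<And>k n. v k (Suc n) = g' (c n) * v (Suc k) n + v k 0 * f (c n)"
   and \<alpha>: "\<And>k j. \<alpha> k (Suc j) = g' (b j) * \<alpha> (Suc k) j + v k 0 * f (b j)"
   and \<alpha>p: "\<And>k j. \<alpha> k (j + q) = \<alpha> k j" and vB: "\<And>k n. norm (v (Suc k) n) \<le> B" and \<alpha>B: "\<And>k j. norm (\<alpha> k j) \<le> B"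
   and \<alpha>0: "\<And>j. \<alpha> 0 j = 0" and v0: "\<And>n. n \<ge> n0 \<Longrightarrow> v 0 n = of_real K * d n" using lifts[OF K] unfolding large_jets_def by blast
  define E where "E n k = (v k n - \<alpha> k n) / T n" for n k
  define S where "S n k = (\<Sum>j<q. E (n + j) k)" for n k
  define H where "H k = (\<Sum>j<q. \<eta> j * \<alpha> k j)" for k
  define F where "F n k = S n k + t n * H k" for n k
  define \<Phi> where "\<Phi> n k = (g'' n * \<alpha> (Suc k) n + f' n * v k 0) / g' (b n)" for n k
  have \<Phi>eq: "\<Phi> n k = \<eta> n * \<alpha> (Suc k) n - \<eta> (Suc n) * \<alpha> k (Suc n) + v k 0 * \<sigma> n" for n k
  proof -
   have "\<Phi> n k = (g'' n / g' (b n)) * \<alpha> (Suc k) n + f' n / g' (b n) * v k 0" by (simp add: \<Phi>_def add_divide_distrib)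
   thus ?thesis unfolding g''_eta \<alpha> \<sigma>_def by (simp add: algebra_simps)
  qed
  have Hw: "(\<Sum>j<q. \<eta> (n + j) * \<alpha> k (n + j)) = H k" for n k
   unfolding H_def by (rule periodic_window_sum[of "\<lambda>j. \<eta> j * \<alpha> k j"]) (simp add: \<eta>p \<alpha>p)
  have \<Phi>sum: "(\<Sum>j<q. \<Phi> (n + j) k) = H (Suc k) - H k" for n k
  proof -
   have "(\<Sum>j<q. \<Phi> (n + j) k) = (\<Sum>j<q. \<eta> (n + j) * \<alpha> (Suc k) (n + j)) -
     (\<Sum>j<q. \<eta> (Suc n + j) * \<alpha> k (Suc n + j)) + v k 0 * (\<Sum>j<q. \<sigma> (n + j))"
    unfolding \<Phi>eq by (simp add: sum.distrib sum_subtractf sum_distrib_left)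
   thus ?thesis unfolding Hw \<sigma>0 by simp
  qed
  have HB: "norm (H k) \<le> Be * B" for k
  proof -
   have "norm (H k) \<le> (\<Sum>j<q. norm (\<eta> j) * B)"
    unfolding H_def by (rule sum_norm_le) (use \<alpha>B in \<open>simp add: norm_mult mult_left_mono\<close>)
   thus ?thesis by (simp add: Be_def sum_distrib_right)
  qed
  have Fstep: "norm (F (Suc n) k - F n (Suc k)) \<le> C5 * e n * (B + norm (v k 0))" for n k
  proof -
   define N where "N = B + norm (v k 0)"
   have N: "0 \<le> N" "B \<le> N" "norm (v k 0) \<le> N" "norm (\<alpha> (Suc k) j) + norm (v k 0) \<le> N" for j
    using B \<alpha>B[of "Suc k" j] by (auto simp: N_def)
   define r where "r m = E (Suc m) k - E m (Suc k) - t m * \<Phi> m k" for m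
   have rb: "norm (r (n + j)) \<le> C2 * Bt * e n * N" if "j < q" for j
   proof -
    have "norm (r (n + j)) \<le> C2 * norm (d (n + j)) * norm (t (n + j)) * (norm (\<alpha> (Suc k) (n + j)) + norm (v k 0))"
     unfolding r_def E_def \<Phi>_def by (rule step[OF v \<alpha>])
    also have "\<dots> \<le> C2 * e n * Bt * N"
     using C2 e(2)[OF that] Bt N(4) e0 by (intro mult_mono mult_nonneg_nonneg) auto
    finally show ?thesis by (simp add: mult_ac)
   qed
   have \<Phi>b: "norm (\<Phi> m k) \<le> (C3 + C4) * N" for m
   proof -
    have "\<Phi> m k = (g'' m / g' (b m)) * \<alpha> (Suc k) m + f' m / g' (b m) * v k 0" by (simp add: \<Phi>_def add_divide_distrib)
    hence "norm (\<Phi> m k) \<le> norm (g'' m / g' (b m)) * norm (\<alpha> (Suc k) m) + norm (f' m / g' (b m)) * norm (v k 0)"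
     by (metis norm_mult norm_triangle_ineq)
    also have "\<dots> \<le> C3 * N + C4 * N" using C3 C4 N order_trans[OF \<alpha>B N(2)] by (intro add_mono mult_mono) auto
    finally show ?thesis by (simp add: distrib_right)
   qed
   have "F (Suc n) k - F n (Suc k) = (\<Sum>j<q. E (Suc (n + j)) k - E (n + j) (Suc k)) + t (Suc n) * H k - t n * H (Suc k)"
    by (simp add: F_def S_def sum_subtractf)
   also have "(\<Sum>j<q. E (Suc (n + j)) k - E (n + j) (Suc k)) =
     (\<Sum>j<q. r (n + j)) + (\<Sum>j<q. (t (n + j) - t n) * \<Phi> (n + j) k) + t n * (\<Sum>j<q. \<Phi> (n + j) k)"
    by (simp add: r_def sum.distrib[symmetric] sum_distrib_left algebra_simps)
   finally have eq: "F (Suc n) k - F n (Suc k) = (t (Suc n) - t n) * H k +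
     ((\<Sum>j<q. (t (n + j) - t n) * \<Phi> (n + j) k) + (\<Sum>j<q. r (n + j)))"
    unfolding \<Phi>sum by (simp add: algebra_simps)
   have "norm ((t (Suc n) - t n) * H k) \<le> C1 * Bt * e n * (Be * N)"
    unfolding norm_mult using tdiff[of 1 n] q_pos HB[of k] mult_left_mono[OF N(2) Be] C1(1) Bt(1) e0[of n]
    by (intro mult_mono) auto
   moreover have "norm (\<Sum>j<q. (t (n + j) - t n) * \<Phi> (n + j) k) \<le> real q * (C1 * Bt * e n * ((C3 + C4) * N))"
   proof -
    have "norm (\<Sum>j<q. (t (n + j) - t n) * \<Phi> (n + j) k) \<le> (\<Sum>j<q. C1 * Bt * e n * ((C3 + C4) * N))"
    proof (rule sum_norm_le)
     fix j assume "j \<in> {..<q}"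
     thus "norm ((t (n + j) - t n) * \<Phi> (n + j) k) \<le> C1 * Bt * e n * ((C3 + C4) * N)"
      unfolding norm_mult using tdiff[of j n] \<Phi>b[of "n + j"] C1(1) Bt(1) e0[of n] by (intro mult_mono) auto
    qed
    thus ?thesis by simp
   qed
   moreover have "norm (\<Sum>j<q. r (n + j)) \<le> real q * (C2 * Bt * e n * N)"
    using sum_norm_le[of "{..<q}" "\<lambda>j. r (n + j)" "\<lambda>j. C2 * Bt * e n * N"] rb by simp
   ultimately have "norm (F (Suc n) k - F n (Suc k)) \<le> C1 * Bt * e n * (Be * N) +
     (real q * (C1 * Bt * e n * ((C3 + C4) * N)) + real q * (C2 * Bt * e n * N))"
    unfolding eq by (intro order_trans[OF norm_triangle_ineq] add_mono)
   thus ?thesis unfolding C5_def N_def[symmetric] by (simp add: algebra_simps)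
  qed
  \<comment> \<open>Only levels \<open>Suc k\<close> occur, where \<open>v\<close> is bounded by
    \<open>B\<close> independently of \<open>K\<close>.\<close>
  have Fdiag: "norm (F N (Suc k) - F 0 (N + Suc k)) \<le> C5 * (2 * B) * (\<Sum>n<N. e n)" for N k
  proof (induction N arbitrary: k)
   case (Suc N)
   have "C5 * e N * (B + norm (v (Suc k) 0)) \<le> C5 * e N * (2 * B)"
    using C5 e0[of N] vB[of k 0] by (intro mult_left_mono) auto
   hence "norm (F (Suc N) (Suc k) - F N (Suc (Suc k))) \<le> C5 * (2 * B) * e N"
    using Fstep[of N "Suc k"] by (simp add: mult_ac)
   moreover have "norm (F N (Suc (Suc k)) - F 0 (N + Suc (Suc k))) \<le> C5 * (2 * B) * (\<Sum>n<N. e n)" by (rule Suc)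
   moreover have "norm (F (Suc N) (Suc k) - F 0 (Suc N + Suc k)) \<le>
     norm (F (Suc N) (Suc k) - F N (Suc (Suc k))) + norm (F N (Suc (Suc k)) - F 0 (N + Suc (Suc k)))"
    using norm_triangle_ineq[of "F (Suc N) (Suc k) - F N (Suc (Suc k))" "F N (Suc (Suc k)) - F 0 (N + Suc (Suc k))"]
    by simp
   ultimately show ?case by (simp add: distrib_left)
  qed simp
  have F0: "norm (F 0 (Suc k)) \<le> C6" for k
  proof -
   have "norm (S 0 (Suc k)) \<le> (\<Sum>j<q. 2 * B / norm (T j))" unfolding S_def
   proof (rule sum_norm_le)
    fix j assume "j \<in> {..<q}"
    have "norm (v (Suc k) j - \<alpha> (Suc k) j) \<le> 2 * B"
     using norm_triangle_ineq4[of "v (Suc k) j" "\<alpha> (Suc k) j"] vB[of k j] \<alpha>B[of "Suc k" j] by linarith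
    thus "norm (E (0 + j) (Suc k)) \<le> 2 * B / norm (T j)"
     unfolding E_def norm_divide by (simp add: divide_right_mono)
   qed
   moreover have "norm (t 0 * H (Suc k)) \<le> Bt * (Be * B)" unfolding norm_mult using Bt HB by (intro mult_mono) auto
   ultimately show ?thesis unfolding F_def C6_def by (intro order_trans[OF norm_triangle_ineq] add_mono)
  qed
  \<comment> \<open>The last step, to level 0, involves \<open>v 0 0\<close>, for which there is no
    bound independent of \<open>K\<close>; its error carries the factor \<open>e N\<close> and
    disappears as \<open>N\<close> tends to infinity.\<close>
  have up: "norm (S (Suc N) 0) \<le> C7 + C5 * e N * (B + norm (v 0 0))" for N
  proof -
   have "S (Suc N) 0 = F (Suc N) 0" by (simp add: F_def H_def \<alpha>0)
   hence "norm (S (Suc N) 0) \<le> norm (F (Suc N) 0 - F N (Suc 0)) + norm (F N (Suc 0) - F 0 (Suc N)) + norm (F 0 (Suc N))"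
    using norm_triangle_ineq[of "F (Suc N) 0 - F N (Suc 0)" "F N (Suc 0)"]
     norm_triangle_ineq[of "F N (Suc 0) - F 0 (Suc N)" "F 0 (Suc N)"] by simp
   moreover have "(\<Sum>n<N. e n) \<le> suminf e" by (rule sum_le_suminf[OF se]) (use e0 in auto)
   hence "C5 * (2 * B) * (\<Sum>n<N. e n) \<le> C5 * (2 * B) * suminf e" using C5 B by (intro mult_left_mono) auto
   ultimately show ?thesis using Fstep[of N 0] Fdiag[of N 0] F0[of N]
    unfolding C7_def add_Suc_right add_0_right by linarith
  qed
  have Slim: "(\<lambda>N. S (Suc N) 0) \<longlonglongrightarrow> (\<Sum>j<q. of_real K * t0)" unfolding S_def
  proof (rule tendsto_sum)
   fix j
   have "(\<lambda>N. of_real K * t (N + Suc j)) \<longlonglongrightarrow> of_real K * t0"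
    by (intro tendsto_mult tendsto_const LIMSEQ_ignore_initial_segment t0(2))
   moreover have "\<forall>\<^sub>F N in sequentially. of_real K * t (N + Suc j) = E (Suc N + j) 0"
    using eventually_ge_at_top[of n0] by eventually_elim (simp add: E_def \<alpha>0 v0 t_def)
   ultimately show "(\<lambda>N. E (Suc N + j) 0) \<longlonglongrightarrow> of_real K * t0" by (rule Lim_transform_eventually)
  qed
  have "norm (\<Sum>j<q. of_real K * t0) \<le> C7 + C5 * 0 * (B + norm (v 0 0))"
  proof (rule LIMSEQ_le[OF tendsto_norm[OF Slim]])
   show "(\<lambda>N. C7 + C5 * e N * (B + norm (v 0 0))) \<longlonglongrightarrow> C7 + C5 * 0 * (B + norm (v 0 0))"
    by (intro tendsto_intros elim0)
   show "\<exists>N. \<forall>n\<ge>N. norm (S (Suc n) 0) \<le> C7 + C5 * e n * (B + norm (v 0 0))" using up by blast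
  qed
  thus ?thesis using K by (simp add: norm_mult mult_ac)
 qed
 have pos: "0 < real q * norm t0" using q_pos t0 by simp
 have "(\<bar>C7\<bar> + 1) / (real q * norm t0) * (real q * norm t0) \<le> C7" by (rule bound) (simp)
 thus False using q_pos t0(1) by simp
qed

end

section \<open>Parabolic cycles with multiplier different from 1\<close>

lemma tendsto_of_nat_quotient:
 assumes N: "0 < (N::nat)"
 shows "(\<lambda>k. of_nat k / of_nat (s + N * k)) \<longlonglongrightarrow> (1 / of_nat N :: complex)"
proof -
 have "(\<lambda>k. of_nat s * (1 / of_nat k) + of_nat N) \<longlonglongrightarrow> of_nat s * 0 + (of_nat N :: complex)"
  by (intro tendsto_intros lim_1_over_n)
 hence "(\<lambda>k. 1 / (of_nat s * (1 / of_nat k) + of_nat N)) \<longlonglongrightarrow> 1 / (of_nat N :: complex)"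
  using N by (intro tendsto_divide tendsto_const) simp_all
 moreover have "\<forall>\<^sub>F k in sequentially. 1 / (of_nat s * (1 / of_nat k) + of_nat N) = (of_nat k / of_nat (s + N * k) :: complex)"
  using eventually_gt_at_top[of 0]
 proof eventually_elim
  case (elim k)
  have "(of_nat s * (1 / of_nat k) + of_nat N :: complex) = of_nat (s + N * k) / of_nat k" using elim by (simp add: field_simps)
  thus ?case by simp
 qed
 ultimately show ?thesis by (rule Lim_transform_eventually)
qed

lemma linear_bound_of_limit:
 fixes v :: "nat \<Rightarrow> complex"
 assumes "(\<lambda>k. v k / of_nat k) \<longlonglongrightarrow> L"
 shows "\<exists>V>0. \<forall>k. norm (v k) \<le> V * (real k + 1)"
proof -
 have "Bseq (\<lambda>k. v k / of_nat k)" using assms convergentI convergent_imp_Bseq by blast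
 then obtain V where V: "0 < V" "\<And>k. norm (v k / of_nat k) \<le> V" by (elim BseqE) blast
 have "norm (v k) \<le> (V + norm (v 0)) * (real k + 1)" for k
 proof (cases "k = 0")
  case False
  hence "norm (v k) \<le> V * real k" using V(2)[of k] by (simp add: norm_divide pos_divide_le_eq)
  also have "\<dots> \<le> (V + norm (v 0)) * (real k + 1)" using V(1) by (intro mult_mono) auto
  finally show ?thesis .
 qed (use V in simp)
 thus ?thesis using V(1) by (intro exI[of _ "V + norm (v 0)"]) (simp add: add_pos_nonneg)
qed

lemma bounded_along_residues:
 fixes A :: "nat \<Rightarrow> real"
 assumes N: "0 < N" and A: "\<And>n. 0 \<le> A n" and step: "\<And>n. A (Suc n) \<le> C * A n" and C: "0 \<le> C"
  and bd: "\<And>k. A (i + N * k) \<le> K"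
 shows "\<exists>B>0. \<forall>n. A n \<le> B"
proof -
 have s: "A (n + s) \<le> C ^ s * A n" for n s
 proof (induction s)
  case (Suc s)
  have "A (n + Suc s) \<le> C * A (n + s)" using step[of "n + s"] by simp
  also have "\<dots> \<le> C * (C ^ s * A n)" by (rule mult_left_mono[OF Suc C])
  finally show ?case by simp
 qed simp
 define C' where "C' = (\<Sum>s<N. C ^ s)"
 have ev: "A n \<le> (C' * \<bar>K\<bar>) * 1" if n: "i \<le> n" for n
 proof -
  define r where "r = (n - i) mod N"
  have "n = (i + N * ((n - i) div N)) + r" using n by (simp add: r_def)
  hence "A n \<le> C ^ r * A (i + N * ((n - i) div N))" using s by metis
  also have "\<dots> \<le> C ^ r * \<bar>K\<bar>" using order_trans[OF bd abs_ge_self] C by (intro mult_left_mono) auto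
  also have "\<dots> \<le> C' * \<bar>K\<bar>"
  proof (rule mult_right_mono)
   show "C ^ r \<le> C'" unfolding C'_def by (rule member_le_sum) (use N C in \<open>auto simp: r_def\<close>)
  qed simp
  finally show ?thesis by simp
 qed
 have "\<exists>B>0. \<forall>n. A n \<le> B * 1" by (rule eventually_bound_all[of A "C' * \<bar>K\<bar>" "\<lambda>n. 1"])
   (use ev A in \<open>auto simp: eventually_sequentially\<close>)
 thus ?thesis by simp
qed

context captured begin

lemma T_add: "T (i + n) = T i * tau (c i) n" by (rule tau_add)

lemma t_shift_lim:
 assumes "(\<lambda>k. t (i + N * k) / of_nat k) \<longlonglongrightarrow> L" "0 < N"
 shows "(\<lambda>k. t (i + s + N * k) / of_nat k) \<longlonglongrightarrow> L"
proof (induction s)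
 case (Suc s)
 have "filterlim (\<lambda>k. i + s + N * k) at_top sequentially"
  using assms(2) by (intro filterlim_subseq strict_monoI) simp
 from filterlim_compose[OF t_ratio_lim this] have "(\<lambda>k. t (Suc (i + s + N * k)) / t (i + s + N * k)) \<longlonglongrightarrow> 1" .
 from tendsto_mult[OF this Suc]
 have "(\<lambda>k. t (Suc (i + s + N * k)) / t (i + s + N * k) * (t (i + s + N * k) / of_nat k)) \<longlonglongrightarrow> L" by simp
 thus ?case using t_nz by simp
qed (use assms in simp)

text \<open>On the progression \<open>i + N * k\<close> the displacement is the petal point
  \<open>p k\<close> and the derivative behaves like \<open>p k / v k\<close>; so \<open>t\<close>
  behaves like \<open>v k\<close>, that is, linearly in \<open>k\<close>, while
  \<open>norm (p k) ^ m\<close> is a constant over \<open>norm (v k)\<close>. The other residues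
  follow, since one step changes \<open>t\<close> by a factor tending to 1 and
  \<open>norm (d n)\<close> by a factor bounded above and below.\<close>

lemma parabolic_growth:
 assumes pa: "parabolic_asymptotics N m b" and N: "0 < N" and m: "0 < m"
 shows "\<exists>L. L \<noteq> 0 \<and> (\<lambda>n. t n / of_nat n) \<longlonglongrightarrow> L"
  and "\<exists>C>0. \<forall>n. norm (d n) ^ m * (real n + 1) \<le> C"
  and "\<exists>C>0. \<forall>n. 1 \<le> C * (norm (d n) * (real n + 1))"
proof -
 obtain i th v where th: "th \<noteq> 0" and cv: "\<And>k. c (i + N * k) = b (i + N * k) + petal m th (v k)"
  and Rv: "\<And>k. 3/4 * real k + 1 \<le> Re (v k)" and vlim: "(\<lambda>k. v k / of_nat k) \<longlonglongrightarrow> 1"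
  and L: "\<exists>L. L \<noteq> 0 \<and> (\<lambda>k. tau (c i) (N * k) * v k / petal m th (v k)) \<longlonglongrightarrow> L"
  using pa unfolding parabolic_asymptotics_def by (elim exE conjE) blast
 define p where "p k = petal m th (v k)" for k
 have pnz: "p k \<noteq> 0" for k using petal_nz[OF th] by (simp add: p_def)
 have dk: "d (i + N * k) = p k" for k by (simp add: d_def cv p_def)
 have nv: "3/4 * real k + 1 \<le> norm (v k)" for k using Rv[of k] complex_Re_le_cmod[of "v k"] by linarith
 have vnz: "v k \<noteq> 0" for k using nv[of k] by auto
 obtain L where L: "L \<noteq> 0" "(\<lambda>k. tau (c i) (N * k) * v k / p k) \<longlonglongrightarrow> L" using L unfolding p_def by blast
 define L1 where "L1 = inverse L / T i"
 have L1: "L1 \<noteq> 0" using L(1) T_nz[of i] by (simp add: L1_def)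
 have "(\<lambda>k. inverse (tau (c i) (N * k) * v k / p k) * (v k / of_nat k) / T i) \<longlonglongrightarrow> inverse L * 1 / T i"
  by (intro tendsto_divide tendsto_mult tendsto_inverse L vlim tendsto_const T_nz)
 moreover have "inverse (tau (c i) (N * k) * v k / p k) * (v k / of_nat k) / T i = t (i + N * k) / of_nat k" for k
  using vnz[of k] by (simp add: t_def dk T_add)
 ultimately have base: "(\<lambda>k. t (i + N * k) / of_nat k) \<longlonglongrightarrow> L1" by (simp add: L1_def)
 have "(\<lambda>n. t (i + n) / of_nat (i + n)) \<longlonglongrightarrow> L1 * (1 / of_nat N)"
 proof (rule tendsto_by_residues[OF N])
  fix s assume "s < N"
  have "(\<lambda>k. t (i + s + N * k) / of_nat k * (of_nat k / of_nat ((i + s) + N * k))) \<longlonglongrightarrow> L1 * (1 / of_nat N)"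
   by (intro tendsto_mult t_shift_lim[OF base N] tendsto_of_nat_quotient N)
  moreover have "\<forall>\<^sub>F k in sequentially. t (i + s + N * k) / of_nat k * (of_nat k / of_nat ((i + s) + N * k)) =
    t (i + (N * k + s)) / of_nat (i + (N * k + s))"
   using eventually_gt_at_top[of 0] by eventually_elim (simp add: add_ac)
  ultimately show "(\<lambda>k. t (i + (N * k + s)) / of_nat (i + (N * k + s))) \<longlonglongrightarrow> L1 * (1 / of_nat N)"
   by (rule Lim_transform_eventually)
 qed
 hence "(\<lambda>n. t (n + i) / of_nat (n + i)) \<longlonglongrightarrow> L1 * (1 / of_nat N)" by (simp add: add.commute)
 hence "(\<lambda>n. t n / of_nat n) \<longlonglongrightarrow> L1 * (1 / of_nat N)" by (rule LIMSEQ_offset)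
 moreover have "L1 * (1 / of_nat N) \<noteq> 0" using L1 N by simp
 ultimately show "\<exists>L. L \<noteq> 0 \<and> (\<lambda>n. t n / of_nat n) \<longlonglongrightarrow> L" by blast
 obtain C where C: "0 < C" "\<And>n. norm (d (Suc n)) \<le> C * norm (d n)" using d_Suc_upper by blast
 define a where "a = norm th ^ m"
 have a: "0 < a" using th by (simp add: a_def)
 have pm: "norm (p k) ^ m = a / norm (v k)" for k unfolding p_def a_def by (rule norm_petal_power[OF m vnz])
 have n2: "real (Suc n) + 1 \<le> 2 * (real n + 1)" for n by simp
 show "\<exists>C>0. \<forall>n. norm (d n) ^ m * (real n + 1) \<le> C"
 proof (rule bounded_along_residues[OF N, of _ "C ^ m * 2" i "a * (4/3 * real N + real i + 1)"])
  show "norm (d (Suc n)) ^ m * (real (Suc n) + 1) \<le> C ^ m * 2 * (norm (d n) ^ m * (real n + 1))" for n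
  proof -
   have "norm (d (Suc n)) ^ m \<le> (C * norm (d n)) ^ m" by (rule power_mono[OF C(2)]) simp
   hence "norm (d (Suc n)) ^ m * (real (Suc n) + 1) \<le> (C * norm (d n)) ^ m * (2 * (real n + 1))"
    using C(1) by (intro mult_mono) auto
   thus ?thesis by (simp only: power_mult_distrib mult_ac)
  qed
  fix k
  have eq: "norm (d (i + N * k)) ^ m * (real (i + N * k) + 1) = a * ((real i + real N * real k + 1) / norm (v k))"
   by (simp add: dk pm)
  have "(real i + real N * real k + 1) / norm (v k) \<le> 4/3 * real N + real i + 1"
  proof -
   have "real i + real N * real k + 1 \<le> (4/3 * real N + real i + 1) * (3/4 * real k + 1)"
    by (simp add: algebra_simps)
   also have "\<dots> \<le> (4/3 * real N + real i + 1) * norm (v k)" by (rule mult_left_mono[OF nv]) simp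
   finally show ?thesis using vnz[of k] by (simp add: pos_divide_le_eq)
  qed
  thus "norm (d (i + N * k)) ^ m * (real (i + N * k) + 1) \<le> a * (4/3 * real N + real i + 1)"
   unfolding eq using a by (intro mult_left_mono) auto
 qed (use C in auto)
 obtain V' where V': "0 < V'" and vle: "\<And>k. norm (v k) \<le> V' * (real k + 1)"
  using linear_bound_of_limit[OF vlim] by blast
 have pl: "min 1 (a / V') \<le> norm (p k) * (real k + 1)" for k
 proof (cases "norm (p k) \<le> 1")
  case True
  have "norm (p k) ^ m \<le> norm (p k) ^ 1" by (rule power_decreasing) (use m True in auto)
  hence "a / norm (v k) \<le> norm (p k)" by (simp add: pm)
  moreover have "a / (V' * (real k + 1)) \<le> a / norm (v k)"
   using vle[of k] a vnz[of k] V' by (intro divide_left_mono mult_pos_pos) auto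
  ultimately have "a / (V' * (real k + 1)) \<le> norm (p k)" by linarith
  hence "a / (V' * (real k + 1)) * (real k + 1) \<le> norm (p k) * (real k + 1)" by (rule mult_right_mono) simp
  moreover have "a / (V' * (real k + 1)) * (real k + 1) = a / V'" by simp
  ultimately show ?thesis by linarith
 next
  case False
  hence "1 * 1 \<le> norm (p k) * (real k + 1)" by (intro mult_mono) auto
  thus ?thesis by simp
 qed
 define w where "w = min 1 (a / V')"
 have w: "0 < w" using a V' by (simp add: w_def)
 obtain D where D: "0 < D" "\<And>n. norm (d n) \<le> D * norm (d (Suc n))" using d_Suc_lower by blast
 have "\<exists>B>0. \<forall>n. inverse (norm (d n) * (real n + 1)) \<le> B"
 proof (rule bounded_along_residues[OF N, of _ D i "inverse w"])
  show "inverse (norm (d (Suc n)) * (real (Suc n) + 1)) \<le> D * inverse (norm (d n) * (real n + 1))" for n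
  proof -
   have le: "norm (d n) * (real n + 1) \<le> D * (norm (d (Suc n)) * (real (Suc n) + 1))"
    unfolding mult.assoc[symmetric] using D by (intro mult_mono) auto
   have inv: "inverse X \<le> D * inverse Y" if "Y \<le> D * X" "0 < X" "0 < Y" for X Y :: real
    using that by (simp add: field_simps)
   show ?thesis by (rule inv[OF le]) (use d_nz[of n] d_nz[of "Suc n"] in simp_all)
  qed
  fix k
  have "real k \<le> real N * real k" using N mult_right_mono[of 1 "real N" "real k"] by simp
  hence "norm (p k) * (real k + 1) \<le> norm (d (i + N * k)) * (real (i + N * k) + 1)" by (simp add: dk mult_left_mono)
  hence "w \<le> norm (d (i + N * k)) * (real (i + N * k) + 1)" using pl[of k] by (simp add: w_def)
  thus "inverse (norm (d (i + N * k)) * (real (i + N * k) + 1)) \<le> inverse w" using w by (rule le_imp_inverse_le)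
 qed (use D in auto)
 then obtain B where B: "0 < B" "\<And>n. inverse (norm (d n) * (real n + 1)) \<le> B" by blast
 have "1 \<le> B * X" if "inverse X \<le> B" "0 < X" for X using that by (simp add: field_simps)
 hence "1 \<le> B * (norm (d n) * (real n + 1))" for n using B(2)[of n] d_nz[of n] by simp
 thus "\<exists>C>0. \<forall>n. 1 \<le> C * (norm (d n) * (real n + 1))" using B(1) by blast
qed

end

lemma analytic_quotient:
 assumes "h analytic_on {a}"
 shows "(\<lambda>z. if z = a then deriv h a else (h z - h a) / (z - a)) analytic_on {a}"
proof -
 obtain e where e: "0 < e" "h holomorphic_on ball a e" using assms by (auto simp: analytic_at_ball)
 have "(\<lambda>z. if z = a then deriv h a else (h z - h a) / (z - a)) holomorphic_on ball a e"
  by (rule pole_lemma[OF e(2)]) (use e(1) in \<open>simp \<close>)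
 thus ?thesis using e(1) by (auto simp: analytic_at_ball)
qed

lemma entire_lipschitz_cball:
 assumes "h holomorphic_on UNIV"
 shows "\<exists>C. \<forall>z\<in>cball a 1. \<forall>w\<in>cball a 1. norm (h z - h w) \<le> C * norm (z - w)"
proof -
 have h': "deriv h holomorphic_on UNIV" by (rule holomorphic_deriv[OF assms open_UNIV])
 have "continuous_on (cball a 1) (deriv h)" using h' holomorphic_on_imp_continuous_on continuous_on_subset by blast
 hence "bounded (deriv h ` cball a 1)" by (intro compact_imp_bounded compact_continuous_image) auto
 then obtain C where C: "\<And>z. z \<in> cball a 1 \<Longrightarrow> norm (deriv h z) \<le> C" by (auto simp: bounded_iff simp del: mem_cball)
 have "norm (h z - h w) \<le> C * norm (z - w)" if "z \<in> cball a 1" "w \<in> cball a 1" for z w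
 proof (rule field_differentiable_bound[of "cball a 1" h "deriv h"])
  fix x assume "x \<in> cball a 1"
  show "(h has_field_derivative deriv h x) (at x within cball a 1)"
   by (rule has_field_derivative_at_within) (rule holomorphic_derivI[OF assms open_UNIV UNIV_I])
 qed (use C that in auto)
 thus ?thesis by blast
qed

section \<open>Polynomial vector fields solving the lifting equation to finite order\<close>

context captured begin

lemma eventually_along_orbit:
 assumes "\<And>j. j < q \<Longrightarrow> \<forall>\<^sub>F z in nhds (b j). P j z"
 shows "\<forall>\<^sub>F n in sequentially. P (n mod q) (c n)"
proof (rule eventually_by_residues[OF q_pos])
 fix s assume s: "s < q"
 have "filterlim (\<lambda>k. q * k + s) at_top sequentially" using q_pos by (intro filterlim_subseq strict_monoI) simp
 from filterlim_compose[OF d_lim this] have "(\<lambda>k. d (q * k + s)) \<longlonglongrightarrow> 0" .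
 moreover have "b (q * k + s) = b s" for k using b_per_mult[of s k] by (simp add: add.commute)
 ultimately have "(\<lambda>k. c (q * k + s) - b s) \<longlonglongrightarrow> 0" by (simp add: d_def)
 hence "(\<lambda>k. c (q * k + s)) \<longlonglongrightarrow> b s" by (rule LIM_zero_cancel)
 from eventually_compose_filterlim[OF assms[OF s] this] s
 show "\<forall>\<^sub>F k in sequentially. P ((q * k + s) mod q) (c (q * k + s))" by simp
qed

text \<open>\<open>X\<close> is a polynomial vector field near the cycle which solves \<open>f = X \<circ> g - \<mu> g' X\<close> to order \<open>i\<close>.\<close>

definition vfield :: "complex \<Rightarrow> nat \<Rightarrow> (nat \<Rightarrow> complex \<Rightarrow> complex) \<Rightarrow> (nat \<Rightarrow> complex \<Rightarrow> complex) \<Rightarrow> bool" where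
 "vfield \<mu> i X S \<longleftrightarrow> (\<forall>n. X n holomorphic_on UNIV \<and> X (n + q) = X n \<and> S n analytic_on {b n} \<and> S (n + q) = S n \<and>
  (\<forall>\<^sub>F z in nhds (b n). f z - X (Suc n) (g z) + \<mu> * g' z * X n z = (z - b n) ^ i * S n z))"

lemma analytic_b: "h holomorphic_on D \<Longrightarrow> h analytic_on {b n}"
 using b_D open_D by (meson analytic_on_open analytic_on_subset empty_subsetI insert_subset)

lemma vfield_0: "vfield \<mu> 0 (\<lambda>_ _. 0) (\<lambda>_. f)" unfolding vfield_def using analytic_b[OF hol_f] by auto

text \<open>A term \<open>x n * (z - b n) ^ i\<close> changes the coefficient of order
  \<open>i\<close> in the defect by
  \<open>\<mu> * g' (b n) * x n - x (Suc n) * g' (b n) ^ i\<close>. The hypothesis makes the new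
  coefficient zero, so that one more factor \<open>z - b n\<close> splits off.\<close>

lemma vfield_step:
 assumes X: "vfield \<mu> i X S" and x: "\<And>n. x (Suc n) * g' (b n) ^ i - \<mu> * g' (b n) * x n = S n (b n)"
  and per: "\<And>n. x (n + q) = x n"
 shows "\<exists>S'. vfield \<mu> (Suc i) (\<lambda>n z. X n z + x n * (z - b n) ^ i) S'"
proof -
 have Xn: "X n holomorphic_on UNIV" "X (n + q) = X n" "S n analytic_on {b n}" "S (n + q) = S n"
  "\<forall>\<^sub>F z in nhds (b n). f z - X (Suc n) (g z) + \<mu> * g' z * X n z = (z - b n) ^ i * S n z" for n
  using X unfolding vfield_def by blast+
 have perS: "x (Suc (n + q)) = x (Suc n)" for n using per[of "Suc n"] by simp
 have dg: "deriv g (b n) = g' (b n)" for n by (rule DERIV_imp_deriv[OF g_deriv[OF b_D]])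
 define R where "R n z = (if z = b n then deriv g (b n) else (g z - g (b n)) / (z - b n))" for n z
 have Ra: "R n analytic_on {b n}" for n
  unfolding R_def[abs_def] by (intro analytic_quotient analytic_intros analytic_b[OF hol_f])
 have Rg: "g z - g (b n) = (z - b n) * R n z" for n z by (simp add: R_def)
 define Br where "Br n z = S n z - x (Suc n) * R n z ^ i + \<mu> * g' z * x n" for n z
 have Ba: "Br n analytic_on {b n}" for n
  unfolding Br_def[abs_def] by (intro analytic_intros Xn Ra analytic_b[OF hol_f'])
 have B0: "Br n (b n) = 0" for n unfolding Br_def x[of n, symmetric] by (simp add: R_def dg)
 define S' where "S' n z = (if z = b n then deriv (Br n) (b n) else (Br n z - Br n (b n)) / (z - b n))" for n z
 have S'a: "S' n analytic_on {b n}" for n unfolding S'_def[abs_def] by (rule analytic_quotient[OF Ba])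
 have BS: "Br n z = (z - b n) * S' n z" for n z by (simp add: S'_def B0)
 have "vfield \<mu> (Suc i) (\<lambda>n z. X n z + x n * (z - b n) ^ i) S'" unfolding vfield_def
 proof (intro allI conjI)
  fix n
  show "(\<lambda>z. X n z + x n * (z - b n) ^ i) holomorphic_on UNIV" by (intro holomorphic_intros Xn)
  show "(\<lambda>z. X (n + q) z + x (n + q) * (z - b (n + q)) ^ i) = (\<lambda>z. X n z + x n * (z - b n) ^ i)"
   by (simp add: Xn per b_per)
  show "S' n analytic_on {b n}" by (rule S'a)
  show "S' (n + q) = S' n"
  proof -
   have "Br (n + q) = Br n" by (rule ext) (simp add: Br_def R_def Xn(4) per perS b_per)
   thus ?thesis by (intro ext) (simp add: S'_def b_per)
  qed
  show "\<forall>\<^sub>F z in nhds (b n). f z - (X (Suc n) (g z) + x (Suc n) * (g z - b (Suc n)) ^ i) +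
    \<mu> * g' z * (X n z + x n * (z - b n) ^ i) = (z - b n) ^ Suc i * S' n z"
   using Xn(5)[of n]
  proof eventually_elim
   case (elim z)
   have "(g z - b (Suc n)) ^ i = (z - b n) ^ i * R n z ^ i"
    using Rg[of z n] g_b[of n] by (simp add: power_mult_distrib)
   hence "f z - (X (Suc n) (g z) + x (Suc n) * (g z - b (Suc n)) ^ i) +
     \<mu> * g' z * (X n z + x n * (z - b n) ^ i) =
     (f z - X (Suc n) (g z) + \<mu> * g' z * X n z) + (z - b n) ^ i * (\<mu> * g' z * x n - x (Suc n) * R n z ^ i)"
    by (simp add: algebra_simps)
   also have "\<dots> = (z - b n) ^ i * Br n z" unfolding elim Br_def by (simp add: algebra_simps)
   finally show ?case unfolding BS by simp
  qed
 qed
 thus ?thesis by blast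
qed

lemma vfield_S_per: "vfield \<mu> i X S \<Longrightarrow> S (n + q) = S n" unfolding vfield_def by blast

lemma vfield_X_per:
 assumes X: "vfield \<mu> i X S"
 shows "X (m + q * k) = X m"
proof (induction k)
 case (Suc k)
 have "X (m + q * Suc k) = X (m + q * k + q)" by (simp add: add_ac)
 also have "\<dots> = X (m + q * k)" using X unfolding vfield_def by blast
 finally show ?case using Suc by simp
qed simp

text \<open>Going around the cycle multiplies \<open>x\<close> by
  \<open>\<mu> ^ q * kappa / kappa ^ i\<close>; unless this is 1, the recursion for the coefficients
  of order \<open>i\<close> has a periodic solution.\<close>

lemma vfield_improve:
 assumes X: "vfield \<mu> i X S" and ne: "\<mu> ^ q * kappa \<noteq> kappa ^ i"
 shows "\<exists>x S'. vfield \<mu> (Suc i) (\<lambda>n z. X n z + x n * (z - b n) ^ i) S'"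
proof -
 have "\<exists>x. (\<forall>n. x (Suc n) = (\<mu> * g' (b n) / g' (b n) ^ i) * x n + S n (b n) / g' (b n) ^ i) \<and> (\<forall>n. x (n + q) = x n)"
 proof (rule cyclic_linear_solve)
  have "(\<Prod>j<q. \<mu> * g' (b j) / g' (b j) ^ i) = \<mu> ^ q * kappa / kappa ^ i"
   by (simp only: prod_dividef prod.distrib prod_power_distrib[symmetric] kappa_def prod_constant card_lessThan)
  thus "(\<Prod>j<q. \<mu> * g' (b j) / g' (b j) ^ i) \<noteq> 1" using ne by simp
 qed (simp_all only: b_per vfield_S_per[OF X])
 then obtain x where x: "\<And>n. x (Suc n) = (\<mu> * g' (b n) / g' (b n) ^ i) * x n + S n (b n) / g' (b n) ^ i"
  and per: "\<And>n. x (n + q) = x n" by blast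
 have "x (Suc n) * g' (b n) ^ i - \<mu> * g' (b n) * x n = S n (b n)" for n
 proof -
  have nz: "g' (b n) ^ i \<noteq> 0" using g'_b_nz[of n] by simp
  have "x (Suc n) * g' (b n) ^ i = \<mu> * g' (b n) * x n + S n (b n)"
   unfolding x using nz by (simp add: distrib_right del: power_mult_distrib)
  thus ?thesis by simp
 qed
 from vfield_step[OF X this per] show ?thesis by blast
qed

lemma vfield_along_orbit:
 assumes X: "vfield \<mu> i X S"
 shows "\<exists>C>0. \<forall>n. norm (f (c n) - X (Suc n) (c (Suc n)) + \<mu> * g' (c n) * X n (c n)) \<le> C * norm (d n) ^ i"
proof -
 have perX: "X n = X (n mod q)" for n using vfield_X_per[OF X, of "n mod q" "n div q"] by simp
 define K where "K = (\<Sum>j<q. norm (S j (b j)) + 1)"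
 have "\<forall>\<^sub>F n in sequentially. norm (f (c n) - X (Suc (n mod q)) (g (c n)) + \<mu> * g' (c n) * X (n mod q) (c n))
   \<le> K * norm (c n - b (n mod q)) ^ i"
 proof (rule eventually_along_orbit)
  fix j assume j: "j < q"
  have "isCont (S j) (b j)" using X unfolding vfield_def by (meson analytic_at_imp_isCont)
  hence "((\<lambda>z. norm (S j z)) \<longlongrightarrow> norm (S j (b j))) (nhds (b j))"
   using tendsto_at_iff_tendsto_nhds[of "S j" "b j"] by (intro tendsto_norm) (simp add: isCont_def)
  hence "\<forall>\<^sub>F z in nhds (b j). norm (S j z) < norm (S j (b j)) + 1" by (rule order_tendstoD(2)) simp
  moreover have "\<forall>\<^sub>F z in nhds (b j). f z - X (Suc j) (g z) + \<mu> * g' z * X j z = (z - b j) ^ i * S j z"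
   using X unfolding vfield_def by blast
  ultimately show "\<forall>\<^sub>F z in nhds (b j). norm (f z - X (Suc j) (g z) + \<mu> * g' z * X j z) \<le> K * norm (z - b j) ^ i"
  proof eventually_elim
   case (elim z)
   have "norm (S j (b j)) + 1 \<le> K" unfolding K_def by (rule member_le_sum) (use j in auto)
   hence "norm (S j z) \<le> K" using elim(1) by linarith
   thus ?case unfolding elim(2) norm_mult norm_power by (subst mult.commute) (intro mult_right_mono, auto)
  qed
 qed
 hence "\<forall>\<^sub>F n in sequentially. norm (f (c n) - X (Suc n) (c (Suc n)) + \<mu> * g' (c n) * X n (c n)) \<le> K * norm (d n) ^ i"
 proof eventually_elim
  case (elim n)
  have "X (Suc (n mod q)) = X (Suc n)" using perX[of "Suc (n mod q)"] perX[of "Suc n"] by (simp add: mod_Suc_eq)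
  thus ?case using elim perX[of n] by (simp add: b_mod d_def)
 qed
 thus ?thesis by (rule eventually_bound_all) (use d_nz in simp_all)
qed

lemma vfield_lipschitz:
 assumes X: "vfield \<mu> i X S"
 shows "\<exists>C>0. \<forall>n. \<forall>z\<in>cball (b n) 1. \<forall>w\<in>cball (b n) 1. norm (X n z - X n w) \<le> C * norm (z - w)"
proof -
 have "\<forall>n. \<exists>C. \<forall>z\<in>cball (b n) 1. \<forall>w\<in>cball (b n) 1. norm (X n z - X n w) \<le> C * norm (z - w)"
  using X unfolding vfield_def by (intro allI entire_lipschitz_cball) simp
 from choice[OF this] obtain C where C: "\<forall>n. \<forall>z\<in>cball (b n) 1. \<forall>w\<in>cball (b n) 1. norm (X n z - X n w) \<le> C n * norm (z - w)"
  by (rule exE)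
 define K where "K = (\<Sum>j<q. \<bar>C j\<bar>) + 1"
 have K: "0 < K" unfolding K_def by (intro add_nonneg_pos sum_nonneg) auto
 have "norm (X n z - X n w) \<le> K * norm (z - w)" if zw: "z \<in> cball (b n) 1" "w \<in> cball (b n) 1" for n z w
 proof -
  define j where "j = n mod q"
  have j: "j < q" "b j = b n" "X j = X n" using q_pos vfield_X_per[OF X, of j "n div q"] by (auto simp: j_def b_mod)
  have "norm (X j z - X j w) \<le> C j * norm (z - w)" using C zw unfolding j(2)[symmetric] by blast
  also have "\<dots> \<le> K * norm (z - w)"
  proof (rule mult_right_mono)
   have "\<bar>C j\<bar> \<le> (\<Sum>j<q. \<bar>C j\<bar>)" by (rule member_le_sum) (use j in auto)
   thus "C j \<le> K" by (simp add: K_def)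
  qed simp
  finally show ?thesis by (simp add: j(3))
 qed
 thus ?thesis using K by blast
qed

lemma vfield_near:
 assumes X: "vfield \<mu> i X S"
 shows "\<exists>C>0. \<forall>n. norm (X n (c n) - X n (b n)) \<le> C * norm (d n)"
proof -
 obtain C where C: "0 < C" "\<And>n z w. z \<in> cball (b n) 1 \<Longrightarrow> w \<in> cball (b n) 1 \<Longrightarrow> norm (X n z - X n w) \<le> C * norm (z - w)"
  using vfield_lipschitz[OF X] by blast
 have "\<forall>\<^sub>F n in sequentially. norm (d n) < 1" using tendstoD[OF d_lim, of 1] by simp
 hence "\<forall>\<^sub>F n in sequentially. norm (X n (c n) - X n (b n)) \<le> C * norm (d n)"
 proof eventually_elim
  case (elim n)
  have "c n \<in> cball (b n) 1" using elim by (simp add: d_def dist_norm norm_minus_commute)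
  from C(2)[OF this, of "b n"] show ?case by (simp add: d_def)
 qed
 thus ?thesis by (rule eventually_bound_all) (use d_nz in simp_all)
qed

end

section \<open>Generating functions on the real segment and their growth at 1\<close>

definition gen :: "(nat \<Rightarrow> complex) \<Rightarrow> real \<Rightarrow> complex" where
 "gen a x = (\<Sum>n. a n * of_real x ^ n)"

lemma linear_sums: "0 \<le> x \<Longrightarrow> x < 1 \<Longrightarrow> (\<lambda>n. (real n + 1) * x ^ n) sums (1 / (1 - x)\<^sup>2)"
 using geometric_deriv_sums[of x] by (simp add: add.commute)

lemma gen_linear:
 assumes a: "\<And>n. norm (a n) \<le> C * (real n + 1)" and x: "0 \<le> x" "x < 1"
 shows "summable (\<lambda>n. norm (a n * of_real x ^ n))" "norm (gen a x) \<le> C / (1 - x)\<^sup>2"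
proof -
 have s: "(\<lambda>n. C * ((real n + 1) * x ^ n)) sums (C * (1 / (1 - x)\<^sup>2))" by (intro sums_mult linear_sums x)
 have le: "norm (a n * of_real x ^ n) \<le> C * ((real n + 1) * x ^ n)" for n
  using mult_right_mono[OF a[of n], of "x ^ n"] x by (simp add: norm_mult norm_power)
 show sm: "summable (\<lambda>n. norm (a n * of_real x ^ n))"
  by (rule summable_comparison_test'[OF sums_summable[OF s]]) (use le in simp)
 have "norm (gen a x) \<le> (\<Sum>n. norm (a n * of_real x ^ n))" unfolding gen_def by (rule summable_norm[OF sm])
 also have "\<dots> \<le> (\<Sum>n. C * ((real n + 1) * x ^ n))" by (rule suminf_le[OF le sm sums_summable[OF s]])
 also have "\<dots> = C / (1 - x)\<^sup>2" using sums_unique[OF s] by simp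
 finally show "norm (gen a x) \<le> C / (1 - x)\<^sup>2" .
qed

lemma gen_const:
 assumes a: "\<And>n. norm (a n) \<le> C" and x: "0 \<le> x" "x < 1"
 shows "summable (\<lambda>n. norm (a n * of_real x ^ n))" "norm (gen a x) \<le> C / (1 - x)"
proof -
 have s: "(\<lambda>n. C * x ^ n) sums (C * (1 / (1 - x)))" by (intro sums_mult geometric_sums) (use x in simp)
 have le: "norm (a n * of_real x ^ n) \<le> C * x ^ n" for n
  using mult_right_mono[OF a[of n], of "x ^ n"] x by (simp add: norm_mult norm_power)
 show sm: "summable (\<lambda>n. norm (a n * of_real x ^ n))"
  by (rule summable_comparison_test'[OF sums_summable[OF s]]) (use le in simp)
 have "norm (gen a x) \<le> (\<Sum>n. norm (a n * of_real x ^ n))" unfolding gen_def by (rule summable_norm[OF sm])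
 also have "\<dots> \<le> (\<Sum>n. C * x ^ n)" by (rule suminf_le[OF le sm sums_summable[OF s]])
 also have "\<dots> = C / (1 - x)" using sums_unique[OF s] by simp
 finally show "norm (gen a x) \<le> C / (1 - x)" .
qed

lemma gen_quadratic_summable:
 fixes a :: "nat \<Rightarrow> complex"
 assumes a: "\<And>n. norm (a n) \<le> C * (real n + 1)\<^sup>2" and x: "0 \<le> x" "x < 1"
 shows "summable (\<lambda>n. norm (a n * of_real x ^ n))"
proof -
 \<comment> \<open>The majorant \<open>(n + 1) ^ 2 * x ^ n\<close> is the square of the bounded and
   summable sequence \<open>(n + 1) * y ^ n\<close>.\<close>
 define y where "y = sqrt x"
 have y: "0 \<le> y" "y < 1" "y * y = x" using x by (auto simp: y_def)
 have s: "summable (\<lambda>n. (real n + 1) * y ^ n)" by (rule sums_summable[OF linear_sums[OF y(1,2)]])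
 have "Bseq (\<lambda>n. (real n + 1) * y ^ n)" using summable_LIMSEQ_zero[OF s] convergentI convergent_imp_Bseq by blast
 then obtain M where M: "\<And>n. norm ((real n + 1) * y ^ n) \<le> M" by (elim BseqE) blast
 have C: "0 \<le> C" using order_trans[OF norm_ge_zero a[of 0]] by simp
 show ?thesis
 proof (rule summable_comparison_test'[OF summable_mult[OF s, of "C * M"]])
  fix n
  have p: "0 \<le> (real n + 1) * y ^ n" using y by simp
  have "norm (a n * of_real x ^ n) \<le> C * (real n + 1)\<^sup>2 * x ^ n"
   using mult_right_mono[OF a[of n], of "x ^ n"] x by (simp add: norm_mult norm_power)
  also have "\<dots> = C * (((real n + 1) * y ^ n) * ((real n + 1) * y ^ n))"
   by (simp add: y(3)[symmetric] power_mult_distrib power2_eq_square)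
  also have "\<dots> \<le> C * (M * ((real n + 1) * y ^ n))"
  proof (rule mult_left_mono[OF mult_right_mono[OF _ p] C])
   show "(real n + 1) * y ^ n \<le> M" using M[of n] by simp
  qed
  finally show "norm (norm (a n * of_real x ^ n)) \<le> C * M * ((real n + 1) * y ^ n)" by simp
 qed
qed

lemma gen_eventually_linear:
 assumes ev: "\<forall>\<^sub>F n in sequentially. norm (a n) \<le> C * (real n + 1)" and C: "0 \<le> C"
 shows "\<exists>E. \<forall>x. 0 \<le> x \<longrightarrow> x < 1 \<longrightarrow> norm (gen a x) \<le> E + C / (1 - x)\<^sup>2"
proof -
 obtain n0 where n0: "\<And>n. n \<ge> n0 \<Longrightarrow> norm (a n) \<le> C * (real n + 1)" using ev unfolding eventually_sequentially by blast
 define a1 where "a1 n = (if n < n0 then a n else 0)" for n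
 define a2 where "a2 n = (if n < n0 then 0 else a n)" for n
 define E where "E = (\<Sum>n<n0. norm (a n))"
 have "norm (gen a x) \<le> E + C / (1 - x)\<^sup>2" if x: "0 \<le> x" "x < 1" for x
 proof -
  have a2: "norm (a2 n) \<le> C * (real n + 1)" for n using n0 C by (simp add: a2_def)
  have s2: "summable (\<lambda>n. a2 n * of_real x ^ n)" by (rule summable_norm_cancel[OF gen_linear(1)[OF a2 x]])
  have s1: "(\<lambda>n. a1 n * of_real x ^ n) sums (\<Sum>n<n0. a1 n * of_real x ^ n)" by (rule sums_finite) (auto simp: a1_def)
  have "gen a x = (\<Sum>n. a1 n * of_real x ^ n + a2 n * of_real x ^ n)"
   unfolding gen_def by (rule arg_cong[of _ _ suminf]) (auto simp: a1_def a2_def)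
  also have "\<dots> = (\<Sum>n. a1 n * of_real x ^ n) + gen a2 x"
   unfolding gen_def by (rule suminf_add[symmetric, OF sums_summable[OF s1] s2])
  also have "(\<Sum>n. a1 n * of_real x ^ n) = (\<Sum>n<n0. a1 n * of_real x ^ n)" using sums_unique[OF s1] by simp
  finally have "norm (gen a x) \<le> norm (\<Sum>n<n0. a1 n * of_real x ^ n) + norm (gen a2 x)" by (metis norm_triangle_ineq)
  moreover have "norm (\<Sum>n<n0. a1 n * of_real x ^ n) \<le> E" unfolding E_def
  proof (rule sum_norm_le)
   fix n assume "n \<in> {..<n0}"
   have "norm (a n) * x ^ n \<le> norm (a n) * 1" using x by (intro mult_left_mono power_le_one) auto
   thus "norm (a1 n * of_real x ^ n) \<le> norm (a n)" using x by (simp add: a1_def norm_mult norm_power)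
  qed
  ultimately show ?thesis using gen_linear(2)[OF a2 x] by linarith
 qed
 thus ?thesis by blast
qed

lemma gen_add:
 assumes "summable (\<lambda>n. norm (a n * of_real x ^ n))" "summable (\<lambda>n. norm (b n * of_real x ^ n))"
 shows "gen (\<lambda>n. a n + b n) x = gen a x + gen b x"
 unfolding gen_def using suminf_add[OF summable_norm_cancel[OF assms(1)] summable_norm_cancel[OF assms(2)]]
 by (simp add: distrib_right)

lemma gen_shift:
 assumes "summable (\<lambda>n. norm (a n * of_real x ^ n))"
 shows "of_real x ^ k * gen (\<lambda>n. a (n + k)) x = gen a x - (\<Sum>n<k. a n * of_real x ^ n)"
  and "0 < x \<Longrightarrow> summable (\<lambda>n. norm (a (n + k) * of_real x ^ n))"
proof -
 have s: "summable (\<lambda>n. a n * of_real x ^ n)" by (rule summable_norm_cancel[OF assms])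
 have 1: "summable (\<lambda>n. a (n + k) * of_real x ^ (n + k))" by (rule summable_iff_shift[of "\<lambda>n. a n * of_real x ^ n" k, THEN iffD2, OF s])
 have 2: "gen a x - (\<Sum>n<k. a n * of_real x ^ n) = (\<Sum>n. a (n + k) * of_real x ^ (n + k))"
  unfolding gen_def using suminf_split_initial_segment[OF s, of k] by simp
 show n: "0 < x \<Longrightarrow> summable (\<lambda>n. norm (a (n + k) * of_real x ^ n))"
 proof -
  assume x: "0 < x"
  have "summable (\<lambda>n. norm (a (n + k) * of_real x ^ (n + k)))"
   by (rule summable_iff_shift[of "\<lambda>n. norm (a n * of_real x ^ n)" k, THEN iffD2, OF assms])
  hence "summable (\<lambda>n. (1 / x ^ k) * norm (a (n + k) * of_real x ^ (n + k)))" by (rule summable_mult)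
  moreover have "(\<lambda>n. (1 / x ^ k) * norm (a (n + k) * of_real x ^ (n + k))) = (\<lambda>n. norm (a (n + k) * of_real x ^ n))"
   using x by (simp add: norm_mult norm_power power_add)
  ultimately show ?thesis by (simp only:)
 qed
 show "of_real x ^ k * gen (\<lambda>n. a (n + k)) x = gen a x - (\<Sum>n<k. a n * of_real x ^ n)"
 proof (cases "x = 0")
  case False
  have "summable (\<lambda>n. a (n + k) * of_real x ^ n)"
  proof -
   have "summable (\<lambda>n. (1 / of_real x ^ k) * (a (n + k) * of_real x ^ (n + k)))" using 1 by (rule summable_mult)
   moreover have "(\<lambda>n. (1 / of_real x ^ k) * (a (n + k) * of_real x ^ (n + k))) = (\<lambda>n. a (n + k) * of_real x ^ n)"
    using False by (simp add: power_add)
   ultimately show ?thesis by (simp only:)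
  qed
  thus ?thesis unfolding 2 by (simp add: gen_def suminf_mult[symmetric] power_add mult_ac)
 next
  case True
  show ?thesis
  proof (cases k)
   case (Suc k')
   have "gen a x = a 0" unfolding gen_def True by simp
   moreover have "(\<Sum>n<Suc k'. a n * of_real x ^ n) = a 0" by (simp only: sum.lessThan_Suc_shift) (simp add: True)
   ultimately show ?thesis by (simp add: True)
  qed simp
 qed
qed

context captured begin

lemma tau_window_rate: "\<exists>C>0. \<forall>n. norm (tau (c n) k - (\<Prod>i<k. g' (b (n + i)))) \<le> C * norm (d n)"
proof (induction k)
 case 0
 show ?case by (intro exI[of _ 1]) simp
next
 case (Suc k)
 then obtain C where C: "0 < C" "\<And>n. norm (tau (c n) k - (\<Prod>i<k. g' (b (n + i)))) \<le> C * norm (d n)" by blast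
 obtain C1 where C1: "0 < C1" "\<And>n. norm (deriv f (c n) - deriv f (b n)) \<le> C1 * norm (d n)"
  using holomorphic_along_orbit[OF hol_f'] by blast
 obtain C2 where C2: "0 < C2" "\<And>n. norm (d (Suc n)) \<le> C2 * norm (d n)" using d_Suc_upper by blast
 have dk: "norm (d (n + k)) \<le> C2 ^ k * norm (d n)" for n
 proof (induction k)
  case (Suc k)
  have "norm (d (n + Suc k)) \<le> C2 * norm (d (n + k))" using C2(2)[of "n + k"] by simp
  also have "\<dots> \<le> C2 * (C2 ^ k * norm (d n))" using Suc C2(1) by (intro mult_left_mono) auto
  finally show ?case by simp
 qed simp
 obtain C3 where C3: "0 < C3" "\<And>n. norm (g' (b n)) \<le> C3" using b_range_bound[of "\<lambda>z. g' z"] by blast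
 obtain D1 where D1: "0 < D1" "\<And>n. norm (tau (c n) k) \<le> D1"
 proof -
  obtain Bd where Bd: "0 < Bd" "\<And>n. norm (d n) \<le> Bd" using d_bounded by blast
  have "norm (\<Prod>i<k. g' (b (n + i))) \<le> C3 ^ k" for n
   unfolding prod_norm[symmetric] using prod_mono[of "{..<k}" "\<lambda>i. norm (g' (b (n + i)))" "\<lambda>i. C3"] C3 by simp
  moreover have "C * norm (d n) \<le> C * Bd" for n using Bd(2)[of n] C(1) by (intro mult_left_mono) auto
  ultimately have "norm (tau (c n) k) \<le> C3 ^ k + C * Bd" for n
   by (intro order_trans[OF norm_triangle_sub[of "tau (c n) k" "\<Prod>i<k. g' (b (n + i))"]] add_mono order_trans[OF C(2)])
  moreover have "0 < C3 ^ k + C * Bd" using C3(1) C(1) Bd(1) by (simp add: add_pos_pos)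
  ultimately show ?thesis using that by blast
 qed
 have "norm (tau (c n) (Suc k) - (\<Prod>i<Suc k. g' (b (n + i)))) \<le> (D1 * norm c1 * C1 * C2 ^ k + C3 * C) * norm (d n)" for n
 proof -
  define P where "P = (\<Prod>i<k. g' (b (n + i)))"
  have "c (n + k) = (g ^^ k) (c n)" by (metis add.commute comp_apply funpow_add)
  hence eq: "tau (c n) (Suc k) - (\<Prod>i<Suc k. g' (b (n + i))) =
    tau (c n) k * (c1 * (deriv f (c (n + k)) - deriv f (b (n + k)))) + g' (b (n + k)) * (tau (c n) k - P)"
   by (simp add: tau_Suc P_def algebra_simps)
  have "norm (tau (c n) k * (c1 * (deriv f (c (n + k)) - deriv f (b (n + k))))) \<le> D1 * (norm c1 * (C1 * (C2 ^ k * norm (d n))))"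
   unfolding norm_mult using D1 C1(1) order_trans[OF C1(2)[of "n + k"] mult_left_mono[OF dk[of n]]]
   by (intro mult_mono) auto
  moreover have "norm (g' (b (n + k)) * (tau (c n) k - P)) \<le> C3 * (C * norm (d n))"
   unfolding norm_mult[of "g' (b (n + k))"] P_def using C3 C by (intro mult_mono) auto
  ultimately have "norm (tau (c n) (Suc k) - (\<Prod>i<Suc k. g' (b (n + i)))) \<le>
    D1 * (norm c1 * (C1 * (C2 ^ k * norm (d n)))) + C3 * (C * norm (d n))"
   unfolding eq by (intro order_trans[OF norm_triangle_ineq] add_mono)
  thus ?thesis by (simp add: algebra_simps)
 qed
 moreover have "0 < D1 * norm c1 * C1 * C2 ^ k + C3 * C"
  using D1(1) C1(1) C2(1) C3(1) C(1) by (intro add_nonneg_pos) auto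
 ultimately show ?case by blast
qed

text \<open>The derivative over one period deviates from \<open>kappa\<close> by a multiple of
  \<open>norm (d n)\<close>, and \<open>d n / T n = t n\<close>; so the error is of the size of
  \<open>t n\<close>, which is small against \<open>1 / T n\<close>.\<close>

lemma inverse_T_window:
 "\<exists>C>0. \<forall>n. norm (1 / T (n + q) - (1 / kappa) / T n) \<le> C * norm (t n)"
proof -
 obtain C where C: "0 < C" "\<And>n. norm (tau (c n) q - kappa) \<le> C * norm (d n)"
  using tau_window_rate[of q] unfolding kappa_window by blast
 obtain C3 where C3: "0 < C3" "\<And>n. C3 \<le> norm (g' (c n))" using g'_c_lower by blast
 have lo: "C3 ^ q \<le> norm (tau (c n) q)" for n
 proof -
  have gc: "(g ^^ i) (c n) = c (n + i)" for i by (metis add.commute comp_apply funpow_add)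
  show ?thesis unfolding tau_def prod_norm[symmetric] gc
   using prod_mono[of "{..<q}" "\<lambda>i. C3" "\<lambda>i. norm (g' (c (n + i)))"] C3 by simp
 qed
 define K where "K = C / (norm kappa * C3 ^ q)"
 have K: "0 < K" using C C3 kappa_nz by (simp add: K_def)
 have "norm (1 / T (n + q) - (1 / kappa) / T n) \<le> K * norm (t n)" for n
 proof -
  have tnz: "tau (c n) q \<noteq> 0" using lo[of n] C3(1) by (metis norm_zero not_less zero_less_power)
  have "1 / T (n + q) - (1 / kappa) / T n = (kappa - tau (c n) q) / (kappa * tau (c n) q) / T n"
   unfolding T_add using T_nz[of n] tnz kappa_nz by (simp add: field_simps)
  moreover have "norm ((kappa - tau (c n) q) / (kappa * tau (c n) q) / T n) \<le> (C * norm (d n)) / (norm kappa * C3 ^ q) / norm (T n)"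
   unfolding norm_divide norm_mult
  proof (rule divide_right_mono[OF frac_le])
   show "norm (kappa - tau (c n) q) \<le> C * norm (d n)" using C(2)[of n] by (simp add: norm_minus_commute)
   show "norm kappa * C3 ^ q \<le> norm kappa * norm (tau (c n) q)" by (rule mult_left_mono[OF lo]) simp
  qed (use C C3 kappa_nz in auto)
  ultimately show ?thesis by (simp add: K_def t_def norm_divide)
 qed
 thus ?thesis using K by blast
qed

end

context captured begin

text \<open>For \<open>\<mu> = 1\<close> order 1 is always resonant: the recursion for the linear
  coefficients is \<open>x (Suc n) = x n + S n (b n) / g' (b n)\<close>, solvable with period
  \<open>q\<close> only if the increments sum to zero. Their sum is the transversality sum, as
  \<open>S n (b n) = f' n + g'' n * A n\<close>.\<close>

lemma vfield_resonant_step: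
 assumes A: "\<And>n. A (Suc n) = g' (b n) * A n + f (b n)" "\<And>n. A (n + q) = A n"
  and zero: "(\<Sum>j<q. (f' j + g'' j * A j) / g' (b j)) = 0"
 shows "\<exists>X S. vfield 1 2 X S"
proof -
 have "\<exists>S'. vfield 1 (Suc 0) (\<lambda>n z. 0 + A n * (z - b n) ^ 0) S'"
  by (rule vfield_step[OF vfield_0]) (use A in simp_all)
 then obtain S where S: "vfield 1 (Suc 0) (\<lambda>n z. A n) S" by auto
 have Sb: "S n (b n) = f' n + g'' n * A n" for n
 proof -
  have S1: "S n analytic_on {b n}" "\<forall>\<^sub>F z in nhds (b n). f z - A (Suc n) + g' z * A n = (z - b n) * S n z"
   using S unfolding vfield_def by simp_all
  obtain e where e: "0 < e" "S n holomorphic_on ball (b n) e" using S1(1) by (auto simp: analytic_at_ball)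
  have be: "b n \<in> ball (b n) e" using e by simp
  have dS: "((\<lambda>z. (z - b n) * S n z) has_field_derivative S n (b n)) (at (b n))"
   using holomorphic_derivI[OF e(2) open_ball be] by (auto intro!: derivative_eq_intros)
  have dL: "((\<lambda>z. f z - A (Suc n) + g' z * A n) has_field_derivative f' n + g'' n * A n) (at (b n))"
   using holomorphic_derivI[OF hol_f open_D b_D] holomorphic_derivI[OF hol_f' open_D b_D]
   by (auto intro!: derivative_eq_intros)
  have "((\<lambda>z. (z - b n) * S n z) has_field_derivative f' n + g'' n * A n) (at (b n))"
   using DERIV_cong_ev[OF refl S1(2) refl, THEN iffD1, OF dL] .
  with dS show ?thesis by (rule DERIV_unique)
 qed
 have "\<exists>x. (\<forall>n. x (Suc n) = x n + S n (b n) / g' (b n)) \<and> (\<forall>n. x (n + q) = x n)"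
 proof (rule cyclic_sum_solve)
  show "(\<Sum>i<q. S i (b i) / g' (b i)) = 0" unfolding Sb by (rule zero)
 qed (simp only: b_per vfield_S_per[OF S])
 then obtain x where x: "\<And>n. x (Suc n) = x n + S n (b n) / g' (b n)" "\<And>n. x (n + q) = x n" by blast
 have "x (Suc n) * g' (b n) ^ Suc 0 - 1 * g' (b n) * x n = S n (b n)" for n
  unfolding x(1) using g'_b_nz[of n] by (simp add: algebra_simps)
 from vfield_step[OF S this x(2)] show ?thesis unfolding numeral_2_eq_2 by blast
qed

text \<open>For \<open>\<mu> = 1\<close> order \<open>i > 0\<close> is resonant only if
  \<open>kappa ^ (i - 1) = 1\<close>. After order 1 the next candidate is order
  \<open>l + 1\<close>, so the defect can be pushed to that order.\<close>

lemma vfield_below_resonance: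
 assumes X: "vfield 1 2 X S" and l: "\<And>k. 0 < k \<Longrightarrow> k < l \<Longrightarrow> kappa ^ k \<noteq> 1"
 shows "i < l \<Longrightarrow> \<exists>X S. vfield 1 (Suc (Suc i)) X S"
proof (induction i)
 case 0
 show ?case using X unfolding numeral_2_eq_2 by blast
next
 case (Suc i)
 then obtain X S where X: "vfield 1 (Suc (Suc i)) X S" by auto
 have "kappa ^ Suc i \<noteq> 1" using l[of "Suc i"] Suc by simp
 hence "1 ^ q * kappa \<noteq> kappa ^ Suc (Suc i)" using kappa_nz by simp
 from vfield_improve[OF X this] show ?case by blast
qed

text \<open>The partial sums are the derivatives at \<open>w = c1\<close> of the iterates
  \<open>(G f w ^^ n) w\<close>, divided by \<open>T n\<close>; here the sequence serves as a
  convolution kernel.\<close>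

definition zeta :: "nat \<Rightarrow> complex" where
 "zeta n = (case n of 0 \<Rightarrow> 1 | Suc k \<Rightarrow> f (c k) / T (Suc k))"

text \<open>Unwinding the lifting recursion along the diagonal expresses the derivative at the
  \<open>n\<close>-th orbit point through the derivatives at \<open>c1\<close> of this and the later
  lifts.\<close>

lemma lift_convolution:
 assumes v: "\<And>k n. v k (Suc n) = g' (c n) * v (Suc k) n + v k 0 * f (c n)"
 shows "v k n / T n = (\<Sum>j\<le>n. v (k + j) 0 * zeta (n - j))"
proof (induction n arbitrary: k)
 case 0
 show ?case by (simp add: zeta_def)
next
 case (Suc n)
 have "v k (Suc n) / T (Suc n) = v (Suc k) n / T n + v k 0 * zeta (Suc n)"
  unfolding v zeta_def T_Suc using g'_c_nz[of n] by (simp add: add_divide_distrib)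
 also have "v (Suc k) n / T n = (\<Sum>j\<le>n. v (k + Suc j) 0 * zeta (Suc n - Suc j))" using Suc[of "Suc k"] by simp
 finally show ?case unfolding sum.atMost_Suc_shift by simp
qed

text \<open>The coefficients may grow quadratically, which alone would allow order 3 at 1. But
  shifting by \<open>q\<close> multiplies them by \<open>1 / kappa\<close> up to a linearly growing
  error, so multiplying the series by \<open>1 - s ^ q / kappa\<close> leaves order 2; this factor
  stays away from 0 on the segment, as \<open>kappa\<close> is on the unit circle and not 1.\<close>

lemma periodic_gen_bound:
 assumes k1: "kappa \<noteq> 1" "norm kappa = 1" and x: "\<And>n. x (n + q) = x n"
  and Ct: "\<And>n. norm (t n) \<le> Ct * (real n + 1)" and quad: "\<And>n. norm (1 / T n) \<le> CT * (real n + 1)\<^sup>2"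
 shows "\<exists>C. \<forall>s. 0 < s \<longrightarrow> s < 1 \<longrightarrow> norm (gen (\<lambda>n. x n / T n) s) \<le> C / (1 - s)\<^sup>2"
proof -
 define Bx where "Bx = (\<Sum>j<q. norm (x j))"
 have xm: "x n = x (n mod q)" for n
 proof -
  have "x (m + q * k) = x m" for m k by (induction k) (simp_all add: x add.assoc[symmetric] add.commute[of q])
  from this[of "n mod q" "n div q"] show ?thesis by simp
 qed
 have Bx: "norm (x n) \<le> Bx" for n unfolding Bx_def xm[of n] by (rule member_le_sum) (use q_pos in auto)
 have Bx0: "0 \<le> Bx" by (simp add: Bx_def sum_nonneg)
 obtain C1 where C1: "0 < C1" "\<And>n. norm (1 / T (n + q) - (1 / kappa) / T n) \<le> C1 * norm (t n)"
  using inverse_T_window by blast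
 define y where "y n = x (n + q) / T (n + q) + (- 1 / kappa) * (x n / T n)" for n
 have yb: "norm (y n) \<le> (Bx * C1 * Ct) * (real n + 1)" for n
 proof -
  have "y n = x n * (1 / T (n + q) - (1 / kappa) / T n)" by (simp add: y_def x algebra_simps)
  hence "norm (y n) \<le> Bx * (C1 * (Ct * (real n + 1)))"
   using mult_mono[OF Bx[of n] order_trans[OF C1(2)[of n] mult_left_mono[OF Ct[of n]]]] Bx0 C1(1) by (simp add: norm_mult)
  thus ?thesis by simp
 qed
 have quad': "norm (x n / T n) \<le> (Bx * CT) * (real n + 1)\<^sup>2" for n
  using mult_mono[OF Bx[of n] quad[of n]] Bx0 by (simp add: norm_mult[symmetric])
 define \<delta> where "\<delta> s = 1 - of_real (s ^ q) / kappa" for s :: real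
 have "\<exists>e>0. \<forall>s\<in>{0..1}. e \<le> norm (\<delta> s)"
 proof -
  have "compact {0..1::real}" "{0..1::real} \<noteq> {}" "continuous_on {0..1} (\<lambda>s. norm (\<delta> s))"
   using kappa_nz by (auto simp: \<delta>_def intro!: continuous_intros)
  then obtain s0 where s0: "s0 \<in> {0..1}" "\<And>s. s \<in> {0..1} \<Longrightarrow> norm (\<delta> s0) \<le> norm (\<delta> s)"
   using continuous_attains_inf[of "{0..1::real}" "\<lambda>s. norm (\<delta> s)"] by auto
  have "\<delta> s0 \<noteq> 0"
  proof
   assume "\<delta> s0 = 0"
   hence eq: "kappa = of_real (s0 ^ q)" by (simp add: \<delta>_def)
   hence "s0 ^ q = 1" using k1(2) s0(1) by (simp add: norm_power)
   thus False using eq k1(1) by simp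
  qed
  thus ?thesis using s0(2) by (intro exI[of _ "norm (\<delta> s0)"]) auto
 qed
 then obtain e where e: "0 < e" "\<And>s. s \<in> {0..1} \<Longrightarrow> e \<le> norm (\<delta> s)" by blast
 define P where "P = (\<Sum>n<q. norm (x n / T n))"
 have P0: "0 \<le> P" by (simp add: P_def sum_nonneg)
 have "norm (gen (\<lambda>n. x n / T n) s) \<le> ((P + Bx * C1 * Ct) / e) / (1 - s)\<^sup>2" if s: "0 < s" "s < 1" for s
 proof -
  define Z where "Z = gen (\<lambda>n. x n / T n) s"
  have sz: "summable (\<lambda>n. norm (x n / T n * of_real s ^ n))" by (rule gen_quadratic_summable[OF quad']) (use s in auto)
  have sh: "of_real s ^ q * gen (\<lambda>n. x (n + q) / T (n + q)) s = Z - (\<Sum>n<q. x n / T n * of_real s ^ n)"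
   unfolding Z_def by (rule gen_shift(1)[OF sz])
  have ssh: "summable (\<lambda>n. norm (x (n + q) / T (n + q) * of_real s ^ n))" by (rule gen_shift(2)[OF sz s(1)])
  have sk: "summable (\<lambda>n. norm ((- 1 / kappa) * (x n / T n) * of_real s ^ n))"
   using summable_mult[OF sz, of "norm (- 1 / kappa)"] by (simp only: mult.assoc norm_mult)
  have "gen y s = gen (\<lambda>n. x (n + q) / T (n + q)) s + gen (\<lambda>n. (- 1 / kappa) * (x n / T n)) s"
   unfolding y_def by (rule gen_add[OF ssh sk])
  also have "gen (\<lambda>n. (- 1 / kappa) * (x n / T n)) s = (- 1 / kappa) * Z"
   unfolding Z_def gen_def using suminf_mult[OF summable_norm_cancel[OF sz], of "- 1 / kappa"] by (simp only: mult.assoc)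
  finally have "of_real s ^ q * gen y s = of_real s ^ q * gen (\<lambda>n. x (n + q) / T (n + q)) s + of_real s ^ q * ((- 1 / kappa) * Z)"
   by (simp only: distrib_left)
  hence eq: "\<delta> s * Z = (\<Sum>n<q. x n / T n * of_real s ^ n) + of_real s ^ q * gen y s"
   unfolding sh by (simp add: \<delta>_def algebra_simps)
  have sq: "s ^ q \<le> 1" using s by (intro power_le_one) auto
  have b1: "norm (\<Sum>n<q. x n / T n * of_real s ^ n) \<le> P" unfolding P_def
  proof (rule sum_norm_le)
   fix n
   have "norm (x n / T n) * s ^ n \<le> norm (x n / T n) * 1" using s by (intro mult_left_mono power_le_one) auto
   thus "norm (x n / T n * of_real s ^ n) \<le> norm (x n / T n)" using s by (simp add: norm_mult norm_power norm_divide)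
  qed
  have b2: "norm (of_real s ^ q * gen y s) \<le> (Bx * C1 * Ct) / (1 - s)\<^sup>2"
  proof -
   have g: "norm (gen y s) \<le> (Bx * C1 * Ct) / (1 - s)\<^sup>2" by (rule gen_linear(2)[OF yb]) (use s in auto)
   have "norm (of_real s ^ q * gen y s) = s ^ q * norm (gen y s)" using s by (simp add: norm_mult norm_power)
   also have "\<dots> \<le> 1 * norm (gen y s)" using sq by (rule mult_right_mono) simp
   finally show ?thesis using g by simp
  qed
  have s1: "0 < (1 - s)\<^sup>2" "(1 - s)\<^sup>2 \<le> 1" using s by (auto simp: power_le_one)
  have "P * (1 - s)\<^sup>2 \<le> P * 1" using P0 s1(2) by (intro mult_left_mono)
  hence "P \<le> P / (1 - s)\<^sup>2" using s1(1) by (simp add: pos_le_divide_eq)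
  hence "norm (\<delta> s) * norm Z \<le> (P + Bx * C1 * Ct) / (1 - s)\<^sup>2"
   using norm_triangle_ineq[of "\<Sum>n<q. x n / T n * of_real s ^ n" "of_real s ^ q * gen y s"] b1 b2
   unfolding norm_mult[symmetric] eq by (simp add: add_divide_distrib)
  moreover have "e * norm Z \<le> norm (\<delta> s) * norm Z" using e(2)[of s] s by (intro mult_right_mono) auto
  ultimately have "e * norm Z \<le> (P + Bx * C1 * Ct) / (1 - s)\<^sup>2" by linarith
  hence "norm Z \<le> (P + Bx * C1 * Ct) / (1 - s)\<^sup>2 / e" by (simp only: pos_le_divide_eq[OF e(1)] mult.commute)
  thus ?thesis unfolding Z_def by (simp add: mult.commute)
 qed
 thus ?thesis by blast
qed

text \<open>With \<open>W n = X n (c n) / T n\<close> the approximate lifting equation reads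
  \<open>zeta (Suc n) = W (Suc n) - W n + \<epsilon> n\<close>. The difference contributes
  \<open>1 - s\<close> times a series of order 2. The error is at most a constant times
  \<open>norm (t n) * norm (d n) ^ l\<close>, bounded because \<open>t\<close> grows linearly,
  \<open>norm (d n) ^ m\<close> is \<open>O(1 / n)\<close> and \<open>m \<le> l\<close>: here the
  count of petals enters.\<close>

lemma zeta_gen_bound:
 assumes k1: "kappa \<noteq> 1" "norm kappa = 1" and X: "vfield 1 (Suc l) X S" and m: "m \<le> l"
  and Ct: "\<And>n. norm (t n) \<le> Ct * (real n + 1)" and quad: "\<And>n. norm (1 / T n) \<le> CT * (real n + 1)\<^sup>2"
  and Cd: "\<And>n. norm (d n) ^ m * (real n + 1) \<le> Cd"
 shows "(\<forall>s. 0 < s \<longrightarrow> s < 1 \<longrightarrow> summable (\<lambda>n. norm (zeta n * of_real s ^ n))) \<and>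
  (\<exists>C. \<forall>s. 0 < s \<longrightarrow> s < 1 \<longrightarrow> norm (gen zeta s) \<le> C / (1 - s))"
proof -
 have Ct0: "0 \<le> Ct" using order_trans[OF norm_ge_zero Ct[of 0]] by simp
 obtain C1 where C1: "0 < C1" "\<And>n. norm (f (c n) - X (Suc n) (c (Suc n)) + 1 * g' (c n) * X n (c n)) \<le> C1 * norm (d n) ^ Suc l"
  using vfield_along_orbit[OF X] by blast
 obtain C2 where C2: "0 < C2" "\<And>n. norm (X n (c n) - X n (b n)) \<le> C2 * norm (d n)" using vfield_near[OF X] by blast
 obtain C3 where C3: "0 < C3" "\<And>n. C3 \<le> norm (g' (c n))" using g'_c_lower by blast
 obtain Bd where Bd: "0 < Bd" "\<And>n. norm (d n) \<le> Bd" using d_bounded by blast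
 define W where "W n = X n (c n) / T n" for n
 define \<epsilon> where "\<epsilon> n = (f (c n) - X (Suc n) (c (Suc n)) + g' (c n) * X n (c n)) / T (Suc n)" for n
 have zS: "zeta (Suc n) = W (Suc n) - W n + \<epsilon> n" for n
  unfolding zeta_def W_def \<epsilon>_def T_Suc using T_nz[of n] g'_c_nz[of n] by (simp add: field_simps)
 define Ce where "Ce = C1 / C3 * Ct * (Bd ^ (l - m) * Cd)"
 have \<epsilon>b: "norm (\<epsilon> n) \<le> Ce" for n
 proof -
  have "norm (\<epsilon> n) \<le> (C1 * norm (d n) ^ Suc l) / (norm (T n) * C3)" unfolding \<epsilon>_def T_Suc norm_divide
  proof (rule frac_le)
   show "norm (f (c n) - X (Suc n) (c (Suc n)) + g' (c n) * X n (c n)) \<le> C1 * norm (d n) ^ Suc l" using C1(2)[of n] by simp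
   show "norm (T n) * C3 \<le> norm (T n * g' (c n))" unfolding norm_mult[of "T n"] by (rule mult_left_mono[OF C3(2)]) simp
  qed (use C1 C3 T_nz[of n] in auto)
  also have "\<dots> = C1 / C3 * (norm (t n) * norm (d n) ^ l)" by (simp add: t_def norm_divide)
  also have "\<dots> \<le> C1 / C3 * (Ct * (Bd ^ (l - m) * Cd))"
  proof (rule mult_left_mono)
   have "norm (d n) ^ l = norm (d n) ^ (l - m) * norm (d n) ^ m" using m by (simp add: power_add[symmetric])
   also have "\<dots> \<le> Bd ^ (l - m) * norm (d n) ^ m" using Bd by (intro mult_right_mono power_mono) auto
   finally have "norm (t n) * norm (d n) ^ l \<le> (Ct * (real n + 1)) * (Bd ^ (l - m) * norm (d n) ^ m)"
    using Ct[of n] Ct0 by (intro mult_mono) auto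
   also have "\<dots> = Ct * (Bd ^ (l - m) * (norm (d n) ^ m * (real n + 1)))" by simp
   also have "\<dots> \<le> Ct * (Bd ^ (l - m) * Cd)" using Ct0 Bd(1) Cd by (intro mult_left_mono) auto
   finally show "norm (t n) * norm (d n) ^ l \<le> Ct * (Bd ^ (l - m) * Cd)" .
  qed (use C1 C3 in simp)
  finally show ?thesis by (simp add: Ce_def)
 qed
 define w2 where "w2 n = (X n (c n) - X n (b n)) / T n" for n
 have w2b: "norm (w2 n) \<le> (C2 * Ct) * (real n + 1)" for n
 proof -
  have "norm (w2 n) \<le> C2 * norm (d n) / norm (T n)" unfolding w2_def norm_divide by (rule divide_right_mono[OF C2(2)]) simp
  also have "\<dots> = C2 * norm (t n)" by (simp add: t_def norm_divide)
  also have "\<dots> \<le> C2 * (Ct * (real n + 1))" using C2(1) Ct by (intro mult_left_mono) auto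
  finally show ?thesis by simp
 qed
 have Xp: "X (n + q) (b (n + q)) = X n (b n)" for n using vfield_X_per[OF X, of n 1] by (simp add: b_per)
 obtain Cz where Cz: "\<And>s. 0 < s \<Longrightarrow> s < 1 \<Longrightarrow> norm (gen (\<lambda>n. X n (b n) / T n) s) \<le> Cz / (1 - s)\<^sup>2"
  using periodic_gen_bound[where x = "\<lambda>n. X n (b n)", OF k1 Xp Ct quad] by blast
 have Bxe: "\<exists>Bx\<ge>0. \<forall>n. norm (X n (b n)) \<le> Bx"
 proof -
  have "norm (X n (b n)) \<le> (\<Sum>j<q. norm (X j (b j)))" for n
  proof -
   have "X n (b n) = X (n mod q) (b (n mod q))" using vfield_X_per[OF X, of "n mod q" "n div q"] by (simp add: b_mod)
   thus ?thesis using member_le_sum[of "n mod q" "{..<q}" "\<lambda>j. norm (X j (b j))"] q_pos by simp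
  qed
  thus ?thesis by (intro exI[of _ "\<Sum>j<q. norm (X j (b j))"]) (simp add: sum_nonneg)
 qed
 then obtain Bx where Bx: "0 \<le> Bx" "\<And>n. norm (X n (b n)) \<le> Bx" by blast
 have w1b: "norm (X n (b n) / T n) \<le> (Bx * CT) * (real n + 1)\<^sup>2" for n
  using mult_mono[OF Bx(2)[of n] quad[of n]] Bx(1) by (simp add: norm_mult[symmetric])
 have Weq: "W n = X n (b n) / T n + w2 n" for n by (simp add: W_def w2_def diff_divide_distrib)
 have all: "summable (\<lambda>n. norm (zeta n * of_real s ^ n)) \<and> norm (gen zeta s) \<le> (1 + norm (W 0) + (Cz + C2 * Ct) + Ce) / (1 - s)"
  if s: "0 < s" "s < 1" for s
 proof -
  have s': "0 \<le> s" using s by simp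
  note s1 = gen_quadratic_summable[OF w1b s' s(2)] and s2 = gen_linear(1)[OF w2b s' s(2)]
  have sW: "summable (\<lambda>n. norm (W n * of_real s ^ n))"
   by (rule summable_comparison_test'[OF summable_add[OF s1 s2]])
    (simp add: Weq distrib_right norm_triangle_ineq)
  have gW: "gen W s = gen (\<lambda>n. X n (b n) / T n) s + gen w2 s" unfolding Weq[abs_def] by (rule gen_add[OF s1 s2])
  have nW: "norm (gen W s) \<le> (Cz + C2 * Ct) / (1 - s)\<^sup>2" unfolding gW add_divide_distrib
   by (intro order_trans[OF norm_triangle_ineq] add_mono Cz s gen_linear(2)[OF w2b s' s(2)])
  note s\<epsilon> = gen_const(1)[OF \<epsilon>b s' s(2)]
  have sW1: "summable (\<lambda>n. norm (W (n + 1) * of_real s ^ n))" by (rule gen_shift(2)[OF sW s(1)])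
  have smW: "summable (\<lambda>n. norm (- W n * of_real s ^ n))" using sW by simp
  have sWW: "summable (\<lambda>n. norm ((W (n + 1) + - W n) * of_real s ^ n))"
   by (rule summable_comparison_test'[OF summable_add[OF sW1 smW]]) (simp only: distrib_right norm_triangle_ineq real_norm_def abs_norm_cancel)
  have sz1: "summable (\<lambda>n. norm (zeta (n + 1) * of_real s ^ n))"
  proof (rule summable_comparison_test'[OF summable_add[OF sWW s\<epsilon>]])
   fix n
   have "zeta (n + 1) * of_real s ^ n = (W (n + 1) + - W n) * of_real s ^ n + \<epsilon> n * of_real s ^ n"
    by (simp add: zS distrib_right)
   thus "norm (norm (zeta (n + 1) * of_real s ^ n)) \<le>
     norm ((W (n + 1) + - W n) * of_real s ^ n) + norm (\<epsilon> n * of_real s ^ n)"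
    by (simp only: real_norm_def abs_norm_cancel norm_triangle_ineq)
  qed
  have "summable (\<lambda>n. norm (zeta (n + 1) * of_real s ^ (n + 1)))"
   using summable_mult[OF sz1, of s] by (simp add: norm_mult mult_ac)
  hence sz: "summable (\<lambda>n. norm (zeta n * of_real s ^ n))"
   by (rule summable_iff_shift[of "\<lambda>n. norm (zeta n * of_real s ^ n)" 1, THEN iffD1])
  have g1: "gen (\<lambda>n. zeta (n + 1)) s = gen (\<lambda>n. W (n + 1)) s + gen (\<lambda>n. - W n) s + gen \<epsilon> s"
  proof -
   have "gen (\<lambda>n. zeta (n + 1)) s = gen (\<lambda>n. (W (n + 1) + - W n) + \<epsilon> n) s" by (simp add: zS)
   also have "\<dots> = gen (\<lambda>n. W (n + 1) + - W n) s + gen \<epsilon> s" by (rule gen_add[OF sWW s\<epsilon>])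
   also have "gen (\<lambda>n. W (n + 1) + - W n) s = gen (\<lambda>n. W (n + 1)) s + gen (\<lambda>n. - W n) s" by (rule gen_add[OF sW1 smW])
   finally show ?thesis .
  qed
  have g2: "gen (\<lambda>n. - W n) s = - gen W s"
   unfolding gen_def using suminf_minus[OF summable_norm_cancel[OF sW]] by simp
  have g3: "of_real s * gen (\<lambda>n. W (n + 1)) s = gen W s - W 0" using gen_shift(1)[OF sW, of 1] by simp
  have g4: "of_real s * gen (\<lambda>n. zeta (n + 1)) s = gen zeta s - 1"
  proof -
   have "zeta 0 = 1" by (simp add: zeta_def)
   thus ?thesis using gen_shift(1)[OF sz, of 1] by simp
  qed
  have "gen zeta s = 1 + of_real s * (gen (\<lambda>n. W (n + 1)) s + - gen W s + gen \<epsilon> s)" using g4 unfolding g1 g2 by simp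
  also have "\<dots> = (1 - W 0) + (of_real (1 - s) * gen W s + of_real s * gen \<epsilon> s)"
   using g3 by (simp add: algebra_simps)
  finally have ge: "gen zeta s = (1 - W 0) + (of_real (1 - s) * gen W s + of_real s * gen \<epsilon> s)" .
  have n1: "norm (1 - W 0) \<le> (1 + norm (W 0)) / (1 - s)"
  proof -
   have "norm (1 - W 0) \<le> 1 + norm (W 0)" using norm_triangle_ineq4[of 1 "W 0"] by simp
   moreover have "(1 + norm (W 0)) * (1 - s) \<le> (1 + norm (W 0)) * 1" using s by (intro mult_left_mono) auto
   hence "1 + norm (W 0) \<le> (1 + norm (W 0)) / (1 - s)" using s by (simp add: pos_le_divide_eq)
   ultimately show ?thesis by linarith
  qed
  have n2: "norm (of_real (1 - s) * gen W s) \<le> (Cz + C2 * Ct) / (1 - s)"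
  proof -
   have "norm (of_real (1 - s) * gen W s) = (1 - s) * norm (gen W s)" unfolding norm_mult norm_of_real using s by simp
   also have "\<dots> \<le> (1 - s) * ((Cz + C2 * Ct) / (1 - s)\<^sup>2)" using nW s by (intro mult_left_mono) auto
   also have "\<dots> = (Cz + C2 * Ct) / (1 - s)" by (simp add: power2_eq_square)
   finally show ?thesis .
  qed
  have n3: "norm (of_real s * gen \<epsilon> s) \<le> Ce / (1 - s)"
  proof -
   have "norm (of_real s * gen \<epsilon> s) = s * norm (gen \<epsilon> s)" unfolding norm_mult using s by simp
   also have "\<dots> \<le> 1 * norm (gen \<epsilon> s)" using s by (intro mult_right_mono) auto
   finally show ?thesis using gen_const(2)[of \<epsilon>, OF \<epsilon>b s' s(2)] by simp
  qed
  have "norm (gen zeta s) \<le> (1 + norm (W 0)) / (1 - s) + ((Cz + C2 * Ct) / (1 - s) + Ce / (1 - s))"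
   unfolding ge by (intro order_trans[OF norm_triangle_ineq] add_mono n1 n2 n3)
  thus ?thesis using sz by (simp add: add_divide_distrib)
 qed
 thus ?thesis by blast
qed

text \<open>By convolution the series of \<open>v 0 n / T n\<close> is the product of the series of
  \<open>v k 0\<close> and of \<open>zeta\<close>. The former has coefficients close to
  \<open>K * L * n\<close>, hence size about \<open>K * norm L / (1 - x) ^ 2\<close>; if the
  transversality sum vanished, the product would be at most about
  \<open>B * Cz / (1 - x) ^ 2\<close>, with \<open>B\<close> and \<open>Cz\<close> independent of
  \<open>K\<close>.\<close>

lemma parabolic_transversal:
 assumes k1: "kappa \<noteq> 1" and l: "0 < l" "kappa ^ l = 1" "\<And>k. 0 < k \<Longrightarrow> k < l \<Longrightarrow> kappa ^ k \<noteq> 1"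
  and pa: "parabolic_asymptotics (q * l) m b" and m: "0 < m" "m \<le> l"
  and A: "\<And>n. A (Suc n) = g' (b n) * A n + f (b n)" "\<And>n. A (n + q) = A n"
 shows "(\<Sum>j<q. (f' j + g'' j * A j) / g' (b j)) \<noteq> 0"
proof
 assume zero: "(\<Sum>j<q. (f' j + g'' j * A j) / g' (b j)) = 0"
 have "norm kappa ^ l = 1" using l(2) by (metis norm_one norm_power)
 hence nk: "norm kappa = 1" using power_eq_imp_eq_base[of "norm kappa" l 1] l(1) by simp
 have l1: "l \<noteq> 1" using k1 l(2) by auto
 obtain X0 S0 where X0: "vfield 1 2 X0 S0" using vfield_resonant_step[OF A zero] by blast
 have "\<exists>X S. vfield 1 (Suc (Suc (l - 1))) X S"
 proof (rule vfield_below_resonance[OF X0, where l = l])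
  show "kappa ^ k \<noteq> 1" if "0 < k" "k < l" for k by (rule l(3)[OF that])
  show "l - 1 < l" using l(1) by simp
 qed
 then obtain X S where X: "vfield 1 (Suc l) X S" using l(1) by auto
 have N: "0 < q * l" using q_pos l(1) by simp
 obtain L where L: "L \<noteq> 0" "(\<lambda>n. t n / of_nat n) \<longlonglongrightarrow> L" using parabolic_growth(1)[OF pa N m(1)] by blast
 obtain Cd where Cd: "0 < Cd" "\<And>n. norm (d n) ^ m * (real n + 1) \<le> Cd" using parabolic_growth(2)[OF pa N m(1)] by blast
 obtain Cl where Cl: "0 < Cl" "\<And>n. 1 \<le> Cl * (norm (d n) * (real n + 1))" using parabolic_growth(3)[OF pa N m(1)] by blast
 have Lp: "0 < norm L" using L(1) by simp
 have tL: "\<forall>\<^sub>F n in sequentially. norm (t n - L * of_real (real n + 1)) \<le> norm L / 2 * (real n + 1)"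
 proof -
  have "(\<lambda>n. t n / of_nat n - L - L * (1 / of_nat n)) \<longlonglongrightarrow> L - L - L * 0" by (intro tendsto_intros L lim_1_over_n)
  hence "(\<lambda>n. t n / of_nat n - L - L * (1 / of_nat n)) \<longlonglongrightarrow> 0" by simp
  from tendstoD[OF this, of "norm L / 2"] Lp
  have "\<forall>\<^sub>F n in sequentially. norm (t n / of_nat n - L - L * (1 / of_nat n)) < norm L / 2" by simp
  thus ?thesis using eventually_gt_at_top[of 0]
  proof eventually_elim
   case (elim n)
   have "t n - L * of_real (real n + 1) = (t n / of_nat n - L - L * (1 / of_nat n)) * of_nat n"
    using elim(2) by (simp add: algebra_simps)
   hence "norm (t n - L * of_real (real n + 1)) = norm (t n / of_nat n - L - L * (1 / of_nat n)) * real n"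
    by (simp only: norm_mult norm_of_nat)
   also have "\<dots> \<le> norm L / 2 * (real n + 1)" using elim(1) by (intro mult_mono) auto
   finally show ?case .
  qed
 qed
 obtain Ct where Ct: "0 < Ct" "\<And>n. norm (t n) \<le> Ct * (real n + 1)" using linear_bound_of_limit[OF L(2)] by blast
 have quad: "norm (1 / T n) \<le> (Ct * Cl) * (real n + 1)\<^sup>2" for n
 proof -
  have dn: "0 < norm (d n)" using d_nz by simp
  have "norm (1 / T n) = norm (t n) / norm (d n)" using d_nz[of n] by (simp add: t_def norm_divide)
  also have "\<dots> \<le> (Ct * (real n + 1)) / norm (d n)" by (rule divide_right_mono[OF Ct(2)]) simp
  also have "\<dots> \<le> (Ct * (real n + 1)) * (Cl * (real n + 1))"
   using mult_left_mono[OF Cl(2)[of n], of "Ct * (real n + 1)"] dn Ct(1) by (simp add: pos_divide_le_eq mult_ac)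
  finally show ?thesis by (simp add: power2_eq_square mult_ac)
 qed
 have "(\<forall>s. 0 < s \<longrightarrow> s < 1 \<longrightarrow> summable (\<lambda>n. norm (zeta n * of_real s ^ n))) \<and>
  (\<exists>C. \<forall>s. 0 < s \<longrightarrow> s < 1 \<longrightarrow> norm (gen zeta s) \<le> C / (1 - s))"
  by (rule zeta_gen_bound[OF k1 nk X m(2) Ct(2) quad Cd(2)])
 then obtain Cz where sz: "\<And>s. 0 < s \<Longrightarrow> s < 1 \<Longrightarrow> summable (\<lambda>n. norm (zeta n * of_real s ^ n))"
  and Cz: "\<And>s. 0 < s \<Longrightarrow> s < 1 \<Longrightarrow> norm (gen zeta s) \<le> Cz / (1 - s)" by blast
 obtain B where B: "0 < B" and lifts: "\<And>K. 0 \<le> K \<Longrightarrow> \<exists>v \<alpha> n0. large_jets B K n0 v \<alpha>" by (rule large_lifts) (rule that)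
 have bound: "K * (norm L / 2) \<le> B * Cz" if K: "0 \<le> K" for K
 proof -
  obtain v n0 where v: "\<And>k n. v k (Suc n) = g' (c n) * v (Suc k) n + v k 0 * f (c n)"
   and vB: "\<And>k n. norm (v (Suc k) n) \<le> B" and v0: "\<And>n. n \<ge> n0 \<Longrightarrow> v 0 n = of_real K * d n"
   using lifts[OF K] unfolding large_jets_def by blast
  define R where "R n = v 0 n / T n" for n
  define s where "s k = v k 0" for k
  have conv: "R n = (\<Sum>j\<le>n. s j * zeta (n - j))" for n
   using lift_convolution[of v, OF v, of 0 n] by (simp add: R_def s_def)
  \<comment> \<open>The deviation of the coefficients from exactly linear growth. Half of
    \<open>K * norm L\<close> is given away to it, so that a crude bound for large \<open>n\<close>
    suffices.\<close>
  define rr where "rr n = R n + - (of_real K * L) * of_real (real n + 1)" for n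
  have "\<forall>\<^sub>F n in sequentially. norm (rr n) \<le> (K * (norm L / 2)) * (real n + 1)" using tL eventually_ge_at_top[of n0]
  proof eventually_elim
   case (elim n)
   have "rr n = of_real K * (t n - L * of_real (real n + 1))" using elim(2) by (simp add: rr_def R_def v0 t_def algebra_simps)
   thus ?case using mult_left_mono[OF elim(1) K] K by (simp add: norm_mult)
  qed
  from gen_eventually_linear[OF this] obtain E where E: "\<And>x. 0 \<le> x \<Longrightarrow> x < 1 \<Longrightarrow> norm (gen rr x) \<le> E + (K * (norm L / 2)) / (1 - x)\<^sup>2"
   using K by auto
  have ineq: "K * (norm L / 2) \<le> (norm (s 0) * (1 - x) + B) * Cz + E * (1 - x)\<^sup>2" if x: "0 < x" "x < 1" for x
  proof -
   have x': "0 \<le> x" using x by simp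
   have x1: "0 < 1 - x" using x by simp
   have sB: "norm (s n) \<le> norm (s 0) + B" for n using B vB[of "n - 1" 0] by (cases n) (simp_all add: s_def add_increasing)
   note ss = gen_const(1)[OF sB x' x(2)]
   have shift: "of_real x * gen (\<lambda>n. s (n + 1)) x = gen s x - s 0" using gen_shift(1)[OF ss, of 1] by simp
   have "norm (gen (\<lambda>n. s (n + 1)) x) \<le> B / (1 - x)" by (rule gen_const(2)[OF _ x' x(2)]) (simp add: s_def vB)
   hence "norm (of_real x * gen (\<lambda>n. s (n + 1)) x) \<le> 1 * (B / (1 - x))"
    unfolding norm_mult using x by (intro mult_mono) auto
   hence "norm (gen s x - s 0) \<le> B / (1 - x)" unfolding shift by simp
   moreover have "norm (gen s x) \<le> norm (s 0) + norm (gen s x - s 0)" by (rule norm_triangle_sub)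
   ultimately have gs: "norm (gen s x) \<le> norm (s 0) + B / (1 - x)" by linarith
   have prod: "(\<lambda>n. R n * of_real x ^ n) sums (gen s x * gen zeta x)"
   proof -
    have "(\<lambda>n. \<Sum>i\<le>n. (s i * of_real x ^ i) * (zeta (n - i) * of_real x ^ (n - i))) sums (gen s x * gen zeta x)"
     unfolding gen_def by (rule Cauchy_product_sums[OF ss sz[OF x]])
    moreover have "(\<Sum>i\<le>n. (s i * of_real x ^ i) * (zeta (n - i) * of_real x ^ (n - i))) = R n * of_real x ^ n" for n
     unfolding conv sum_distrib_right
    proof (rule sum.cong[OF refl])
     fix i assume "i \<in> {..n}"
     hence "(of_real x ^ n :: complex) = of_real x ^ i * of_real x ^ (n - i)" by (simp add: power_add[symmetric])
     thus "(s i * of_real x ^ i) * (zeta (n - i) * of_real x ^ (n - i)) = s i * zeta (n - i) * of_real x ^ n"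
      by simp
    qed
    ultimately show ?thesis by simp
   qed
   have lin: "(\<lambda>n. - (of_real K * L) * of_real (real n + 1) * of_real x ^ n) sums (- (of_real K * L) * of_real (1 / (1 - x)\<^sup>2))"
   proof -
    have "(\<lambda>n. of_real ((real n + 1) * x ^ n) :: complex) sums of_real (1 / (1 - x)\<^sup>2)"
     by (rule sums_of_real[OF linear_sums[OF x' x(2)]])
    from sums_mult[OF this, of "- (of_real K * L)"] show ?thesis by (simp add: mult.assoc)
   qed
   have "(\<lambda>n. rr n * of_real x ^ n) sums (gen s x * gen zeta x + - (of_real K * L) * of_real (1 / (1 - x)\<^sup>2))"
    using sums_add[OF prod lin] by (simp only: rr_def distrib_right)
   hence "gen rr x = gen s x * gen zeta x + - (of_real K * L) * of_real (1 / (1 - x)\<^sup>2)"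
    unfolding gen_def[of rr] by (rule sums_unique[symmetric])
   hence "of_real K * L * of_real (1 / (1 - x)\<^sup>2) = gen s x * gen zeta x - gen rr x" by simp
   hence "norm (of_real K * L * of_real (1 / (1 - x)\<^sup>2)) \<le> norm (gen s x * gen zeta x) + norm (gen rr x)"
    by (simp only: norm_triangle_ineq4)
   moreover have "norm (of_real K * L * of_real (1 / (1 - x)\<^sup>2) :: complex) = K * norm L / (1 - x)\<^sup>2"
    unfolding norm_mult norm_of_real using K by simp
   moreover have "norm (gen s x * gen zeta x) \<le> (norm (s 0) + B / (1 - x)) * (Cz / (1 - x))"
    unfolding norm_mult using gs Cz[OF x] B x1 by (intro mult_mono) (auto)
   ultimately have "K * norm L / (1 - x)\<^sup>2 \<le> (norm (s 0) + B / (1 - x)) * (Cz / (1 - x)) + (E + (K * (norm L / 2)) / (1 - x)\<^sup>2)"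
    using E[OF x' x(2)] by linarith
   hence "K * norm L / (1 - x)\<^sup>2 * (1 - x)\<^sup>2 \<le>
     ((norm (s 0) + B / (1 - x)) * (Cz / (1 - x)) + (E + (K * (norm L / 2)) / (1 - x)\<^sup>2)) * (1 - x)\<^sup>2"
    by (rule mult_right_mono) simp
   also have "\<dots> = (norm (s 0) * (1 - x) + B) * Cz + (E * (1 - x)\<^sup>2 + K * (norm L / 2))"
    using x1 by (simp add: distrib_right power2_eq_square) (simp add: field_simps)
   finally show ?thesis using x1 by simp
  qed
  \<comment> \<open>Letting \<open>x\<close> tend to 1 removes \<open>s 0 = v 0 0\<close> and
    \<open>E\<close>, for which there is no bound independent of \<open>K\<close>.\<close>
  have lim: "((\<lambda>x. (norm (s 0) * (1 - x) + B) * Cz + E * (1 - x)\<^sup>2) \<longlongrightarrow> (norm (s 0) * (1 - 1) + B) * Cz + E * (1 - 1)\<^sup>2) (at_left 1)"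
   by (intro tendsto_intros)
  have "K * (norm L / 2) \<le> (norm (s 0) * (1 - 1) + B) * Cz + E * (1 - 1)\<^sup>2"
  proof (rule tendsto_lowerbound[OF lim])
   show "\<forall>\<^sub>F x in at_left 1. K * (norm L / 2) \<le> (norm (s 0) * (1 - x) + B) * Cz + E * (1 - x)\<^sup>2"
    using eventually_at_left_real[OF zero_less_one] by (rule eventually_mono) (rule ineq, auto)
  qed simp
  thus ?thesis by simp
 qed
 have "(\<bar>B * Cz\<bar> + 1) / (norm L / 2) * (norm L / 2) \<le> B * Cz" by (rule bound) (simp)
 thus False using Lp by simp
qed

end

section \<open>Parabolic cycles with multiplier 1\<close>

lemma holomorphic_lower_lipschitz:
 assumes h: "h holomorphic_on D" "open D" "z \<in> D" "deriv h z \<noteq> 0"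
 shows "\<exists>r>0. \<exists>\<eta>>0. \<forall>x\<in>ball z r. \<forall>y\<in>ball z r. \<eta> * norm (x - y) \<le> norm (h x - h y)"
proof -
 define \<eta> where "\<eta> = norm (deriv h z) / 2"
 have \<eta>: "0 < \<eta>" using h(4) by (simp add: \<eta>_def)
 have "isCont (deriv h) z"
  by (rule continuous_on_interior[OF holomorphic_on_imp_continuous_on[OF holomorphic_deriv[OF h(1,2)]]])
   (use h in \<open>simp add: interior_open\<close>)
 hence "(deriv h \<longlongrightarrow> deriv h z) (nhds z)" using tendsto_at_iff_tendsto_nhds[of "deriv h" z] by (simp add: isCont_def)
 from tendstoD[OF this \<eta>] have "\<forall>\<^sub>F x in nhds z. dist (deriv h x) (deriv h z) < \<eta>" .
 moreover have "\<forall>\<^sub>F x in nhds z. x \<in> D" by (rule eventually_nhds_in_open) (use h in auto)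
 ultimately have "\<forall>\<^sub>F x in nhds z. dist (deriv h x) (deriv h z) < \<eta> \<and> x \<in> D" by (rule eventually_conj)
 then obtain r where r: "0 < r" "\<And>x. dist x z < r \<Longrightarrow> dist (deriv h x) (deriv h z) < \<eta> \<and> x \<in> D"
  unfolding eventually_nhds_metric by blast
 have "\<eta> * norm (x - y) \<le> norm (h x - h y)" if xy: "x \<in> ball z r" "y \<in> ball z r" for x y
 proof -
  define k where "k w = h w - deriv h z * w" for w
  have "norm (k x - k y) \<le> \<eta> * norm (x - y)"
  proof (rule field_differentiable_bound[of "ball z r" k "\<lambda>w. deriv h w - deriv h z"])
   fix w assume w: "w \<in> ball z r"
   hence w': "dist (deriv h w) (deriv h z) < \<eta>" "w \<in> D" using r(2)[of w] by (auto simp: dist_commute)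
   have "(k has_field_derivative deriv h w - deriv h z) (at w)"
    unfolding k_def using holomorphic_derivI[OF h(1,2) w'(2)] by (auto intro!: derivative_eq_intros)
   thus "(k has_field_derivative deriv h w - deriv h z) (at w within ball z r)" by (rule has_field_derivative_at_within)
   show "norm (deriv h w - deriv h z) \<le> \<eta>" using w'(1) by (simp add: dist_norm)
  qed (use xy in auto)
  moreover have e: "deriv h z * (x - y) = (h x - h y) - (k x - k y)" by (simp add: k_def algebra_simps)
  have "norm (deriv h z) * norm (x - y) \<le> norm (h x - h y) + norm (k x - k y)"
   unfolding norm_mult[symmetric] e by (rule norm_triangle_ineq4)
  ultimately show ?thesis by (simp add: \<eta>_def)
 qed
 thus ?thesis using r(1) \<eta> by blast
qed

section \<open>Separation of the orbit and Lipschitz data on it\<close>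

context captured begin

text \<open>Near the cycle \<open>g\<close> shrinks distances at most by a constant factor, so the
  estimate passes from one residue class to the next.\<close>

lemma orbit_separation_step:
 assumes "\<exists>e>0. \<exists>k1. \<forall>k\<ge>k1. \<forall>k'>k. e \<le> norm (c (i + q * k) - c (i + q * k')) * (real k + 1)\<^sup>2"
 shows "\<exists>e>0. \<exists>k1. \<forall>k\<ge>k1. \<forall>k'>k. e \<le> norm (c (i + s + q * k) - c (i + s + q * k')) * (real k + 1)\<^sup>2"
proof (induction s)
 case (Suc s)
 then obtain e k1 where e: "0 < e" "\<And>k k'. k1 \<le> k \<Longrightarrow> k < k' \<Longrightarrow> e \<le> norm (c (i + s + q * k) - c (i + s + q * k')) * (real k + 1)\<^sup>2"
  by blast
 have dg: "deriv g (b (i + s)) \<noteq> 0" using DERIV_imp_deriv[OF g_deriv[OF b_D]] g'_b_nz[of "i + s"] by simp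
 have hg: "g holomorphic_on D" by (intro holomorphic_intros hol_f)
 obtain r \<eta> where r: "0 < r" "0 < \<eta>"
  "\<And>x y. x \<in> ball (b (i + s)) r \<Longrightarrow> y \<in> ball (b (i + s)) r \<Longrightarrow> \<eta> * norm (x - y) \<le> norm (g x - g y)"
  using holomorphic_lower_lipschitz[OF hg open_D b_D dg] by blast
 have "filterlim (\<lambda>k. i + s + q * k) at_top sequentially" using q_pos by (intro filterlim_subseq strict_monoI) simp
 from tendstoD[OF filterlim_compose[OF d_lim this] r(1)]
 obtain k2 where k2: "\<And>k. k2 \<le> k \<Longrightarrow> norm (d (i + s + q * k)) < r" unfolding eventually_sequentially by auto
 have inb: "c (i + s + q * k) \<in> ball (b (i + s)) r" if "k2 \<le> k" for k
  using k2[OF that] by (simp add: d_def b_per_mult dist_norm norm_minus_commute)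
 have "\<eta> * e \<le> norm (c (i + Suc s + q * k) - c (i + Suc s + q * k')) * (real k + 1)\<^sup>2"
  if k: "max k1 k2 \<le> k" "k < k'" for k k'
 proof -
  have "\<eta> * e \<le> \<eta> * (norm (c (i + s + q * k) - c (i + s + q * k')) * (real k + 1)\<^sup>2)"
   using e(2)[of k k'] k r(2) by (intro mult_left_mono) auto
  also have "\<dots> = \<eta> * norm (c (i + s + q * k) - c (i + s + q * k')) * (real k + 1)\<^sup>2" by simp
  also have "\<dots> \<le> norm (g (c (i + s + q * k)) - g (c (i + s + q * k'))) * (real k + 1)\<^sup>2"
   using k by (intro mult_right_mono r(3) inb) auto
  finally show ?thesis by simp
 qed
 thus ?case using e(1) r(2) by (intro exI[of _ "\<eta> * e"] conjI exI[of _ "max k1 k2"] allI impI) auto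
qed (use assms in simp)

text \<open>For \<open>m = 1\<close> the orbit in one residue class is \<open>th / v k\<close> up to
  translation, so two points differ by \<open>th * (v k' - v k) / (v k * v k')\<close>. The
  numerator is at least of size \<open>norm th * 3/4 * (k' - k)\<close> and
  \<open>norm (v k)\<close> grows at most linearly; the other classes follow by applying
  \<open>g\<close>.\<close>

lemma orbit_separation:
 assumes pa: "parabolic_asymptotics q 1 b"
 shows "\<exists>e>0. \<exists>n1. \<forall>n\<ge>n1. \<forall>n'>n. n mod q = n' mod q \<longrightarrow> e \<le> norm (c n - c n') * (real n + 1)\<^sup>2"
proof -
 obtain i th v where th: "th \<noteq> 0" and cv: "\<And>k. c (i + q * k) = b (i + q * k) + petal 1 th (v k)"
  and Rv: "\<And>k. 3/4 * real k + 1 \<le> Re (v k)" and dv: "\<And>k. norm (v (Suc k) - v k - 1) \<le> 1/4"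
  and vlim: "(\<lambda>k. v k / of_nat k) \<longlonglongrightarrow> 1" using pa unfolding parabolic_asymptotics_def by (elim exE conjE) blast
 have nv: "3/4 * real k + 1 \<le> norm (v k)" for k using Rv[of k] complex_Re_le_cmod[of "v k"] by linarith
 have vnz: "v k \<noteq> 0" for k using nv[of k] by auto
 have pt: "petal 1 th (v k) = th / v k" for k using petal_power[of 1 "v k" th] vnz[of k] by simp
 have inc: "3/4 * real m \<le> Re (v (k + m)) - Re (v k)" for k m
 proof (induction m)
  case (Suc m)
  have "\<bar>Re (v (Suc (k + m)) - v (k + m) - 1)\<bar> \<le> 1/4" using dv[of "k + m"] abs_Re_le_cmod order_trans by blast
  hence "\<bar>Re (v (Suc (k + m))) - Re (v (k + m)) - 1\<bar> \<le> 1/4" by (simp only: minus_complex.sel one_complex.sel)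
  hence "3/4 \<le> Re (v (k + Suc m)) - Re (v (k + m))" unfolding add_Suc_right by linarith
  thus ?case using Suc unfolding of_nat_Suc distrib_left by linarith
 qed simp
 obtain V' where V': "0 < V'" and vle: "\<And>k. norm (v k) \<le> V' * (real k + 1)"
  using linear_bound_of_limit[OF vlim] by blast
 \<comment> \<open>3/8 is 3/4, from the growth of \<open>Re (v k)\<close>, times 1/2, from
   \<open>2 * (k' - k) * (k + 1) \<ge> k' + 1\<close>.\<close>
 define e where "e = norm th * (3/8) / (V' * V')"
 have e: "0 < e" using th V' by (simp add: e_def)
 have base: "e \<le> norm (c (i + q * k) - c (i + q * k')) * (real k + 1)\<^sup>2" if kk: "k < k'" for k k'
 proof -
  have "c (i + q * k) - c (i + q * k') = th * (v k' - v k) / (v k * v k')"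
   unfolding cv pt b_per_mult using vnz[of k] vnz[of k'] by (simp add: field_simps)
  hence eq: "norm (c (i + q * k) - c (i + q * k')) = norm th * norm (v k' - v k) / (norm (v k) * norm (v k'))"
   by (simp add: norm_mult norm_divide)
  have "3/4 * real (k' - k) \<le> Re (v k') - Re (v k)" using inc[of "k' - k" k] kk by simp
  also have "\<dots> \<le> norm (v k' - v k)" using complex_Re_le_cmod[of "v k' - v k"] by simp
  finally have "3/4 * (real k' - real k) \<le> norm (v k' - v k)" by simp
  hence "norm th * (3/4 * (real k' - real k)) / ((V' * (real k + 1)) * (V' * (real k' + 1)))
    \<le> norm th * norm (v k' - v k) / (norm (v k) * norm (v k'))"
   using vle[of k] vle[of k'] vnz[of k] vnz[of k'] V'
   by (intro frac_le mult_left_mono mult_mono mult_nonneg_nonneg mult_pos_pos) auto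
  hence "norm th * (3/4 * (real k' - real k)) / ((V' * (real k + 1)) * (V' * (real k' + 1))) * (real k + 1)\<^sup>2
    \<le> norm (c (i + q * k) - c (i + q * k')) * (real k + 1)\<^sup>2"
   unfolding eq by (rule mult_right_mono) simp
  moreover have "norm th * (3/4 * (real k' - real k)) / ((V' * (real k + 1)) * (V' * (real k' + 1))) * (real k + 1)\<^sup>2
    = e * (2 * ((real k' - real k) * (real k + 1) / (real k' + 1)))"
  proof -
   have ab: "A * (3/4 * y) / ((V' * X) * (V' * Z)) * X\<^sup>2 = (A * (3/8) / (V' * V')) * (2 * (y * X / Z))"
    if "X \<noteq> 0" for A y X Z :: real by (simp add: power2_eq_square mult_ac)
   show ?thesis unfolding e_def by (rule ab) simp
  qed
  moreover have "1 \<le> 2 * ((real k' - real k) * (real k + 1) / (real k' + 1))"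
  proof -
   define x where "x = real k' - real k"
   have x: "1 \<le> x" using kk by (simp add: x_def)
   have "1 * real k \<le> x * real k" using x by (rule mult_right_mono) simp
   hence "real k' + 1 \<le> 2 * ((real k' - real k) * (real k + 1))"
    using x by (simp add: x_def[symmetric] algebra_simps) (simp add: x_def)
   thus ?thesis by simp
  qed
  hence "e * 1 \<le> e * (2 * ((real k' - real k) * (real k + 1) / (real k' + 1)))"
   using e by (intro mult_left_mono) auto
  ultimately show ?thesis by linarith
 qed
 have "\<exists>e>0. \<exists>k1. \<forall>k\<ge>k1. \<forall>k'>k. e \<le> norm (c (i + s + q * k) - c (i + s + q * k')) * (real k + 1)\<^sup>2" for s
  by (rule orbit_separation_step) (use base e in blast)
 hence "\<forall>s. \<exists>e. 0 < e \<and> (\<exists>k1. \<forall>k\<ge>k1. \<forall>k'>k. e \<le> norm (c (i + s + q * k) - c (i + s + q * k')) * (real k + 1)\<^sup>2)" by simp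
 from choice[OF this] obtain E where
  E: "\<forall>s. 0 < E s \<and> (\<exists>k1. \<forall>k\<ge>k1. \<forall>k'>k. E s \<le> norm (c (i + s + q * k) - c (i + s + q * k')) * (real k + 1)\<^sup>2)" by (rule exE)
 hence "\<forall>s. \<exists>k1. \<forall>k\<ge>k1. \<forall>k'>k. E s \<le> norm (c (i + s + q * k) - c (i + s + q * k')) * (real k + 1)\<^sup>2" by simp
 from choice[OF this] obtain K where
  K: "\<forall>s. \<forall>k\<ge>K s. \<forall>k'>k. E s \<le> norm (c (i + s + q * k) - c (i + s + q * k')) * (real k + 1)\<^sup>2" by (rule exE)
 define e0 where "e0 = Min (E ` {..<q})"
 have Epos: "0 < E s" for s using E by simp
 have "0 < e0" unfolding e0_def using q_pos Epos by (subst Min_gr_iff) auto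
 hence e0: "0 < e0" "\<And>s. s < q \<Longrightarrow> e0 \<le> E s" by (auto simp: e0_def)
 define K0 where "K0 = Max (K ` {..<q})"
 have K0: "\<And>s. s < q \<Longrightarrow> K s \<le> K0" by (auto simp: K0_def)
 have "e0 \<le> norm (c n - c n') * (real n + 1)\<^sup>2"
  if n: "i + q * (K0 + 1) \<le> n" "n < n'" "n mod q = n' mod q" for n n'
 proof -
  define s where "s = (n - i) mod q"
  define k where "k = (n - i) div q"
  define k' where "k' = (n' - i) div q"
  have s: "s < q" using q_pos by (simp add: s_def)
  have ni: "i \<le> n" "i \<le> n'" using n by auto
  have "(n - i + i) mod q = (n' - i + i) mod q" using n by simp
  hence 1: "(n - i + i + (q - 1) * i) mod q = (n' - i + i + (q - 1) * i) mod q" by (metis mod_add_left_eq)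
  have 2: "x + i + (q - 1) * i = x + q * i" for x using q_pos by (cases q) (simp_all)
  have s': "(n' - i) mod q = s" using 1 unfolding 2 by (simp add: s_def)
  have nn: "n = i + s + q * k" "n' = i + s + q * k'"
  proof -
   have "n - i = s + q * k" by (simp add: s_def k_def)
   thus "n = i + s + q * k" using ni by linarith
   have "n' - i = s + q * k'" using s' by (metis k'_def mod_mult_div_eq)
   thus "n' = i + s + q * k'" using ni by linarith
  qed
  have "q * k < q * k'" using n(2) nn by simp
  hence kk: "k < k'" by simp
  have "q * (K0 + 1) \<le> n - i" using n(1) by simp
  hence "(q * (K0 + 1)) div q \<le> (n - i) div q" by (rule div_le_mono)
  hence "K0 + 1 \<le> k" using q_pos by (simp add: k_def)
  hence "K s \<le> k" using K0[OF s] by simp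
  hence "E s \<le> norm (c n - c n') * (real k + 1)\<^sup>2" using K kk unfolding nn by blast
  also have "\<dots> \<le> norm (c n - c n') * (real n + 1)\<^sup>2"
  proof (rule mult_left_mono)
   have "k \<le> n" unfolding nn using q_pos by (simp add: trans_le_add2)
   thus "(real k + 1)\<^sup>2 \<le> (real n + 1)\<^sup>2" by (intro power_mono) auto
  qed simp
  finally show ?thesis using e0(2)[OF s] by linarith
 qed
 thus ?thesis using e0(1) by (intro exI[of _ e0] conjI exI[of _ "i + q * (K0 + 1)"] allI impI) auto
qed

text \<open>\<open>T n = d n / t n\<close>, where \<open>d n\<close> is \<open>O(1 / n)\<close> for
  one petal and \<open>t n\<close> is of exact order \<open>n\<close>.\<close>

lemma T_decay:
 assumes pa: "parabolic_asymptotics q 1 b"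
 shows "\<exists>C>0. \<forall>n. norm (T n) * (real n + 1)\<^sup>2 \<le> C" and "\<exists>C>0. \<forall>n. norm (t n) \<le> C * (real n + 1)"
proof -
 obtain L where L: "L \<noteq> 0" "(\<lambda>n. t n / of_nat n) \<longlonglongrightarrow> L" using parabolic_growth(1)[OF pa q_pos] by auto
 obtain Cd where Cd: "0 < Cd" "\<And>n. norm (d n) * (real n + 1) \<le> Cd" using parabolic_growth(2)[OF pa q_pos] by auto
 have Lp: "0 < norm L" using L(1) by simp
 show "\<exists>C>0. \<forall>n. norm (t n) \<le> C * (real n + 1)" by (rule linear_bound_of_limit[OF L(2)])
 have "\<forall>\<^sub>F n in sequentially. norm L / 2 < norm (t n / of_nat n)"
  by (rule order_tendstoD[OF tendsto_norm[OF L(2)]]) (use Lp in simp)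
 hence "\<forall>\<^sub>F n in sequentially. real n + 1 \<le> (4 / norm L) * norm (t n)" using eventually_gt_at_top[of 0]
 proof eventually_elim
  case (elim n)
  hence "norm L * real n \<le> 2 * norm (t n)" by (simp add: norm_divide pos_less_divide_eq)
  moreover have "norm L * (real n + 1) \<le> norm L * (2 * real n)" using elim(2) by (intro mult_left_mono) auto
  ultimately have "norm L * (real n + 1) \<le> 4 * norm (t n)" by linarith
  thus ?case using Lp by (simp add: pos_le_divide_eq mult.commute)
 qed
 from eventually_bound_all[OF this] obtain K where K: "0 < K" "\<And>n. real n + 1 \<le> K * norm (t n)" using t_nz by auto
 have "norm (T n) * (real n + 1)\<^sup>2 \<le> K * Cd" for n
 proof -
  have "norm (T n) * (real n + 1)\<^sup>2 = (norm (T n) * (real n + 1)) * (real n + 1)" by (simp add: power2_eq_square)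
  also have "\<dots> \<le> (norm (T n) * (K * norm (t n))) * (real n + 1)"
   using K(2)[of n] by (intro mult_right_mono mult_left_mono) auto
  also have "\<dots> = K * (norm (d n) * (real n + 1))" using T_nz[of n] by (simp add: t_def norm_divide)
  also have "\<dots> \<le> K * Cd" using K(1) Cd(2) by (intro mult_left_mono) auto
  finally show ?thesis .
 qed
 thus "\<exists>C>0. \<forall>n. norm (T n) * (real n + 1)\<^sup>2 \<le> C" using K Cd by (intro exI[of _ "K * Cd"]) simp
qed

end

context captured begin

lemma late_centers:
 obtains \<rho> where "0 < \<rho>" "\<And>p. p \<in> centers \<Longrightarrow> ball p \<rho> \<subseteq> D - {0}"
  "\<And>u n m. u \<in> U \<Longrightarrow> b n \<noteq> u * b m \<Longrightarrow> 2 * \<rho> \<le> dist (b n) (u * b m)"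
proof (rule center_radius)
 fix \<rho> :: real
 assume \<rho>: "0 < \<rho>" "\<And>p. p \<in> centers \<Longrightarrow> ball p \<rho> \<subseteq> D - {0}"
  "\<And>p p'. p \<in> centers \<Longrightarrow> p' \<in> centers \<Longrightarrow> p' \<noteq> p \<Longrightarrow> 2 * \<rho> \<le> dist p p'"
 show ?thesis
 proof (rule that[OF \<rho>(1,2)])
  fix u n m assume u: "u \<in> U" and ne: "b n \<noteq> u * b m"
  show "2 * \<rho> \<le> dist (b n) (u * b m)" by (rule \<rho>(3)[OF b_center center_U[OF u b_center]]) (use ne in simp)
 qed
qed

text \<open>The points of the orbit, the cycle and their mirror images accumulate only at
  \<open>centers\<close>, and \<open>c n\<close> is not one of these.\<close>

lemma early_point_isolated:
 "\<exists>e>0. \<forall>u\<in>U. \<forall>j\<in>Idx. j \<noteq> Inl n \<longrightarrow> e \<le> norm (c n - u * pnt j)"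
proof -
 have nc: "c n \<notin> centers" using c_ne_b by (auto simp: centers_def)
 obtain e0 where e0: "0 < e0" "\<forall>x\<in>centers. x \<noteq> c n \<longrightarrow> e0 \<le> dist (c n) x"
  using finite_set_avoid[OF finite_centers] by blast
 have "e0 / 2 > 0" using e0 by simp
 from tendstoD[OF d_lim this] obtain n3 where n3: "\<And>m. n3 \<le> m \<Longrightarrow> norm (d m) < e0 / 2"
  unfolding eventually_sequentially by auto
 define S where "S = (\<lambda>(u, m). u * c m) ` (U \<times> {..<n3})"
 have "finite S" unfolding S_def using U_sub finite_subset by blast
 from finite_set_avoid[OF this, of "c n"] obtain e1 where e1: "0 < e1" "\<forall>x\<in>S. x \<noteq> c n \<longrightarrow> e1 \<le> dist (c n) x" by blast
 have far: "e0 \<le> norm (c n - u * b m)" if "u \<in> U" for u m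
 proof -
  have "u * b m \<in> centers" by (rule center_U[OF that b_center])
  moreover have "u * b m \<noteq> c n" using c_ne_b[OF that, of n m] by metis
  ultimately show ?thesis using e0(2) unfolding dist_norm by blast
 qed
 have "min (e0 / 2) e1 \<le> norm (c n - u * pnt j)" if u: "u \<in> U" and j: "j \<in> Idx" "j \<noteq> Inl n" for u j
 proof (cases j)
  case (Inr m)
  thus ?thesis using far[OF u, of m] e0(1) by (simp add: pnt_def)
 next
  case (Inl m)
  show ?thesis
  proof (cases "m < n3")
   case True
   have "u * c m \<in> S" unfolding S_def using u True by (intro image_eqI[of _ _ "(u, m)"]) auto
   moreover have "u * c m \<noteq> c n" using c_ne_c[OF u, of n m] j(2) Inl by metis
   ultimately have "e1 \<le> dist (c n) (u * c m)" using e1(2) by blast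
   thus ?thesis by (simp add: Inl pnt_def dist_norm)
  next
   case False
   have "norm (c n - u * b m) \<le> norm (c n - u * c m) + norm (u * d m)"
    using norm_triangle_ineq[of "c n - u * c m" "u * d m"] by (simp add: d_def algebra_simps)
   hence "e0 \<le> norm (c n - u * c m) + norm (d m)" using far[OF u, of m] norm_U[OF u] by (simp add: norm_mult)
   hence "e0 / 2 \<le> norm (c n - u * c m)" using n3[of m] False by simp
   thus ?thesis by (simp add: Inl pnt_def)
  qed
 qed
 thus ?thesis using e0(1) e1(1) by (intro exI[of _ "min (e0 / 2) e1"]) auto
qed

text \<open>The two local estimates handle pairs close to the same cycle point. All other pairs,
  among them those with an early orbit point or with a nontrivial sign, are at distance at least
  \<open>e'\<close>, where boundedness of the data suffices.\<close>

lemma global_lipschitz: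
 assumes V: "\<And>n. norm (V n) \<le> Bw" and a: "\<And>n. norm (a n) \<le> Bw" "\<And>n. a (n + q) = a n"
  and H1: "\<And>n n'. n1 \<le> n \<Longrightarrow> n < n' \<Longrightarrow> n mod q = n' mod q \<Longrightarrow> norm (V n - V n') \<le> L * norm (c n - c n')"
  and H2: "\<And>n. n1 \<le> n \<Longrightarrow> norm (V n - a n) \<le> L * norm (d n)" and L: "0 \<le> L"
 shows "\<exists>K>0. \<forall>i\<in>Idx. \<forall>j\<in>Idx. \<forall>u\<in>U. i \<noteq> j \<longrightarrow>
  norm (case_sum V a i - u * case_sum V a j) \<le> K * norm (pnt i - u * pnt j)"
proof -
 define W where "W = case_sum V a"
 have WB: "norm (W i) \<le> Bw" for i using V a(1) by (cases i) (simp_all add: W_def)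
 have amod: "a n = a m" if "n mod q = m mod q" for n m
 proof -
  have "a (m + q * k) = a m" for m k by (induction k) (simp_all add: a(2) add.assoc[symmetric] add.commute[of q])
  from this[of "n mod q" "n div q"] this[of "m mod q" "m div q"]
  have "a n = a (n mod q)" "a m = a (m mod q)" by simp_all
  thus ?thesis using that by metis
 qed
 obtain \<rho> where \<rho>: "0 < \<rho>" "\<And>u n m. u \<in> U \<Longrightarrow> b n \<noteq> u * b m \<Longrightarrow> 2 * \<rho> \<le> dist (b n) (u * b m)"
  by (rule late_centers) blast
 have "0 < \<rho> / 2" using \<rho> by simp
 from tendstoD[OF d_lim this] obtain n2' where n2': "\<And>m. n2' \<le> m \<Longrightarrow> norm (d m) < \<rho> / 2"
  unfolding eventually_sequentially by auto
 define n2 where "n2 = max n1 n2'"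
 have n2: "n1 \<le> m \<and> norm (d m) < \<rho> / 2" if "n2 \<le> m" for m using n2'[of m] that by (simp add: n2_def)
 have "\<exists>e>0. \<forall>n\<in>{..<n2}. \<forall>u\<in>U. \<forall>j\<in>Idx. j \<noteq> Inl n \<longrightarrow> e \<le> norm (c n - u * pnt j)"
  by (rule finite_uniform_radius) (use early_point_isolated in \<open>auto intro: order_trans\<close>)
 then obtain e where e: "0 < e" "\<And>n u j. n < n2 \<Longrightarrow> u \<in> U \<Longrightarrow> j \<in> Idx \<Longrightarrow> j \<noteq> Inl n \<Longrightarrow> e \<le> norm (c n - u * pnt j)" by auto
 define e' where "e' = min e \<rho>"
 have e': "0 < e'" using e \<rho> by (simp add: e'_def)
 have Bw: "0 \<le> Bw" using order_trans[OF norm_ge_zero V[of 0]] .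
 define K where "K = 2 * Bw / e' + L + 1"
 have K: "0 < K" "2 * Bw / e' \<le> K" "L \<le> K" using Bw e' L by (auto simp: K_def intro: add_nonneg_pos)
 have big: "norm (W i - u * W j) \<le> K * norm (pnt i - u * pnt j)" if u: "u \<in> U" and le: "e' \<le> norm (pnt i - u * pnt j)" for i j u
 proof -
  have "norm (W i - u * W j) \<le> norm (W i) + norm (u * W j)" by (rule norm_triangle_ineq4)
  also have "\<dots> \<le> 2 * Bw" using WB[of i] WB[of j] norm_U[OF u] by (simp add: norm_mult)
  also have "\<dots> = (2 * Bw / e') * e'" using e' by simp
  also have "\<dots> \<le> K * norm (pnt i - u * pnt j)" using K e' le by (intro mult_mono) auto
  finally show ?thesis .
 qed
 have small: "norm (W i - u * W j) \<le> K * norm (pnt i - u * pnt j)"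
  if u: "u \<in> U" and le: "norm (W i - u * W j) \<le> L * norm (pnt i - u * pnt j)" for i j u
  using le K(3) by (meson mult_right_mono norm_ge_zero order_trans)
 define late where "late i \<longleftrightarrow> (case i of Inl n \<Rightarrow> n2 \<le> n | Inr j \<Rightarrow> True)" for i :: "nat + nat"
 define ctr where "ctr i = (case i of Inl n \<Rightarrow> n | Inr j \<Rightarrow> j)" for i :: "nat + nat"
 have lc: "norm (pnt i - b (ctr i)) < \<rho> / 2" if "late i" for i
  using that n2 \<rho>(1) by (cases i) (auto simp: late_def ctr_def pnt_def d_def)
 have main: "norm (W i - u * W j) \<le> K * norm (pnt i - u * pnt j)"
  if ij: "i \<in> Idx" "j \<in> Idx" "i \<noteq> j" and u: "u \<in> U" for i j u
 proof (cases "late i \<and> late j")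
  case False
  have uu: "u * u = 1" by (rule U_square[OF u])
  have "e \<le> norm (pnt i - u * pnt j)"
  proof (cases "late i")
   case False
   then obtain n where n: "i = Inl n" "n < n2" by (cases i) (auto simp: late_def)
   show ?thesis using e(2)[OF n(2) u ij(2)] ij(3) n(1) by (auto simp: pnt_def)
  next
   case True
   hence "\<not> late j" using False by simp
   then obtain n where n: "j = Inl n" "n < n2" by (cases j) (auto simp: late_def)
   have "e \<le> norm (c n - u * pnt i)" by (rule e(2)[OF n(2) u ij(1)]) (use ij(3) n(1) in simp)
   also have "c n - u * pnt i = - u * (pnt i - u * pnt j)" using uu by (simp add: n(1) pnt_def algebra_simps)
   also have "norm (- u * (pnt i - u * pnt j)) = norm (pnt i - u * pnt j)" using norm_U[OF u] by (simp add: norm_mult)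
   finally show ?thesis .
  qed
  thus ?thesis by (intro big[OF u]) (simp add: e'_def)
 next
  case True
  show ?thesis
  proof (cases "b (ctr i) = u * b (ctr j)")
   case False
   have "2 * \<rho> \<le> norm (b (ctr i) - u * b (ctr j))" using \<rho>(2)[OF u False] by (simp add: dist_norm)
   also have "b (ctr i) - u * b (ctr j) = (pnt i - u * pnt j) - ((pnt i - b (ctr i)) - u * (pnt j - b (ctr j)))"
    by (simp add: algebra_simps)
   also have "norm \<dots> \<le> norm (pnt i - u * pnt j) + (norm (pnt i - b (ctr i)) + norm (u * (pnt j - b (ctr j))))"
    by (intro order_trans[OF norm_triangle_ineq4] add_mono order_refl norm_triangle_ineq4)
   also have "norm (u * (pnt j - b (ctr j))) = norm (pnt j - b (ctr j))" using norm_U[OF u] by (simp add: norm_mult)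
   finally have "\<rho> \<le> norm (pnt i - u * pnt j)" using lc[of i] lc[of j] True by linarith
   thus ?thesis by (intro big[OF u]) (simp add: e'_def)
  next
   case eq: True
   have u1: "u = 1" by (rule asym[OF u eq])
   hence md: "ctr i mod q = ctr j mod q" using eq b_eq_iff by simp
   have H2': "norm (V n - a m) \<le> L * norm (c n - b m)" if "n2 \<le> n" "n mod q = m mod q" for n m
    using H2[of n] n2[of n] amod[OF that(2)] that b_eq_iff[of n m] by (simp add: d_def)
   have "norm (W i - W j) \<le> L * norm (pnt i - pnt j)"
   proof (cases i; cases j)
    fix n n' assume nn: "i = Inl n" "j = Inl n'"
    hence "n \<noteq> n'" "n1 \<le> n" "n1 \<le> n'" using ij(3) True n2 by (auto simp: late_def)
    moreover have "n mod q = n' mod q" using md nn by (simp add: ctr_def)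
    ultimately show ?thesis using H1[of n n'] H1[of n' n] nn
     by (cases "n < n'") (simp_all add: W_def pnt_def norm_minus_commute)
   next
    fix n m assume nm: "i = Inl n" "j = Inr m"
    thus ?thesis using H2'[of n m] True md by (simp add: W_def pnt_def late_def ctr_def)
   next
    fix n m assume nm: "i = Inr m" "j = Inl n"
    thus ?thesis using H2'[of n m] True md by (simp add: W_def pnt_def late_def ctr_def norm_minus_commute)
   next
    fix n m assume nm: "i = Inr m" "j = Inr n"
    thus ?thesis using ij md by (auto simp: Idx_def ctr_def)
   qed
   thus ?thesis by (intro small[OF u]) (simp add: u1)
  qed
 qed
 show ?thesis
 proof (intro exI[of _ K] conjI ballI impI)
  show "0 < K" by (rule K(1))
  fix i j u assume h: "i \<in> Idx" "j \<in> Idx" "u \<in> U" "i \<noteq> j"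
  show "norm (case_sum V a i - u * case_sum V a j) \<le> K * norm (pnt i - u * pnt j)"
   using main[OF h(1,2,4,3)] unfolding W_def .
 qed
qed

text \<open>For \<open>norm \<epsilon> * K < 1\<close> the relative displacement of a pair is
  smaller than its distance, so moving along straight lines keeps the points apart. A small
  \<open>\<epsilon>\<close> also keeps them in discs inside \<open>D - {0}\<close>, whose radius can
  be uniform because late points lie near the cycle.\<close>

lemma linear_base_motion:
 assumes B: "\<And>i. norm (W i) \<le> Bw"
  and lip: "\<And>i j u. i \<in> Idx \<Longrightarrow> j \<in> Idx \<Longrightarrow> u \<in> U \<Longrightarrow> i \<noteq> j \<Longrightarrow> norm (W i - u * W j) \<le> K * norm (pnt i - u * pnt j)"
  and K: "0 < K"
 shows "\<exists>\<epsilon>. \<epsilon> \<noteq> 0 \<and> motion Idx pnt (Inl 0) (\<lambda>i x. pnt i + x * (\<epsilon> * W i))"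
proof -
 have "\<exists>r>0. \<forall>i\<in>Idx. ball (pnt i) r \<subseteq> D - {0}"
 proof -
  obtain \<rho> where \<rho>: "0 < \<rho>" "\<And>p. p \<in> centers \<Longrightarrow> ball p \<rho> \<subseteq> D - {0}" by (rule late_centers) blast
  have "0 < \<rho> / 2" using \<rho> by simp
  from tendstoD[OF d_lim this] obtain n2 where n2: "\<And>m. n2 \<le> m \<Longrightarrow> norm (d m) < \<rho> / 2"
   unfolding eventually_sequentially by auto
  have "\<exists>r>0. \<forall>n\<in>{..<n2}. ball (c n) r \<subseteq> D - {0}"
  proof (rule finite_uniform_radius)
   fix n
   have "c n \<in> D - {0}" using c_D c_nz by simp
   thus "\<exists>e>0. ball (c n) e \<subseteq> D - {0}" using open_contains_ball[of "D - {0}"] open_D by (meson open_delete)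
  qed (simp, meson subset_ball subset_trans)
  then obtain r where r: "0 < r" "\<And>n. n < n2 \<Longrightarrow> ball (c n) r \<subseteq> D - {0}" by auto
  have "ball (pnt i) (min r (\<rho> / 2)) \<subseteq> D - {0}" if "i \<in> Idx" for i
  proof (cases i)
   case (Inr j)
   have "ball (b j) (min r (\<rho> / 2)) \<subseteq> ball (b j) \<rho>" using \<rho>(1) by (intro subset_ball) simp
   thus ?thesis using \<rho>(2)[OF b_center, of j] Inr by (simp add: pnt_def)
  next
   case (Inl n)
   show ?thesis
   proof (cases "n < n2")
    case True
    have "ball (c n) (min r (\<rho> / 2)) \<subseteq> ball (c n) r" by (intro subset_ball) simp
    thus ?thesis using r(2)[OF True] Inl by (simp add: pnt_def)
   next
    case False
    have "ball (c n) (min r (\<rho> / 2)) \<subseteq> ball (b n) \<rho>"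
    proof
     fix x assume "x \<in> ball (c n) (min r (\<rho> / 2))"
     hence "dist (c n) x < \<rho> / 2" by simp
     moreover have "dist (b n) (c n) < \<rho> / 2" using n2[of n] False by (simp add: d_def dist_norm norm_minus_commute)
     ultimately show "x \<in> ball (b n) \<rho>" using dist_triangle[of "b n" x "c n"] by simp
    qed
    thus ?thesis using \<rho>(2)[OF b_center, of n] Inl by (simp add: pnt_def)
   qed
  qed
  thus ?thesis using r(1) \<rho>(1) by (intro exI[of _ "min r (\<rho> / 2)"]) simp
 qed
 then obtain r where r: "0 < r" "\<And>i. i \<in> Idx \<Longrightarrow> ball (pnt i) r \<subseteq> D - {0}" by blast
 have Bw: "0 \<le> Bw" using order_trans[OF norm_ge_zero B] .
 define e where "e = min (r / (Bw + 1)) (1 / (2 * K))"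
 have e: "0 < e" using r K Bw by (simp add: e_def)
 have eB: "e * Bw < r"
 proof -
  have "e * Bw \<le> (r / (Bw + 1)) * Bw" using Bw by (intro mult_right_mono) (simp_all add: e_def)
  also have "\<dots> < r" using r(1) Bw by (simp add: field_simps)
  finally show ?thesis .
 qed
 have eK: "e * K < 1"
 proof -
  have "e * K \<le> 1 / (2 * K) * K" using K by (intro mult_right_mono) (simp_all add: e_def)
  thus ?thesis using K by simp
 qed
 have inb: "pnt i + x * (of_real e * W i) \<in> ball (pnt i) r" if "x \<in> ball 0 1" for i x
 proof -
  have "norm (x * (of_real e * W i)) \<le> 1 * (e * Bw)"
   unfolding norm_mult using that B[of i] e by (intro mult_mono) auto
  thus ?thesis using eB by (simp add: dist_norm)
 qed
 have "motion Idx pnt (Inl 0) (\<lambda>i x. pnt i + x * (of_real e * W i))" unfolding motion_def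
 proof (intro conjI ballI impI)
  fix i assume i: "i \<in> Idx"
  show "(\<lambda>x. pnt i + x * (of_real e * W i)) holomorphic_on ball 0 1" by (intro holomorphic_intros)
  show "pnt i + 0 * (of_real e * W i) = pnt i" by simp
  fix x :: complex assume x: "x \<in> ball 0 1"
  show "pnt i + x * (of_real e * W i) \<in> D" "pnt i + x * (of_real e * W i) \<noteq> 0"
   using r(2)[OF i] inb[OF x, of i] by blast+
 next
  fix x :: complex assume x: "x \<in> ball 0 1"
  have p0: "pnt (Inl 0) = c1" by (simp add: pnt_def)
  have "ball (pnt (Inl 0)) r \<subseteq> D" using r(2)[OF Idx_props(1)] by blast
  moreover have "pnt (Inl 0) \<in> ball (pnt (Inl 0)) r" using r(1) by simp
  moreover have "pnt (Inl 0) \<in> Dp" unfolding p0 using c1 by blast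
  ultimately have "ball (pnt (Inl 0)) r \<subseteq> Dp" by (rule Dp_connected_subset[OF connected_ball])
  thus "pnt (Inl 0) + x * (of_real e * W (Inl 0)) \<in> Dp" using inb[OF x] by blast
 next
  fix i j u and x :: complex
  assume ij: "i \<in> Idx" "j \<in> Idx" and u: "u \<in> U" and x: "x \<in> ball 0 1" and ne: "i \<noteq> j"
  show "pnt i + x * (of_real e * W i) \<noteq> u * (pnt j + x * (of_real e * W j))"
  proof
   assume "pnt i + x * (of_real e * W i) = u * (pnt j + x * (of_real e * W j))"
   hence eq: "pnt i - u * pnt j = - x * of_real e * (W i - u * W j)" by (simp add: algebra_simps)
   have pos: "0 < norm (pnt i - u * pnt j)" using pnt_separated[OF ij u ne] by simp
   have "norm (pnt i - u * pnt j) = norm x * e * norm (W i - u * W j)" unfolding eq norm_mult using e by simp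
   also have "\<dots> \<le> 1 * e * (K * norm (pnt i - u * pnt j))" using x e lip[OF ij u ne] by (intro mult_mono) auto
   also have "\<dots> < 1 * norm (pnt i - u * pnt j)" using mult_strict_right_mono[OF eK pos] by simp
   finally show False by simp
  qed
 qed
 thus ?thesis using e by (intro exI[of _ "of_real e"]) simp
qed

end

lemma geometric_sum_bound:
 fixes z :: complex
 assumes "norm z = 1" "z \<noteq> 1"
 shows "norm (\<Sum>k<K. z ^ k) \<le> 2 / norm (1 - z)"
proof -
 have "(\<Sum>k<K. z ^ k) = (1 - z ^ K) / (1 - z)" using assms(2) by (simp add: sum_gp_strict)
 moreover have "norm (1 - z ^ K) \<le> 2" using norm_triangle_ineq4[of 1 "z ^ K"] assms(1) by (simp add: norm_power)
 ultimately show ?thesis by (simp add: norm_divide divide_right_mono)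
qed

context captured begin

text \<open>An eigenvector, with eigenvalue \<open>\<mu>\<close>, of the action of the lifting operator on infinitesimal motions.\<close>

definition eigenvector :: "complex \<Rightarrow> (nat \<Rightarrow> complex) \<Rightarrow> (nat \<Rightarrow> complex) \<Rightarrow> bool" where
 "eigenvector \<mu> V a \<longleftrightarrow> V 0 = 1 \<and> (\<forall>n. V (Suc n) = \<mu> * g' (c n) * V n + f (c n)) \<and>
  (\<forall>n. a (Suc n) = \<mu> * g' (b n) * a n + f (b n)) \<and> (\<forall>n. a (n + q) = a n) \<and>
  (\<exists>B. \<forall>i. norm (case_sum V a i) \<le> B) \<and> (\<exists>K>0. \<forall>i\<in>Idx. \<forall>j\<in>Idx. \<forall>u\<in>U. i \<noteq> j \<longrightarrow>
   norm (case_sum V a i - u * case_sum V a j) \<le> K * norm (pnt i - u * pnt j))"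

text \<open>Since \<open>kappa = 1\<close> and \<open>\<mu> ^ q \<noteq> 1\<close>, no order is
  resonant and the equation has approximate solutions \<open>X\<close> near the cycle to any order.
  The exact solution \<open>V\<close> along the orbit is generated from \<open>V 0 = 1\<close>. Its
  deviation from \<open>X\<close>, divided by \<open>T\<close>, has a modulus that grows by at most
  summable amounts, so the deviation is bounded by a multiple of \<open>norm (T n)\<close>. This
  decays like \<open>1 / n ^ 2\<close>, no slower than the gaps between orbit points in one residue
  class, and so is harmless for the Lipschitz bound.\<close>

lemma lipschitz_eigenvector:
 assumes k1: "kappa = 1" and pa: "parabolic_asymptotics q 1 b" and \<mu>: "norm \<mu> = 1" "\<mu> ^ q \<noteq> 1"
 shows "\<exists>V a. eigenvector \<mu> V a"
proof -
 have imp: "\<exists>X S. vfield \<mu> i X S" for i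
 proof (induction i)
  case 0
  show ?case using vfield_0 by blast
 next
  case (Suc i)
  then obtain X S where "vfield \<mu> i X S" by blast
  from vfield_improve[OF this] show ?case using k1 \<mu>(2) by auto
 qed
 \<comment> \<open>Order 4 makes the error relative to \<open>T\<close> of size
   \<open>norm (t n) * norm (d n) ^ 3\<close>, hence \<open>O(1 / n ^ 2)\<close> and
   summable.\<close>
 obtain X S where X: "vfield \<mu> 4 X S" using imp by blast
 define a where "a n = X n (b n)" for n
 have a: "a (Suc n) = \<mu> * g' (b n) * a n + f (b n)" for n
 proof -
  have "\<forall>\<^sub>F z in nhds (b n). f z - X (Suc n) (g z) + \<mu> * g' z * X n z = (z - b n) ^ 4 * S n z"
   using X unfolding vfield_def by blast
  from eventually_nhds_x_imp_x[OF this] have "f (b n) - X (Suc n) (b (Suc n)) + \<mu> * g' (b n) * X n (b n) = 0"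
   by (simp add: g_b)
  thus ?thesis by (simp add: a_def algebra_simps)
 qed
 have ap: "a (n + q) = a n" for n using vfield_X_per[OF X, of n 1] by (simp add: a_def b_per)
 have aB: "\<exists>B. \<forall>n. norm (a n) \<le> B"
 proof -
  have "norm (a n) \<le> (\<Sum>j<q. norm (a j))" for n
  proof -
   have "a n = a (n mod q)" using vfield_X_per[OF X, of "n mod q" "n div q"] by (simp add: a_def b_mod)
   thus ?thesis using member_le_sum[of "n mod q" "{..<q}" "\<lambda>j. norm (a j)"] q_pos by simp
  qed
  thus ?thesis by blast
 qed
 define V where "V = rec_nat 1 (\<lambda>n v. \<mu> * g' (c n) * v + f (c n))"
 have V: "V 0 = 1" "V (Suc n) = \<mu> * g' (c n) * V n + f (c n)" for n by (simp_all add: V_def)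
 obtain CT where CT: "0 < CT" "\<And>n. norm (T n) * (real n + 1)\<^sup>2 \<le> CT" using T_decay(1)[OF pa] by blast
 obtain Ct where Ct: "0 < Ct" "\<And>n. norm (t n) \<le> Ct * (real n + 1)" using T_decay(2)[OF pa] by blast
 obtain Cd where Cd: "0 < Cd" "\<And>n. norm (d n) * (real n + 1) \<le> Cd" using parabolic_growth(2)[OF pa q_pos] by auto
 obtain Cl where Cl: "0 < Cl" "\<And>n. 1 \<le> Cl * (norm (d n) * (real n + 1))" using parabolic_growth(3)[OF pa q_pos] by auto
 obtain C1 where C1: "0 < C1" "\<And>n. norm (f (c n) - X (Suc n) (c (Suc n)) + \<mu> * g' (c n) * X n (c n)) \<le> C1 * norm (d n) ^ 4"
  using vfield_along_orbit[OF X] by blast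
 obtain C3 where C3: "0 < C3" "\<And>n. C3 \<le> norm (g' (c n))" using g'_c_lower by blast
 define p where "p n = V n - X n (c n)" for n
 define r where "r n = f (c n) - X (Suc n) (c (Suc n)) + \<mu> * g' (c n) * X n (c n)" for n
 have pS: "p (Suc n) = \<mu> * g' (c n) * p n + r n" for n by (simp add: p_def r_def V(2) algebra_simps)
 define w where "w n = norm (p n) / norm (T n)" for n
 have wS: "w (Suc n) \<le> w n + (C1 * Ct * Cd ^ 3 / C3) * (1 / (real n + 1)\<^sup>2)" for n
 proof -
  have "norm (p (Suc n)) \<le> norm (g' (c n)) * norm (p n) + norm (r n)"
   unfolding pS by (rule order_trans[OF norm_triangle_ineq]) (simp add: norm_mult \<mu>(1))
  hence "w (Suc n) \<le> (norm (g' (c n)) * norm (p n) + norm (r n)) / norm (T (Suc n))"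
   unfolding w_def by (rule divide_right_mono) simp
  also have "\<dots> = w n + norm (r n) / norm (T n * g' (c n))"
   unfolding T_Suc norm_mult[of "T n"] using g'_c_nz[of n] by (simp add: w_def add_divide_distrib)
  finally have le: "w (Suc n) \<le> w n + norm (r n) / norm (T n * g' (c n))" .
  have dn: "norm (d n) \<le> Cd / (real n + 1)" using Cd(2)[of n] by (simp add: pos_le_divide_eq)
  have "norm (r n) / norm (T n * g' (c n)) \<le> (C1 * norm (d n) ^ 4) / (norm (T n) * C3)"
  proof (rule frac_le)
   show "norm (T n) * C3 \<le> norm (T n * g' (c n))" unfolding norm_mult[of "T n"] by (rule mult_left_mono[OF C3(2)]) simp
   show "norm (r n) \<le> C1 * norm (d n) ^ 4" unfolding r_def by (rule C1(2))
  qed (use C1(1) C3(1) T_nz[of n] in auto)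
  also have "\<dots> = (C1 / C3) * (norm (t n) * norm (d n) ^ 3)"
   by (simp add: t_def norm_divide power4_eq_xxxx power3_eq_cube mult_ac)
  also have "\<dots> \<le> (C1 / C3) * ((Ct * (real n + 1)) * (Cd / (real n + 1)) ^ 3)"
   using C1(1) C3(1) Ct dn by (intro mult_left_mono mult_mono power_mono) auto
  also have "\<dots> = (C1 * Ct * Cd ^ 3 / C3) * (1 / (real n + 1)\<^sup>2)"
  proof -
   have "x * (Cd / x) ^ 3 = Cd ^ 3 * (1 / x\<^sup>2)" if "x \<noteq> 0" for x :: real
    by (simp add: power3_eq_cube power2_eq_square)
   hence "(real n + 1) * (Cd / (real n + 1)) ^ 3 = Cd ^ 3 * (1 / (real n + 1)\<^sup>2)" by simp
   thus ?thesis by (simp add: mult.assoc)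
  qed
  finally show ?thesis using le by linarith
 qed
 have sm: "summable (\<lambda>n. 1 / (real n + 1)\<^sup>2)"
  using summable_Suc_iff[of "\<lambda>n. 1 / (real n)\<^sup>2"] inverse_power_summable[of 2, where 'a = real]
  by (simp add: inverse_eq_divide add.commute)
 define Q where "Q = C1 * Ct * Cd ^ 3 / C3"
 have Q: "0 \<le> Q" using C1(1) Ct(1) Cd(1) C3(1) by (simp add: Q_def)
 define Cp where "Cp = w 0 + Q * (\<Sum>n. 1 / (real n + 1)\<^sup>2)"
 have wB: "w n \<le> Cp" for n
 proof -
  have "w n \<le> w 0 + Q * (\<Sum>i<n. 1 / (real i + 1)\<^sup>2)"
  proof (induction n)
   case (Suc n)
   thus ?case using wS[of n] by (simp add: Q_def[symmetric] distrib_left)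
  qed simp
  also have "\<dots> \<le> Cp" unfolding Cp_def using Q by (intro add_left_mono mult_left_mono sum_le_suminf sm) auto
  finally show ?thesis .
 qed
 have Cp: "0 \<le> Cp" using wB[of 0] by (rule order_trans[rotated]) (simp add: w_def)
 have pB: "norm (p n) \<le> Cp * norm (T n)" for n using wB[of n] T_nz[of n] by (simp add: w_def pos_divide_le_eq)
 have TB: "norm (T n) \<le> CT / (real n + 1)\<^sup>2" for n using CT(2)[of n] by (simp add: pos_le_divide_eq)
 obtain CX where CX: "0 < CX" "\<And>n z w. z \<in> cball (b n) 1 \<Longrightarrow> w \<in> cball (b n) 1 \<Longrightarrow> norm (X n z - X n w) \<le> CX * norm (z - w)"
  using vfield_lipschitz[OF X] by blast
 obtain CX' where CX': "0 < CX'" "\<And>n. norm (X n (c n) - X n (b n)) \<le> CX' * norm (d n)" using vfield_near[OF X] by blast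
 have "\<forall>\<^sub>F n in sequentially. norm (d n) < 1" using tendstoD[OF d_lim, of 1] by simp
 then obtain n0 where n0: "\<And>n. n0 \<le> n \<Longrightarrow> norm (d n) < 1" unfolding eventually_sequentially by blast
 obtain e n1 where e: "0 < e" "\<And>n n'. n1 \<le> n \<Longrightarrow> n < n' \<Longrightarrow> n mod q = n' mod q \<Longrightarrow> e \<le> norm (c n - c n') * (real n + 1)\<^sup>2"
  using orbit_separation[OF pa] by blast
 define L where "L = max (CX + 2 * Cp * CT / e) (CX' + Cp * (CT * Cl))"
 have L: "0 \<le> L" using CX(1) Cp CT(1) e(1) by (simp add: L_def le_max_iff_disj)
 have H2: "norm (V n - a n) \<le> L * norm (d n)" for n
 proof -
  have "norm (T n) \<le> CT * Cl * norm (d n)"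
  proof -
   have "norm (T n) * 1 \<le> norm (T n) * (Cl * (norm (d n) * (real n + 1)))" using Cl(2)[of n] by (rule mult_left_mono) simp
   also have "\<dots> = Cl * norm (d n) * (norm (T n) * (real n + 1))" by simp
   also have "norm (T n) * (real n + 1) \<le> norm (T n) * (real n + 1)\<^sup>2"
    by (intro mult_left_mono) (simp_all add: power2_eq_square)
   hence "Cl * norm (d n) * (norm (T n) * (real n + 1)) \<le> Cl * norm (d n) * CT"
    using CT(2)[of n] Cl(1) by (intro mult_left_mono) auto
   finally show ?thesis by (simp add: mult_ac)
  qed
  hence "Cp * norm (T n) \<le> Cp * (CT * Cl * norm (d n))" using Cp by (rule mult_left_mono)
  moreover have "V n - a n = p n + (X n (c n) - X n (b n))" by (simp add: p_def a_def)
  hence "norm (V n - a n) \<le> norm (p n) + norm (X n (c n) - X n (b n))" by (metis norm_triangle_ineq)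
  ultimately have "norm (V n - a n) \<le> (CX' + Cp * (CT * Cl)) * norm (d n)"
   using pB[of n] CX'(2)[of n] by (simp add: algebra_simps)
  also have "\<dots> \<le> L * norm (d n)" by (intro mult_right_mono) (simp_all add: L_def)
  finally show ?thesis .
 qed
 have H1: "norm (V n - V n') \<le> L * norm (c n - c n')"
  if n: "max n0 n1 \<le> n" "n < n'" "n mod q = n' mod q" for n n'
 proof -
  have bb: "b n' = b n" using n(3) b_eq_iff by simp
  have Xmod: "X k = X (k mod q)" for k using vfield_X_per[OF X, of "k mod q" "k div q"] by simp
  have XX: "X n' = X n" by (subst (1 2) Xmod) (simp add: n(3))
  have cb: "c n \<in> cball (b n) 1" "c n' \<in> cball (b n) 1"
   using n0[of n] n0[of n'] n bb by (auto simp: d_def dist_norm norm_minus_commute)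
  define s where "s = CT / (real n + 1)\<^sup>2"
  have T1: "norm (T n) \<le> s" using TB[of n] by (simp add: s_def)
  have T2: "norm (T n') \<le> s"
  proof -
   have "CT / (real n' + 1)\<^sup>2 \<le> CT / (real n + 1)\<^sup>2"
    using CT(1) n(2) by (intro divide_left_mono power_mono mult_pos_pos) auto
   thus ?thesis using TB[of n'] by (simp add: s_def)
  qed
  have s: "s \<le> CT / e * norm (c n - c n')"
  proof -
   have "e \<le> norm (c n - c n') * (real n + 1)\<^sup>2" using e(2)[of n n'] n by simp
   hence "CT * e \<le> CT * (norm (c n - c n') * (real n + 1)\<^sup>2)" using CT(1) by (intro mult_left_mono) auto
   hence "CT \<le> CT / e * norm (c n - c n') * (real n + 1)\<^sup>2" using e(1) by (simp add: field_simps)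
   thus ?thesis unfolding s_def by (subst pos_divide_le_eq) auto
  qed
  have "V n - V n' = (p n - p n') + (X n (c n) - X n (c n'))" by (simp add: p_def XX)
  hence "norm (V n - V n') \<le> norm (p n - p n') + norm (X n (c n) - X n (c n'))" by (metis norm_triangle_ineq)
  also have "norm (p n - p n') \<le> norm (p n) + norm (p n')" by (rule norm_triangle_ineq4)
  finally have "norm (V n - V n') \<le> norm (p n) + norm (p n') + norm (X n (c n) - X n (c n'))" by simp
  moreover have "norm (p n) \<le> Cp * s" using pB[of n] mult_left_mono[OF T1 Cp] by linarith
  moreover have "norm (p n') \<le> Cp * s" using pB[of n'] mult_left_mono[OF T2 Cp] by linarith
  moreover have "Cp * s \<le> Cp * (CT / e * norm (c n - c n'))" using s Cp by (rule mult_left_mono)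
  ultimately have "norm (V n - V n') \<le> 2 * (Cp * (CT / e * norm (c n - c n'))) + CX * norm (c n - c n')"
   using CX(2)[OF cb] by linarith
  also have "\<dots> = (CX + 2 * Cp * CT / e) * norm (c n - c n')" by (simp add: algebra_simps)
  also have "\<dots> \<le> L * norm (c n - c n')" by (intro mult_right_mono) (simp_all add: L_def)
  finally show ?thesis .
 qed
 obtain Ba where Ba: "\<And>n. norm (a n) \<le> Ba" using aB by blast
 obtain Bd where Bd: "0 < Bd" "\<And>n. norm (d n) \<le> Bd" using d_bounded by blast
 define Bw where "Bw = Ba + L * Bd"
 have LB: "0 \<le> L * Bd" using L Bd by simp
 have VB: "norm (V n) \<le> Bw" for n
 proof -
  have "norm (V n) \<le> norm (a n) + norm (V n - a n)" by (rule norm_triangle_sub)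
  moreover have "L * norm (d n) \<le> L * Bd" using L Bd(2) by (rule mult_left_mono[rotated])
  ultimately show ?thesis using H2[of n] Ba[of n] by (simp add: Bw_def)
 qed
 have aBw: "norm (a n) \<le> Bw" for n using Ba[of n] LB by (simp add: Bw_def)
 have "\<exists>K>0. \<forall>i\<in>Idx. \<forall>j\<in>Idx. \<forall>u\<in>U. i \<noteq> j \<longrightarrow>
  norm (case_sum V a i - u * case_sum V a j) \<le> K * norm (pnt i - u * pnt j)"
  by (rule global_lipschitz[OF VB aBw ap H1 H2 L])
 moreover have "norm (case_sum V a i) \<le> Bw" for i using VB aBw by (cases i) simp_all
 ultimately show ?thesis unfolding eigenvector_def using V a ap by blast
qed

end

text \<open>Over \<open>K\<close> steps the two oscillating terms contribute bounded geometric sums,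
  so \<open>K * X\<close> has to remain bounded.\<close>

lemma bounded_drift_zero:
 fixes B :: "nat \<Rightarrow> complex"
 assumes bd: "\<And>k. norm (B k) \<le> C" and z: "norm z1 = 1" "z1 \<noteq> 1" "norm z2 = 1" "z2 \<noteq> 1"
  and B: "\<And>k. B k = B (Suc k) + (X + z1 ^ k * X1 + z2 ^ k * X2)"
 shows "X = 0"
proof (rule ccontr)
 assume "X \<noteq> 0"
 define E where "E = C + C + (2 / norm (1 - z1) * norm X1 + 2 / norm (1 - z2) * norm X2)"
 have tel: "B 0 = B K + (of_nat K * X + (\<Sum>k<K. z1 ^ k) * X1 + (\<Sum>k<K. z2 ^ k) * X2)" for K
 proof (induction K)
  case (Suc K)
  thus ?case using B[of K] by (simp add: algebra_simps)
 qed simp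
 have le: "real K * norm X \<le> E" for K
 proof -
  have "of_nat K * X = (B 0 - B K) - ((\<Sum>k<K. z1 ^ k) * X1 + (\<Sum>k<K. z2 ^ k) * X2)" using tel[of K] by simp
  hence "norm (of_nat K * X) \<le> norm (B 0 - B K) + norm ((\<Sum>k<K. z1 ^ k) * X1 + (\<Sum>k<K. z2 ^ k) * X2)"
   by (simp only: norm_triangle_ineq4)
  moreover have "norm (B 0 - B K) \<le> C + C" by (rule order_trans[OF norm_triangle_ineq4 add_mono[OF bd bd]])
  moreover have "norm ((\<Sum>k<K. z1 ^ k) * X1 + (\<Sum>k<K. z2 ^ k) * X2) \<le>
    2 / norm (1 - z1) * norm X1 + 2 / norm (1 - z2) * norm X2"
   by (rule order_trans[OF norm_triangle_ineq], unfold norm_mult)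
    (intro add_mono mult_right_mono geometric_sum_bound z norm_ge_zero)
  ultimately show ?thesis by (simp add: E_def norm_mult)
 qed
 obtain K :: nat where "E / norm X < real K" using reals_Archimedean2 by blast
 thus False using le[of K] \<open>X \<noteq> 0\<close> by (simp add: field_simps)
qed

lemma sum_periodic_shift:
 fixes h :: "nat \<Rightarrow> complex"
 assumes "h q = h 0"
 shows "(\<Sum>j<q. h (Suc j)) = (\<Sum>j<q. h j)" using sum.lessThan_Suc_shift[of h q] assms by simp

section \<open>Fourier data of a cycle with multiplier 1\<close>

context map_cycle begin

text \<open>The gauge that turns the linear factors \<open>g' (b n)\<close> of the recursions into
  1; it is periodic for multiplier 1.\<close>

definition rho :: "nat \<Rightarrow> complex" where "rho n = inverse (tau (b 0) n)"

text \<open>The inhomogeneous term of the gauged recursion,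
  \<open>N (Suc n) = rho (Suc n) * f (b n)\<close>, written through the positions so that it visibly
  never vanishes.\<close>

definition N :: "nat \<Rightarrow> complex" where "N n = rho n * b n / c1"

text \<open>A discrete Fourier sum of \<open>N\<close>, polynomial in \<open>\<mu>\<close>. For
  multiplier 1 it is \<open>1 - \<mu> ^ q\<close> times the gauged eigenvector, and at
  \<open>\<mu> = 1\<close> it is \<open>rho j\<close> times \<open>Q\<close> at
  \<open>b j\<close>.\<close>

definition P :: "complex \<Rightarrow> nat \<Rightarrow> complex" where "P \<mu> j = (\<Sum>i<q. \<mu> ^ i * N (j + q - i))"

text \<open>For multiplier 1 the chain rule identifies this with the second derivative of
  \<open>g ^^ q\<close> at \<open>b 0\<close>.\<close>

definition Gam :: complex where "Gam = (\<Sum>j<q. rho (Suc j) * (c1 * deriv (deriv f) (b j)) / (rho j)\<^sup>2)"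

lemma tau_b0_nz: "tau (b 0) n \<noteq> 0" unfolding tau_def by (simp add: funpow_b) (use c1 deriv_b in auto)

lemma rho_nz: "rho n \<noteq> 0" using tau_b0_nz by (simp add: rho_def)

lemma rho_Suc: "g' (b n) * rho (Suc n) = rho n"
 using deriv_b[of n] c1 by (simp add: rho_def tau_Suc funpow_b field_simps)

lemma N_Suc: "N (Suc n) = rho (Suc n) * f (b n)" using g_b[of n, symmetric] c1 by (simp add: N_def)

lemma rho_per: "kappa = 1 \<Longrightarrow> rho (n + q) = rho n"
 using tau_add[of "b 0" q n] tau_b[of 0] b_per[of 0] by (simp add: rho_def funpow_b add.commute)

lemma N_per: "kappa = 1 \<Longrightarrow> N (n + q) = N n" by (simp add: N_def rho_per b_per)

lemma P_Suc:
 assumes "kappa = 1"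
 shows "P \<mu> (Suc j) = \<mu> * P \<mu> j + (1 - \<mu> ^ q) * N (Suc j)"
proof -
 obtain p where p: "q = Suc p" using q_pos by (cases q) auto
 have Pj: "P \<mu> k = (\<Sum>i<Suc p. \<mu> ^ i * N (k + q - i))" for k by (simp only: P_def p[symmetric])
 have "P \<mu> (Suc j) = N (Suc j + q) + (\<Sum>i<p. \<mu> ^ Suc i * N (j + q - i))" unfolding Pj sum.lessThan_Suc_shift by simp
 also have "(\<Sum>i<p. \<mu> ^ Suc i * N (j + q - i)) = \<mu> * P \<mu> j - \<mu> ^ q * N (Suc j)"
  unfolding Pj by (simp add: p mult.assoc sum_distrib_left distrib_left)
 finally show ?thesis using N_per[OF assms, of "Suc j"] by (simp add: algebra_simps)
qed

lemma P_root: "kappa = 1 \<Longrightarrow> w ^ q = 1 \<Longrightarrow> P w j = w ^ j * P w 0" by (induction j) (simp_all add: P_Suc)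

text \<open>One turn of the gauged recursion. The polynomial on the right still makes sense at roots
  of unity, where the eigenvector need not exist.\<close>

lemma P_eigenvector:
 assumes a: "\<And>n. a (Suc n) = \<mu> * g' (b n) * a n + f (b n)" "\<And>n. a (n + q) = a n" and k1: "kappa = 1"
 shows "(1 - \<mu> ^ q) * (rho j * a j) = P \<mu> j"
proof -
 define x where "x n = rho n * a n" for n
 have xS: "x (Suc n) = \<mu> * x n + N (Suc n)" for n
  unfolding x_def N_Suc a(1) by (simp add: algebra_simps rho_Suc[of n, symmetric])
 have "x (j + m) = \<mu> ^ m * x j + (\<Sum>i<m. \<mu> ^ i * N (j + m - i))" for m
 proof (induction m)
  case (Suc m)
  have "(\<Sum>i<Suc m. \<mu> ^ i * N (j + Suc m - i)) = N (Suc (j + m)) + \<mu> * (\<Sum>i<m. \<mu> ^ i * N (j + m - i))"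
   unfolding sum.lessThan_Suc_shift sum_distrib_left by (simp add: mult.assoc)
  thus ?case using Suc xS[of "j + m"] by (simp add: algebra_simps)
 qed simp
 from this[of q] have "x (j + q) = \<mu> ^ q * x j + P \<mu> j" by (simp add: P_def)
 moreover have "x (j + q) = x j" by (simp add: x_def rho_per[OF k1] a(2))
 ultimately show ?thesis by (simp add: x_def algebra_simps)
qed

text \<open>As a polynomial in \<open>w\<close> of degree below \<open>q\<close> with constant
  coefficient \<open>N q \<noteq> 0\<close>, \<open>P w 0\<close> cannot vanish at all
  \<open>q\<close> roots of unity.\<close>

lemma P_some_root:
 assumes k1: "kappa = 1"
 shows "\<exists>w. w ^ q = 1 \<and> P w 0 \<noteq> 0"
proof (rule ccontr)
 assume "\<not> ?thesis"
 hence z: "\<And>w. w ^ q = 1 \<Longrightarrow> P w 0 = 0" by blast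
 have Peq: "P w 0 = (\<Sum>i\<le>q - 1. N (q - i) * w ^ i)" for w unfolding P_def using q_pos by (intro sum.cong) (auto)
 have "N (q - 0) \<noteq> 0" using rho_nz b_nz c1 by (simp add: N_def)
 hence "finite {w. (\<Sum>i\<le>q - 1. N (q - i) * w ^ i) = 0} \<and> card {w. (\<Sum>i\<le>q - 1. N (q - i) * w ^ i) = 0} \<le> q - 1"
  by (intro polyfun_rootbound exI[of _ 0]) simp
 moreover have "{w. w ^ q = 1} \<subseteq> {w. (\<Sum>i\<le>q - 1. N (q - i) * w ^ i) = 0}" using z Peq by auto
 ultimately have "card {w :: complex. w ^ q = 1} \<le> q - 1" using card_mono order_trans by blast
 thus False using card_roots_unity_eq[OF q_pos] q_pos by simp
qed

text \<open>For \<open>kappa = 1\<close> the count of petals gives \<open>m \<le> 1\<close>, so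
  \<open>g ^^ q\<close> has the expansion \<open>x + x ^ 2 * S x\<close> at \<open>b 0\<close> with
  \<open>S 0 \<noteq> 0\<close>, and its second derivative there is \<open>2 * S 0\<close>.\<close>

lemma Gam_nz:
 assumes k1: "kappa = 1"
 shows "Gam \<noteq> 0"
proof
 assume G0: "Gam = 0"
 have t1: "tau (b 0) (q * 1) = 1" using tau_b_mult[of 0 1] k1 by simp
 have q1: "0 < q * 1" "b (q * 1) = b 0" using q_pos b_per[of 0] by simp_all
 obtain S r m where r: "0 < r" and S: "S holomorphic_on ball 0 r" and m: "0 < m" and S0: "S 0 \<noteq> 0"
  and ph: "\<And>x. x \<in> ball 0 r \<Longrightarrow> (g ^^ (q * 1)) (b 0 + x) - b 0 = x + x ^ Suc m * S x"
  and DN: "\<And>x j. x \<in> ball 0 r \<Longrightarrow> j < q * 1 \<Longrightarrow> (g ^^ j) (b 0 + x) \<in> D \<and> (g ^^ j) (b 0 + x) \<noteq> 0"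
  by (rule germ_at_cycle[OF q1 t1]) (rule that)
 have "m \<le> 1" using parabolic_orbit[of 1, OF _ _ r S m S0 ph DN] k1 by simp
 hence m1: "m = 1" using m by simp
 have dt: "((\<lambda>z. tau z n) has_field_derivative
   tau (b 0) n * (\<Sum>i<n. c1 * deriv (deriv f) (b i) * tau (b 0) i / g' (b i))) (at (b 0))" for n
 proof (induction n)
  case 0
  show ?case by simp
 next
  case (Suc n)
  have fn: "((g ^^ n) has_field_derivative tau (b 0) n) (at (b 0))" by (rule funpow_deriv) (simp add: funpow_b b_D)
  have "(deriv f has_field_derivative deriv (deriv f) ((g ^^ n) (b 0))) (at ((g ^^ n) (b 0)))"
   by (rule holomorphic_derivI[OF hol_f' open_D]) (simp add: funpow_b b_D)
  from DERIV_mult[OF Suc DERIV_cmult[OF DERIV_chain2[OF this fn]], of c1]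
  have "((\<lambda>z. tau z (Suc n)) has_field_derivative
    tau (b 0) n * (\<Sum>i<n. c1 * deriv (deriv f) (b i) * tau (b 0) i / g' (b i)) * g' ((g ^^ n) (b 0)) +
    c1 * (deriv (deriv f) ((g ^^ n) (b 0)) * tau (b 0) n) * tau (b 0) n) (at (b 0))"
   by (simp only: tau_Suc)
  thus ?case by (rule DERIV_cong) (use deriv_b[of n] in \<open>simp add: tau_Suc funpow_b field_simps\<close>)
 qed
 have "(\<Sum>i<q. c1 * deriv (deriv f) (b i) * tau (b 0) i / g' (b i)) = Gam" unfolding Gam_def
 proof (intro sum.cong refl)
  fix i
  show "c1 * deriv (deriv f) (b i) * tau (b 0) i / g' (b i) = rho (Suc i) * (c1 * deriv (deriv f) (b i)) / (rho i)\<^sup>2"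
    by (simp add: rho_def tau_Suc funpow_b power2_eq_square field_simps)
 qed
 hence d0: "((\<lambda>z. tau z q) has_field_derivative 0) (at (b 0))" using dt[of q] G0 by simp
 have d1: "((\<lambda>x. tau (b 0 + x) q) has_field_derivative 0) (at 0)"
 proof -
  have "((\<lambda>x. b 0 + x) has_field_derivative 1) (at 0)" by (auto intro!: derivative_eq_intros)
  from DERIV_chain2[of "\<lambda>z. tau z q" 0 "\<lambda>x. b 0 + x" 0 1, OF _ this] d0 show ?thesis by simp
 qed
 have S': "deriv S holomorphic_on ball 0 r" by (rule holomorphic_deriv[OF S open_ball])
 have te: "tau (b 0 + x) q = 1 + 2 * x * S x + x\<^sup>2 * deriv S x" if x: "x \<in> ball 0 r" for x
 proof -
  have "((\<lambda>x. x + x\<^sup>2 * S x) has_field_derivative 1 + (2 * x * S x + x\<^sup>2 * deriv S x)) (at x)"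
   by (auto intro!: derivative_eq_intros holomorphic_derivI[OF S open_ball x])
  hence "((\<lambda>x. (g ^^ q) (b 0 + x) - b 0) has_field_derivative 1 + (2 * x * S x + x\<^sup>2 * deriv S x)) (at x)"
   by (rule has_field_derivative_transform_within_open[OF _ open_ball x])
    (use ph m1 in \<open>simp add: numeral_2_eq_2\<close>)
  moreover have "((\<lambda>x. (g ^^ q) (b 0 + x) - b 0) has_field_derivative tau (b 0 + x) q) (at x)"
  proof -
   have "((g ^^ q) has_field_derivative tau (b 0 + x) q) (at (b 0 + x))"
    by (rule funpow_deriv) (use DN[OF x] in simp)
   moreover have "((\<lambda>x. b 0 + x) has_field_derivative 1) (at x)" by (auto intro!: derivative_eq_intros)
   ultimately have "((\<lambda>x. (g ^^ q) (b 0 + x)) has_field_derivative tau (b 0 + x) q * 1) (at x)" by (rule DERIV_chain2)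
   thus ?thesis by (auto intro!: derivative_eq_intros)
  qed
  ultimately show ?thesis by (simp add: DERIV_unique add.assoc)
 qed
 have z: "0 \<in> ball (0::complex) r" using r by simp
 have "((\<lambda>x. 1 + 2 * x * S x + x\<^sup>2 * deriv S x) has_field_derivative 2 * S 0) (at 0)"
  using holomorphic_derivI[OF S open_ball z] holomorphic_derivI[OF S' open_ball z]
  by (auto intro!: derivative_eq_intros)
 hence "((\<lambda>x. tau (b 0 + x) q) has_field_derivative 2 * S 0) (at 0)"
  by (rule has_field_derivative_transform_within_open[OF _ open_ball z]) (simp add: te)
 from DERIV_unique[OF d1 this] show False using S0 by simp
qed

end

context captured begin

text \<open>The coefficient of the mixed term of two eigenvectors in the second-order recursion,
  summed over the cycle with weights. It is multiplied by
  \<open>(1 - \<mu>1 ^ q) * (1 - \<mu>2 ^ q)\<close>, which replaces the eigenvectors by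
  \<open>P\<close> and keeps it continuous up to roots of unity.\<close>

definition resonance :: "complex \<Rightarrow> complex \<Rightarrow> complex" where
 "resonance \<mu>1 \<mu>2 = (\<Sum>j<q. inverse (\<mu>1 * \<mu>2) ^ Suc j * rho (Suc j) *
  (2 * f' j * (\<mu>1 * P \<mu>1 j * (1 - \<mu>2 ^ q) + \<mu>2 * P \<mu>2 j * (1 - \<mu>1 ^ q)) / rho j +
   2 * g'' j * (\<mu>1 * P \<mu>1 j) * (\<mu>2 * P \<mu>2 j) / (rho j)\<^sup>2))"

text \<open>Lifting a motion whose derivative is a sum of two eigenvectors with eigenvalues \<open>\<mu>1\<close>, \<open>\<mu>2\<close> multiplies
 the summands by powers of \<open>\<mu>1\<close>, \<open>\<mu>2\<close>; the second derivatives then drift linearly, by the resonant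
 term with \<open>(\<mu>1 * \<mu>2)^q = 1\<close>, unless this term vanishes.\<close>

lemma resonance_zero:
 assumes k1: "kappa = 1" and pa: "parabolic_asymptotics q 1 b"
  and \<mu>1: "norm \<mu>1 = 1" "\<mu>1 ^ q \<noteq> 1" and \<mu>2: "norm \<mu>2 = 1" "\<mu>2 ^ q \<noteq> 1" and ne: "\<mu>1 \<noteq> \<mu>2"
  and w: "(\<mu>1 * \<mu>2) ^ q = 1" "P (\<mu>1 * \<mu>2) 0 = 0"
 shows "resonance \<mu>1 \<mu>2 = 0"
proof -
 obtain V1 a1 where E1: "eigenvector \<mu>1 V1 a1" using lipschitz_eigenvector[OF k1 pa \<mu>1] by blast
 then obtain B1 K1 where B1: "\<And>i. norm (case_sum V1 a1 i) \<le> B1" and K1: "0 < K1" "\<And>i j u. i \<in> Idx \<Longrightarrow> j \<in> Idx \<Longrightarrow>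
   u \<in> U \<Longrightarrow> i \<noteq> j \<Longrightarrow> norm (case_sum V1 a1 i - u * case_sum V1 a1 j) \<le> K1 * norm (pnt i - u * pnt j)"
  unfolding eigenvector_def by blast
 have V1: "V1 0 = 1" "\<And>n. V1 (Suc n) = \<mu>1 * g' (c n) * V1 n + f (c n)"
  and a1: "\<And>n. a1 (Suc n) = \<mu>1 * g' (b n) * a1 n + f (b n)" "\<And>n. a1 (n + q) = a1 n"
  using E1 unfolding eigenvector_def by simp_all
 obtain V2 a2 where E2: "eigenvector \<mu>2 V2 a2" using lipschitz_eigenvector[OF k1 pa \<mu>2] by blast
 then obtain B2 K2 where B2: "\<And>i. norm (case_sum V2 a2 i) \<le> B2" and K2: "0 < K2" "\<And>i j u. i \<in> Idx \<Longrightarrow> j \<in> Idx \<Longrightarrow>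
   u \<in> U \<Longrightarrow> i \<noteq> j \<Longrightarrow> norm (case_sum V2 a2 i - u * case_sum V2 a2 j) \<le> K2 * norm (pnt i - u * pnt j)"
  unfolding eigenvector_def by blast
 have V2: "V2 0 = 1" "\<And>n. V2 (Suc n) = \<mu>2 * g' (c n) * V2 n + f (c n)"
  and a2: "\<And>n. a2 (Suc n) = \<mu>2 * g' (b n) * a2 n + f (b n)" "\<And>n. a2 (n + q) = a2 n"
  using E2 unfolding eigenvector_def by simp_all
 define W where "W i = case_sum V1 a1 i + case_sum V2 a2 i" for i
 have "\<exists>\<epsilon>. \<epsilon> \<noteq> 0 \<and> motion Idx pnt (Inl 0) (\<lambda>i x. pnt i + x * (\<epsilon> * W i))"
 proof (rule linear_base_motion)
  show "norm (W i) \<le> B1 + B2" for i unfolding W_def by (rule order_trans[OF norm_triangle_ineq add_mono[OF B1 B2]])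
  show "0 < K1 + K2" using K1(1) K2(1) by simp
  fix i j u assume h: "i \<in> Idx" "j \<in> Idx" "u \<in> U" "i \<noteq> j"
  have "W i - u * W j = (case_sum V1 a1 i - u * case_sum V1 a1 j) + (case_sum V2 a2 i - u * case_sum V2 a2 j)"
   by (simp add: W_def algebra_simps)
  hence "norm (W i - u * W j) \<le> norm (case_sum V1 a1 i - u * case_sum V1 a1 j) + norm (case_sum V2 a2 i - u * case_sum V2 a2 j)"
   by (simp only: norm_triangle_ineq)
  thus "norm (W i - u * W j) \<le> (K1 + K2) * norm (pnt i - u * pnt j)"
   using K1(2)[OF h] K2(2)[OF h] by (simp add: distrib_right)
 qed
 then obtain \<epsilon> where \<epsilon>: "\<epsilon> \<noteq> 0" and M: "motion Idx pnt (Inl 0) (\<lambda>i x. pnt i + x * (\<epsilon> * W i))" by blast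
 obtain B where B: "0 < B" "\<And>M. motion Idx pnt (Inl 0) M \<Longrightarrow> \<exists>v \<alpha> s2 \<alpha>2. lift_jets B M v \<alpha> s2 \<alpha>2"
  by (rule lift_jets_exist) blast
 from B(2)[OF M] obtain v \<alpha> s2 \<alpha>2 where J: "lift_jets B (\<lambda>i x. pnt i + x * (\<epsilon> * W i)) v \<alpha> s2 \<alpha>2" by blast
 have dW: "deriv (\<lambda>x. p + x * (\<epsilon> * y)) 0 = \<epsilon> * y" for p y
  by (rule DERIV_imp_deriv) (auto intro!: derivative_eq_intros)
 have v0: "v 0 n = \<epsilon> * (V1 n + V2 n)" for n using J unfolding lift_jets_def dW by (simp add: W_def)
 have amod: "a (j mod q) = a j" if "\<And>n. a (n + q) = a n" for a :: "nat \<Rightarrow> complex" and j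
 proof -
  have "a (m + q * k) = a m" for m k
  proof (induction k)
   case (Suc k)
   thus ?case using that[of "m + q * k"] by (simp add: ac_simps)
  qed simp
  from this[of "j mod q" "j div q"] show ?thesis by simp
 qed
 have \<alpha>0: "\<alpha> 0 j = \<epsilon> * (a1 j + a2 j)" for j
  using J unfolding lift_jets_def dW by (simp add: W_def amod[of a1, OF a1(2)] amod[of a2, OF a2(2)])
 have vS: "v k (Suc n) = g' (c n) * v (Suc k) n + v k 0 * f (c n)"
  and \<alpha>S: "\<alpha> k (Suc j) = g' (b j) * \<alpha> (Suc k) j + v k 0 * f (b j)"
  and \<alpha>2S: "\<alpha>2 k (Suc j) = g' (b j) * \<alpha>2 (Suc k) j + s2 k * f (b j) +
   2 * v k 0 * deriv f (b j) * \<alpha> (Suc k) j + c1 * deriv (deriv f) (b j) * (\<alpha> (Suc k) j) ^ 2"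
  and \<alpha>2p: "\<alpha>2 k (j + q) = \<alpha>2 k j" and \<alpha>2B: "norm (\<alpha>2 (Suc k) j) \<le> B" for k n j
  using J unfolding lift_jets_def by simp_all
 have vk: "v k n = \<epsilon> * (\<mu>1 ^ k * V1 n + \<mu>2 ^ k * V2 n)" for k n
 proof (induction k arbitrary: n)
  case 0
  show ?case by (simp add: v0)
 next
  case (Suc k)
  have "g' (c n) * v (Suc k) n = g' (c n) * (\<epsilon> * (\<mu>1 ^ Suc k * V1 n + \<mu>2 ^ Suc k * V2 n))"
   using vS[of k n] unfolding Suc V1 V2 by (simp add: algebra_simps)
  thus ?case using g'_c_nz[of n] by simp
 qed
 have \<alpha>k: "\<alpha> k n = \<epsilon> * (\<mu>1 ^ k * a1 n + \<mu>2 ^ k * a2 n)" for k n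
 proof (induction k arbitrary: n)
  case 0
  show ?case by (simp add: \<alpha>0)
 next
  case (Suc k)
  have "g' (b n) * \<alpha> (Suc k) n = g' (b n) * (\<epsilon> * (\<mu>1 ^ Suc k * a1 n + \<mu>2 ^ Suc k * a2 n))"
   using \<alpha>S[of k n] unfolding Suc a1(1) a2(1) vk V1(1) V2(1) by (simp add: algebra_simps)
  thus ?case using g'_b_nz[of n] by simp
 qed
 define \<omega> where "\<omega> = inverse (\<mu>1 * \<mu>2)"
 have nz: "\<mu>1 \<noteq> 0" "\<mu>2 \<noteq> 0" using \<mu>1 \<mu>2 by auto
 have \<omega>q: "\<omega> ^ q = 1" by (simp only: \<omega>_def power_inverse w(1) inverse_1)
 have n\<omega>: "norm \<omega> = 1" by (simp add: \<omega>_def norm_inverse norm_mult \<mu>1 \<mu>2)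
 \<comment> \<open>The second derivatives \<open>s2 k\<close> of the motion of \<open>c1\<close> are
   unknown; \<open>P (\<mu>1 * \<mu>2) 0 = 0\<close> cancels them from the sum over the
   cycle.\<close>
 have N0: "(\<Sum>j<q. \<omega> ^ Suc j * N (Suc j)) = 0"
 proof -
  have "P (\<mu>1 * \<mu>2) 0 = (\<Sum>j<q. (\<mu>1 * \<mu>2) ^ (q - Suc j) * N (q - (q - Suc j)))"
   unfolding P_def by (subst sum.nat_diff_reindex[symmetric]) simp
  also have "\<dots> = (\<Sum>j<q. \<omega> ^ Suc j * N (Suc j))"
  proof (intro sum.cong refl)
   fix j assume "j \<in> {..<q}"
   hence j: "Suc j \<le> q" by simp
   have "(\<mu>1 * \<mu>2) ^ (q - Suc j) * (\<mu>1 * \<mu>2) ^ Suc j = 1" by (simp only: power_add[symmetric] le_add_diff_inverse2[OF j] w(1))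
   hence "(\<mu>1 * \<mu>2) ^ (q - Suc j) = inverse ((\<mu>1 * \<mu>2) ^ Suc j)" using inverse_unique by (metis mult.commute)
   thus "(\<mu>1 * \<mu>2) ^ (q - Suc j) * N (q - (q - Suc j)) = \<omega> ^ Suc j * N (Suc j)"
    using j by (simp only: \<omega>_def power_inverse diff_diff_cancel)
  qed
  finally show ?thesis using w(2) by simp
 qed
 define \<beta> where "\<beta> k j = rho j * \<alpha>2 k j" for k j
 \<comment> \<open>The weight \<open>\<omega> ^ (j + k)\<close> is constant along the diagonals of
   the lifting recursion and compensates the factor \<open>(\<mu>1 * \<mu>2) ^ k\<close> of the
   mixed term, which thus becomes a constant drift.\<close>
 define S where "S k = (\<Sum>j<q. \<omega> ^ (j + k) * \<beta> k j)" for k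
 define F where "F j y = \<omega> ^ Suc j * rho (Suc j) * y" for j y
 define X where "X = (\<Sum>j<q. F j (2 * f' j * (\<mu>1 * a1 j + \<mu>2 * a2 j) + 2 * g'' j * (\<mu>1 * a1 j) * (\<mu>2 * a2 j)))"
 define X1 where "X1 = (\<Sum>j<q. F j (2 * f' j * (\<mu>1 * a1 j) + g'' j * (\<mu>1 * a1 j)\<^sup>2))"
 define X2 where "X2 = (\<Sum>j<q. F j (2 * f' j * (\<mu>2 * a2 j) + g'' j * (\<mu>2 * a2 j)\<^sup>2))"
 have drift: "S k = S (Suc k) + (\<epsilon>\<^sup>2 * X + (\<mu>1 / \<mu>2) ^ k * (\<epsilon>\<^sup>2 * X1) + (\<mu>2 / \<mu>1) ^ k * (\<epsilon>\<^sup>2 * X2))" for k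
 proof -
  have m11: "\<omega> ^ k * (\<mu>1 ^ k)\<^sup>2 = (\<mu>1 / \<mu>2) ^ k" and m22: "\<omega> ^ k * (\<mu>2 ^ k)\<^sup>2 = (\<mu>2 / \<mu>1) ^ k"
   and m12: "\<omega> ^ k * (\<mu>1 ^ k * \<mu>2 ^ k) = 1" using nz by (simp_all add: \<omega>_def power2_eq_square field_simps)
  have step: "\<omega> ^ (Suc j + k) * \<beta> k (Suc j) = \<omega> ^ (j + Suc k) * \<beta> (Suc k) j + (s2 k * \<omega> ^ k) * (\<omega> ^ Suc j * N (Suc j)) +
    (\<epsilon>\<^sup>2 * F j (2 * f' j * (\<mu>1 * a1 j + \<mu>2 * a2 j) + 2 * g'' j * (\<mu>1 * a1 j) * (\<mu>2 * a2 j)) +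
    (\<mu>1 / \<mu>2) ^ k * (\<epsilon>\<^sup>2 * F j (2 * f' j * (\<mu>1 * a1 j) + g'' j * (\<mu>1 * a1 j)\<^sup>2)) +
    (\<mu>2 / \<mu>1) ^ k * (\<epsilon>\<^sup>2 * F j (2 * f' j * (\<mu>2 * a2 j) + g'' j * (\<mu>2 * a2 j)\<^sup>2)))" for j
  proof -
   define R where "R = 2 * v k 0 * deriv f (b j) * \<alpha> (Suc k) j + c1 * deriv (deriv f) (b j) * (\<alpha> (Suc k) j) ^ 2"
   define x y where "x = \<mu>1 * a1 j" and "y = \<mu>2 * a2 j"
   have "\<beta> k (Suc j) = (g' (b j) * rho (Suc j)) * \<alpha>2 (Suc k) j + s2 k * (rho (Suc j) * f (b j)) + rho (Suc j) * R"
    unfolding \<beta>_def \<alpha>2S R_def by (simp add: algebra_simps)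
   hence hb: "\<beta> k (Suc j) = \<beta> (Suc k) j + s2 k * N (Suc j) + rho (Suc j) * R" by (simp only: rho_Suc N_Suc \<beta>_def)
   have hR: "\<omega> ^ k * R = \<epsilon>\<^sup>2 * (2 * f' j * (x + y) + 2 * g'' j * x * y) +
     (\<mu>1 / \<mu>2) ^ k * (\<epsilon>\<^sup>2 * (2 * f' j * x + g'' j * x\<^sup>2)) + (\<mu>2 / \<mu>1) ^ k * (\<epsilon>\<^sup>2 * (2 * f' j * y + g'' j * y\<^sup>2))"
   proof -
    have "R = 2 * f' j * (\<epsilon> * (\<mu>1 ^ k + \<mu>2 ^ k)) * (\<epsilon> * (\<mu>1 ^ k * x + \<mu>2 ^ k * y)) +
      g'' j * (\<epsilon> * (\<mu>1 ^ k * x + \<mu>2 ^ k * y))\<^sup>2"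
     unfolding R_def vk \<alpha>k V1(1) V2(1) x_def y_def by (simp add: algebra_simps)
    also have "\<dots> = (\<mu>1 ^ k)\<^sup>2 * (\<epsilon>\<^sup>2 * (2 * f' j * x + g'' j * x\<^sup>2)) + (\<mu>2 ^ k)\<^sup>2 * (\<epsilon>\<^sup>2 * (2 * f' j * y + g'' j * y\<^sup>2)) +
      (\<mu>1 ^ k * \<mu>2 ^ k) * (\<epsilon>\<^sup>2 * (2 * f' j * (x + y) + 2 * g'' j * x * y))"
     by (simp add: power2_eq_square algebra_simps)
    finally have "\<omega> ^ k * R = (\<omega> ^ k * (\<mu>1 ^ k)\<^sup>2) * (\<epsilon>\<^sup>2 * (2 * f' j * x + g'' j * x\<^sup>2)) +
      (\<omega> ^ k * (\<mu>2 ^ k)\<^sup>2) * (\<epsilon>\<^sup>2 * (2 * f' j * y + g'' j * y\<^sup>2)) +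
      (\<omega> ^ k * (\<mu>1 ^ k * \<mu>2 ^ k)) * (\<epsilon>\<^sup>2 * (2 * f' j * (x + y) + 2 * g'' j * x * y))"
     by (simp only: distrib_left mult.assoc)
    thus ?thesis unfolding m11 m22 m12 by simp
   qed
   have "\<omega> ^ (Suc j + k) * \<beta> k (Suc j) = \<omega> ^ (j + Suc k) * \<beta> (Suc k) j + (s2 k * \<omega> ^ k) * (\<omega> ^ Suc j * N (Suc j)) +
     F j (\<omega> ^ k * R)"
    unfolding hb F_def by (simp add: power_add algebra_simps)
   note this[unfolded hR]
   thus ?thesis unfolding x_def y_def F_def by (simp only: distrib_left mult_ac)
  qed
  have "S k = (\<Sum>j<q. \<omega> ^ (Suc j + k) * \<beta> k (Suc j))" unfolding S_def by (rule sum_periodic_shift[symmetric])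
    (use rho_per[OF k1, of 0] \<alpha>2p[of k 0] \<omega>q in \<open>simp add: \<beta>_def power_add\<close>)
  also have "\<dots> = S (Suc k) + (s2 k * \<omega> ^ k) * (\<Sum>j<q. \<omega> ^ Suc j * N (Suc j)) +
    (\<epsilon>\<^sup>2 * X + (\<mu>1 / \<mu>2) ^ k * (\<epsilon>\<^sup>2 * X1) + (\<mu>2 / \<mu>1) ^ k * (\<epsilon>\<^sup>2 * X2))"
   unfolding step S_def X_def X1_def X2_def by (simp only: sum.distrib sum_distrib_left)
  finally show ?thesis unfolding N0 by simp
 qed
 have "\<epsilon>\<^sup>2 * X = 0"
 \<comment> \<open>Shifted by one, as the bound on second derivatives holds from the first lift
   on.\<close>
 proof (rule bounded_drift_zero[of "\<lambda>k. S (Suc k)"])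
  fix k
  show "norm (S (Suc k)) \<le> (\<Sum>j<q. norm (rho j) * B)"
   unfolding S_def \<beta>_def by (rule sum_norm_le) (simp add: norm_mult norm_power n\<omega> \<alpha>2B mult_left_mono)
  show "norm (\<mu>1 / \<mu>2) = 1" "norm (\<mu>2 / \<mu>1) = 1" by (simp_all add: norm_divide \<mu>1 \<mu>2)
  show "\<mu>1 / \<mu>2 \<noteq> 1" "\<mu>2 / \<mu>1 \<noteq> 1" using ne by auto
  show "S (Suc k) = S (Suc (Suc k)) + (\<epsilon>\<^sup>2 * X + (\<mu>1 / \<mu>2) ^ k * (\<mu>1 / \<mu>2 * (\<epsilon>\<^sup>2 * X1)) + (\<mu>2 / \<mu>1) ^ k * (\<mu>2 / \<mu>1 * (\<epsilon>\<^sup>2 * X2)))"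
   using drift[of "Suc k"] by (simp only: power_Suc2 mult.assoc)
 qed
 hence X0: "X = 0" using \<epsilon> by simp
 have e1: "P \<mu>1 j = (1 - \<mu>1 ^ q) * (rho j * a1 j)" and e2: "P \<mu>2 j = (1 - \<mu>2 ^ q) * (rho j * a2 j)" for j
  using P_eigenvector[of a1, OF a1 k1, of j] P_eigenvector[of a2, OF a2 k1, of j] by simp_all
 have alg: "2 * F' * (m1 * (x * (r * y1)) * z + m2 * (z * (r * y2)) * x) / r + 2 * G2 * (m1 * (x * (r * y1))) * (m2 * (z * (r * y2))) / r\<^sup>2 =
  x * z * (2 * F' * (m1 * y1 + m2 * y2) + 2 * G2 * (m1 * y1) * (m2 * y2))" if "r \<noteq> 0" for F' G2 m1 m2 x z r y1 y2 :: complex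
  using that by (simp add: power2_eq_square field_simps)
 have "resonance \<mu>1 \<mu>2 = (\<Sum>j<q. (1 - \<mu>1 ^ q) * (1 - \<mu>2 ^ q) *
   F j (2 * f' j * (\<mu>1 * a1 j + \<mu>2 * a2 j) + 2 * g'' j * (\<mu>1 * a1 j) * (\<mu>2 * a2 j)))"
  unfolding resonance_def e1 e2 F_def \<omega>_def by (simp only: alg rho_nz not_False_eq_True) (simp only: mult_ac)
 thus ?thesis unfolding sum_distrib_left[symmetric] X_def[symmetric] X0 by simp
qed

text \<open>At the roots of unity themselves no Lipschitz eigenvectors are at hand. Rotating
  \<open>w1\<close> and \<open>w2\<close> by opposite small angles keeps the product and gives
  admissible eigenvalues, so if \<open>P (w1 * w2) 0 = 0\<close> the resonance vanishes for small
  positive angles and, by continuity, at angle 0. There the terms with \<open>1 - \<mu> ^ q\<close>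
  drop out and \<open>2 * P w1 0 * P w2 0 * Gam\<close> remains.\<close>

lemma nonvanishing_roots_mult:
 assumes k1: "kappa = 1" and pa: "parabolic_asymptotics q 1 b"
  and w1: "w1 ^ q = 1" "P w1 0 \<noteq> 0" and w2: "w2 ^ q = 1" "P w2 0 \<noteq> 0"
 shows "P (w1 * w2) 0 \<noteq> 0"
proof
 assume z: "P (w1 * w2) 0 = 0"
 define m1 m2 where "m1 \<theta> = w1 * cis \<theta>" and "m2 \<theta> = w2 * cis (- \<theta>)" for \<theta>
 have n1: "norm w1 = 1" "norm w2 = 1" using power_eq_1_iff[OF w1(1)] power_eq_1_iff[OF w2(1)] q_pos by auto
 have m12: "m1 \<theta> * m2 \<theta> = w1 * w2" for \<theta> by (simp add: m1_def m2_def cis_mult)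
 have mq: "m1 \<theta> ^ q = cis (real q * \<theta>)" "m2 \<theta> ^ q = cis (- (real q * \<theta>))" for \<theta>
  by (simp_all add: m1_def m2_def power_mult_distrib w1 w2 Complex.DeMoivre)
 define \<Phi> where "\<Phi> \<theta> = resonance (m1 \<theta>) (m2 \<theta>)" for \<theta>
 have \<Phi>0: "\<Phi> \<theta> = 0" if \<theta>: "0 < \<theta>" "real q * \<theta> < pi / 2" for \<theta>
 proof -
  have "real q * \<theta> < pi" using \<theta>(2) pi_gt_zero by linarith
  hence s: "sin (real q * \<theta>) > 0" using \<theta>(1) q_pos by (intro sin_gt_zero) simp_all
  have ne: "m1 \<theta> \<noteq> m2 \<theta>"
  proof
   assume "m1 \<theta> = m2 \<theta>"
   hence "cis (real q * \<theta>) = cis (- (real q * \<theta>))" unfolding mq[symmetric] by simp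
   hence "sin (real q * \<theta>) = - sin (real q * \<theta>)" by (metis cis.simps(2) sin_minus)
   thus False using s by simp
  qed
  have "m1 \<theta> ^ q \<noteq> 1" "m2 \<theta> ^ q \<noteq> 1" unfolding mq using s by (auto simp: complex_eq_iff)
  moreover have "norm (m1 \<theta>) = 1" "norm (m2 \<theta>) = 1" by (simp_all add: m1_def m2_def norm_mult n1)
  moreover have "(m1 \<theta> * m2 \<theta>) ^ q = 1" "P (m1 \<theta> * m2 \<theta>) 0 = 0"
   unfolding m12 by (simp_all add: power_mult_distrib w1 w2 z)
  ultimately show ?thesis using resonance_zero[OF k1 pa, of "m1 \<theta>" "m2 \<theta>"] ne unfolding \<Phi>_def by blast
 qed
 have "isCont \<Phi> 0"
 proof -
  have "continuous_on UNIV (\<lambda>\<theta>. P (m1 \<theta>) j)" "continuous_on UNIV (\<lambda>\<theta>. P (m2 \<theta>) j)" for j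
   unfolding P_def m1_def m2_def by (intro continuous_intros)+
  moreover have "continuous_on UNIV m1" "continuous_on UNIV m2"
   unfolding m1_def m2_def by (intro continuous_intros)+
  ultimately have "continuous_on UNIV \<Phi>"
   unfolding \<Phi>_def[abs_def] resonance_def m12 using rho_nz by (intro continuous_intros) auto
  thus ?thesis by (simp add: continuous_on_eq_continuous_at)
 qed
 hence "(\<Phi> \<longlongrightarrow> \<Phi> 0) (at_right 0)" unfolding isCont_def by (rule filterlim_at_split[THEN iffD1, THEN conjunct2])
 moreover have "(\<Phi> \<longlongrightarrow> 0) (at_right 0)"
 proof (rule tendsto_eventually)
  have "\<forall>\<^sub>F \<theta> in at_right (0::real). \<theta> \<in> {0<..<pi / (2 * real q)}"
   using q_pos by (intro eventually_at_right_real) simp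
  thus "\<forall>\<^sub>F \<theta> in at_right 0. \<Phi> \<theta> = 0" by eventually_elim (rule \<Phi>0, use q_pos in \<open>auto simp: field_simps\<close>)
 qed
 ultimately have \<Phi>00: "\<Phi> 0 = 0" using tendsto_unique trivial_limit_at_right_real by blast
 have "\<Phi> 0 = 2 * P w1 0 * P w2 0 * Gam" unfolding \<Phi>_def Gam_def sum_distrib_left resonance_def m12
 proof (intro sum.cong refl)
  fix j
  have nz: "w1 \<noteq> 0" "w2 \<noteq> 0" using n1 by auto
  have m0: "m1 0 = w1" "m2 0 = w2" by (simp_all add: m1_def m2_def)
  have alg: "I * R * (2 * F' * (w1 * (x1 * p1) * (1 - 1) + w2 * (x2 * p2) * (1 - 1)) / r + 2 * G2 * (w1 * (x1 * p1)) * (w2 * (x2 * p2)) / r\<^sup>2) =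
   (I * ((w1 * x1) * (w2 * x2))) * (2 * p1 * p2 * (R * G2 / r\<^sup>2))" for I R F' x1 x2 p1 p2 r G2 :: complex
   by (simp add: mult_ac)
  have inv: "inverse (w1 * w2) ^ Suc j * ((w1 * w1 ^ j) * (w2 * w2 ^ j)) = 1"
   using nz by (simp add: power_mult_distrib field_simps)
  show "inverse (w1 * w2) ^ Suc j * rho (Suc j) *
   (2 * f' j * (m1 0 * P (m1 0) j * (1 - m2 0 ^ q) + m2 0 * P (m2 0) j * (1 - m1 0 ^ q)) / rho j +
   2 * g'' j * (m1 0 * P (m1 0) j) * (m2 0 * P (m2 0) j) / (rho j)\<^sup>2) =
   2 * P w1 0 * P w2 0 * (rho (Suc j) * (c1 * deriv (deriv f) (b j)) / (rho j)\<^sup>2)"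
   unfolding m0 P_root[OF k1 w1(1), of j] P_root[OF k1 w2(1), of j] w1(1) w2(1) alg inv by simp
 qed
 thus False using \<Phi>00 w1(2) w2(2) Gam_nz[OF k1] by simp
qed

text \<open>Powers of a root \<open>w\<close> with \<open>P w 0 \<noteq> 0\<close> inherit this
  property, in particular \<open>w ^ q = 1\<close>; but a periodic \<open>A\<close> forces
  \<open>P 1 0 = 0\<close>.\<close>

lemma degenerate_transversal:
 assumes k1: "kappa = 1" and pa: "parabolic_asymptotics q 1 b"
  and A: "\<And>n. A (Suc n) = g' (b n) * A n + f (b n)" "\<And>n. A (n + q) = A n"
 shows False
proof -
 obtain w where w: "w ^ q = 1" "P w 0 \<noteq> 0" using P_some_root[OF k1] by blast
 have "P (w ^ Suc n) 0 \<noteq> 0" for n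
 proof (induction n)
  case (Suc n)
  have wn: "(w ^ Suc n) ^ q = 1" by (metis power_mult mult.commute w(1) power_one)
  show ?case using nonvanishing_roots_mult[OF k1 pa w wn Suc] by simp
 qed (use w in simp)
 from this[of "q - 1"] have "P 1 0 \<noteq> 0" using q_pos w(1) by simp
 moreover have "P 1 0 = 0" using P_eigenvector[of A 1, OF _ A(2) k1, of 0] A(1) by simp
 ultimately show False by simp
qed

end

section \<open>Unfoldings of a cycle\<close>

text \<open>Newton's method for \<open>F w z = z\<close>, with the derivative frozen at the base
  point, is a contraction near it, uniformly in \<open>w\<close>. Its iterates are holomorphic in
  \<open>w\<close>, and so is their uniform limit. Joint holomorphy of \<open>F\<close> enters only
  along holomorphic graphs, as \<open>hol\<close>.\<close>

lemma holomorphic_fixed_point: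
 fixes F F' :: "complex \<Rightarrow> complex \<Rightarrow> complex"
 assumes fix0: "F w0 z0 = z0" and ne: "F' w0 z0 \<noteq> 1" and e: "0 < e"
  and der: "\<And>w z. w \<in> ball w0 e \<Longrightarrow> z \<in> ball z0 e \<Longrightarrow> (F w has_field_derivative F' w z) (at z)"
  and cont: "isCont (\<lambda>p. F' (fst p) (snd p)) (w0, z0)"
  and hol: "\<And>h s. s \<le> e \<Longrightarrow> h holomorphic_on ball w0 s \<Longrightarrow> (\<And>w. w \<in> ball w0 s \<Longrightarrow> h w \<in> ball z0 e) \<Longrightarrow>
   (\<lambda>w. F w (h w)) holomorphic_on ball w0 s"
 shows "\<exists>\<alpha> s. 0 < s \<and> \<alpha> holomorphic_on ball w0 s \<and> \<alpha> w0 = z0 \<and> (\<forall>w\<in>ball w0 s. F w (\<alpha> w) = \<alpha> w)"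
proof -
 define k where "k = F' w0 z0 - 1"
 have k: "k \<noteq> 0" using ne by (simp add: k_def)
 define H where "H w z = z - (F w z - z) / k" for w z
 define H' where "H' w z = 1 - (F' w z - 1) / k" for w z
 have "isCont (\<lambda>p. H' (fst p) (snd p)) (w0, z0)" unfolding H'_def using cont k by (intro continuous_intros) auto
 moreover have "H' w0 z0 = 0" using k by (simp add: H'_def k_def)
 ultimately obtain s1 where s1: "0 < s1" "\<And>p. dist p (w0, z0) < s1 \<Longrightarrow> norm (H' (fst p) (snd p)) < 1 / 2"
  unfolding continuous_at_eps_delta by (elim allE[of _ "1 / 2"]) auto
 define r where "r = min (s1 / 2) (e / 2)"
 have r: "0 < r" "r < e" "r \<le> s1 / 2" using s1(1) e by (auto simp: r_def)
 have "(\<lambda>w. F w z0) holomorphic_on ball w0 e" by (rule hol) (use e in auto)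
 hence "isCont (\<lambda>w. F w z0) w0"
  using e holomorphic_on_imp_continuous_on continuous_on_eq_continuous_at[OF open_ball] by (metis centre_in_ball)
 hence "isCont (\<lambda>w. H w z0) w0" unfolding H_def using k by (intro continuous_intros) auto
 moreover have H0: "H w0 z0 = z0" by (simp add: H_def fix0)
 ultimately obtain s2 where s2: "0 < s2" "\<And>w. dist w w0 < s2 \<Longrightarrow> norm (H w z0 - z0) < r / 2"
  unfolding continuous_at_eps_delta using r(1) by (elim allE[of _ "r / 2"]) (auto simp: dist_norm)
 define s where "s = min (min (s1 / 2) s2) e"
 have s: "0 < s" "s \<le> s1 / 2" "s \<le> s2" "s \<le> e" using s1 s2 e by (auto simp: s_def)
 have H'b: "norm (H' w z) \<le> 1 / 2" if "w \<in> ball w0 s" "z \<in> cball z0 r" for w z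
 proof -
  have "dist (w, z) (w0, z0) \<le> dist w w0 + dist z z0"
   unfolding dist_Pair_Pair by (rule sqrt_sum_squares_le_sum) auto
  also have "\<dots> < s1" using that s(2) r(3) by (simp add: dist_commute)
  finally show ?thesis using s1(2)[of "(w, z)"] by simp
 qed
 have contr: "norm (H w z - H w z') \<le> 1 / 2 * norm (z - z')"
  if w: "w \<in> ball w0 s" and z: "z \<in> cball z0 r" "z' \<in> cball z0 r" for w z z'
 proof (rule field_differentiable_bound[OF convex_cball _ _ z, of "H w" "H' w"])
  fix x assume x: "x \<in> cball z0 r"
  have xe: "x \<in> ball z0 e" and we: "w \<in> ball w0 e" using x r(2) w s(4) by auto
  have "(F w has_field_derivative F' w x) (at x)" by (rule der[OF we xe])
  hence "(H w has_field_derivative H' w x) (at x)"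
   unfolding H_def[abs_def] H'_def by (auto intro!: derivative_eq_intros simp: k)
  thus "(H w has_field_derivative H' w x) (at x within cball z0 r)" by (rule has_field_derivative_at_within)
  show "norm (H' w x) \<le> 1 / 2" by (rule H'b[OF w x])
 qed
 have self: "H w z \<in> cball z0 r" if w: "w \<in> ball w0 s" and z: "z \<in> cball z0 r" for w z
 proof -
  have "norm (H w z - H w z0) \<le> 1 / 2 * norm (z - z0)" using contr[OF w z, of z0] r(1) by simp
  moreover have "norm (H w z0 - z0) < r / 2" using s2(2)[of w] w s(3) by (simp add: dist_commute)
  moreover have "norm (z - z0) \<le> r" using z by (simp add: dist_norm norm_minus_commute)
  moreover have "norm (H w z - z0) \<le> norm (H w z - H w z0) + norm (H w z0 - z0)"
   using norm_triangle_ineq[of "H w z - H w z0" "H w z0 - z0"] by simp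
  ultimately show ?thesis by (simp add: dist_norm norm_minus_commute)
 qed
 have ex1: "\<exists>!z\<in>cball z0 r. H w z = z" if w: "w \<in> ball w0 s" for w
 proof (rule Banach_fix[of _ "1 / 2"])
  show "complete (cball z0 r)" by (simp add: complete_eq_closed)
  show "cball z0 r \<noteq> {}" using r(1) by simp
  show "H w ` cball z0 r \<subseteq> cball z0 r" using self[OF w] by blast
  show "dist (H w x) (H w y) \<le> 1 / 2 * dist x y" if "x \<in> cball z0 r" "y \<in> cball z0 r" for x y
   unfolding dist_norm by (rule contr[OF w that])
 qed simp_all
 define \<alpha> where "\<alpha> w = (THE z. z \<in> cball z0 r \<and> H w z = z)" for w
 have \<alpha>: "\<alpha> w \<in> cball z0 r" "H w (\<alpha> w) = \<alpha> w" if "w \<in> ball w0 s" for w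
  using theI'[OF ex1[OF that]] by (simp_all add: \<alpha>_def)
 define An where "An n w = ((H w ^^ n) z0)" for n w
 have An: "An n w \<in> cball z0 r" if w: "w \<in> ball w0 s" for n w
 proof (induction n)
  case 0
  show ?case using r(1) by (simp add: An_def)
 next
  case (Suc n)
  from self[OF w this] show ?case by (simp add: An_def)
 qed
 have AnS: "An (Suc n) = (\<lambda>w. H w (An n w))" for n by (rule ext) (simp add: An_def)
 have hol_An: "An n holomorphic_on ball w0 s" for n
 proof (induction n)
  case 0
  thus ?case by (simp add: An_def[abs_def])
 next
  case (Suc n)
  have "(\<lambda>w. F w (An n w)) holomorphic_on ball w0 s"
  proof (rule hol[OF s(4) Suc])
   fix w assume "w \<in> ball w0 s"
   from An[OF this, of n] show "An n w \<in> ball z0 e" using r(2) by auto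
  qed
  thus ?case unfolding AnS H_def using Suc by (intro holomorphic_intros) auto
 qed
 have rate: "norm (An n w - \<alpha> w) \<le> (1 / 2) ^ n * r" if w: "w \<in> ball w0 s" for n w
 proof (induction n)
  case 0
  thus ?case using \<alpha>(1)[OF w] by (simp add: An_def dist_norm)
 next
  case (Suc n)
  have "norm (H w (An n w) - H w (\<alpha> w)) \<le> 1 / 2 * norm (An n w - \<alpha> w)" by (rule contr[OF w An[OF w] \<alpha>(1)[OF w]])
  thus ?case using Suc \<alpha>(2)[OF w] by (simp add: AnS)
 qed
 have ul: "uniform_limit (ball w0 s) An \<alpha> sequentially"
 proof (rule uniform_limitI)
  fix \<epsilon> :: real assume "0 < \<epsilon>"
  have "(\<lambda>n. (1 / 2) ^ n * r) \<longlonglongrightarrow> 0 * r" by (intro tendsto_intros LIMSEQ_realpow_zero) auto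
  hence "\<forall>\<^sub>F n in sequentially. (1 / 2) ^ n * r < \<epsilon>" using \<open>0 < \<epsilon>\<close> order_tendstoD(2)[of _ 0] by simp
  thus "\<forall>\<^sub>F n in sequentially. \<forall>w\<in>ball w0 s. dist (An n w) (\<alpha> w) < \<epsilon>"
   by eventually_elim (use rate in \<open>auto simp: dist_norm simp del: mem_ball intro: le_less_trans\<close>)
 qed
 have "\<alpha> holomorphic_on ball w0 s"
 proof (rule holomorphic_uniform_sequence[OF open_ball hol_An])
  fix x assume "x \<in> ball w0 s"
  then obtain d where d: "0 < d" "cball x d \<subseteq> ball w0 s" using open_contains_cball[of "ball w0 s"] by blast
  thus "\<exists>d>0. cball x d \<subseteq> ball w0 s \<and> uniform_limit (cball x d) An \<alpha> sequentially"
   using uniform_limit_on_subset[OF ul] by blast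
 qed
 moreover have "\<alpha> w0 = z0"
  using ex1[of w0] \<alpha>[of w0] s(1) r(1) H0 by (metis centre_in_ball centre_in_cball less_imp_le)
 moreover have "F w (\<alpha> w) = \<alpha> w" if "w \<in> ball w0 s" for w using \<alpha>(2)[OF that] k by (simp add: H_def)
 ultimately show ?thesis using s(1) by blast
qed

lemma isCont_eventually_mem: "isCont h x \<Longrightarrow> open S \<Longrightarrow> h x \<in> S \<Longrightarrow> \<forall>\<^sub>F y in nhds x. h y \<in> S"
 unfolding isCont_def eventually_nhds_conv_at by (simp add: topological_tendstoD)

lemma G_funpow_Suc: "(G f w ^^ Suc i) z = w * f ((G f w ^^ i) z)"
 by (simp only: funpow.simps o_apply G_def[of f w "(G f w ^^ i) z"])

lemma G_funpow_deriv:
 assumes "f holomorphic_on D" "open D" "\<And>i. i < n \<Longrightarrow> (G f w ^^ i) z \<in> D"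
 shows "((G f w ^^ n) has_field_derivative (\<Prod>i<n. w * deriv f ((G f w ^^ i) z))) (at z)" using assms(3)
proof (induction n)
 case 0
 have *: "G f w ^^ 0 = (\<lambda>x. x)" by auto
 show ?case unfolding * by simp
next
 case (Suc n)
 have "(f has_field_derivative deriv f ((G f w ^^ n) z)) (at ((G f w ^^ n) z))"
  by (rule holomorphic_derivI[OF assms(1,2)]) (rule Suc.prems, simp)
 moreover have "((G f w ^^ n) has_field_derivative (\<Prod>i<n. w * deriv f ((G f w ^^ i) z))) (at z)" using Suc by simp
 ultimately have "((\<lambda>x. f ((G f w ^^ n) x)) has_field_derivative
   deriv f ((G f w ^^ n) z) * (\<Prod>i<n. w * deriv f ((G f w ^^ i) z))) (at z)" by (rule DERIV_chain2)
 from DERIV_cmult[OF this, of w] show ?case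
  by (simp only: prod.lessThan_Suc mult_ac G_funpow_Suc[abs_def, symmetric])
qed

lemma prod_has_field_derivative_nonzero:
 fixes h :: "nat \<Rightarrow> complex \<Rightarrow> complex"
 assumes "\<And>i. i < n \<Longrightarrow> (h i has_field_derivative h' i) (at x)" "\<And>i. i < n \<Longrightarrow> h i x \<noteq> 0"
 shows "((\<lambda>w. \<Prod>i<n. h i w) has_field_derivative (\<Prod>i<n. h i x) * (\<Sum>i<n. h' i / h i x)) (at x)" using assms
proof (induction n)
 case (Suc n)
 have "((\<lambda>w. (\<Prod>i<n. h i w) * h n w) has_field_derivative
   (\<Prod>i<n. h i x) * (\<Sum>i<n. h' i / h i x) * h n x + h' n * (\<Prod>i<n. h i x)) (at x)"
  by (rule DERIV_mult) (use Suc in auto)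
 thus ?case using Suc.prems(2)[of n] by (simp add: algebra_simps)
qed simp

context map_cycle begin

lemma G_c1: "G f c1 = g" by (rule ext) (simp add: G_def)

lemma G_curve_deriv:
 assumes \<alpha>: "(\<alpha> has_field_derivative A 0) (at c1)" "\<alpha> c1 = b m"
  and A: "\<And>i. A (Suc i) = g' (b (m + i)) * A i + f (b (m + i))"
 shows "((\<lambda>w. (G f w ^^ i) (\<alpha> w)) has_field_derivative A i) (at c1)"
proof (induction i)
 case 0
 show ?case using \<alpha>(1) by simp
next
 case (Suc i)
 have at: "(G f c1 ^^ i) (\<alpha> c1) = b (m + i)" by (simp add: G_c1 \<alpha>(2) funpow_b)
 have "(f has_field_derivative deriv f (b (m + i))) (at ((G f c1 ^^ i) (\<alpha> c1)))"
  unfolding at by (rule holomorphic_derivI[OF hol_f open_D b_D])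
 from DERIV_mult[OF DERIV_ident DERIV_chain2[OF this Suc]]
 have "((\<lambda>w. w * f ((G f w ^^ i) (\<alpha> w))) has_field_derivative A (Suc i)) (at c1)" by (simp add: at A algebra_simps)
 thus ?case by (simp only: G_funpow_Suc)
qed

lemma continuation_exists:
 assumes "kappa \<noteq> 1"
 shows "\<exists>\<alpha>. continues_periodic_point f c1 q (b 0) \<alpha>"
proof -
 define F' where "F' w z = (\<Prod>i<q. w * deriv f ((G f w ^^ i) z))" for w z
 have at: "(G f c1 ^^ i) (b 0) = b i" for i by (simp add: G_c1 funpow_b)
 have ci: "isCont (\<lambda>p. (G f (fst p) ^^ i) (snd p)) (c1, b 0)" for i
 proof (induction i)
  case (Suc i)
  have "isCont f (b i)" by (rule DERIV_isCont[OF holomorphic_derivI[OF hol_f open_D b_D]])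
  hence "isCont f ((G f (fst (c1, b 0)) ^^ i) (snd (c1, b 0)))" by (simp add: at)
  from isCont_o2[OF Suc this] show ?case unfolding G_funpow_Suc by (intro continuous_intros)
 qed simp
 have "isCont (\<lambda>p. F' (fst p) (snd p)) (c1, b 0)"
 proof -
  have "isCont (\<lambda>p. deriv f ((G f (fst p) ^^ i) (snd p))) (c1, b 0)" for i
  proof -
   have "isCont (deriv f) (b i)" by (rule DERIV_isCont[OF holomorphic_derivI[OF hol_f' open_D b_D]])
   hence "isCont (deriv f) ((G f (fst (c1, b 0)) ^^ i) (snd (c1, b 0)))" by (simp add: at)
   from isCont_o2[OF ci this] show ?thesis .
  qed
  thus ?thesis unfolding F'_def by (intro continuous_intros)
 qed
 moreover have "\<exists>e>0. \<forall>w\<in>ball c1 e. \<forall>z\<in>ball (b 0) e. \<forall>i<q. (G f w ^^ i) z \<in> D"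
 proof -
  have "\<forall>\<^sub>F p in nhds (c1, b 0). \<forall>i\<in>{..<q}. (G f (fst p) ^^ i) (snd p) \<in> D"
  proof (rule eventually_ball_finite, simp, rule ballI)
   fix i
   show "\<forall>\<^sub>F p in nhds (c1, b 0). (G f (fst p) ^^ i) (snd p) \<in> D"
    by (rule isCont_eventually_mem[OF ci open_D]) (simp add: at b_D)
  qed
  then obtain e where e: "0 < e" "\<And>p. dist p (c1, b 0) < e \<Longrightarrow> \<forall>i\<in>{..<q}. (G f (fst p) ^^ i) (snd p) \<in> D"
   unfolding eventually_nhds_metric by blast
  have "(G f w ^^ i) z \<in> D" if "w \<in> ball c1 (e / 2)" "z \<in> ball (b 0) (e / 2)" "i < q" for w z i
  proof -
   have "dist (w, z) (c1, b 0) \<le> dist w c1 + dist z (b 0)"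
    unfolding dist_Pair_Pair by (rule sqrt_sum_squares_le_sum) auto
   also have "\<dots> < e" using that by (simp add: dist_commute)
   finally show ?thesis using e(2)[of "(w, z)"] that(3) by simp
  qed
  thus ?thesis using e(1) by (intro exI[of _ "e / 2"]) auto
 qed
 then obtain e where e: "0 < e" "\<And>w z i. w \<in> ball c1 e \<Longrightarrow> z \<in> ball (b 0) e \<Longrightarrow> i < q \<Longrightarrow> (G f w ^^ i) z \<in> D" by blast
 have "\<exists>\<alpha> s. 0 < s \<and> \<alpha> holomorphic_on ball c1 s \<and> \<alpha> c1 = b 0 \<and> (\<forall>w\<in>ball c1 s. (G f w ^^ q) (\<alpha> w) = \<alpha> w)"
 proof (rule holomorphic_fixed_point[OF _ _ e(1), of "\<lambda>w. G f w ^^ q" c1 "b 0" F'])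
  show "(G f c1 ^^ q) (b 0) = b 0" using b_per[of 0] by (simp add: at)
  show "F' c1 (b 0) \<noteq> 1" using assms by (simp add: F'_def at kappa_def)
  show "isCont (\<lambda>p. F' (fst p) (snd p)) (c1, b 0)" by fact
  fix w z assume "w \<in> ball c1 e" "z \<in> ball (b 0) e"
  thus "((G f w ^^ q) has_field_derivative F' w z) (at z)"
   unfolding F'_def by (intro G_funpow_deriv[OF hol_f open_D] e(2))
 next
  fix h s assume s: "s \<le> e" and h: "h holomorphic_on ball c1 s" "\<And>w. w \<in> ball c1 s \<Longrightarrow> h w \<in> ball (b 0) e"
  have "(\<lambda>w. (G f w ^^ i) (h w)) holomorphic_on ball c1 s" if "i \<le> q" for i using that
  proof (induction i)
   case 0
   thus ?case using h(1) by simp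
  next
   case (Suc i)
   have "(f \<circ> (\<lambda>w. (G f w ^^ i) (h w))) holomorphic_on ball c1 s"
   proof (rule holomorphic_on_compose_gen[OF _ hol_f])
    show "(\<lambda>w. (G f w ^^ i) (h w)) holomorphic_on ball c1 s" using Suc by simp
    show "(\<lambda>w. (G f w ^^ i) (h w)) ` ball c1 s \<subseteq> D"
    proof (rule image_subsetI)
     fix w assume w: "w \<in> ball c1 s"
     show "(G f w ^^ i) (h w) \<in> D" by (rule e(2)[OF _ h(2)[OF w]]) (use w s Suc.prems in auto)
    qed
   qed
   hence "(\<lambda>w. w * f ((G f w ^^ i) (h w))) holomorphic_on ball c1 s" unfolding o_def by (intro holomorphic_intros)
   thus ?case by (simp only: G_funpow_Suc)
  qed
  thus "(\<lambda>w. (G f w ^^ q) (h w)) holomorphic_on ball c1 s" by simp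
 qed
 then obtain \<alpha> s where s: "0 < s" "\<alpha> holomorphic_on ball c1 s" "\<alpha> c1 = b 0" "\<And>w. w \<in> ball c1 s \<Longrightarrow> (G f w ^^ q) (\<alpha> w) = \<alpha> w"
  by blast
 have "continues_periodic_point f c1 q (b 0) \<alpha>" unfolding continues_periodic_point_def
 proof (intro conjI)
  show "\<alpha> analytic_on {c1}" using s(1,2) by (auto simp: analytic_at intro!: exI[of _ "ball c1 s"])
  show "\<alpha> c1 = b 0" by (rule s(3))
  have "\<forall>\<^sub>F w in nhds c1. w \<in> ball c1 s" using s(1) by (intro eventually_nhds_in_open) auto
  thus "\<forall>\<^sub>F w in nhds c1. (G f w ^^ q) (\<alpha> w) = \<alpha> w" by eventually_elim (rule s(4))
 qed
 thus ?thesis by blast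
qed

lemma solution_per:
 assumes B: "\<And>i. B (Suc i) = g' (b (m + i)) * B i + f (b (m + i))" and q: "B q = B 0"
 shows "B (i + q) = B i"
proof (induction i)
 case (Suc i)
 have "b (m + (i + q)) = b (m + i)" using b_per[of "m + i"] by (simp add: add.assoc)
 thus ?case using B[of i] B[of "i + q"] Suc by simp
qed (simp add: q)

text \<open>\<open>A n\<close> is the parameter derivative of the \<open>n\<close>-th point of the
  continued cycle, periodic since the continued point is. The formula is the logarithmic derivative
  of the product of the factors \<open>w * deriv f\<close> along the cycle.\<close>

lemma multiplier_derivative:
 assumes \<alpha>: "continues_periodic_point f c1 q (b 0) \<alpha>"
 shows "\<exists>A. (\<forall>n. A (Suc n) = g' (b n) * A n + f (b n)) \<and> (\<forall>n. A (n + q) = A n) \<and>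
  deriv (\<lambda>w. multiplier (G f w) q (\<alpha> w)) c1 =
   kappa * (\<Sum>j<q. (deriv f (b j) + c1 * deriv (deriv f) (b j) * A j) / g' (b j))"
proof -
 have an: "\<alpha> analytic_on {c1}" and \<alpha>0: "\<alpha> c1 = b 0"
  and ev: "\<forall>\<^sub>F w in nhds c1. (G f w ^^ q) (\<alpha> w) = \<alpha> w" using \<alpha> unfolding continues_periodic_point_def by auto
 define B where "B = rec_nat (deriv \<alpha> c1) (\<lambda>n y. g' (b n) * y + f (b n))"
 have B: "B 0 = deriv \<alpha> c1" "B (Suc i) = g' (b (0 + i)) * B i + f (b (0 + i))" for i by (simp_all add: B_def)
 have "(\<alpha> has_field_derivative B 0) (at c1)"
  unfolding B(1) using an by (simp add: analytic_on_imp_differentiable_at DERIV_deriv_iff_field_differentiable)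
 from G_curve_deriv[of \<alpha> B 0, OF this \<alpha>0 B(2)]
 have dB: "((\<lambda>w. (G f w ^^ i) (\<alpha> w)) has_field_derivative B i) (at c1)" for i .
 have "(\<alpha> has_field_derivative B q) (at c1)" using dB[of q] unfolding DERIV_cong_ev[OF refl ev refl] .
 hence "B q = B 0" using dB[of 0] DERIV_unique by simp
 note per = solution_per[of B 0, OF B(2) this]
 have at: "(G f c1 ^^ i) (\<alpha> c1) = b i" for i by (simp add: G_c1 \<alpha>0 funpow_b)
 have "\<forall>\<^sub>F w in nhds c1. \<forall>i\<in>{..<q}. (G f w ^^ i) (\<alpha> w) \<in> D"
 proof (rule eventually_ball_finite, simp, rule ballI)
  fix i
  show "\<forall>\<^sub>F w in nhds c1. (G f w ^^ i) (\<alpha> w) \<in> D"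
   by (rule isCont_eventually_mem[OF DERIV_isCont[OF dB] open_D]) (simp add: at b_D)
 qed
 hence mult: "\<forall>\<^sub>F w in nhds c1. multiplier (G f w) q (\<alpha> w) = (\<Prod>i<q. w * deriv f ((G f w ^^ i) (\<alpha> w)))"
 proof eventually_elim
  case (elim w)
  show ?case unfolding multiplier_def
   by (rule DERIV_imp_deriv, rule G_funpow_deriv[OF hol_f open_D]) (use elim in auto)
 qed
 have dh: "((\<lambda>w. w * deriv f ((G f w ^^ i) (\<alpha> w))) has_field_derivative
   deriv f (b i) + c1 * deriv (deriv f) (b i) * B i) (at c1)" for i
 proof -
  have "(deriv f has_field_derivative deriv (deriv f) (b i)) (at ((G f c1 ^^ i) (\<alpha> c1)))"
   unfolding at by (rule holomorphic_derivI[OF hol_f' open_D b_D])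
  from DERIV_mult[OF DERIV_ident DERIV_chain2[OF this dB]] show ?thesis by (simp add: at algebra_simps)
 qed
 have "((\<lambda>w. \<Prod>i<q. w * deriv f ((G f w ^^ i) (\<alpha> w))) has_field_derivative
  (\<Prod>i<q. c1 * deriv f ((G f c1 ^^ i) (\<alpha> c1))) *
  (\<Sum>i<q. (deriv f (b i) + c1 * deriv (deriv f) (b i) * B i) / (c1 * deriv f ((G f c1 ^^ i) (\<alpha> c1))))) (at c1)"
  by (rule prod_has_field_derivative_nonzero[OF dh]) (use g'_b_nz in \<open>simp add: at\<close>)
 hence "((\<lambda>w. \<Prod>i<q. w * deriv f ((G f w ^^ i) (\<alpha> w))) has_field_derivative
  kappa * (\<Sum>i<q. (deriv f (b i) + c1 * deriv (deriv f) (b i) * B i) / g' (b i))) (at c1)"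
  unfolding at kappa_def .
 hence "deriv (\<lambda>w. multiplier (G f w) q (\<alpha> w)) c1 =
   kappa * (\<Sum>i<q. (deriv f (b i) + c1 * deriv (deriv f) (b i) * B i) / g' (b i))"
  unfolding deriv_cong_ev[OF mult refl] by (rule DERIV_imp_deriv)
 thus ?thesis using B(2) per by (intro exI[of _ B]) simp
qed

text \<open>\<open>Q\<close> at \<open>b m\<close> is the value after \<open>q\<close> steps of the
  linearised recursion started with 0 at \<open>b m\<close>. If it vanishes, that solution closes
  up.\<close>

lemma Q_periodic:
 assumes m: "m < q" and Q: "Q f c1 q (b m) = 0"
 shows "\<exists>A. (\<forall>n. A (Suc n) = g' (b n) * A n + f (b n)) \<and> (\<forall>n. A (n + q) = A n)"
proof -
 define B where "B = rec_nat 0 (\<lambda>n y. g' (b (m + n)) * y + f (b (m + n)))"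
 have B: "B 0 = 0" "B (Suc i) = g' (b (m + i)) * B i + f (b (m + i))" for i by (simp_all add: B_def)
 have "((\<lambda>w. b m) has_field_derivative B 0) (at c1)" by (simp add: B(1))
 from G_curve_deriv[of "\<lambda>w. b m" B m, OF this refl B(2), of q] have "Q f c1 q (b m) = B q"
  unfolding Q_def by (rule DERIV_imp_deriv)
 hence "B q = B 0" using Q B(1) by simp
 note per = solution_per[of B m, OF B(2) this]
 \<comment> \<open>\<open>B\<close> is numbered from \<open>b m\<close>; adding \<open>q - m\<close>
   renumbers it from \<open>b 0\<close> without negative indices.\<close>
 have "B (Suc n + (q - m)) = g' (b n) * B (n + (q - m)) + f (b n)" for n
  using B(2)[of "n + (q - m)"] m b_per[of n] by simp
 moreover have "B (n + q + (q - m)) = B (n + (q - m))" for n using per[of "n + (q - m)"] by (simp add: ac_simps)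
 ultimately show ?thesis by (intro exI[of _ "\<lambda>n. B (n + (q - m))"]) simp
qed

end

lemma sum_mod_shift:
 fixes h :: "nat \<Rightarrow> complex"
 assumes "\<And>n. h (n + q) = h n"
 shows "(\<Sum>j<q. h (j + s)) = (\<Sum>j<q. h j)"
proof (induction s)
 case (Suc s)
 have "(\<Sum>j<q. h (Suc j + s)) = (\<Sum>j<q. h (j + s))"
  by (rule sum_periodic_shift[of "\<lambda>j. h (j + s)"]) (use assms[of s] in \<open>simp add: add.commute\<close>)
 thus ?case using Suc by simp
qed simp

context map_cycle begin

lemma deriv2_f_U: "u \<in> U \<Longrightarrow> z \<in> D \<Longrightarrow> deriv (deriv f) (u * z) = u * deriv (deriv f) z"
proof -
 assume u: "u \<in> U" and z: "z \<in> D"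
 have uz: "u * z \<in> D" using U_inv[OF u z] by simp
 have "((\<lambda>x. u * x) has_field_derivative u) (at z)" by auto
 with holomorphic_derivI[OF hol_f' open_D uz]
 have "((\<lambda>x. deriv f (u * x)) has_field_derivative deriv (deriv f) (u * z) * u) (at z)" by (rule DERIV_chain2)
 hence "(deriv f has_field_derivative deriv (deriv f) (u * z) * u) (at z)"
  by (rule has_field_derivative_transform_within_open[OF _ open_D z]) (rule deriv_f_U[OF u])
 hence "deriv (deriv f) z = deriv (deriv f) (u * z) * u" by (rule DERIV_imp_deriv)
 hence "u * deriv (deriv f) z = deriv (deriv f) (u * z) * (u * u)" by simp
 thus ?thesis using U_square[OF u] by simp
qed

text \<open>One of the cycles \<open>u * \<O>\<close>, suitably numbered, attracts the orbit of \<open>c1\<close>; the quantities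
 involved do not change when \<open>\<O>\<close> is replaced by this cycle.\<close>

lemma cycle_transversal:
 assumes kap: "norm kappa < 1 \<or> (\<exists>l>0. kappa ^ l = 1)"
  and A: "\<And>n. A (Suc n) = g' (b n) * A n + f (b n)" "\<And>n. A (n + q) = A n"
 shows "kappa \<noteq> 1 \<and> (\<Sum>j<q. (deriv f (b j) + c1 * deriv (deriv f) (b j) * A j) / g' (b j)) \<noteq> 0"
proof -
 define l where "l = (LEAST l. 0 < l \<and> kappa ^ l = 1)"
 have l: "0 < l" "kappa ^ l = 1" "\<And>k. 0 < k \<Longrightarrow> k < l \<Longrightarrow> kappa ^ k \<noteq> 1" if "\<not> norm kappa < 1"
  using LeastI_ex[of "\<lambda>l. 0 < l \<and> kappa ^ l = 1"] not_less_Least[of _ "\<lambda>l. 0 < l \<and> kappa ^ l = 1"] kap that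
  unfolding l_def by blast+
 have "\<exists>u s. u \<in> U \<and> orbit_attracted c (\<lambda>n. u * b (n + s)) \<and>
  (norm kappa < 1 \<or> (\<exists>m. 0 < m \<and> m \<le> l \<and> parabolic_asymptotics (q * l) m (\<lambda>n. u * b (n + s))))"
  using attracting_orbit_attracted l(1,2) parabolic_captured by blast
 then obtain u s where u: "u \<in> U" and att: "orbit_attracted c (\<lambda>n. u * b (n + s))"
  and par: "norm kappa < 1 \<or> (\<exists>m. 0 < m \<and> m \<le> l \<and> parabolic_asymptotics (q * l) m (\<lambda>n. u * b (n + s)))" by blast
 interpret S: map_cycle D f U Dp c1 "\<lambda>n. u * b (n + s)" q by (rule map_cycle_shift[OF u])
 interpret S: captured D f U Dp c1 "\<lambda>n. u * b (n + s)" q by unfold_locales (rule att)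
 have d1: "deriv f (u * b n) = deriv f (b n)" and d2: "deriv (deriv f) (u * b n) = u * deriv (deriv f) (b n)"
  and d0: "f (u * b n) = u * f (b n)" for n
  using deriv_f_U[OF u b_D] deriv2_f_U[OF u b_D] U_inv[OF u b_D] by simp_all
 have kS: "S.kappa = kappa"
 proof -
  have "S.kappa = tau (u * b (0 + s)) q" using S.tau_b[of 0] by simp
  also have "\<dots> = tau (b s) q"
   unfolding tau_def by (intro prod.cong refl) (simp add: S.funpow_b[of _ 0, simplified] funpow_b d1 add.commute)
  finally show ?thesis by (simp add: tau_b)
 qed
 define A' where "A' n = u * A (n + s)" for n
 have A': "A' (Suc n) = g' (u * b (n + s)) * A' n + f (u * b (n + s))" "A' (n + q) = A' n" for n
  using A(2)[of "n + s"] by (simp_all add: A'_def A(1) d1 d0 algebra_simps)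
 have "(\<Sum>j<q. (deriv f (u * b (j + s)) + c1 * deriv (deriv f) (u * b (j + s)) * A' j) / g' (u * b (j + s))) =
   (\<Sum>j<q. (deriv f (b (j + s)) + c1 * deriv (deriv f) (b (j + s)) * A (j + s)) / g' (b (j + s)))"
  using U_square[OF u] by (intro sum.cong refl) (simp add: d1 d2 A'_def)
 also have "\<dots> = (\<Sum>j<q. (deriv f (b j) + c1 * deriv (deriv f) (b j) * A j) / g' (b j))"
  by (rule sum_mod_shift[of "\<lambda>j. (deriv f (b j) + c1 * deriv (deriv f) (b j) * A j) / g' (b j)"]) (simp add: b_per A(2))
 finally have sm: "(\<Sum>j<q. (deriv f (u * b (j + s)) + c1 * deriv (deriv f) (u * b (j + s)) * A' j) / g' (u * b (j + s))) =
   (\<Sum>j<q. (deriv f (b j) + c1 * deriv (deriv f) (b j) * A j) / g' (b j))" .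
 show ?thesis
 proof (cases "norm kappa < 1")
  case True
  hence "kappa \<noteq> 1" by auto
  thus ?thesis using S.attracting_transversal[of A', OF _ A'] True sm by (simp add: kS)
 next
  case False
  obtain m where m: "0 < m" "m \<le> l" "parabolic_asymptotics (q * l) m (\<lambda>n. u * b (n + s))" using par False by blast
  have k1: "kappa \<noteq> 1"
  proof
   assume k: "kappa = 1"
   have "l = 1" using l(3)[OF False, of 1] l(1)[OF False] k by (cases "l = 1") auto
   hence "parabolic_asymptotics q 1 (\<lambda>n. u * b (n + s))" using m by (simp add: le_Suc_eq)
   from S.degenerate_transversal[of A', OF _ this A'] show False using k kS by simp
  qed
  thus ?thesis
   using S.parabolic_transversal[of l m A', OF _ l(1)[OF False] _ _ m(3,1,2) A'] l(2,3)[OF False] sm by (simp add: kS)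
 qed
qed

lemma map_cycle_transversal:
 assumes "norm kappa < 1 \<or> (\<exists>l>0. kappa ^ l = 1)"
 shows "transversal f c1 q b"
proof -
 have mu: "multiplier (G f c1) q (b 0) = kappa"
  unfolding multiplier_def G_c1 using funpow_deriv[of q "b 0"] b_orbit_D tau_b[of 0] DERIV_imp_deriv by metis
 show ?thesis unfolding transversal_def mu
 proof (intro conjI impI allI)
  assume k1: "kappa \<noteq> 1"
  show "\<exists>\<alpha>. continues_periodic_point f c1 q (b 0) \<alpha>" by (rule continuation_exists[OF k1])
  fix \<alpha> assume "continues_periodic_point f c1 q (b 0) \<alpha>"
  from multiplier_derivative[OF this] obtain A
   where A: "\<forall>n. A (Suc n) = g' (b n) * A n + f (b n)" "\<forall>n. A (n + q) = A n"
    and d: "deriv (\<lambda>w. multiplier (G f w) q (\<alpha> w)) c1 =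
     kappa * (\<Sum>j<q. (deriv f (b j) + c1 * deriv (deriv f) (b j) * A j) / g' (b j))" by (elim exE conjE)
  show "deriv (\<lambda>w. multiplier (G f w) q (\<alpha> w)) c1 \<noteq> 0"
   unfolding d using cycle_transversal[OF assms A[rule_format]] kappa_nz by simp
 next
  fix j assume k: "kappa = 1" and j: "j < q"
  show "Q f c1 q (b j) \<noteq> 0"
  proof
   assume "Q f c1 q (b j) = 0"
   from Q_periodic[OF j this] obtain A
    where A: "\<forall>n. A (Suc n) = g' (b n) * A n + f (b n)" "\<forall>n. A (n + q) = A n" by (elim exE conjE)
   show False using cycle_transversal[OF assms A[rule_format]] k by simp
  qed
 qed
qed

end

section \<open>The classes of maps\<close>

text \<open>The part of an open interval to the right of its point \<open>c\<close> is a nonempty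
  interval, so it lies in exactly one component and the definite description is well
  defined.\<close>

lemma D_plus_component:
 assumes D: "open D" and b: "cond_b D f c"
 shows "D_plus D c \<in> components D"
proof -
 define J where "J = real_trace D \<inter> {c<..}"
 have op: "open (insert c (real_trace D))" and iv: "is_interval (insert c (real_trace D))"
  using b unfolding cond_b_def by auto
 obtain e where e: "0 < e" "ball c e \<subseteq> insert c (real_trace D)" using op open_contains_ball by (metis insertI1)
 have "c + e / 2 \<in> ball c e" using e(1) by (simp add: dist_real_def)
 hence ne: "J \<noteq> {}" using e by (force simp: J_def)
 have "is_interval (insert c (real_trace D) \<inter> {c<..})" by (intro is_interval_Int iv) (simp)
 moreover have "insert c (real_trace D) \<inter> {c<..} = J" by (auto simp: J_def)
 ultimately have "connected J" using is_interval_connected by metis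
 hence con: "connected (complex_of_real ` J)" by (intro connected_continuous_image continuous_intros)
 have sub: "complex_of_real ` J \<subseteq> D" by (auto simp: J_def real_trace_def)
 obtain C where C: "C \<in> components D" "complex_of_real ` J \<subseteq> C"
  using exists_component_superset[OF sub _ con] sub ne by blast
 have "D_plus D c = C" unfolding D_plus_def
 proof (rule the_equality)
  show "C \<in> components D \<and> complex_of_real ` (real_trace D \<inter> {c<..}) \<subseteq> C" using C by (simp add: J_def)
  fix C' assume C': "C' \<in> components D \<and> complex_of_real ` (real_trace D \<inter> {c<..}) \<subseteq> C'"
  hence "C \<inter> C' \<noteq> {}" using C(2) ne by (auto simp: J_def)
  thus "C' = C" using components_nonoverlap C(1) C' by blast
 qed
 thus ?thesis using C(1) by simp
qed

lemma first_unit_max_value: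
 assumes "first_unit_max D f c" "complex_of_real c \<in> D"
 shows "f (complex_of_real c) = 1"
 using assms unfolding first_unit_max_def real_extension_def unit_local_max_def real_trace_def by auto

text \<open>By the intermediate value theorem \<open>F\<close> takes a value just below its maximum on both sides of \<open>c\<close>.\<close>

lemma first_unit_max_not_inj:
 assumes b: "cond_b D f c" and fm: "first_unit_max D f c" and X: "finite X" "- X \<subseteq> D"
 shows "\<not> inj_on f (- X)"
proof
 assume inj: "inj_on f (- X)"
 define I where "I = real_trace D"
 obtain F where F: "continuous_on (closure I) F" "\<And>x. x \<in> I \<Longrightarrow> f (complex_of_real x) = complex_of_real (F x)"
  and Fc: "F c = 1" and mx: "\<forall>\<^sub>F y in at c within closure I. F y \<le> F c"
  using fm unfolding first_unit_max_def real_extension_def unit_local_max_def I_def by blast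
 have "open (insert c I)" using b unfolding cond_b_def I_def by blast
 then obtain e1 where e1: "0 < e1" "ball c e1 \<subseteq> insert c I" using open_contains_ball by (metis insertI1)
 obtain e2 where e2: "0 < e2" "\<And>y. y \<in> closure I \<Longrightarrow> y \<noteq> c \<Longrightarrow> dist y c < e2 \<Longrightarrow> F y \<le> 1"
  using mx unfolding eventually_at Fc by auto
 have "finite (complex_of_real -` X - {c})" by (intro finite_Diff finite_vimageI X(1)) (simp add: inj_of_real)
 then obtain e3 where e3: "0 < e3" "\<And>x. complex_of_real x \<in> X \<Longrightarrow> x \<noteq> c \<Longrightarrow> e3 \<le> dist c x"
  using finite_set_avoid[of "complex_of_real -` X - {c}" c] by auto
 define e where "e = min e1 (min e2 e3)"
 have e: "0 < e" using e1 e2 e3 by (simp add: e_def)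
 have nearI: "x \<in> I" and nearX: "complex_of_real x \<in> - X" and nearF: "F x \<le> 1" if "x \<noteq> c" "\<bar>x - c\<bar> < e" for x
 proof -
  show I: "x \<in> I" using e1(2) that by (force simp: e_def dist_real_def)
  show "complex_of_real x \<in> - X" using e3(2)[of x] that by (auto simp: e_def dist_real_def)
  show "F x \<le> 1" using e2(2)[of x] I closure_subset[of I] that by (auto simp: e_def dist_real_def)
 qed
 have Finj: "x = y" if "x \<noteq> c" "\<bar>x - c\<bar> < e" "y \<noteq> c" "\<bar>y - c\<bar> < e" "F x = F y" for x y
 proof -
  have "f (complex_of_real x) = f (complex_of_real y)" using that by (simp add: F(2) nearI)
  hence "complex_of_real x = complex_of_real y" by (rule inj_onD[OF inj _ nearX[OF that(1,2)] nearX[OF that(3,4)]])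
  thus ?thesis by simp
 qed
 have cont: "continuous_on {x. \<bar>x - c\<bar> < e} F"
 proof (rule continuous_on_subset[OF F(1)])
  have cI: "c \<in> closure I" using b interior_subset unfolding cond_b_def I_def by blast
  show "{x. \<bar>x - c\<bar> < e} \<subseteq> closure I"
  proof
   fix x assume "x \<in> {x. \<bar>x - c\<bar> < e}"
   thus "x \<in> closure I" using cI nearI[of x] closure_subset[of I] by (cases "x = c") auto
  qed
 qed
 \<comment> \<open>By injectivity two points on the same side cannot both take the maximal
   value.\<close>
 have one_side: "\<exists>x. x \<noteq> c \<and> \<bar>x - c\<bar> < e \<and> 0 < s * (x - c) \<and> F x < 1" if s: "s = 1 \<or> s = - 1" for s :: real
 proof -
  define x y where "x = c + s * (e / 2)" and "y = c + s * (e / 3)"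
  have xy: "x \<noteq> c" "\<bar>x - c\<bar> < e" "y \<noteq> c" "\<bar>y - c\<bar> < e" "x \<noteq> y" "0 < s * (x - c)" "0 < s * (y - c)"
   using s e by (auto simp: x_def y_def)
  hence "F x \<noteq> F y" using Finj by blast
  hence "F x < 1 \<or> F y < 1" using nearF[of x] nearF[of y] xy by fastforce
  thus ?thesis using xy by blast
 qed
 obtain x where x: "x < c" "\<bar>x - c\<bar> < e" "F x < 1" using one_side[of "- 1"] by auto
 obtain y where y: "c < y" "\<bar>y - c\<bar> < e" "F y < 1" using one_side[of 1] by auto
 define m where "m = (max (F x) (F y) + 1) / 2"
 have m: "F x < m" "F y < m" "m < 1" using x(3) y(3) by (auto simp: m_def)
 have "\<exists>x'. x \<le> x' \<and> x' \<le> c \<and> F x' = m" by (rule IVT') (use m x Fc in \<open>auto intro!: continuous_on_subset[OF cont]\<close>)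
 then obtain x' where x': "x \<le> x'" "x' \<le> c" "F x' = m" by blast
 have "\<exists>y'. c \<le> y' \<and> y' \<le> y \<and> F y' = m" by (rule IVT2') (use m y Fc in \<open>auto intro!: continuous_on_subset[OF cont]\<close>)
 then obtain y' where y': "c \<le> y'" "y' \<le> y" "F y' = m" by blast
 have "x' \<noteq> c" "y' \<noteq> c" using x'(3) y'(3) m(3) Fc by auto
 hence "x' = y'" using Finj[of x' y'] x' y' x y by auto
 thus False using x'(2) y'(1) \<open>x' \<noteq> c\<close> by simp
qed

lemma lift_map_of_class:
 assumes a: "cond_a D V f" and b: "cond_b D f c" and cc: "cond_c D V c" and fm: "first_unit_max D f c"
  and sing: "\<And>v. v \<in> V \<Longrightarrow> v \<noteq> 0 \<Longrightarrow> v \<notin> U \<Longrightarrow> \<not> singular_value D f v"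
  and U: "U \<subseteq> {1, -1}" "1 \<in> U" "\<And>u z. u \<in> U \<Longrightarrow> z \<in> D \<Longrightarrow> u * z \<in> D \<and> f (u * z) = u * f z"
  and c1: "c1 \<in> D_plus D c - {0}"
 shows "lift_map D f U (D_plus D c) c1"
proof unfold_locales
 have D: "open D" and hol: "f holomorphic_on D" and im: "f ` D = V" using a unfolding cond_a_def by auto
 show "open D" "f holomorphic_on D" by fact+
 show "f 0 = 0" if z: "0 \<in> D"
 proof -
  have "(f \<longlongrightarrow> 0) (at 0)" using b at_within_open[OF z D] unfolding cond_b_def by simp
  moreover have "(f \<longlongrightarrow> f 0) (at 0)" using DERIV_isCont[OF holomorphic_derivI[OF hol D z]] by (simp add: isCont_def)
  ultimately show ?thesis using tendsto_unique[OF at_neq_bot] by blast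
 qed
 show "U \<subseteq> {1, -1}" "1 \<in> U" by fact+
 show "u * z \<in> D \<and> f (u * z) = u * f z" if "u \<in> U" "z \<in> D" for u z using U(3)[OF that] .
 show "\<not> singular_value D f v" if "v \<in> f ` D" "v \<noteq> 0" "v \<notin> U" for v using sing that im by simp
 show "D_plus D c \<in> components D" by (rule D_plus_component[OF D b])
 show "u / v \<in> f ` D" if "u \<in> D" "u \<noteq> 0" "v \<in> D_plus D c" "v \<noteq> 0" "v \<noteq> u" for u v
  using cc that unfolding cond_c_def im by blast
 have "0 < c" using b unfolding cond_b_def by simp
 \<comment> \<open>The turning point \<open>c\<close> is either outside \<open>D\<close> or mapped
   to 1.\<close>
 thus "\<exists>p. p \<noteq> 0 \<and> (p \<in> D \<longrightarrow> f p = 1)" using first_unit_max_value[OF fm] by (intro exI[of _ "complex_of_real c"]) auto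
 show "\<not> inj_on f (- X)" if "finite X" "- X \<subseteq> D" for X by (rule first_unit_max_not_inj[OF b fm that])
 show "c1 \<in> D_plus D c" "c1 \<noteq> 0" using c1 by auto
qed

text \<open>A relation \<open>b m = - b n\<close> propagates around the cycle by oddness and makes
  it symmetric, so excluding symmetric cycles yields \<open>asym\<close>. A hyperbolic attracting or
  parabolic multiplier is nonzero, which excludes critical points on the cycle.\<close>

lemma transversal_of_cycle:
 assumes lm: "lift_map D f U Dp c1" and cyc: "is_cycle (G f c1) q a" and aD: "a ` {..<q} \<subseteq> D - {0}"
  and mu: "hyperbolic_attracting (multiplier (G f c1) q (a 0)) \<or> parabolic (multiplier (G f c1) q (a 0))"
  and sym: "-1 \<in> U \<Longrightarrow> uminus ` (a ` {..<q}) \<noteq> a ` {..<q}"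
 shows "transversal f c1 q a"
proof -
 interpret lift_map D f U Dp c1 by (rule lm)
 have q: "0 < q" and inj: "inj_on a {..<q}" and step: "\<And>j. j < q \<Longrightarrow> c1 * f (a j) = a (Suc j mod q)"
  using cyc unfolding is_cycle_def G_def by auto
 define b where "b n = a (n mod q)" for n
 have bD: "b n \<in> D - {0}" for n using aD mod_less_divisor[OF q, of n] unfolding b_def by blast
 have gb: "g (b n) = b (Suc n)" for n using step[of "n mod q"] q by (simp add: b_def mod_Suc_eq)
 have bper: "b (n + q) = b n" and bq: "b (n + q * k) = b n" for n k by (simp_all add: b_def)
 have ab: "a j = b j" if "j < q" for j using that by (simp add: b_def)
 have fb: "(g ^^ i) (b n) = b (n + i)" for i n by (induction i) (simp_all add: gb)
 have mul: "multiplier (G f c1) q (a 0) = (\<Prod>i<q. g' (b i))"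
 proof -
  have G: "G f c1 = g" by (rule ext) (simp add: G_def)
  have "((g ^^ q) has_field_derivative tau (b 0) q) (at (b 0))" by (rule funpow_deriv) (use bD fb in auto)
  thus ?thesis unfolding multiplier_def G ab[OF q] by (simp add: DERIV_imp_deriv tau_def fb)
 qed
 have munz: "multiplier (G f c1) q (a 0) \<noteq> 0"
  using mu unfolding hyperbolic_attracting_def parabolic_def by (auto simp: power_0_left)
 interpret map_cycle D f U Dp c1 b q
 proof unfold_locales
  show "0 < q" "b (n + q) = b n" "b n \<in> D" "b n \<noteq> 0" "g (b n) = b (Suc n)" for n using q bper bD gb by auto
  show "inj_on b {..<q}" using inj by (simp add: inj_on_def b_def)
  show "deriv f (b n) \<noteq> 0" for n
  proof -
   have "g' (b (n mod q)) \<noteq> 0" using munz q unfolding mul by simp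
   thus ?thesis by (simp add: b_def)
  qed
  fix u m n assume u: "u \<in> U" and eq: "b m = u * b n"
  show "u = 1"
  proof (rule ccontr)
   assume "u \<noteq> 1"
   hence u1: "u = -1" using U_cases[OF u] by simp
   have e: "b (m + k) = - b (n + k)" for k
   proof (induction k)
    case (Suc k)
    have "b (m + Suc k) = g (- b (n + k))" using gb[of "m + k"] Suc by simp
    also have "\<dots> = - g (b (n + k))" using U_inv[OF u, of "b (n + k)"] bD[of "n + k"] u1 by simp
    finally show ?case using gb[of "n + k"] by simp
   qed (simp add: eq u1)
   have neg: "- b j \<in> a ` {..<q}" for j
   proof -
    \<comment> \<open>\<open>(q - 1) * n\<close> is \<open>- n\<close> modulo \<open>q\<close>, so
      every index \<open>j\<close> is reached from \<open>n\<close>.\<close>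
    have "n + (j + (q - 1) * n) = j + q * n" using q by (cases q) (simp_all)
    hence "b (n + (j + (q - 1) * n)) = b j" by (simp only: bq)
    hence "- b j = b (m + (j + (q - 1) * n))" using e[of "j + (q - 1) * n"] by simp
    thus ?thesis using q by (simp add: b_def)
   qed
   have sub: "uminus ` (a ` {..<q}) \<subseteq> a ` {..<q}" using neg by (auto simp: ab)
   have "a ` {..<q} \<subseteq> uminus ` (a ` {..<q})"
   proof
    fix x assume "x \<in> a ` {..<q}"
    hence "- x \<in> a ` {..<q}" using sub by blast
    hence "- (- x) \<in> uminus ` (a ` {..<q})" by (rule imageI)
    thus "x \<in> uminus ` (a ` {..<q})" by simp
   qed
   thus False using sym sub u u1 by blast
  qed
 qed
 have "multiplier (G f c1) q (a 0) = kappa" by (simp add: mul kappa_def)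
 hence "norm kappa < 1 \<or> (\<exists>l>0. kappa ^ l = 1)" using mu unfolding hyperbolic_attracting_def parabolic_def by auto
 from map_cycle_transversal[OF this] show ?thesis unfolding transversal_def using ab q by simp
qed

theorem theorem2p2:
  fixes D V :: "complex set" and f :: "complex \<Rightarrow> complex" and c :: real
    and c1 :: complex and q :: nat and a :: "nat \<Rightarrow> complex"
  assumes "class_E D V f c \<or> class_Eo D V f c"
    and "c1 \<in> D_plus D c - {0}"
    and "is_cycle (G f c1) q a"
    and "a ` {..<q} \<subseteq> D - {0}"
    and "hyperbolic_attracting (multiplier (G f c1) q (a 0)) \<or>
         parabolic (multiplier (G f c1) q (a 0))"
  shows "transversal f c1 q a \<or>
         (class_Eo D V f c \<and> uminus ` (a ` {..<q}) = a ` {..<q})"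
proof (cases "class_E D V f c")
 case True
 have "lift_map D f {1} (D_plus D c) c1"
  by (rule lift_map_of_class[where V = V]) (use True assms(2) in \<open>auto simp: class_E_def\<close>)
 from transversal_of_cycle[OF this assms(3,4,5)] show ?thesis by simp
next
 case False
 hence Eo: "class_Eo D V f c" using assms(1) by simp
 show ?thesis
 proof (cases "uminus ` (a ` {..<q}) = a ` {..<q}")
  case False
  have "lift_map D f {1, -1} (D_plus D c) c1"
   by (rule lift_map_of_class[where V = V]) (use Eo assms(2) in \<open>auto simp: class_Eo_def odd_map_def\<close>)
  from transversal_of_cycle[OF this assms(3,4,5)] False show ?thesis by simp
 qed (use Eo in simp)
qed

end
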